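(* Let $g\ge2$, let $({\mathcal S},T)$ be the two-sided shift on doubly infinite reduced sequences in the letters $\{g_i\}_{i=1}^{2g}$, and let ${\mathcal S}_T$ be its mapping torus. The cohomology $H^1({\mathcal S}_T,\mathbb{Z})$ satisfies the following properties. 1. There is an identification of $H^1({\mathcal S}_T,\mathbb{Z})$ with the $K_0$-group of the crossed product $C^*$-algebra for the action of $T$ on ${\mathcal S}$, $$H^1({\mathcal S}_T,\mathbb{Z})\cong K_0\big(C({\mathcal S})\rtimes_T\mathbb{Z}\big).$$ 2. This identification endows $H^1({\mathcal S}_T,\mathbb{Z})$ with a filtration by free abelian groups $F_0\hookrightarrow F_1\hookrightarrow\cdots\hookrightarrow F_n\hookrightarrow\cdots$, with $\mathrm{rank}\,F_0=2g$ and $\mathrm{rank}\,F_n=2g(2g-1)^{n-1}(2g-2)+1$ for $n\ge1$, so that $$H^1({\mathcal S}_T,\mathbb{Z})=\varinjlim_nF_n.$$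
   Context: $g_1,\dots,g_g$ are free generators of a Schottky group $\Gamma$ of rank $g\ge2$ (a free group), and $g_{i+g}:=g_i^{-1}$. ${\mathcal S}$ is the set of doubly infinite reduced sequences $\ldots a_{-1}a_0a_1\ldots$ with $a_k\in\{g_i\}_{i=1}^{2g}$ and $a_{k+1}\ne a_k^{-1}$ for all $k\in\mathbb{Z}$, with the topology induced by the product topology on $\{g_i\}^{\mathbb{Z}}$ (a Cantor set). $T$ is the shift homeomorphism, $(Ta)_k=a_{k+1}$. The mapping torus is ${\mathcal S}_T={\mathcal S}\times[0,1]/(x,0)\sim(Tx,1)$. $H^1({\mathcal S}_T,\mathbb{Z})$ is Čech cohomology, i.e. the group of homotopy classes of continuous maps ${\mathcal S}_T\to S^1$. *)

theory Defs
  imports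
    "HOL-Analysis.Analysis"
    "HOL-Algebra.Ring"
    "HOL-Algebra.Generated_Groups"
    "HOL-Algebra.Free_Abelian_Groups"
begin

section \<open>Operations on equivalence classes\<close>

text \<open>If \<open>r\<close> is an equivalence relation compatible with \<open>f\<close>, these unions consist of a
  single class, namely the class of \<open>f a\<close> (resp. \<open>f a b\<close>) for any representatives.\<close>

definition class_op1 :: "('a \<times> 'a) set \<Rightarrow> ('a \<Rightarrow> 'a) \<Rightarrow> 'a set \<Rightarrow> 'a set" where
  "class_op1 r f A = (\<Union>a\<in>A. r `` {f a})"

definition class_op2 :: "('a \<times> 'a) set \<Rightarrow> ('a \<Rightarrow> 'a \<Rightarrow> 'a) \<Rightarrow> 'a set \<Rightarrow> 'a set \<Rightarrow> 'a set" where
  "class_op2 r f A B = (\<Union>a\<in>A. \<Union>b\<in>B. r `` {f a b})"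


section \<open>The shift on doubly infinite reduced sequences\<close>

text \<open>\<open>\<gamma> 1, \<dots>, \<gamma> g\<close> are free generators of the group \<open>G\<close>, and \<open>\<gamma> (i + g)\<close> is the inverse of
  \<open>\<gamma> i\<close>. Freeness says that no nonempty word in the indices \<open>1, \<dots>, 2 * g\<close> without adjacent
  formally inverse indices evaluates to the identity.\<close>

definition opposite_index :: "nat \<Rightarrow> nat \<Rightarrow> nat" where
  "opposite_index g i = (if i \<le> g then i + g else i - g)"

definition free_generators :: "('a, 'b) monoid_scheme \<Rightarrow> nat \<Rightarrow> (nat \<Rightarrow> 'a) \<Rightarrow> bool" where
  "free_generators G g \<gamma> \<longleftrightarrow>
     (\<forall>i\<in>{1..g}. \<gamma> i \<in> carrier G \<and> \<gamma> (i + g) = inv\<^bsub>G\<^esub> (\<gamma> i)) \<and>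
     generate G (\<gamma> ` {1..g}) = carrier G \<and>
     (\<forall>w. w \<noteq> [] \<and> set w \<subseteq> {1..2 * g} \<and> successively (\<lambda>i j. j \<noteq> opposite_index g i) w \<longrightarrow>
        foldr (\<lambda>i y. \<gamma> i \<otimes>\<^bsub>G\<^esub> y) w \<one>\<^bsub>G\<^esub> \<noteq> \<one>\<^bsub>G\<^esub>)"

definition reduced_sequences :: "('a, 'b) monoid_scheme \<Rightarrow> 'a set \<Rightarrow> (int \<Rightarrow> 'a) set" where
  "reduced_sequences G L = {a. (\<forall>k. a k \<in> L) \<and> (\<forall>k. a (k + 1) \<noteq> inv\<^bsub>G\<^esub> (a k))}"

definition reduced_space :: "('a, 'b) monoid_scheme \<Rightarrow> 'a set \<Rightarrow> (int \<Rightarrow> 'a) topology" where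
  "reduced_space G L =
     subtopology (product_topology (\<lambda>_. discrete_topology L) UNIV) (reduced_sequences G L)"

definition shift_pow :: "int \<Rightarrow> (int \<Rightarrow> 'a) \<Rightarrow> int \<Rightarrow> 'a" where
  "shift_pow n a = (\<lambda>k. a (k + n))"

abbreviation shift :: "(int \<Rightarrow> 'a) \<Rightarrow> int \<Rightarrow> 'a" where
  "shift \<equiv> shift_pow 1"


section \<open>Mapping torus and its first cohomology\<close>

definition quotient_topology :: "'a topology \<Rightarrow> ('a \<times> 'a) set \<Rightarrow> 'a set topology" where
  "quotient_topology X r =
     topology (\<lambda>U. U \<subseteq> topspace X // r \<and> openin X {x \<in> topspace X. r `` {x} \<in> U})"

lemma openin_quotient_topology:
  "openin (quotient_topology X r) U \<longleftrightarrow>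
     U \<subseteq> topspace X // r \<and> openin X {x \<in> topspace X. r `` {x} \<in> U}"
proof -
  let ?P = "\<lambda>U. U \<subseteq> topspace X // r \<and> openin X {x \<in> topspace X. r `` {x} \<in> U}"
  have 1: "?P (U \<inter> V)" if "?P U" "?P V" for U V
  proof -
    have "{x \<in> topspace X. r `` {x} \<in> U \<inter> V} =
        {x \<in> topspace X. r `` {x} \<in> U} \<inter> {x \<in> topspace X. r `` {x} \<in> V}" by auto
    with that show ?thesis by auto
  qed
  have 2: "?P (\<Union>K)" if "\<forall>U\<in>K. ?P U" for K
  proof -
    have "{x \<in> topspace X. r `` {x} \<in> \<Union>K} = (\<Union>U\<in>K. {x \<in> topspace X. r `` {x} \<in> U})" by auto
    with that show ?thesis by auto
  qed
  have "istopology ?P"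
    unfolding istopology_def using 1 2 by blast
  then show ?thesis
    by (simp add: quotient_topology_def topology_inverse')
qed

lemma topspace_quotient_topology: "topspace (quotient_topology X r) = topspace X // r"
proof -
  have "{x \<in> topspace X. r `` {x} \<in> topspace X // r} = topspace X"
    by (auto simp: quotient_def)
  then have "openin (quotient_topology X r) (topspace X // r)"
    by (simp add: openin_quotient_topology)
  then show ?thesis
    by (metis openin_quotient_topology openin_subset openin_topspace subset_antisym)
qed

lemma quotient_map_quotient_topology:
  "quotient_map X (quotient_topology X r) (\<lambda>x. r `` {x})"
  by (auto simp: quotient_map_def topspace_quotient_topology openin_quotient_topology quotient_def)

abbreviation cylinder :: "'a topology \<Rightarrow> ('a \<times> real) topology" where
  "cylinder X \<equiv> prod_topology X (top_of_set {0..1})"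

definition mapping_torus_gluing :: "'a topology \<Rightarrow> ('a \<Rightarrow> 'a) \<Rightarrow> (('a \<times> real) \<times> ('a \<times> real)) set" where
  "mapping_torus_gluing X T = {((x, 0), (T x, 1)) | x. x \<in> topspace X}"

definition mapping_torus_rel :: "'a topology \<Rightarrow> ('a \<Rightarrow> 'a) \<Rightarrow> (('a \<times> real) \<times> ('a \<times> real)) set" where
  "mapping_torus_rel X T =
     (mapping_torus_gluing X T \<union> (mapping_torus_gluing X T)\<inverse>)\<^sup>* \<inter>
     (topspace (cylinder X) \<times> topspace (cylinder X))"

definition mapping_torus :: "'a topology \<Rightarrow> ('a \<Rightarrow> 'a) \<Rightarrow> ('a \<times> real) set topology" where
  "mapping_torus X T = quotient_topology (cylinder X) (mapping_torus_rel X T)"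

abbreviation circle :: "complex topology" where
  "circle \<equiv> top_of_set (sphere 0 1)"

definition homotopy_rel :: "'a topology \<Rightarrow> (('a \<Rightarrow> complex) \<times> ('a \<Rightarrow> complex)) set" where
  "homotopy_rel Y = {(f, h). homotopic_with (\<lambda>_. True) Y circle f h}"

definition cohomology1 :: "'a topology \<Rightarrow> ('a \<Rightarrow> complex) set monoid" where
  "cohomology1 Y =
     \<lparr>carrier = {f. continuous_map Y circle f} // homotopy_rel Y,
      monoid.mult = class_op2 (homotopy_rel Y) (\<lambda>f h x. f x * h x),
      monoid.one = homotopy_rel Y `` {\<lambda>_. 1}\<rparr>"


section \<open>C*-completions of *-algebras\<close>

record 'a star_algebra = "'a ring" +
  cscale :: "complex \<Rightarrow> 'a \<Rightarrow> 'a"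
  adj :: "'a \<Rightarrow> 'a"

text \<open>Nonnegativity and \<open>p (adj x) = p x\<close> follow from the clauses below. The C*-seminorms are
  exactly the functions \<open>x \<mapsto> \<parallel>\<pi> x\<parallel>\<close> for *-representations \<open>\<pi>\<close> on Hilbert spaces.\<close>

definition cstar_seminorm :: "('a, 'm) star_algebra_scheme \<Rightarrow> ('a \<Rightarrow> real) \<Rightarrow> bool" where
  "cstar_seminorm A p \<longleftrightarrow>
     (\<forall>x\<in>carrier A. \<forall>y\<in>carrier A. p (x \<oplus>\<^bsub>A\<^esub> y) \<le> p x + p y \<and> p (x \<otimes>\<^bsub>A\<^esub> y) \<le> p x * p y) \<and>
     (\<forall>c. \<forall>x\<in>carrier A. p (cscale A c x) = cmod c * p x) \<and>
     (\<forall>x\<in>carrier A. p (adj A x \<otimes>\<^bsub>A\<^esub> x) = (p x)\<^sup>2)"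

text \<open>The largest C*-seminorm dominated by \<open>L\<close>.\<close>

definition enveloping_norm :: "('a, 'm) star_algebra_scheme \<Rightarrow> ('a \<Rightarrow> real) \<Rightarrow> 'a \<Rightarrow> real" where
  "enveloping_norm A L x =
     (SUP p\<in>{p. cstar_seminorm A p \<and> (\<forall>y\<in>carrier A. p y \<le> L y)}. p x)"

definition cauchy_seqs :: "('a, 'm) star_algebra_scheme \<Rightarrow> ('a \<Rightarrow> real) \<Rightarrow> (nat \<Rightarrow> 'a) set" where
  "cauchy_seqs A N = {s. (\<forall>k. s k \<in> carrier A) \<and>
     (\<forall>e>0. \<exists>M. \<forall>m\<ge>M. \<forall>n\<ge>M. N (s m \<ominus>\<^bsub>A\<^esub> s n) < e)}"

definition null_rel ::
  "('a, 'm) star_algebra_scheme \<Rightarrow> ('a \<Rightarrow> real) \<Rightarrow> ((nat \<Rightarrow> 'a) \<times> (nat \<Rightarrow> 'a)) set" where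
  "null_rel A N = {(s, t). s \<in> cauchy_seqs A N \<and> t \<in> cauchy_seqs A N \<and>
     (\<lambda>k. N (s k \<ominus>\<^bsub>A\<^esub> t k)) \<longlonglongrightarrow> 0}"

definition completion ::
  "('a, 'm) star_algebra_scheme \<Rightarrow> ('a \<Rightarrow> real) \<Rightarrow> (nat \<Rightarrow> 'a) set star_algebra" where
  "completion A N =
     \<lparr>carrier = cauchy_seqs A N // null_rel A N,
      monoid.mult = class_op2 (null_rel A N) (\<lambda>s t k. s k \<otimes>\<^bsub>A\<^esub> t k),
      monoid.one = null_rel A N `` {\<lambda>_. \<one>\<^bsub>A\<^esub>},
      ring.zero = null_rel A N `` {\<lambda>_. \<zero>\<^bsub>A\<^esub>},
      ring.add = class_op2 (null_rel A N) (\<lambda>s t k. s k \<oplus>\<^bsub>A\<^esub> t k),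
      cscale = (\<lambda>c. class_op1 (null_rel A N) (\<lambda>s k. cscale A c (s k))),
      adj = class_op1 (null_rel A N) (\<lambda>s k. adj A (s k))\<rparr>"


section \<open>The crossed product of a compact space by the integers\<close>

text \<open>Elements of \<open>C(X)\<close> are represented by functions that vanish outside \<open>topspace X\<close>.\<close>

definition cfun :: "'a topology \<Rightarrow> ('a \<Rightarrow> complex) set" where
  "cfun X = {f. continuous_map X euclidean f \<and> (\<forall>x. x \<notin> topspace X \<longrightarrow> f x = 0)}"

abbreviation fsupp :: "(int \<Rightarrow> 'a \<Rightarrow> complex) \<Rightarrow> int set" where
  "fsupp F \<equiv> {n. F n \<noteq> (\<lambda>_. 0)}"

text \<open>The algebraic crossed product \<open>C\<^sub>c(\<int>, C(X))\<close> for an action \<open>\<theta>\<close> of the integers on \<open>X\<close>: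
  \<open>F\<close> stands for the finite sum of the \<open>F n u\<^sup>n\<close>, where \<open>u\<close> is unitary and
  \<open>u\<^sup>n f u\<^sup>-\<^sup>n = f \<circ> \<theta> (- n)\<close>.\<close>

definition algebraic_crossed_product ::
  "'a topology \<Rightarrow> (int \<Rightarrow> 'a \<Rightarrow> 'a) \<Rightarrow> (int \<Rightarrow> 'a \<Rightarrow> complex) star_algebra" where
  "algebraic_crossed_product X \<theta> =
     \<lparr>carrier = {F. (\<forall>n. F n \<in> cfun X) \<and> finite (fsupp F)},
      monoid.mult = (\<lambda>F H n x. \<Sum>m\<in>fsupp F. F m x * H (n - m) (\<theta> (- m) x)),
      monoid.one = (\<lambda>n x. if n = 0 \<and> x \<in> topspace X then 1 else 0),
      ring.zero = (\<lambda>n x. 0),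
      ring.add = (\<lambda>F H n x. F n x + H n x),
      cscale = (\<lambda>c F n x. c * F n x),
      adj = (\<lambda>F n x. cnj (F (- n) (\<theta> (- n) x)))\<rparr>"

definition l1_norm :: "'a topology \<Rightarrow> (int \<Rightarrow> 'a \<Rightarrow> complex) \<Rightarrow> real" where
  "l1_norm X F = (\<Sum>n\<in>fsupp F. SUP x\<in>topspace X. cmod (F n x))"

text \<open>The full crossed product \<open>C(X) \<rtimes> \<int>\<close>: the enveloping C*-algebra, i.e. the completion in
  the supremum of all \<open>\<ell>\<^sup>1\<close>-contractive C*-seminorms.\<close>

abbreviation crossed_norm ::
  "'a topology \<Rightarrow> (int \<Rightarrow> 'a \<Rightarrow> 'a) \<Rightarrow> (int \<Rightarrow> 'a \<Rightarrow> complex) \<Rightarrow> real" where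
  "crossed_norm X \<theta> \<equiv> enveloping_norm (algebraic_crossed_product X \<theta>) (l1_norm X)"

definition crossed_product ::
  "'a topology \<Rightarrow> (int \<Rightarrow> 'a \<Rightarrow> 'a) \<Rightarrow> (nat \<Rightarrow> int \<Rightarrow> 'a \<Rightarrow> complex) set star_algebra" where
  "crossed_product X \<theta> = completion (algebraic_crossed_product X \<theta>) (crossed_norm X \<theta>)"

definition cfun_embed ::
  "'a topology \<Rightarrow> (int \<Rightarrow> 'a \<Rightarrow> 'a) \<Rightarrow> ('a \<Rightarrow> complex) \<Rightarrow> (nat \<Rightarrow> int \<Rightarrow> 'a \<Rightarrow> complex) set" where
  "cfun_embed X \<theta> f =
     null_rel (algebraic_crossed_product X \<theta>) (crossed_norm X \<theta>) ``
       {\<lambda>_ n x. if n = 0 then f x else 0}"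


section \<open>The group \<open>K\<^sub>0\<close> of a unital C*-algebra\<close>

text \<open>A square matrix is a pair of its size \<open>n\<close> and an entry function, of which only the values
  at indices below \<open>n\<close> are relevant.\<close>

type_synonym 'b sq_matrix = "nat \<times> (nat \<Rightarrow> nat \<Rightarrow> 'b)"

definition projections :: "('b, 'm) star_algebra_scheme \<Rightarrow> 'b sq_matrix set" where
  "projections B = {(n, p). \<forall>i<n. \<forall>j<n. p i j \<in> carrier B \<and> adj B (p j i) = p i j \<and>
     (\<Oplus>\<^bsub>B\<^esub>k\<in>{..<n}. p i k \<otimes>\<^bsub>B\<^esub> p k j) = p i j}"

text \<open>Murray-von Neumann equivalence of projections of possibly different sizes \<open>n\<close> and \<open>m\<close>:
  there is an \<open>m \<times> n\<close> matrix \<open>v\<close> with \<open>v\<^sup>* v = p\<close> and \<open>v v\<^sup>* = q\<close>.\<close>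

definition mvn_rel :: "('b, 'm) star_algebra_scheme \<Rightarrow> ('b sq_matrix \<times> 'b sq_matrix) set" where
  "mvn_rel B = {((n, p), (m, q)). (n, p) \<in> projections B \<and> (m, q) \<in> projections B \<and>
     (\<exists>v. (\<forall>i<m. \<forall>j<n. v i j \<in> carrier B) \<and>
          (\<forall>i<n. \<forall>j<n. (\<Oplus>\<^bsub>B\<^esub>k\<in>{..<m}. adj B (v k i) \<otimes>\<^bsub>B\<^esub> v k j) = p i j) \<and>
          (\<forall>i<m. \<forall>j<m. (\<Oplus>\<^bsub>B\<^esub>k\<in>{..<n}. v i k \<otimes>\<^bsub>B\<^esub> adj B (v j k)) = q i j))}"

definition direct_sum ::
  "('b, 'm) star_algebra_scheme \<Rightarrow> 'b sq_matrix \<Rightarrow> 'b sq_matrix \<Rightarrow> 'b sq_matrix" where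
  "direct_sum B P Q =
     (fst P + fst Q,
      \<lambda>i j. if i < fst P \<and> j < fst P then snd P i j
            else if fst P \<le> i \<and> fst P \<le> j then snd Q (i - fst P) (j - fst P)
            else \<zero>\<^bsub>B\<^esub>)"

definition projection_monoid :: "('b, 'm) star_algebra_scheme \<Rightarrow> 'b sq_matrix set monoid" where
  "projection_monoid B =
     \<lparr>carrier = projections B // mvn_rel B,
      monoid.mult = class_op2 (mvn_rel B) (direct_sum B),
      monoid.one = mvn_rel B `` {(0, \<lambda>_ _. \<zero>\<^bsub>B\<^esub>)}\<rparr>"

definition grothendieck_rel :: "('a, 'm) monoid_scheme \<Rightarrow> (('a \<times> 'a) \<times> ('a \<times> 'a)) set" where
  "grothendieck_rel M = {((a, b), (c, d)).
     a \<in> carrier M \<and> b \<in> carrier M \<and> c \<in> carrier M \<and> d \<in> carrier M \<and>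
     (\<exists>e\<in>carrier M. a \<otimes>\<^bsub>M\<^esub> d \<otimes>\<^bsub>M\<^esub> e = c \<otimes>\<^bsub>M\<^esub> b \<otimes>\<^bsub>M\<^esub> e)}"

definition grothendieck_group :: "('a, 'm) monoid_scheme \<Rightarrow> ('a \<times> 'a) set monoid" where
  "grothendieck_group M =
     \<lparr>carrier = (carrier M \<times> carrier M) // grothendieck_rel M,
      monoid.mult = class_op2 (grothendieck_rel M)
        (\<lambda>x y. (fst x \<otimes>\<^bsub>M\<^esub> fst y, snd x \<otimes>\<^bsub>M\<^esub> snd y)),
      monoid.one = grothendieck_rel M `` {(\<one>\<^bsub>M\<^esub>, \<one>\<^bsub>M\<^esub>)}\<rparr>"

definition K0 ::
  "('b, 'm) star_algebra_scheme \<Rightarrow> ('b sq_matrix set \<times> 'b sq_matrix set) set monoid" where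
  "K0 B = grothendieck_group (projection_monoid B)"

definition K0_class ::
  "('b, 'm) star_algebra_scheme \<Rightarrow> 'b sq_matrix \<Rightarrow> ('b sq_matrix set \<times> 'b sq_matrix set) set" where
  "K0_class B P = grothendieck_rel (projection_monoid B) ``
     {(mvn_rel B `` {P}, \<one>\<^bsub>projection_monoid B\<^esub>)}"


section \<open>The filtration\<close>

definition word_cylinder :: "(int \<Rightarrow> 'a) set \<Rightarrow> nat \<Rightarrow> (int \<Rightarrow> 'a) \<Rightarrow> (int \<Rightarrow> 'a) set" where
  "word_cylinder S n a = {b \<in> S. \<forall>k\<in>{0..int n}. b k = a k}"

text \<open>The image in \<open>K\<^sub>0(C(X) \<rtimes> \<int>)\<close> of the group of integer valued functions on \<open>X\<close> that depend
  only on the coordinates \<open>0, \<dots>, n\<close>, under \<open>C(X, \<int>) = K\<^sub>0(C(X)) \<rightarrow> K\<^sub>0(C(X) \<rtimes> \<int>)\<close>: such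
  functions are the integer combinations of indicators of cylinder sets, and the indicator of
  a clopen set corresponds to the class of the same function viewed as a \<open>1 \<times> 1\<close> projection.\<close>

definition K0_filtration ::
  "(int \<Rightarrow> 'a) topology \<Rightarrow> nat \<Rightarrow>
     ((nat \<Rightarrow> int \<Rightarrow> (int \<Rightarrow> 'a) \<Rightarrow> complex) set sq_matrix set \<times>
      (nat \<Rightarrow> int \<Rightarrow> (int \<Rightarrow> 'a) \<Rightarrow> complex) set sq_matrix set) set set" where
  "K0_filtration X n =
     generate (K0 (crossed_product X shift_pow))
       {K0_class (crossed_product X shift_pow)
          (1, \<lambda>_ _. cfun_embed X shift_pow (indicator (word_cylinder (topspace X) n a)))
        | a. a \<in> topspace X}"

definition free_abelian_of_rank :: "('a, 'm) monoid_scheme \<Rightarrow> nat \<Rightarrow> bool" where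
  "free_abelian_of_rank G r \<longleftrightarrow> G \<cong> free_Abelian_group {..<r}"


section \<open>Direct limits of sequences of groups\<close>

text \<open>\<open>transition \<phi> m d\<close> is the composite of \<open>\<phi> m, \<dots>, \<phi> (m + d - 1)\<close>, where \<open>\<phi> n\<close> is the
  structure map from the \<open>n\<close>-th to the next group.\<close>

primrec transition :: "(nat \<Rightarrow> 'a \<Rightarrow> 'a) \<Rightarrow> nat \<Rightarrow> nat \<Rightarrow> 'a \<Rightarrow> 'a" where
  "transition \<phi> m 0 x = x"
| "transition \<phi> m (Suc d) x = \<phi> (m + d) (transition \<phi> m d x)"

definition direct_limit_rel ::
  "(nat \<Rightarrow> ('a, 'm) monoid_scheme) \<Rightarrow> (nat \<Rightarrow> 'a \<Rightarrow> 'a) \<Rightarrow> ((nat \<times> 'a) \<times> (nat \<times> 'a)) set" where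
  "direct_limit_rel G \<phi> = {((m, x), (n, y)). x \<in> carrier (G m) \<and> y \<in> carrier (G n) \<and>
     (\<exists>k. m \<le> k \<and> n \<le> k \<and> transition \<phi> m (k - m) x = transition \<phi> n (k - n) y)}"

definition direct_limit ::
  "(nat \<Rightarrow> ('a, 'm) monoid_scheme) \<Rightarrow> (nat \<Rightarrow> 'a \<Rightarrow> 'a) \<Rightarrow> (nat \<times> 'a) set monoid" where
  "direct_limit G \<phi> =
     \<lparr>carrier = (SIGMA n:UNIV. carrier (G n)) // direct_limit_rel G \<phi>,
      monoid.mult = class_op2 (direct_limit_rel G \<phi>)
        (\<lambda>(m, x) (n, y). let k = max m n in
           (k, transition \<phi> m (k - m) x \<otimes>\<^bsub>G k\<^esub> transition \<phi> n (k - n) y)),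
      monoid.one = direct_limit_rel G \<phi> `` {(0, \<one>\<^bsub>G 0\<^esub>)}\<rparr>"

definition direct_limit_inj ::
  "(nat \<Rightarrow> ('a, 'm) monoid_scheme) \<Rightarrow> (nat \<Rightarrow> 'a \<Rightarrow> 'a) \<Rightarrow> nat \<Rightarrow> 'a \<Rightarrow> (nat \<times> 'a) set" where
  "direct_limit_inj G \<phi> n x = direct_limit_rel G \<phi> `` {(n, x)}"

text \<open>An increasing sequence of subgroups of \<open>H\<close> such that the inclusions induce an isomorphism
  from its direct limit onto \<open>H\<close>.\<close>

definition exhaustive_filtration :: "('a, 'm) monoid_scheme \<Rightarrow> (nat \<Rightarrow> 'a set) \<Rightarrow> bool" where
  "exhaustive_filtration H F \<longleftrightarrow>
     (\<forall>n. subgroup (F n) H \<and> F n \<subseteq> F (Suc n)) \<and>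
     (\<exists>\<psi>\<in>iso (direct_limit (\<lambda>n. H\<lparr>carrier := F n\<rparr>) (\<lambda>_ x. x)) H.
        \<forall>n. \<forall>x\<in>F n. \<psi> (direct_limit_inj (\<lambda>n. H\<lparr>carrier := F n\<rparr>) (\<lambda>_ x. x) n x) = x)"

end

theory Submission
  imports Defs "HOL-Library.Function_Algebras"
begin

text \<open>Both groups are identified with \<open>C(S, \<int>)\<close> modulo coboundaries \<open>f \<circ> T - f\<close>. For the mapping torus
  this follows by taking logarithms of circle-valued maps. For \<open>K\<^sub>0\<close>, let matrices over the crossed product
  act on \<open>\<ell>\<^sup>2(S \<times> \<int> \<times> \<nat>)\<close>. A projection \<open>p\<close> is replaced by a banded selfadjoint invertible operator \<open>h\<close> close
  to \<open>2p - 1\<close>; once hyperbolic summands are added, the equations of \<open>h\<close> on half-lines become solvable and their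
  solutions make \<open>h\<close> congruent to a matrix over \<open>C(S)\<close>, hence to a locally constant diagonal matrix of signs.
  So \<open>K\<^sub>0\<close> is generated by the classes of clopen sets. Relations are detected by the traces that sum a function
  over a periodic orbit: a locally constant function with vanishing sums is a coboundary. The functions of
  \<open>n + 1\<close> consecutive letters modulo coboundaries form the group of edges of the graph of words of length \<open>n\<close>
  modulo differences of vertices, which is free on the edges outside a spanning tree.\<close>

text \<open>Generation of \<open>K\<^sub>0\<close> by clopen sets is the surjectivity contained in
  the Pimsner-Voiculescu sequence, obtained here by explicit operators. They are available because
  the supremum over all C*-seminorms is the norm of the regular representation: the
  \<open>k\<close>-th power of a Laurent polynomial has only about \<open>k\<close> coefficients,
  too few to separate the two norms exponentially. The obstacle in diagonalizing \<open>h\<close> is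
  that its compression to a half-line may have kernel and cokernel. The hyperbolic summands supply,
  as new unknowns, the values of a solution on the \<open>D\<close> levels just outside the
  half-line, and a real parameter \<open>t\<close>. At each point obstructions for different
  \<open>t\<close> are orthogonal in a fixed finite-dimensional space, so some natural number is
  good, and dimension zero makes the choice locally constant. Exponential decay of the inverse of
  \<open>h\<close> keeps the solution in the norm-closed algebra. Congruence of forms, not unitary
  equivalence, survives these changes; polar decomposition finally turns it into an equivalence of
  projections.\<close>

type_synonym 'x idx = "'x \<times> int \<times> nat"
type_synonym 'x lau = "int => 'x => complex"
type_synonym 'x cel = "(nat => 'x lau) set"
notation scaleR (infixr "*r" 75) and iff (infixr "<->" 25)
abbreviation lim_seq ("(_)/ ----> (_)" [60, 60] 60) where "f ----> l \<equiv> (f \<longlongrightarrow> l) sequentially"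

section \<open>Square-summable families\<close>

typedef 'i ell2 = "{f :: 'i => complex. (%i. (cmod (f i))\<^sup>2) summable_on UNIV}"
morphisms coord ell2_of
by (rule exI[of _ "%_. 0"]) simp

setup_lifting type_definition_ell2

lemma coord_summable: "(%i. (cmod (coord x i))\<^sup>2) summable_on UNIV"
using coord[of x] by simp

lemma ell2_eqI: "(!!i. coord x i = coord y i) ==> x = y"
by (simp add: coord_inject[symmetric] fun_eq_iff)

lemma inner_summable:
fixes f h :: "'i => complex"
assumes "(%i. (cmod (f i))\<^sup>2) summable_on UNIV" "(%i. (cmod (h i))\<^sup>2) summable_on UNIV"
shows "(%i. inner (f i) (h i)) summable_on UNIV"
proof (rule abs_summable_summable, rule summable_on_comparison_test[OF summable_on_add[OF assms]])
fix i
have "0 <= cmod (f i) * cmod (h i)" by simp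
thus "norm (inner (f i) (h i)) <= (cmod (f i))\<^sup>2 + (cmod (h i))\<^sup>2"
 using Cauchy_Schwarz_ineq2[of "f i" "h i"] sum_squares_bound[of "cmod (f i)" "cmod (h i)"]
 by (simp only: real_norm_def)
qed simp

lemma square_summable_add:
fixes f h :: "'i => complex"
assumes "(%i. (cmod (f i))\<^sup>2) summable_on UNIV" "(%i. (cmod (h i))\<^sup>2) summable_on UNIV"
shows "(%i. (cmod (f i + h i))\<^sup>2) summable_on UNIV"
proof -
have "(%i. (cmod (f i))\<^sup>2 + (cmod (h i))\<^sup>2 + 2 * inner (f i) (h i)) summable_on UNIV"
 by (intro summable_on_add assms summable_on_cmult_right inner_summable)
moreover have "(cmod (f i))\<^sup>2 + (cmod (h i))\<^sup>2 + 2 * inner (f i) (h i) = (cmod (f i + h i))\<^sup>2" for i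
 by (simp add: power2_norm_eq_inner inner_add inner_commute algebra_simps)
ultimately show ?thesis by simp
qed

instantiation ell2 :: (type) real_inner
begin

lift_definition zero_ell2 :: "'a ell2" is "%_. 0" by simp
lift_definition plus_ell2 :: "'a ell2 => 'a ell2 => 'a ell2" is "%f h i. f i + h i"
by (rule square_summable_add)
lift_definition uminus_ell2 :: "'a ell2 => 'a ell2" is "%f i. - f i" by simp
lift_definition scaleR_ell2 :: "real => 'a ell2 => 'a ell2" is "%r f i. r *r f i"
by (simp add: power_mult_distrib summable_on_cmult_right)
definition minus_ell2 :: "'a ell2 => 'a ell2 => 'a ell2" where "minus_ell2 x y = x + (- y)"
text \<open>The real part of the Hermitian product, so that the theory of real inner product spaces
  applies. Imaginary parts are recovered by pairing with \<open>cscl \<i>\<close>.\<close>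

definition inner_ell2 :: "'a ell2 => 'a ell2 => real" where
"inner_ell2 x y = (\<Sum>\<^sub>\<infinity>i. inner (coord x i) (coord y i))"
definition norm_ell2 :: "'a ell2 => real" where "norm_ell2 x = sqrt (inner x x)"
definition sgn_ell2 :: "'a ell2 => 'a ell2" where "sgn_ell2 x = inverse (norm x) *r x"
definition dist_ell2 :: "'a ell2 => 'a ell2 => real" where "dist_ell2 x y = norm (x - y)"
definition uniformity_ell2 :: "('a ell2 \<times> 'a ell2) filter" where
"uniformity_ell2 = (INF e\<in>{0<..}. principal {(x, y). dist x y < e})"
definition open_ell2 :: "'a ell2 set => bool" where
"open_ell2 U = (\<forall>x\<in>U. eventually (%(x', y). x' = x --> y \<in> U) uniformity)"

instance
proof
fix x y z :: "'a ell2" and a b :: real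
show "x + y + z = x + (y + z)" "x + y = y + x" "0 + x = x" "- x + x = 0" "x - y = x + - y"
 "a *r (x + y) = a *r x + a *r y" "(a + b) *r x = a *r x + b *r x"
 "a *r b *r x = (a * b) *r x" "1 *r x = x"
 by (rule ell2_eqI; simp add: minus_ell2_def plus_ell2.rep_eq uminus_ell2.rep_eq zero_ell2.rep_eq
   scaleR_ell2.rep_eq algebra_simps)+
have ip: "(%i. inner (coord u i) (coord v i)) summable_on UNIV" for u v :: "'a ell2"
 by (rule inner_summable) (rule coord_summable)+
show "inner x y = inner y x" by (simp add: inner_ell2_def inner_commute)
show "inner (x + y) z = inner x z + inner y z"
 using infsum_add[OF ip ip, of x z y z]
 by (simp add: inner_ell2_def plus_ell2.rep_eq inner_add_left)
show "inner (a *r x) y = a * inner x y"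
 by (simp add: inner_ell2_def scaleR_ell2.rep_eq infsum_cmult_right[OF ip])
show "0 <= inner x x" unfolding inner_ell2_def by (rule infsum_nonneg) simp
show "(inner x x = 0) = (x = 0)"
proof
 assume "inner x x = 0"
 hence "inner (coord x i) (coord x i) <= 0" for i
  using finite_sum_le_infsum[OF ip[of x x], of "{i}"] by (simp add: inner_ell2_def)
 hence "coord x i = 0" for i by (metis inner_gt_zero_iff not_le)
 thus "x = 0" by (intro ell2_eqI) (simp add: zero_ell2.rep_eq)
next
 assume "x = 0"
 thus "inner x x = 0" unfolding inner_ell2_def by (simp add: zero_ell2.rep_eq)
qed
show "dist x y = norm (x - y)" by (rule dist_ell2_def)
show "sgn x = inverse (norm x) *r x" by (rule sgn_ell2_def)
show "norm x = sqrt (inner x x)" by (rule norm_ell2_def)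
show "uniformity = (INF e\<in>{0<..}. principal {(x, y :: 'a ell2). dist x y < e})" by (rule uniformity_ell2_def)
show "open U = (\<forall>x\<in>U. \<forall>\<^sub>F (x', y) in uniformity. x' = x --> y \<in> U)" for U :: "'a ell2 set" by (rule open_ell2_def)
qed

end

lemma coord_simps [simp]:
"coord 0 i = 0" "coord (x + y) i = coord x i + coord y i" "coord (- x) i = - coord x i"
"coord (r *r x) i = r *r coord x i"
by (simp_all add: zero_ell2.rep_eq plus_ell2.rep_eq uminus_ell2.rep_eq scaleR_ell2.rep_eq)

lemma coord_diff [simp]: "coord (x - y) i = coord x i - coord y i"
by (simp only: minus_ell2_def coord_simps diff_conv_add_uminus)

lemma coord_sum: "coord (sum f A) i = (\<Sum>a\<in>A. coord (f a) i)"
by (induction A rule: infinite_finite_induct) auto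

lemma norm_ell2_sq: "(norm x)\<^sup>2 = (\<Sum>\<^sub>\<infinity>i. (cmod (coord x i))\<^sup>2)"
by (simp add: power2_norm_eq_inner inner_ell2_def)

lemma sum_coord_le: "finite F ==> (\<Sum>i\<in>F. (cmod (coord x i))\<^sup>2) <= (norm x)\<^sup>2"
unfolding norm_ell2_sq by (rule finite_sum_le_infsum[OF coord_summable]) auto

lemma norm_coord_le: "cmod (coord x i) <= norm x"
using sum_coord_le[of "{i}" x] by (simp add: abs_le_square_iff[symmetric])

lemma norm_ell2_leI:
assumes "!!F. finite F ==> (\<Sum>i\<in>F. (cmod (coord x i))\<^sup>2) <= C\<^sup>2" "0 <= C"
shows "norm x <= C"
proof -
have "(norm x)\<^sup>2 <= C\<^sup>2"
 unfolding norm_ell2_sq by (rule infsum_le_finite_sums[OF coord_summable]) (use assms in auto)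
thus ?thesis using assms(2) by (simp add: abs_le_square_iff[symmetric])
qed

lemma bounded_linear_coord: "bounded_linear (%x. coord x i)"
by (rule bounded_linear_intro[of _ 1]) (auto simp: norm_coord_le)

instance ell2 :: (type) complete_space
proof
fix X :: "nat => 'a ell2" assume X: "Cauchy X"
hence "Cauchy (%n. coord (X n) i)" for i by (rule bounded_linear.Cauchy[OF bounded_linear_coord])
then obtain f where f: "!!i. (%n. coord (X n) i) ----> f i"
 unfolding Cauchy_convergent_iff convergent_def by metis
\<comment> \<open>The Cauchy estimate passes to coordinatewise limits only on finite index sets, but
  with a bound independent of the set. This yields both the summability of \<open>f\<close> and the
  convergence in norm.\<close>
have bound: "\<exists>M. \<forall>n\<ge>M. \<forall>F. finite F --> (\<Sum>i\<in>F. (cmod (coord (X n) i - f i))\<^sup>2) <= e\<^sup>2"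
 if e: "0 < e" for e
proof -
 obtain M where M: "\<forall>m\<ge>M. \<forall>n\<ge>M. dist (X m) (X n) < e"
  using X e by (auto simp: Cauchy_def)
 have "(\<Sum>i\<in>F. (cmod (coord (X n) i - f i))\<^sup>2) <= e\<^sup>2" if "n >= M" "finite F" for n F
 proof (rule LIMSEQ_le_const2)
  show "(%m. \<Sum>i\<in>F. (cmod (coord (X n) i - coord (X m) i))\<^sup>2)
    ----> (\<Sum>i\<in>F. (cmod (coord (X n) i - f i))\<^sup>2)"
   by (intro tendsto_intros f)
  have "(\<Sum>i\<in>F. (cmod (coord (X n) i - coord (X m) i))\<^sup>2) <= e\<^sup>2" if "m >= M" for m
  proof -
   have "(norm (X n - X m))\<^sup>2 <= e\<^sup>2"
    using M that \<open>n >= M\<close> by (intro power_mono) (auto simp: dist_norm intro: less_imp_le)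
   with sum_coord_le[OF \<open>finite F\<close>, of "X n - X m"] show ?thesis by simp
  qed
  thus "\<exists>N. \<forall>m\<ge>N. (\<Sum>i\<in>F. (cmod (coord (X n) i - coord (X m) i))\<^sup>2) <= e\<^sup>2" by blast
 qed
 thus ?thesis by blast
qed
obtain M where M: "\<forall>n\<ge>M. \<forall>F. finite F --> (\<Sum>i\<in>F. (cmod (coord (X n) i - f i))\<^sup>2) <= 1\<^sup>2"
 using bound[of 1] by auto
have "(%i. (cmod (coord (X M) i - f i))\<^sup>2) summable_on UNIV"
 by (rule nonneg_bdd_above_summable_on) (use M in "auto intro!: bdd_aboveI[of _ 1]")
hence "(%i. (cmod (coord (X M) i + (- (coord (X M) i - f i))))\<^sup>2) summable_on UNIV"
 by (intro square_summable_add coord_summable) (simp only: norm_minus_cancel)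
hence "(%i. (cmod (f i))\<^sup>2) summable_on UNIV" by simp
hence cf: "coord (ell2_of f) = f" by (simp add: ell2_of_inverse)
have "X ----> ell2_of f"
proof (rule LIMSEQ_I)
 fix r :: real assume r: "0 < r"
 then obtain N where N: "\<forall>n\<ge>N. \<forall>F. finite F -->
   (\<Sum>i\<in>F. (cmod (coord (X n) i - f i))\<^sup>2) <= (r / 2)\<^sup>2"
  using bound[of "r / 2"] by auto
 have "norm (X n - ell2_of f) < r" if "n >= N" for n
 proof -
  have "norm (X n - ell2_of f) <= r / 2"
   by (rule norm_ell2_leI) (use N that r cf in auto)
  thus ?thesis using r by simp
 qed
 thus "\<exists>N. \<forall>n\<ge>N. norm (X n - ell2_of f) < r" by blast
qed
thus "convergent X" by (auto simp: convergent_def)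
qed

lift_definition unit_vec :: "'i => 'i ell2" is "%j i. if i = j then 1 else 0"
proof -
fix j :: 'i
have "(%i. (cmod (if i = j then 1 else 0))\<^sup>2) summable_on {j}" by (rule summable_on_finite) simp
thus "(%i. (cmod (if i = j then 1 else 0))\<^sup>2) summable_on UNIV"
 by (rule summable_on_cong_neutral[THEN iffD1, rotated -1]) auto
qed

lemma coord_unit_vec: "coord (unit_vec j) i = (if i = j then 1 else 0)"
by (simp add: unit_vec.rep_eq)

lift_definition cscl :: "complex => 'i ell2 => 'i ell2" is "%c f i. c * f i"
by (simp add: norm_mult power_mult_distrib summable_on_cmult_right)

lemma coord_cscl [simp]: "coord (cscl c x) i = c * coord x i"
by (simp add: cscl.rep_eq)

lemma inner_unit_vec: "inner (unit_vec j) x = Re (coord x j)"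
proof -
have "inner (unit_vec j) x = (\<Sum>\<^sub>\<infinity>i\<in>{j}. inner (coord (unit_vec j) i) (coord x i))"
 unfolding inner_ell2_def by (rule infsum_cong_neutral) (auto simp: coord_unit_vec)
thus ?thesis by (simp add: coord_unit_vec)
qed

lemma inner_cscl: "inner (cscl c x) y = inner x (cscl (cnj c) y)"
unfolding inner_ell2_def by (rule infsum_cong) (simp add: inner_complex_def algebra_simps)

lemma inner_ii_unit_vec: "inner (cscl \<i> (unit_vec j)) x = Im (coord x j)"
by (simp add: inner_cscl inner_unit_vec)

lemma inner_eq_0_disjoint:
assumes "!!i. coord x i = 0 | coord y i = 0"
shows "inner x y = 0"
proof -
have "inner (coord x i) (coord y i) = 0" for i using assms[of i] by auto
thus ?thesis unfolding inner_ell2_def by simp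
qed

lemma norm_cscl: "norm (cscl c x) = cmod c * norm x"
proof -
have "(norm (cscl c x))\<^sup>2 = (cmod c * norm x)\<^sup>2"
 unfolding power_mult_distrib norm_ell2_sq
 by (simp add: norm_mult power_mult_distrib infsum_cmult_right[OF coord_summable])
thus ?thesis by simp
qed

lemma bounded_linear_cscl: "bounded_linear (cscl c)"
by (rule bounded_linear_intro[of _ "cmod c"])
 (auto intro!: ell2_eqI simp: norm_cscl algebra_simps)

section \<open>Bounded operators with an adjoint\<close>

lifting_forget ell2.lifting

instance ell2 :: (type) banach ..

text \<open>Bounded maps are only real linear here. The second clause adds complex linearity of
  \<open>f\<close>; that of \<open>h\<close> follows from it in
  \<open>adjoint_pair_sym\<close>.\<close>

definition adjoint_pair ::
"('i ell2 \<Rightarrow>\<^sub>L 'i ell2) => ('i ell2 \<Rightarrow>\<^sub>L 'i ell2) => bool" where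
"adjoint_pair f h <->
  (\<forall>x y. inner (blinfun_apply f x) y = inner x (blinfun_apply h y)) &
  (\<forall>x. blinfun_apply f (cscl \<i> x) = cscl \<i> (blinfun_apply f x))"

text \<open>Carrying the adjoint along avoids the Riesz representation theorem.\<close>

typedef 'i bop = "{(f :: 'i ell2 \<Rightarrow>\<^sub>L 'i ell2, h). adjoint_pair f h}"
by (rule exI[of _ "(0, 0)"]) (auto simp: adjoint_pair_def intro!: ell2_eqI)

setup_lifting type_definition_bop

lemma cscl_minus: "cscl (- c) x = - cscl c x"
by (rule ell2_eqI) simp

lemma inner_cscl_ii: "inner (cscl \<i> x) y = - inner x (cscl \<i> y)"
by (simp add: inner_cscl cscl_minus)

lemma adjoint_pair_sym:
assumes "adjoint_pair f h" shows "adjoint_pair h f"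
proof -
have f: "inner (blinfun_apply f x) y = inner x (blinfun_apply h y)"
 "blinfun_apply f (cscl \<i> x) = cscl \<i> (blinfun_apply f x)" for x y
 using assms by (auto simp: adjoint_pair_def)
have "inner z (blinfun_apply h (cscl \<i> x)) = inner z (cscl \<i> (blinfun_apply h x))" for z x
proof -
 have "inner z (blinfun_apply h (cscl \<i> x)) = inner (blinfun_apply f z) (cscl \<i> x)" by (simp add: f)
 also have "... = - inner (blinfun_apply f (cscl \<i> z)) x" by (metis f(2) inner_cscl_ii minus_minus)
 also have "... = - inner (cscl \<i> z) (blinfun_apply h x)" by (simp only: f(1))
 also have "... = inner z (cscl \<i> (blinfun_apply h x))" by (simp add: inner_cscl_ii)
 finally show ?thesis .
qed
hence "blinfun_apply h (cscl \<i> x) = cscl \<i> (blinfun_apply h x)" for x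
 by (metis vector_eq_rdot inner_commute)
thus ?thesis using f by (auto simp: adjoint_pair_def) (metis inner_commute)
qed

lift_definition app :: "'i bop => 'i ell2 => 'i ell2" is "%(f, h). blinfun_apply f" .

lift_definition star :: "'i bop => 'i bop" is "%(f, h). (h, f)"
by (auto intro: adjoint_pair_sym)

text \<open>An adjoint is determined by its operator, so the second component of a pair carries no
  further information.\<close>

lemma bop_eqI:
assumes "!!x. app A x = app B x" shows "A = B"
proof -
obtain f h where A: "Rep_bop A = (f, h)" by force
obtain f' h' where B: "Rep_bop B = (f', h')" by force
have ap: "adjoint_pair f h" "adjoint_pair f' h'" using Rep_bop[of A] Rep_bop[of B] A B by auto
have f: "f = f'" using assms A B by (auto simp: app.rep_eq intro: blinfun_eqI)
have "blinfun_apply h y = blinfun_apply h' y" for y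
 using ap f by (metis adjoint_pair_def vector_eq_ldot)
hence "h = h'" by (rule blinfun_eqI)
thus ?thesis using f A B by (simp add: Rep_bop_inject[symmetric])
qed

instantiation bop :: (type) real_normed_vector
begin

lift_definition zero_bop :: "'a bop" is "(0, 0)"
by (auto simp: adjoint_pair_def intro!: ell2_eqI)
lift_definition plus_bop :: "'a bop => 'a bop => 'a bop" is
"%(f, h) (f', h'). (f + f', h + h')"
by (auto simp: adjoint_pair_def blinfun.add_left inner_add algebra_simps intro!: ell2_eqI)
lift_definition uminus_bop :: "'a bop => 'a bop" is "%(f, h). (- f, - h)"
by (auto simp: adjoint_pair_def blinfun.minus_left intro!: ell2_eqI)
lift_definition scaleR_bop :: "real => 'a bop => 'a bop" is "%r (f, h). (r *r f, r *r h)"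
by (auto simp: adjoint_pair_def blinfun.scaleR_left intro!: ell2_eqI)
lift_definition norm_bop :: "'a bop => real" is "%(f, h). norm f" .
definition minus_bop :: "'a bop => 'a bop => 'a bop" where "minus_bop A B = A + (- B)"
definition sgn_bop :: "'a bop => 'a bop" where "sgn_bop A = inverse (norm A) *r A"
definition dist_bop :: "'a bop => 'a bop => real" where "dist_bop A B = norm (A - B)"
definition uniformity_bop :: "('a bop \<times> 'a bop) filter" where
"uniformity_bop = (INF e\<in>{0<..}. principal {(A, B). dist A B < e})"
definition open_bop :: "'a bop set => bool" where
"open_bop U = (\<forall>x\<in>U. eventually (%(x', y). x' = x --> y \<in> U) uniformity)"

instance
proof
fix A B C :: "'a bop" and a b :: real
show "A + B + C = A + (B + C)" "A + B = B + A" "0 + A = A" "- A + A = 0"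
 "a *r (A + B) = a *r A + a *r B" "(a + b) *r A = a *r A + b *r A"
 "a *r b *r A = (a * b) *r A" "1 *r A = A"
 by (transfer; auto simp: algebra_simps)+
show "A - B = A + - B" by (rule minus_bop_def)
show "dist A B = norm (A - B)" by (rule dist_bop_def)
show "sgn A = inverse (norm A) *r A" by (rule sgn_bop_def)
show "uniformity = (INF e\<in>{0<..}. principal {(x, y :: 'a bop). dist x y < e})"
 by (rule uniformity_bop_def)
show "open U = (\<forall>x\<in>U. \<forall>\<^sub>F (x', y) in uniformity. x' = x --> y \<in> U)" for U :: "'a bop set"
 by (rule open_bop_def)
show "norm A = 0 <-> A = 0"
proof
 assume "norm A = 0"
 hence "app A x = app 0 x" for x by transfer auto
 thus "A = 0" by (rule bop_eqI)
qed (transfer, auto)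
show "norm (A + B) <= norm A + norm B" by transfer (auto intro: norm_triangle_ineq)
show "norm (a *r A) = \<bar>a\<bar> * norm A" by transfer auto
qed

end

instantiation bop :: (type) real_normed_algebra_1
begin

lift_definition times_bop :: "'a bop => 'a bop => 'a bop" is
"%(f, h) (f', h'). (f o\<^sub>L f', h' o\<^sub>L h)"
by (auto simp: adjoint_pair_def)
lift_definition one_bop :: "'a bop" is "(id_blinfun, id_blinfun)"
by (auto simp: adjoint_pair_def)

instance
proof
fix A B C :: "'a bop" and r :: real
show "A * B * C = A * (B * C)" "1 * A = A" "A * 1 = A"
 "(A + B) * C = A * C + B * C" "A * (B + C) = A * B + A * C"
 "r *r A * B = r *r (A * B)" "A * r *r B = r *r (A * B)"
 by (transfer; auto intro!: blinfun_eqI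
   simp: blinfun.add_left blinfun.add_right blinfun.scaleR_left blinfun.scaleR_right)+
show "norm (A * B) <= norm A * norm B" by transfer (auto intro: norm_blinfun_compose)
have n1: "norm (id_blinfun :: 'a ell2 \<Rightarrow>\<^sub>L 'a ell2) = 1"
proof (rule antisym)
 let ?u = "unit_vec undefined :: 'a ell2"
 have "?u ~= 0" by (metis coord_simps(1) coord_unit_vec zero_neq_one)
 thus "1 <= norm (id_blinfun :: 'a ell2 \<Rightarrow>\<^sub>L 'a ell2)"
  using norm_blinfun[of "id_blinfun :: 'a ell2 \<Rightarrow>\<^sub>L 'a ell2" ?u] by simp
qed (rule norm_blinfun_bound; simp)
thus n: "norm (1 :: 'a bop) = 1" by transfer simp
thus "(0 :: 'a bop) ~= 1" by (metis norm_zero zero_neq_one)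
qed

end

lemma app_simps [simp]:
"app 0 x = 0" "app (A + B) x = app A x + app B x" "app (- A) x = - app A x"
"app (r *r A) x = r *r app A x" "app (A * B) x = app A (app B x)" "app 1 x = x"
by (transfer; auto simp: blinfun.add_left blinfun.minus_left blinfun.scaleR_left)+

lemma app_diff_left [simp]: "app (A - B) x = app A x - app B x"
by (simp only: diff_conv_add_uminus app_simps)

lemma bounded_linear_app: "bounded_linear (app A)"
by transfer (auto simp: blinfun.bounded_linear_right)

lemmas app_linear [simp] =
linear_add[OF bounded_linear.linear[OF bounded_linear_app]]
linear_diff[OF bounded_linear.linear[OF bounded_linear_app]]
linear_neg[OF bounded_linear.linear[OF bounded_linear_app]]
linear_0[OF bounded_linear.linear[OF bounded_linear_app]]
linear_scale[OF bounded_linear.linear[OF bounded_linear_app]]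

lemma app_sum: "app A (sum f S) = (\<Sum>s\<in>S. app A (f s))"
by (rule linear_sum[OF bounded_linear.linear[OF bounded_linear_app]])

lemma app_sum_left: "app (sum F S) x = (\<Sum>s\<in>S. app (F s) x)"
by (induction S rule: infinite_finite_induct) auto

lemma norm_app_le: "norm (app A x) <= norm A * norm x"
by transfer (auto intro: norm_blinfun)

lemma norm_bop_leI: "(!!x. norm (app A x) <= C * norm x) ==> 0 <= C ==> norm A <= C"
by transfer (auto intro: norm_blinfun_bound)

lemma bounded_linear_app_left: "bounded_linear (%A. app A x)"
by (rule bounded_linear_intro[of _ "norm x"]) (auto simp: norm_app_le mult.commute)

lemma app_cscl [simp]: "app A (cscl c x) = cscl c (app A x)"
proof -
have i: "app A (cscl \<i> x) = cscl \<i> (app A x)" by transfer (auto simp: adjoint_pair_def)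
have c: "cscl c y = Re c *r y + Im c *r cscl \<i> y" for y :: "'a ell2"
 by (rule ell2_eqI) (simp add: complex_eq_iff)
show ?thesis by (subst (1 2) c) (simp add: i)
qed

lemma star_inner: "inner (app A x) y = inner x (app (star A) y)"
by transfer (auto simp: adjoint_pair_def)

lemma star_inner': "inner (app (star A) x) y = inner x (app A y)"
by (metis inner_commute star_inner)

lemma star_simps [simp]:
"star (star A) = A" "star 0 = 0" "star 1 = 1" "star (A + B) = star A + star B"
"star (- A) = - star A" "star (r *r A) = r *r star A" "star (A * B) = star B * star A"
by (transfer; auto)+

lemma star_diff [simp]: "star (A - B) = star A - star B"
by (simp only: diff_conv_add_uminus star_simps)

lemma star_sum: "star (sum F S) = (\<Sum>s\<in>S. star (F s))"
by (induction S rule: infinite_finite_induct) auto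

lemma star_power: "star (A ^ n) = star A ^ n"
by (induction n) (auto simp: power_commutes)

text \<open>The squared length of \<open>A x\<close> is a value of the form of
  \<open>star A * A\<close>, so the square of \<open>norm A\<close> is at most
  \<open>norm (star A * A)\<close>. Submultiplicativity then gives
  \<open>norm A \<le> norm (star A)\<close>, and applying this to \<open>star A\<close> closes the
  circle.\<close>

lemma norm_star [simp]: "norm (star A) = norm A"
and norm_star_mult: "norm (star A * A) = (norm A)\<^sup>2"
proof -
have sq: "(norm (app A x))\<^sup>2 <= norm (star A * A) * (norm x)\<^sup>2" for A :: "'a bop" and x
proof -
 have "(norm (app A x))\<^sup>2 = inner (app (star A * A) x) x"
  by (simp add: power2_norm_eq_inner star_inner')
 also have "... <= norm (app (star A * A) x) * norm x" by (rule norm_cauchy_schwarz)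
 also have "... <= norm (star A * A) * norm x * norm x"
  by (intro mult_right_mono norm_app_le) simp
 finally show ?thesis by (simp add: power2_eq_square)
qed
have le: "(norm A)\<^sup>2 <= norm (star A * A)" for A :: "'a bop"
proof -
 have "norm (app A x) <= sqrt (norm (star A * A)) * norm x" for x
  by (rule power2_le_imp_le) (auto simp: power_mult_distrib sq)
 hence "norm A <= sqrt (norm (star A * A))" by (rule norm_bop_leI) simp
 thus ?thesis by (metis norm_ge_zero power_mono real_sqrt_pow2)
qed
have ns: "norm A <= norm (star A)" for A :: "'a bop"
proof (cases "norm A = 0")
 case False
 have "norm A * norm A <= norm (star A) * norm A"
  using le[of A] norm_mult_ineq[of "star A" A] by (simp add: power2_eq_square)
 thus ?thesis using False by (simp add: mult_le_cancel_right)
qed simp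
show "norm (star A) = norm A" using ns[of A] ns[of "star A"] by simp
thus "norm (star A * A) = (norm A)\<^sup>2" using le[of A] norm_mult_ineq[of "star A" A]
 by (simp add: power2_eq_square)
qed

lemma bounded_linear_star: "bounded_linear star"
by (rule bounded_linear_intro[of _ 1]) auto

lemma Rep_bop_diff:
"Rep_bop (A - B) = (fst (Rep_bop A) - fst (Rep_bop B), snd (Rep_bop A) - snd (Rep_bop B))"
by (simp only: minus_bop_def plus_bop.rep_eq uminus_bop.rep_eq case_prod_beta fst_conv snd_conv
  diff_conv_add_uminus)

instance bop :: (type) banach
proof
fix X :: "nat => 'a bop"
assume X: "Cauchy X"
let ?f = "%n. fst (Rep_bop (X n))" and ?h = "%n. snd (Rep_bop (X n))"
have nf: "norm (?f m - ?f n) = norm (X m - X n)" for m n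
 by (simp add: norm_bop.rep_eq Rep_bop_diff)
have nh: "norm (?h m - ?h n) = norm (star (X m - X n))" for m n
 by (simp add: norm_bop.rep_eq star.rep_eq Rep_bop_diff del: star_diff norm_star)
have "Cauchy ?f" "Cauchy ?h"
 using X unfolding Cauchy_def dist_norm by (simp_all only: nf nh norm_star)
then obtain f h where f: "?f ----> f" and h: "?h ----> h"
 unfolding Cauchy_convergent_iff convergent_def by auto
have ap: "adjoint_pair (?f n) (?h n)" for n using Rep_bop[of "X n"] by auto
have lf: "(%n. blinfun_apply (?f n) x) ----> blinfun_apply f x" for x
 by (intro tendsto_intros f)
have lh: "(%n. blinfun_apply (?h n) x) ----> blinfun_apply h x" for x
 by (intro tendsto_intros h)
have "adjoint_pair f h"
 unfolding adjoint_pair_def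
proof (intro conjI allI)
 fix x y
 have "(%n. inner (blinfun_apply (?f n) x) y) ----> inner (blinfun_apply f x) y"
  by (intro tendsto_intros lf)
 moreover have "(%n. inner (blinfun_apply (?f n) x) y) ----> inner x (blinfun_apply h y)"
  using ap by (simp add: adjoint_pair_def) (intro tendsto_intros lh)
 ultimately show "inner (blinfun_apply f x) y = inner x (blinfun_apply h y)"
  by (rule LIMSEQ_unique)
 have "(%n. cscl \<i> (blinfun_apply (?f n) x)) ----> cscl \<i> (blinfun_apply f x)"
  by (rule bounded_linear.tendsto[OF bounded_linear_cscl lf])
 hence "(%n. blinfun_apply (?f n) (cscl \<i> x)) ----> cscl \<i> (blinfun_apply f x)"
  using ap by (simp add: adjoint_pair_def)
 thus "blinfun_apply f (cscl \<i> x) = cscl \<i> (blinfun_apply f x)"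
  using lf LIMSEQ_unique by blast
qed
hence "Rep_bop (Abs_bop (f, h)) = (f, h)" by (simp add: Abs_bop_inverse)
hence "norm (X n - Abs_bop (f, h)) = norm (?f n - f)" for n
 by (simp add: norm_bop.rep_eq Rep_bop_diff)
hence "X ----> Abs_bop (f, h)"
 using f by (simp add: LIMSEQ_iff)
thus "convergent X" by (auto simp: convergent_def)
qed

text \<open>Polarization: for a selfadjoint operator the off-diagonal values
  \<open>inner (B x) y\<close> are differences of diagonal ones, controlled by the parallelogram
  law.\<close>

lemma norm_selfadjoint_le:
assumes "star B = B" and b: "!!x. \<bar>inner (app B x) x\<bar> <= b * (norm x)\<^sup>2" and "0 <= b"
shows "norm B <= b"
proof (rule norm_bop_leI)
fix x
let ?z = "app B x"
show "norm ?z <= b * norm x"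
proof (cases "?z = 0 | x = 0")
 case False
 \<comment> \<open>Parallel to \<open>B x\<close> and of the same length as \<open>x\<close>: then
   the left-hand side is \<open>norm x * norm (B x)\<close> and the parallelogram law returns
   \<open>4 * (norm x)^2\<close>.\<close>
 define y where "y = (norm x / norm ?z) *r ?z"
 have ny: "norm y = norm x" using False by (simp add: y_def)
 have sym: "inner (app B u) v = inner u (app B v)" for u v
  using star_inner[of B u v] assms(1) by simp
 have "4 * inner ?z y = inner (app B (x + y)) (x + y) - inner (app B (x - y)) (x - y)"
  using sym[of y x] by (simp add: inner_add inner_diff algebra_simps inner_commute)
 also have "... <= b * (norm (x + y))\<^sup>2 + b * (norm (x - y))\<^sup>2"
  using b[of "x + y"] b[of "x - y"] by linarith
 also have "... = b * ((norm (x + y))\<^sup>2 + (norm (x - y))\<^sup>2)" by (simp add: algebra_simps)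
 also have "(norm (x + y))\<^sup>2 + (norm (x - y))\<^sup>2 = 2 * (norm x)\<^sup>2 + 2 * (norm y)\<^sup>2"
  by (simp add: power2_norm_eq_inner inner_add inner_diff inner_commute)
 also have "b * ... = b * (4 * (norm x)\<^sup>2)" by (simp add: ny)
 finally have "inner ?z y <= b * (norm x)\<^sup>2" by simp
 moreover have "inner ?z y = norm x * norm ?z"
  using False by (simp add: y_def power2_norm_eq_inner[symmetric] power2_eq_square)
 ultimately have "norm x * norm ?z <= norm x * (b * norm x)"
  by (simp add: power2_eq_square algebra_simps)
 thus ?thesis using False by (simp add: mult_le_cancel_left)
qed (use \<open>0 <= b\<close> in auto)
qed (rule \<open>0 <= b\<close>)

lemma inner_app_le: "inner (app A x) x <= norm A * (norm x)\<^sup>2"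
using Cauchy_Schwarz_ineq2[of "app A x" x] mult_right_mono[OF norm_app_le[of A x], of "norm x"]
by (simp add: power2_eq_square mult.assoc)

section \<open>Polar decomposition\<close>

text \<open>The Taylor coefficients of \<open>1 / sqrt (1 - y)\<close>.\<close>

definition binom_half :: "nat => real" where "binom_half k = pochhammer (1 / 2) k / fact k"

text \<open>The binomial theorem for rising factorials with \<open>1 / 2 + 1 / 2 = 1\<close>: the
  square of the series is the geometric series.\<close>

lemma binom_half_convolution: "(\<Sum>i\<le>k. binom_half i * binom_half (k - i)) = 1"
proof -
have "fact k * (\<Sum>i\<le>k. binom_half i * binom_half (k - i)) = pochhammer (1 / 2 + 1 / 2 :: real) k"
 unfolding pochhammer_binomial_sum sum_distrib_left
 by (intro sum.cong refl) (simp add: binom_half_def binomial_fact)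
thus ?thesis by (simp add: pochhammer_fact[symmetric])
qed

text \<open>Each coefficient is one term (\<open>i = 0\<close>) of the convolution, whose
  nonnegative terms add up to 1. Hence the geometric series dominates the binomial one.\<close>

lemma binom_half_bounds: "0 <= binom_half k" "binom_half k <= 1"
proof -
show n: "0 <= binom_half k" for k by (simp add: binom_half_def pochhammer_nonneg)
have "binom_half 0 * binom_half (k - 0) <= (\<Sum>i\<le>k. binom_half i * binom_half (k - i))"
 using n by (intro member_le_sum[of 0 "{..k}" "%i. binom_half i * binom_half (k - i)"]) auto
thus "binom_half k <= 1" by (simp add: binom_half_convolution) (simp add: binom_half_def)
qed

lemma neumann:
fixes y :: "'a :: {real_normed_algebra_1, banach}"
assumes "norm y < 1"
shows "summable (%k. y ^ k)" "suminf ((^) y) = 1 + y * suminf ((^) y)" "suminf ((^) y) = 1 + suminf ((^) y) * y"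
proof -
show s: "summable (%k. y ^ k)"
 by (rule summable_norm_cancel, rule summable_comparison_test[OF _ summable_geometric[of "norm y"]])
  (use assms in "auto intro: norm_power_ineq")
show "suminf ((^) y) = 1 + y * suminf ((^) y)" "suminf ((^) y) = 1 + suminf ((^) y) * y"
 using suminf_split_head[OF s] suminf_mult[OF s, of y] suminf_mult2[OF s, of y] by (simp_all add: power_commutes)
qed

definition inv_sqrt :: "'a :: {real_normed_algebra_1, banach} => 'a" where
"inv_sqrt y = suminf (%k. binom_half k *r y ^ k)"

lemma inv_sqrt_summable:
fixes y :: "'a :: {real_normed_algebra_1, banach}"
assumes "norm y < 1"
shows "summable (%k. norm (binom_half k *r y ^ k))"
proof (rule summable_comparison_test)
show "summable (%k. norm y ^ k)" using assms by (simp add: summable_geometric)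
have "norm (norm (binom_half k *r y ^ k)) <= norm y ^ k" for k
 using binom_half_bounds[of k] mult_mono[OF binom_half_bounds(2) norm_power_ineq[of y k]] by simp
thus "\<exists>N. \<forall>k\<ge>N. norm (norm (binom_half k *r y ^ k)) <= norm y ^ k" by blast
qed

lemma inv_sqrt_square:
fixes y :: "'a :: {real_normed_algebra_1, banach}"
assumes "norm y < 1"
shows "inv_sqrt y * inv_sqrt y * (1 - y) = 1" "(1 - y) * (inv_sqrt y * inv_sqrt y) = 1"
proof -
have "inv_sqrt y * inv_sqrt y = suminf (%k. \<Sum>i\<le>k. (binom_half i *r y ^ i) * (binom_half (k - i) *r y ^ (k - i)))"
 unfolding inv_sqrt_def by (rule Cauchy_product) (rule inv_sqrt_summable[OF assms])+
also have "... = suminf ((^) y)"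
proof (rule suminf_cong)
 fix k
 have "(\<Sum>i\<le>k. (binom_half i *r y ^ i) * (binom_half (k - i) *r y ^ (k - i))) =
   (\<Sum>i\<le>k. (binom_half i * binom_half (k - i)) *r y ^ k)"
  by (intro sum.cong refl) (auto simp: power_add[symmetric])
 also have "... = y ^ k" by (simp add: binom_half_convolution flip: scaleR_sum_left)
 finally show "(\<Sum>i\<le>k. (binom_half i *r y ^ i) * (binom_half (k - i) *r y ^ (k - i))) = y ^ k" .
qed
finally have eq: "inv_sqrt y * inv_sqrt y = suminf ((^) y)" .
show "inv_sqrt y * inv_sqrt y * (1 - y) = 1" "(1 - y) * (inv_sqrt y * inv_sqrt y) = 1"
 unfolding eq using neumann(2,3)[OF assms] by (simp_all add: right_diff_distrib left_diff_distrib diff_eq_eq)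
qed

lemma inv_sqrt_commute:
fixes y :: "'a :: {real_normed_algebra_1, banach}"
assumes "norm y < 1" "z * y = y * z"
shows "z * inv_sqrt y = inv_sqrt y * z"
proof -
note s = summable_norm_cancel[OF inv_sqrt_summable[OF assms(1)]]
have "z * y ^ k = y ^ k * z" for k
 using power_commuting_commutes[OF assms(2)[symmetric], of k] by simp
thus ?thesis unfolding inv_sqrt_def
 by (simp add: suminf_mult[OF s, symmetric] suminf_mult2[OF s])
qed

lemma star_inv_sqrt: "norm y < 1 ==> star y = y ==> star (inv_sqrt y) = inv_sqrt y"
unfolding inv_sqrt_def
by (subst bounded_linear.suminf[OF bounded_linear_star])
 (auto intro: summable_norm_cancel[OF inv_sqrt_summable] simp: star_power)

text \<open>\<open>v\<close> is invertible between the corners \<open>Q\<close> and \<open>P\<close>; its polar part implements an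
equivalence of these projections and is a limit of polynomials \<open>v p(v\<^sup>* v)\<close>.\<close>

lemma polar_decomposition:
fixes v P Q :: "'i bop"
assumes P: "star P = P" "P * P = P" and Q: "star Q = Q" "Q * Q = Q"
 and v: "P * v = v" "v * Q = v"
 and c: "0 < c" "!!x. c * (norm (app Q x))\<^sup>2 <= (norm (app v x))\<^sup>2"
  "!!x. c * (norm (app P x))\<^sup>2 <= (norm (app (star v) x))\<^sup>2"
obtains w where "star w * w = Q" "w * star w = P"
 "!!M. closed M ==> v \<in> M ==> (!!x y r. x \<in> M ==> y \<in> M ==> x + r *r y \<in> M) ==>
   (!!x. x \<in> M ==> x * (star v * v) \<in> M) ==> w \<in> M"
proof -
have vP: "star v * P = star v" and vQ: "Q * star v = star v"
 using v P Q by (metis star_simps(7))+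
\<comment> \<open>The summand \<open>1 - Q\<close> makes \<open>star v * v\<close> bounded below on
  the whole space, not only on the corner \<open>Q\<close>. After division by \<kappa> the form of
  \<open>a\<close> lies between \<open>d / \<kappa>\<close> and 1, so \<open>y\<close> has norm less
  than 1 and \<open>1 - y\<close> is a multiple of \<open>a\<close>.\<close>
define a where "a = star v * v + (1 - Q)"
define \<kappa> where "\<kappa> = max (norm a) 1"
define y where "y = 1 - (1 / \<kappa>) *r a"
have \<kappa>: "0 < \<kappa>" "norm a <= \<kappa>" by (auto simp: \<kappa>_def)
have sa: "star a = a" by (simp add: a_def Q)
have Qv: "star v * v * Q = star v * v" "Q * (star v * v) = star v * v"
 using v vQ by (simp_all add: mult.assoc[symmetric]) (simp add: mult.assoc)
have aQ: "a * Q = star v * v" "Q * a = star v * v"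
 using Qv Q by (simp_all add: a_def algebra_simps)
define d where "d = min c 1"
have d: "0 < d" "d <= 1" "d <= c" using c by (auto simp: d_def)
have pyth: "(norm x)\<^sup>2 = (norm (app Q x))\<^sup>2 + (norm (app (1 - Q) x))\<^sup>2" for x
proof -
 have "inner (app Q x) (app Q x) = inner x (app Q x)" for x
  using star_inner[of Q x "app Q x"] Q by (simp flip: app_simps(5))
 thus ?thesis
  by (simp add: power2_norm_eq_inner inner_diff algebra_simps inner_commute)
qed
have forma: "inner (app a x) x = (norm (app v x))\<^sup>2 + (norm (app (1 - Q) x))\<^sup>2" for x
proof -
 have "inner (app Q x) (app Q x) = inner x (app Q x)" for x
  using star_inner[of Q x "app Q x"] Q by (simp flip: app_simps(5))
 moreover have "inner (app (star v) (app v x)) x = inner (app v x) (app v x)" by (rule star_inner')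
 ultimately show ?thesis
  by (simp add: a_def power2_norm_eq_inner inner_add inner_diff inner_commute)
qed
have lower: "d * (norm x)\<^sup>2 <= inner (app a x) x" for x
proof -
 have "d * (norm (app Q x))\<^sup>2 <= (norm (app v x))\<^sup>2"
  using c(2)[of x] d by (meson mult_right_mono order_trans zero_le_power2)
 moreover have "d * (norm (app (1 - Q) x))\<^sup>2 <= (norm (app (1 - Q) x))\<^sup>2"
  using d by (simp add: mult_left_le_one_le)
 ultimately show ?thesis unfolding forma by (subst pyth) (simp add: algebra_simps)
qed
have sy: "star y = y" by (simp add: y_def sa)
have "norm y <= 1 - d / \<kappa>"
proof (rule norm_selfadjoint_le[OF sy])
 have d\<kappa>: "d <= \<kappa>" using d by (simp add: \<kappa>_def)
 thus "0 <= 1 - d / \<kappa>" using \<kappa> by simp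
 fix x
 have eq: "inner (app y x) x = (norm x)\<^sup>2 - inner (app a x) x / \<kappa>"
  by (simp add: y_def inner_diff power2_norm_eq_inner)
 have "inner (app a x) x <= \<kappa> * (norm x)\<^sup>2"
  using inner_app_le[of a x] \<kappa>(2) by (meson mult_right_mono order_trans zero_le_power2)
 hence "0 <= inner (app y x) x" using \<kappa>(1) unfolding eq by (simp add: field_simps)
 moreover have "inner (app y x) x <= (1 - d / \<kappa>) * (norm x)\<^sup>2"
  unfolding eq using lower[of x] \<kappa>(1) by (simp add: field_simps)
 ultimately show "\<bar>inner (app y x) x\<bar> <= (1 - d / \<kappa>) * (norm x)\<^sup>2" by linarith
qed
moreover have "0 < d / \<kappa>" using d \<kappa> by simp
ultimately have y: "norm y < 1" by linarith
have ya: "1 - y = (1 / \<kappa>) *r a" by (simp add: y_def)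
define s where "s = inv_sqrt y"
have unscale: "z = \<kappa> *r 1" if "(1 / \<kappa>) *r z = 1" for z :: "'i bop"
 using \<kappa>(1) arg_cong[OF that, of "scaleR \<kappa>"] by simp
have ss: "s * s * a = \<kappa> *r 1" "a * (s * s) = \<kappa> *r 1"
 using inv_sqrt_square[OF y] unfolding ya s_def[symmetric] by (auto intro: unscale)
have sst: "star s = s" unfolding s_def by (rule star_inv_sqrt[OF y sy])
have Qy: "Q * y = y * Q" using aQ by (simp add: y_def algebra_simps)
have Qs: "Q * s = s * Q" unfolding s_def by (rule inv_sqrt_commute[OF y Qy])
have ay: "a * y = y * a" by (simp add: y_def algebra_simps)
have as: "a * s = s * a" unfolding s_def by (rule inv_sqrt_commute[OF y ay])
\<comment> \<open>Since \<open>s * s\<close> is \<kappa> times the inverse of \<open>a\<close>, this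
  is \<open>v\<close> times the inverse square root of \<open>a\<close>.\<close>
define w where "w = (1 / sqrt \<kappa>) *r (v * s)"
have k2: "(1 / sqrt \<kappa>) * (1 / sqrt \<kappa>) = 1 / \<kappa>" using \<kappa>(1) by simp
have ww: "star w * w = Q"
proof -
 have "star w * w = (1 / \<kappa>) *r (s * (star v * v) * s)"
  by (simp add: w_def sst mult.assoc k2[symmetric])
 also have "s * (star v * v) * s = s * s * a * Q"
  by (simp add: aQ(1)[symmetric] mult.assoc Qs as) (simp add: mult.assoc[symmetric] as)
 also have "... = \<kappa> *r Q" by (simp add: ss)
 finally show ?thesis using \<kappa>(1) by simp
qed
define R where "R = w * star w"
have R: "R * R = R" "star R = R"
proof -
 have "R * R = w * (star w * w) * star w" by (simp add: R_def mult.assoc)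
 also have "... = w * star w" unfolding ww by (simp add: w_def mult.assoc Qs[symmetric]) (simp add: mult.assoc[symmetric] v)
 finally show "R * R = R" by (simp add: R_def)
qed (simp add: R_def)
have Rv: "R * v = v"
proof -
 have "R * v = (1 / \<kappa>) *r (v * (s * s) * (star v * v))"
  by (simp add: R_def w_def sst mult.assoc k2[symmetric])
 also have "v * (s * s) * (star v * v) = v * (s * s * a) * Q"
  by (simp add: aQ(1)[symmetric] mult.assoc)
 also have "... = \<kappa> *r v" using v by (simp add: ss)
 finally show ?thesis using \<kappa>(1) by simp
qed
have PR: "P * R = R" "R * P = R"
 using v vP by (simp_all add: R_def w_def mult.assoc) (simp add: mult.assoc[symmetric])
\<comment> \<open>The final projection \<open>R\<close> of \<open>w\<close> fixes the range of
  \<open>v\<close>, so \<open>star v\<close> vanishes on the part of \<open>P\<close> outside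
  \<open>R\<close>; the lower bound for \<open>star v\<close> leaves no such part.\<close>
have "app (P - R) x = app 0 x" for x
proof -
 let ?z = "app (P - R) x"
 have "star v * (P - R) = 0" using Rv R vP by (metis (no_types) cancel_comm_monoid_add_class.diff_cancel right_diff_distrib star_simps(7))
 hence "app (star v) ?z = 0" by (metis app_simps(1,5))
 hence "norm (app P ?z) = 0" using c(1) c(3)[of ?z] by (simp add: mult_le_0_iff)
 moreover have "app P ?z = ?z" using P PR by (simp flip: app_simps(5))
 ultimately show ?thesis by simp
qed
hence "P - R = 0" by (rule bop_eqI)
hence wP: "w * star w = P" by (simp add: R_def)
have "w \<in> M" if M: "closed M" "v \<in> M" "!!x y r. x \<in> M ==> y \<in> M ==> x + r *r y \<in> M"
 "!!x. x \<in> M ==> x * (star v * v) \<in> M" for M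
proof -
 have z: "0 \<in> M" using M(3)[OF M(2) M(2), of "-1"] by simp
 have sc: "r *r x \<in> M" if "x \<in> M" for x r using M(3)[OF z that, of r] by simp
 \<comment> \<open>Behind a factor that absorbs \<open>Q\<close> on the right, \<open>a\<close> acts
   as \<open>star v * v\<close>. So the powers stay in \<open>M\<close> although \<open>M\<close>
   need not contain a unit.\<close>
 have pow: "v * y ^ k \<in> M & v * y ^ k * Q = v * y ^ k" for k
 proof (induction k)
  case (Suc k)
  have "v * y ^ Suc k = v * y ^ k + (- (1 / \<kappa>)) *r (v * y ^ k * a)"
   unfolding power_Suc2 by (simp add: y_def algebra_simps)
  also have "v * y ^ k * a = v * y ^ k * (star v * v)"
   using Suc aQ(2) by (metis mult.assoc)
  finally have "v * y ^ Suc k = v * y ^ k + (- (1 / \<kappa>)) *r (v * y ^ k * (star v * v))" .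
  moreover have "v * y ^ Suc k * Q = v * y ^ Suc k"
   unfolding power_Suc2 mult.assoc Qy[symmetric] using Suc by (metis mult.assoc)
  ultimately show ?case using M(3)[of "v * y ^ k" "v * y ^ k * (star v * v)" "- (1 / \<kappa>)"] M(4) Suc by auto
 qed (simp add: M v)
 have part: "(\<Sum>k<n. v * (binom_half k *r y ^ k)) \<in> M" for n
 proof (induction n)
  case (Suc n)
  thus ?case using M(3)[of "\<Sum>k<n. v * (binom_half k *r y ^ k)" "v * y ^ n" "binom_half n"] pow[of n] by simp
 qed (simp add: z)
 have sm: "summable (%k. binom_half k *r y ^ k)"
  by (rule summable_norm_cancel[OF inv_sqrt_summable[OF y]])
 have "(%n. v * (\<Sum>k<n. binom_half k *r y ^ k)) ----> v * s"
  unfolding s_def inv_sqrt_def by (intro tendsto_intros summable_LIMSEQ[OF sm])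
 hence "(%n. \<Sum>k<n. v * (binom_half k *r y ^ k)) ----> v * s"
  by (simp add: sum_distrib_left)
 hence "v * s \<in> M" by (rule closed_sequentially[OF M(1) part])
 thus ?thesis unfolding w_def by (rule sc)
qed
with ww wP show ?thesis by (rule that)
qed

section \<open>Matrix coefficients and weighted composition operators\<close>

definition coef :: "'i bop => 'i => 'i => complex" where
"coef A q r = coord (app A (unit_vec r)) q"

lemma coef_star: "coef (star A) q r = cnj (coef A r q)"
proof -
have "Re (coef (star A) q r) = Re (coef A r q)"
 unfolding coef_def inner_unit_vec[symmetric]
 by (metis inner_commute star_inner)
moreover have "Im (coef (star A) q r) = - Im (coef A r q)"
proof -
 have "Im (coef (star A) q r) = inner (cscl \<i> (app A (unit_vec q))) (unit_vec r)"
  unfolding coef_def inner_ii_unit_vec[symmetric] by (metis app_cscl star_inner)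
 also have "... = - inner (app A (unit_vec q)) (cscl \<i> (unit_vec r))" by (rule inner_cscl_ii)
 finally show ?thesis unfolding coef_def inner_ii_unit_vec[symmetric] by (metis inner_commute)
qed
ultimately show ?thesis by (simp add: complex_eq_iff)
qed

lemma coef_linear [simp]: "coef (A + B) q r = coef A q r + coef B q r" "coef (A - B) q r = coef A q r - coef B q r"
"coef 0 q r = 0" "coef (- A) q r = - coef A q r"
by (simp_all add: coef_def)

lemma coef_sum: "coef (sum F S) q r = (\<Sum>s\<in>S. coef (F s) q r)"
by (simp add: coef_def app_sum_left coord_sum)

lemma coef_mult: "coef (A * B) q r = coord (app A (app B (unit_vec r))) q"
by (simp add: coef_def)

lemma norm_coef_le: "cmod (coef A q r) <= norm A"
proof -
have "norm (unit_vec r) = 1"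
 unfolding norm_eq_sqrt_inner inner_unit_vec by (simp add: coord_unit_vec)
thus ?thesis unfolding coef_def
 by (metis norm_coord_le norm_app_le order_trans mult.right_neutral)
qed

text \<open>The coordinate of \<open>A x\<close> at \<open>q\<close> is the pairing of
  \<open>x\<close> with the column of \<open>star A\<close> at \<open>q\<close>, so disjoint
  supports annihilate it even when both are infinite. This lets matrix coefficients determine an
  operator.\<close>

lemma coord_app_disjoint:
assumes "!!r. coef A q r = 0 | coord x r = 0" shows "coord (app A x) q = 0"
proof -
have d: "coord (app (star A) (unit_vec q)) r = 0 | coord x r = 0" for r
 using assms[of r] coef_star[of A r q] unfolding coef_def[of "star A"] by (metis complex_cnj_zero)
have "inner (app (star A) (unit_vec q)) x = 0" "inner (cscl \<i> (app (star A) (unit_vec q))) x = 0"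
 by (rule inner_eq_0_disjoint; use d in force)+
hence "inner (unit_vec q) (app A x) = 0" "inner (cscl \<i> (unit_vec q)) (app A x) = 0"
 by (metis star_inner', metis star_inner' app_cscl)
thus ?thesis by (simp add: inner_unit_vec inner_ii_unit_vec complex_eq_iff)
qed

lemma coord_app:
assumes "finite S" and z: "!!r. r ~: S ==> coef A q r = 0 | coord x r = 0"
shows "coord (app A x) q = (\<Sum>r\<in>S. coef A q r * coord x r)"
proof -
define x' where "x' = x - (\<Sum>r\<in>S. cscl (coord x r) (unit_vec r))"
have "coord x' r = (if r \<in> S then 0 else coord x r)" for r
proof -
 have "(\<Sum>a\<in>S. coord x a * (if r = a then 1 else 0)) = (\<Sum>a\<in>S. if r = a then coord x a else 0)"
  by (intro sum.cong refl) auto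
 thus ?thesis using assms(1)
  by (simp add: x'_def coord_sum coord_unit_vec)
qed
hence "coord (app A x') q = 0" by (intro coord_app_disjoint) (use z in auto)
thus ?thesis
 unfolding x'_def by (simp add: app_sum coord_sum coef_def mult.commute)
qed

lemma bop_coef_eqI:
assumes "!!q r. coef A q r = coef B q r" shows "A = B"
proof (rule bop_eqI, rule ell2_eqI)
fix x q
have "coord (app (A - B) x) q = 0" by (rule coord_app_disjoint) (simp add: assms)
thus "coord (app A x) q = coord (app B x) q" by simp
qed

lemma bop_idx_eqI:
"(!!s k c s' l d. coef A (s, k, c) (s', l, d) = coef B (s, k, c) (s', l, d)) ==> A = B"
by (rule bop_coef_eqI) (auto simp: split_paired_all)

lemma coef_mult_sum:
assumes "finite S" "!!p. p ~: S ==> coef A q p = 0 | coef B p r = 0"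
shows "coef (A * B) q r = (\<Sum>p\<in>S. coef A q p * coef B p r)"
unfolding coef_mult using assms by (subst coord_app[of S]) (auto simp: coef_def[of B])

lemma bop_exists:
assumes F: "bounded_linear F" and G: "bounded_linear G"
 and adj: "!!x y. inner (F x) y = inner x (G y)" and i: "!!x. F (cscl \<i> x) = cscl \<i> (F x)"
shows "\<exists>A. app A = F & app (star A) = G"
proof -
have "adjoint_pair (Blinfun F) (Blinfun G)"
 using assms by (simp add: adjoint_pair_def bounded_linear_Blinfun_apply)
hence "Rep_bop (Abs_bop (Blinfun F, Blinfun G)) = (Blinfun F, Blinfun G)"
 by (simp add: Abs_bop_inverse)
hence "app (Abs_bop (Blinfun F, Blinfun G)) = F & app (star (Abs_bop (Blinfun F, Blinfun G))) = G"
 by (simp add: app.rep_eq star.rep_eq bounded_linear_Blinfun_apply F G)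
thus ?thesis by blast
qed

definition weighted :: "('i => complex) => ('i => 'i) => 'i ell2 => 'i ell2" where
"weighted \<phi> \<sigma> x = ell2_of (%i. \<phi> i * coord x (\<sigma> i))"

lemma weighted_bounded_linear:
fixes \<phi> :: "'i => complex" and \<sigma> :: "'i => 'i"
assumes \<sigma>: "bij \<sigma>" and \<phi>: "!!i. cmod (\<phi> i) <= C"
shows "coord (weighted \<phi> \<sigma> x) i = \<phi> i * coord x (\<sigma> i)"
 and "norm (weighted \<phi> \<sigma> x) <= C * norm x"
 and "bounded_linear (weighted \<phi> \<sigma>)"
proof -
have C: "0 <= C" using \<phi> norm_ge_zero order_trans by blast
have s: "(%i. C\<^sup>2 * (cmod (coord x (\<sigma> i)))\<^sup>2) summable_on UNIV"
 "(\<Sum>\<^sub>\<infinity>i. C\<^sup>2 * (cmod (coord x (\<sigma> i)))\<^sup>2) = (C * norm x)\<^sup>2" for x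
 using summable_on_reindex_bij_betw[OF \<sigma>, of "%i. (cmod (coord x i))\<^sup>2"] coord_summable[of x]
  infsum_reindex_bij_betw[OF \<sigma>, of "%i. (cmod (coord x i))\<^sup>2"]
 by (auto simp: norm_ell2_sq power_mult_distrib infsum_cmult_right intro: summable_on_cmult_right)
have le: "(cmod (\<phi> i * coord x (\<sigma> i)))\<^sup>2 <= C\<^sup>2 * (cmod (coord x (\<sigma> i)))\<^sup>2" for x i
 unfolding norm_mult power_mult_distrib using \<phi>[of i] by (intro mult_right_mono power_mono) auto
have 1: "(%i. (cmod (\<phi> i * coord x (\<sigma> i)))\<^sup>2) summable_on UNIV" for x
 by (rule summable_on_comparison_test[OF s(1)]) (use le in auto)
show c: "coord (weighted \<phi> \<sigma> x) i = \<phi> i * coord x (\<sigma> i)" for x i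
 using 1 by (simp add: weighted_def ell2_of_inverse)
show n: "norm (weighted \<phi> \<sigma> x) <= C * norm x" for x
proof (rule power2_le_imp_le)
 show "(norm (weighted \<phi> \<sigma> x))\<^sup>2 <= (C * norm x)\<^sup>2"
  unfolding norm_ell2_sq[of "weighted \<phi> \<sigma> x"] c s(2)[symmetric] by (rule infsum_mono[OF 1 s(1) le])
qed (use C in simp)
show "bounded_linear (weighted \<phi> \<sigma>)"
 by (rule bounded_linear_intro[of _ C]) (auto intro!: ell2_eqI n simp: c distrib_left mult.commute[of _ C])
qed

text \<open>Chosen by its coordinates; for a bijection and bounded weights the existence comes from
  \<open>weighted\<close>, with adjoint given by the inverse bijection and the conjugate
  weights.\<close>

definition wop :: "('i => complex) => ('i => 'i) => 'i bop" where
"wop \<phi> \<sigma> = (SOME A. \<forall>x i. coord (app A x) i = \<phi> i * coord x (\<sigma> i))"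

lemma wop_aux:
fixes \<phi> :: "'i => complex" and \<sigma> :: "'i => 'i"
assumes \<sigma>: "bij \<sigma>" and C: "!!i. cmod (\<phi> i) <= C"
shows "coord (app (wop \<phi> \<sigma>) x) i = \<phi> i * coord x (\<sigma> i)"
 and "norm (wop \<phi> \<sigma>) <= C"
proof -
let ?F = "weighted \<phi> \<sigma>"
let ?G = "weighted (%i. cnj (\<phi> (inv_into UNIV \<sigma> i))) (inv_into UNIV \<sigma>)"
have isig: "bij (inv_into UNIV \<sigma>)" using \<sigma> by (rule bij_imp_bij_inv)
have C': "cmod (cnj (\<phi> (inv_into UNIV \<sigma> i))) <= C" for i using C by simp
note F = weighted_bounded_linear[OF \<sigma> C]
note G = weighted_bounded_linear[OF isig C']
have adj: "inner (?F x) y = inner x (?G y)" for x y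
proof -
 have "inner (?F x) y = (\<Sum>\<^sub>\<infinity>i. inner (\<phi> i * coord x (\<sigma> i)) (coord y i))"
  unfolding inner_ell2_def F(1) ..
 also have "... = (\<Sum>\<^sub>\<infinity>i. inner (coord x (\<sigma> i)) (cnj (\<phi> (inv_into UNIV \<sigma> (\<sigma> i))) * coord y (inv_into UNIV \<sigma> (\<sigma> i))))"
  using \<sigma> by (simp add: bij_is_inj inner_complex_def algebra_simps)
 also have "... = (\<Sum>\<^sub>\<infinity>i. inner (coord x i) (cnj (\<phi> (inv_into UNIV \<sigma> i)) * coord y (inv_into UNIV \<sigma> i)))"
  by (rule infsum_reindex_bij_betw[OF \<sigma>])
 also have "... = inner x (?G y)" unfolding inner_ell2_def G(1) ..
 finally show ?thesis .
qed
have i: "?F (cscl \<i> x) = cscl \<i> (?F x)" for x by (rule ell2_eqI) (simp add: F)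
obtain A where A: "app A = ?F" "app (star A) = ?G"
 using bop_exists[OF F(3) G(3) adj i] by auto
have "\<forall>x i. coord (app (wop \<phi> \<sigma>) x) i = \<phi> i * coord x (\<sigma> i)"
 unfolding wop_def by (rule someI[of _ A]) (simp add: A F)
hence "wop \<phi> \<sigma> = A" by (intro bop_eqI ell2_eqI) (simp add: A F)
moreover have "norm A <= C"
proof (rule norm_bop_leI)
 show "norm (app A x) <= C * norm x" for x unfolding A(1) by (rule F(2))
 show "0 <= C" using C norm_ge_zero order_trans by blast
qed
ultimately show "coord (app (wop \<phi> \<sigma>) x) i = \<phi> i * coord x (\<sigma> i)" "norm (wop \<phi> \<sigma>) <= C"
 by (simp_all add: A F(1))
qed

lemma norm_bop_cscl:
assumes "!!x. app A x = cscl c (app B x)"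
shows "norm A = cmod c * norm B"
proof -
have le: "norm A <= cmod c * norm B" if "!!x. app A x = cscl c (app B x)" for A B :: "'i bop" and c
 by (rule norm_bop_leI) (auto simp: that norm_cscl mult.assoc intro!: mult_left_mono norm_app_le)
show ?thesis
proof (cases "c = 0")
 case True
 thus ?thesis using le[OF assms] by simp
next
 case False
 have "app B x = cscl (1 / c) (app A x)" for x
  using False by (intro ell2_eqI) (simp add: assms)
 from le[OF this] have "cmod c * norm B <= norm A" using False by (simp add: norm_divide field_simps)
 with le[OF assms] show ?thesis by simp
qed
qed

section \<open>Zero-dimensional dynamical systems\<close>

text \<open>The generation of \<open>K\<^sub>0\<close>, the traces and the mapping torus are treated
  at this level of generality; letters and words enter only for the relations and the ranks.\<close>

locale zero_dim_system =
fixes X :: "'x topology" and \<theta> :: "int => 'x => 'x"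
assumes theta_0 [simp]: "\<theta> 0 x = x"
 and theta_add: "\<theta> (m + n) x = \<theta> m (\<theta> n x)"
 and theta_continuous: "continuous_map X X (\<theta> n)"
 and compact: "compact_space X"
 and nonempty: "topspace X ~= {}"
 and zero_dim: "openin X W ==> x \<in> W ==> \<exists>U. openin X U & closedin X U & x \<in> U & U \<subseteq> W"
begin

abbreviation "XX \<equiv> topspace X"
abbreviation "\<A> \<equiv> algebraic_crossed_product X \<theta>"
abbreviation "CA \<equiv> carrier \<A>"
abbreviation amult (infixl "\<cdot>" 70) where "a \<cdot> b \<equiv> a \<otimes>\<^bsub>\<A>\<^esub> b"

lemma theta_theta [simp]: "\<theta> m (\<theta> n x) = \<theta> (m + n) x"
by (simp add: theta_add)

lemma theta_topspace [simp]: "\<theta> n x \<in> XX <-> x \<in> XX"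
proof
have *: "y \<in> XX ==> \<theta> m y \<in> XX" for m y
 using theta_continuous[of m] by (auto simp: continuous_map_def)
thus "x \<in> XX ==> \<theta> n x \<in> XX" .
assume "\<theta> n x \<in> XX"
from *[OF this, of "- n"] show "x \<in> XX" by simp
qed

lemma cfun_bound:
assumes "f \<in> cfun X"
shows "bdd_above ((%x. cmod (f x)) ` XX)"
 and "cmod (f x) <= (SUP x\<in>XX. cmod (f x))"
proof -
have c: "continuous_map X euclideanreal (%x. cmod (f x))"
 using assms by (auto simp: cfun_def intro: continuous_map_norm)
have "compactin euclideanreal ((%x. cmod (f x)) ` XX)"
 using image_compactin[OF _ c] compact by (simp add: compact_space_def)
thus bdd: "bdd_above ((%x. cmod (f x)) ` XX)"
 by (simp add: bounded_imp_bdd_above compact_imp_bounded)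
obtain x0 where x0: "x0 \<in> XX" using nonempty by blast
show "cmod (f x) <= (SUP x\<in>XX. cmod (f x))"
proof (cases "x \<in> XX")
 case True
 thus ?thesis by (intro cSUP_upper bdd)
next
 case False
 have "0 <= cmod (f x0)" by simp
 also have "... <= (SUP x\<in>XX. cmod (f x))" by (intro cSUP_upper bdd x0)
 finally show ?thesis using assms False by (simp add: cfun_def)
qed
qed

lemma cfun_zero [simp]: "(%_. 0) \<in> cfun X"
by (simp add: cfun_def)

lemma cfun_one: "(%x. if x \<in> XX then 1 else 0) \<in> cfun X"
by (auto simp: cfun_def intro: continuous_map_eq[of X euclidean "%_. 1"])

lemma cfun_add: "f \<in> cfun X ==> h \<in> cfun X ==> (%x. f x + h x) \<in> cfun X"
by (auto simp: cfun_def intro: continuous_map_add)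

lemma cfun_minus: "f \<in> cfun X ==> (%x. - f x) \<in> cfun X"
by (auto simp: cfun_def intro: continuous_map_minus)

lemma cfun_diff: "f \<in> cfun X ==> h \<in> cfun X ==> (%x. f x - h x) \<in> cfun X"
by (auto simp: cfun_def intro: continuous_map_diff)

lemma cfun_mult: "f \<in> cfun X ==> h \<in> cfun X ==> (%x. f x * h x) \<in> cfun X"
by (auto simp: cfun_def continuous_map_atin intro: tendsto_mult)

lemma cfun_cnj: "f \<in> cfun X ==> (%x. cnj (f x)) \<in> cfun X"
by (auto simp: cfun_def continuous_map_atin intro: tendsto_cnj)

lemma cfun_scale: "f \<in> cfun X ==> (%x. c * f x) \<in> cfun X"
by (auto simp: cfun_def continuous_map_atin intro: tendsto_mult)

lemma cfun_theta: "f \<in> cfun X ==> (%x. f (\<theta> n x)) \<in> cfun X"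
using continuous_map_compose[OF theta_continuous, of euclidean f n] by (auto simp: cfun_def o_def)

lemma cfun_sum: "(!!i. i \<in> I ==> f i \<in> cfun X) ==> (%x. \<Sum>i\<in>I. f i x) \<in> cfun X"
by (induction I rule: infinite_finite_induct) (auto intro: cfun_add)

lemma carrier_iff: "F \<in> CA <-> (\<forall>n. F n \<in> cfun X) & finite (fsupp F)"
by (simp add: algebraic_crossed_product_def)

lemma carrierD: "F \<in> CA ==> F n \<in> cfun X" "F \<in> CA ==> finite (fsupp F)"
by (simp_all add: carrier_iff)

lemma alg_simps:
"\<zero>\<^bsub>\<A>\<^esub> = (%n x. 0)" "F \<oplus>\<^bsub>\<A>\<^esub> H = (%n x. F n x + H n x)"
"F \<cdot> H = (%n x. \<Sum>m\<in>fsupp F. F m x * H (n - m) (\<theta> (- m) x))"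
"\<one>\<^bsub>\<A>\<^esub> = (%n x. if n = 0 & x \<in> XX then 1 else 0)"
"adj \<A> F = (%n x. cnj (F (- n) (\<theta> (- n) x)))" "cscale \<A> c F = (%n x. c * F n x)"
by (simp_all add: algebraic_crossed_product_def)

lemma zero_closed: "\<zero>\<^bsub>\<A>\<^esub> \<in> CA"
by (simp add: carrier_iff alg_simps)

lemma fsupp_one: "fsupp \<one>\<^bsub>\<A>\<^esub> = {0}"
proof -
obtain x where "x \<in> XX" using nonempty by blast
hence "(%x. if x \<in> XX then 1 else 0 :: complex) ~= (%_. 0)" by (metis zero_neq_one)
thus ?thesis by (auto simp: alg_simps)
qed

lemma one_closed: "\<one>\<^bsub>\<A>\<^esub> \<in> CA"
proof -
have "fsupp (%n x. if n = 0 & x \<in> XX then 1 else 0) \<subseteq> {0}" by (auto simp: fun_eq_iff)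
hence "finite (fsupp (%n x. if n = 0 & x \<in> XX then 1 else 0))"
 by (rule finite_subset) simp
moreover have "(%x. if n = 0 & x \<in> XX then 1 else 0 :: complex) \<in> cfun X" for n :: int
 using cfun_one by (cases "n = 0") auto
ultimately show ?thesis by (auto simp: carrier_iff alg_simps)
qed

lemma add_closed: "F \<in> CA ==> H \<in> CA ==> F \<oplus>\<^bsub>\<A>\<^esub> H \<in> CA"
proof -
assume *: "F \<in> CA" "H \<in> CA"
have "fsupp (%n x. F n x + H n x) \<subseteq> fsupp F \<union> fsupp H" by auto
moreover have "finite (fsupp F \<union> fsupp H)" using * by (simp add: carrierD)
ultimately have "finite (fsupp (%n x. F n x + H n x))" by (rule finite_subset)
thus ?thesis using * by (auto simp: carrier_iff alg_simps intro: cfun_add)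
qed

lemma cscale_closed: "F \<in> CA ==> cscale \<A> c F \<in> CA"
proof -
assume *: "F \<in> CA"
have "fsupp (%n x. c * F n x) \<subseteq> fsupp F" by auto
hence "finite (fsupp (%n x. c * F n x))" by (rule finite_subset) (simp add: * carrierD)
thus ?thesis using * by (auto simp: carrier_iff alg_simps intro: cfun_scale)
qed

lemma fsupp_mult: "fsupp (F \<cdot> H) \<subseteq> (%(m, n). m + n) ` (fsupp F \<times> fsupp H)"
proof
fix n assume "n \<in> fsupp (F \<cdot> H)"
then obtain x where "(\<Sum>m\<in>fsupp F. F m x * H (n - m) (\<theta> (- m) x)) ~= 0"
 by (auto simp: alg_simps fun_eq_iff)
then obtain m where m: "m \<in> fsupp F" "H (n - m) (\<theta> (- m) x) ~= 0"
 by (rule sum.not_neutral_contains_not_neutral) auto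
hence "(m, n - m) \<in> fsupp F \<times> fsupp H" by auto
thus "n \<in> (%(m, n). m + n) ` (fsupp F \<times> fsupp H)" by (rule rev_image_eqI) simp
qed

lemma mult_closed: "F \<in> CA ==> H \<in> CA ==> F \<cdot> H \<in> CA"
proof -
assume *: "F \<in> CA" "H \<in> CA"
hence "finite (fsupp (F \<cdot> H))"
 by (intro finite_subset[OF fsupp_mult]) (simp add: carrierD)
moreover have "(F \<cdot> H) n \<in> cfun X" for n
 unfolding alg_simps using * by (intro cfun_sum cfun_mult cfun_theta carrierD)
ultimately show ?thesis by (simp add: carrier_iff)
qed

lemma fsupp_adj: "fsupp (adj \<A> F) = uminus ` fsupp F"
proof -
have "(%x. cnj (F (- n) (\<theta> (- n) x))) = (%_. 0) <-> F (- n) = (%_. 0)" for n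
proof
 assume *: "(%x. cnj (F (- n) (\<theta> (- n) x))) = (%_. 0)"
 show "F (- n) = (%_. 0)"
 proof
  fix y
  show "F (- n) y = 0" using fun_cong[OF *, of "\<theta> n y"] by simp
 qed
qed simp
thus ?thesis unfolding alg_simps by (force simp: image_iff)
qed

lemma adj_closed: "F \<in> CA ==> adj \<A> F \<in> CA"
unfolding carrier_iff fsupp_adj by (simp add: alg_simps) (intro allI cfun_cnj cfun_theta, simp)

text \<open>The regular representation placed at the matrix position \<open>(i, j)\<close>: on the
  fibre over \<open>s\<close> a function acts at level \<open>k\<close> by its value at
  \<open>\<theta> (- k) s\<close>, and the canonical unitary shifts the level.\<close>

definition cross_op :: "nat => nat => 'x lau => 'x idx bop" where
"cross_op i j F = (\<Sum>n\<in>fsupp F.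
  wop (%(s, k, c). if c = i then F n (\<theta> (- k) s) else 0)
    (%(s, k, c). (s, k + n, Transposition.transpose i j c)))"

lemma bij_shift_transpose: "bij (%(s :: 'x, k :: int, c :: nat). (s, k + n, Transposition.transpose i j c))"
by (rule o_bij[of "%(s, k, c). (s, k - n, Transposition.transpose i j c)"]) auto

lemma weight_bound:
assumes "F \<in> CA"
shows "cmod ((%(s :: 'x, k :: int, c :: nat). if c = i then F n (\<theta> (- k) s) else 0) q)
 <= (SUP x\<in>XX. cmod (F n x))"
proof -
have "0 <= (SUP x\<in>XX. cmod (F n x))"
 using cfun_bound(2)[OF carrierD(1)[OF assms]] norm_ge_zero order_trans by blast
thus ?thesis
 by (cases q) (auto intro: cfun_bound(2)[OF carrierD(1)[OF assms]])
qed

lemma coord_cross_op: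
assumes F: "F \<in> CA" and N: "finite N" "fsupp F \<subseteq> N"
shows "coord (app (cross_op i j F) x) (s, k, c) =
 (if c = i then \<Sum>n\<in>N. F n (\<theta> (- k) s) * coord x (s, k + n, j) else 0)"
proof -
have "coord (app (cross_op i j F) x) (s, k, c) =
  (\<Sum>n\<in>fsupp F. if c = i then F n (\<theta> (- k) s) * coord x (s, k + n, j) else 0)"
 unfolding cross_op_def app_sum_left coord_sum
 by (intro sum.cong refl) (simp add: wop_aux(1)[OF bij_shift_transpose weight_bound[OF F]])
also have "... = (\<Sum>n\<in>N. if c = i then F n (\<theta> (- k) s) * coord x (s, k + n, j) else 0)"
 by (rule sum.mono_neutral_left) (use N in auto)
finally show ?thesis by simp
qed

lemma coef_cross_op:
assumes "F \<in> CA"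
shows "coef (cross_op i j F) (s, k, c) (s', l, d) = (if s = s' & c = i & d = j then F (l - k) (\<theta> (- k) s) else 0)"
proof -
let ?N = "insert (l - k) (fsupp F)"
have "(\<Sum>n\<in>?N. F n (\<theta> (- k) s) * coord (unit_vec (s', l, d)) (s, k + n, j)) =
  (\<Sum>n\<in>?N. if n = l - k then (if s = s' & d = j then F n (\<theta> (- k) s) else 0) else 0)"
 by (intro sum.cong refl) (auto simp: coord_unit_vec)
thus ?thesis unfolding coef_def
 by (subst coord_cross_op[OF assms _ subset_insertI]) (use carrierD(2)[OF assms] in auto)
qed

lemma norm_cross_op_coeff: "F \<in> CA ==> cmod (F n x) <= norm (cross_op i j F)"
using norm_coef_le[of "cross_op i j F" "(x, 0, i)" "(x, n, j)"] by (simp add: coef_cross_op)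

lemma cross_op_inject:
assumes "F \<in> CA" "H \<in> CA" "cross_op i j F = cross_op i j H"
shows "F = H"
proof (intro ext)
show "F n x = H n x" for n x
 using arg_cong[OF assms(3), of "%A. coef A (x, 0, i) (x, n, j)"] assms(1,2) by (simp add: coef_cross_op)
qed

lemma cross_op_add:
"F \<in> CA ==> H \<in> CA ==> cross_op i j (F \<oplus>\<^bsub>\<A>\<^esub> H) = cross_op i j F + cross_op i j H"
using add_closed[of F H] by (intro bop_idx_eqI) (simp add: coef_cross_op alg_simps(2))

lemma cross_op_cscale:
assumes "F \<in> CA"
shows "app (cross_op i j (cscale \<A> c F)) x = cscl c (app (cross_op i j F) x)"
proof (rule ell2_eqI)
fix q :: "'x idx"
obtain s k d where q: "q = (s, k, d)" by (cases q)
have N: "finite (fsupp F)" "fsupp (cscale \<A> c F) \<subseteq> fsupp F" using assms by (auto simp: carrierD alg_simps)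
show "coord (app (cross_op i j (cscale \<A> c F)) x) q = coord (cscl c (app (cross_op i j F) x)) q"
 using N assms by (simp add: q coord_cross_op[OF _ N(1)] cscale_closed)
  (simp add: alg_simps sum_distrib_left mult.assoc)
qed

lemma cross_op_mult:
assumes F: "F \<in> CA" and H: "H \<in> CA"
shows "cross_op i j F * cross_op j' l H = (if j = j' then cross_op i l (F \<cdot> H) else 0)"
proof (rule bop_idx_eqI)
fix s s' :: 'x and k k' :: int and c d :: nat
have "coef (cross_op i j F * cross_op j' l H) (s, k, c) (s', k', d) =
  (\<Sum>p\<in>(%m. (s, k + m, j)) ` fsupp F. coef (cross_op i j F) (s, k, c) p * coef (cross_op j' l H) p (s', k', d))"
proof (rule coef_mult_sum)
 fix p assume p: "p ~: (%m. (s, k + m, j)) ` fsupp F"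
 obtain x n e where "p = (x, n, e)" by (metis prod.collapse)
 thus "coef (cross_op i j F) (s, k, c) p = 0 | coef (cross_op j' l H) p (s', k', d) = 0"
  using p by (force simp: coef_cross_op[OF F] image_iff dest: spec[of _ "n - k"])
qed (simp add: carrierD[OF F])
also have "... = (\<Sum>m\<in>fsupp F. if s = s' & c = i & d = l & j = j'
  then F m (\<theta> (- k) s) * H (k' - k - m) (\<theta> (- m) (\<theta> (- k) s)) else 0)"
 by (subst sum.reindex) (auto simp: inj_on_def coef_cross_op F H algebra_simps intro!: sum.cong)
also have "... = coef (if j = j' then cross_op i l (F \<cdot> H) else 0) (s, k, c) (s', k', d)"
 by (auto simp: coef_cross_op mult_closed F H intro!: sum.neutral) (simp add: alg_simps)
finally show "coef (cross_op i j F * cross_op j' l H) (s, k, c) (s', k', d) = ..." .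
qed

lemma star_cross_op: "F \<in> CA ==> star (cross_op i j F) = cross_op j i (adj \<A> F)"
using adj_closed[of F] by (intro bop_idx_eqI) (auto simp: coef_star coef_cross_op alg_simps(5))

lemma alg_one:
assumes F: "F \<in> CA"
shows "\<one>\<^bsub>\<A>\<^esub> \<cdot> F = F" "F \<cdot> \<one>\<^bsub>\<A>\<^esub> = F"
proof -
have Fz: "F n x = 0" if "x ~: XX" for n x
 using carrierD(1)[OF F, of n] that by (simp add: cfun_def)
show "\<one>\<^bsub>\<A>\<^esub> \<cdot> F = F" unfolding alg_simps(3) fsupp_one by (auto simp: alg_simps fun_eq_iff Fz)
have "(\<Sum>m\<in>fsupp F. F m x * (if n - m = 0 & \<theta> (- m) x \<in> XX then 1 else 0)) =
  (\<Sum>m\<in>fsupp F. if n = m then F m x else 0)" for n x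
 by (intro sum.cong refl) (auto simp: Fz)
thus "F \<cdot> \<one>\<^bsub>\<A>\<^esub> = F" using carrierD(2)[OF F] by (auto simp: alg_simps fun_eq_iff)
qed

lemma norm_cross_op_l1:
assumes "F \<in> CA"
shows "norm (cross_op i j F) <= l1_norm X F"
unfolding cross_op_def l1_norm_def
by (rule order_trans[OF norm_sum]) (intro sum_mono wop_aux(2)[OF bij_shift_transpose weight_bound[OF assms]])

text \<open>A partial isometry moves the matrix position.\<close>

lemma norm_cross_op:
assumes F: "F \<in> CA"
shows "norm (cross_op i j F) = norm (cross_op 0 0 F)"
proof -
let ?u = "%i j. cross_op i j \<one>\<^bsub>\<A>\<^esub>"
have u: "norm (?u i j) <= 1" for i j
 using norm_cross_op_l1[OF one_closed, of i j] nonempty by (simp add: l1_norm_def fsupp_one) (simp add: alg_simps)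
have le: "norm (cross_op i j F) <= norm (cross_op i' j' F)" for i j i' j'
proof -
 have "cross_op i j F = ?u i i' * cross_op i' j' F * ?u j' j"
  by (simp add: cross_op_mult F one_closed mult_closed alg_one)
 also have "norm ... <= norm (?u i i') * norm (cross_op i' j' F) * norm (?u j' j)"
  by (meson mult_right_mono norm_ge_zero norm_mult_ineq order_trans)
 also have "... <= 1 * norm (cross_op i' j' F) * 1"
  by (intro mult_mono u) auto
 finally show ?thesis by simp
qed
show ?thesis using le[of i j 0 0] le[of 0 0 i j] by simp
qed

lemma cstar_seminorm_cross_op: "cstar_seminorm \<A> (%F. norm (cross_op 0 0 F))"
proof -
have "norm (cross_op 0 0 (F \<cdot> H)) <= norm (cross_op 0 0 F) * norm (cross_op 0 0 H)"
 if "F \<in> CA" "H \<in> CA" for F H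
 using norm_mult_ineq[of "cross_op 0 0 F" "cross_op 0 0 H"] that by (simp add: cross_op_mult)
moreover have "norm (cross_op 0 0 (adj \<A> F \<cdot> F)) = (norm (cross_op 0 0 F))\<^sup>2"
 if "F \<in> CA" for F
 using norm_star_mult[of "cross_op 0 0 F"] that
 by (simp add: star_cross_op cross_op_mult adj_closed)
ultimately show ?thesis
 unfolding cstar_seminorm_def
 by (auto simp: cross_op_add norm_triangle_ineq norm_bop_cscl[OF cross_op_cscale])
qed

primrec squarings :: "'x lau => nat => int => 'x => complex" where
"squarings H 0 = H"
| "squarings H (Suc k) = squarings H k \<cdot> squarings H k"

text \<open>The \<open>\<ell>\<^sup>1\<close>-norm of the \<open>2\<^sup>k\<close>-th power of a Laurent polynomial exceeds its regular
norm only by a factor linear in \<open>2\<^sup>k\<close>, and a C*-seminorm is multiplicative on these powers.\<close>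

lemma cstar_seminorm_le_regular:
assumes p: "cstar_seminorm \<A> p" and l1: "!!y. y \<in> CA ==> p y <= l1_norm X y"
 and F: "F \<in> CA"
shows "p F <= norm (cross_op 0 0 F)"
proof -
\<comment> \<open>For a selfadjoint element the C*-identity says that \<open>p\<close> of the square
  is the square of \<open>p\<close>, so \<open>p H\<close> can be read off from iterated
  squares.\<close>
define H where "H = adj \<A> F \<cdot> F"
let ?r = "norm (cross_op 0 0 H)"
have H: "H \<in> CA" using F by (simp add: H_def mult_closed adj_closed)
have closed: "squarings H k \<in> CA" for k
 by (induction k) (auto simp: H mult_closed)
have op: "cross_op 0 0 (squarings H k) = cross_op 0 0 H ^ (2 ^ k)" for k
proof (induction k)
 case (Suc k)
 thus ?case using cross_op_mult[OF closed closed, of 0 0 k 0 0 k]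
  by (simp add: mult_2 power_add)
qed simp
have "star (cross_op 0 0 H) = cross_op 0 0 H"
proof -
 have "cross_op 0 0 H = star (cross_op 0 0 F) * cross_op 0 0 F"
  using F by (simp add: H_def star_cross_op cross_op_mult adj_closed)
 thus ?thesis by simp
qed
hence "cross_op 0 0 (adj \<A> (squarings H k)) = cross_op 0 0 (squarings H k)" for k
 using star_cross_op[OF closed, of 0 0 k] by (simp add: op star_power)
hence sa: "adj \<A> (squarings H k) = squarings H k" for k
 using cross_op_inject closed adj_closed by blast
have pk: "p (squarings H k) = p H ^ (2 ^ k)" for k
proof (induction k)
 case (Suc k)
 have "p (squarings H (Suc k)) = (p (squarings H k))\<^sup>2"
  using p closed[of k] sa[of k] unfolding cstar_seminorm_def by (metis squarings.simps(2))
 thus ?case using Suc by (simp add: power2_eq_square mult_2 power_add)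
qed simp
obtain d :: nat where d: "\<forall>n\<in>fsupp H. nat \<bar>n\<bar> <= d"
 using carrierD(2)[OF H] finite_nat_set_iff_bounded_le[of "(%n. nat \<bar>n\<bar>) ` fsupp H"] by auto
have "\<bar>n\<bar> <= int (d * 2 ^ k)" if "n \<in> fsupp (squarings H k)" for n k
 using that
proof (induction k arbitrary: n)
 case (Suc k)
 obtain m m' where "n = m + m'" "m \<in> fsupp (squarings H k)" "m' \<in> fsupp (squarings H k)"
  using subsetD[OF fsupp_mult Suc.prems[unfolded squarings.simps]] by auto
 thus ?case using Suc(1)[of m] Suc(1)[of m'] abs_triangle_ineq[of m m'] by simp
qed (use d in "force simp: nat_le_iff")
hence supp: "fsupp (squarings H k) \<subseteq> {- int (d * 2 ^ k)..int (d * 2 ^ k)}" for k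
 unfolding subset_iff atLeastAtMost_iff abs_le_iff by (metis minus_le_iff)
have bound: "p H ^ (2 ^ k) <= (2 * d * 2 ^ k + 1) * ?r ^ (2 ^ k)" for k
proof -
 have "p H ^ (2 ^ k) <= l1_norm X (squarings H k)" using l1[OF closed] pk by metis
 also have "... <= (\<Sum>n\<in>fsupp (squarings H k). norm (cross_op 0 0 (squarings H k)))"
  unfolding l1_norm_def
  by (intro sum_mono cSUP_least nonempty norm_cross_op_coeff closed)
 also have "... = card (fsupp (squarings H k)) * norm (cross_op 0 0 (squarings H k))" by simp
 also have "... <= card {- int (d * 2 ^ k)..int (d * 2 ^ k)} * norm (cross_op 0 0 (squarings H k))"
  by (intro mult_right_mono of_nat_mono card_mono supp) auto
 also have "... <= (2 * d * 2 ^ k + 1) * ?r ^ (2 ^ k)"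
  unfolding op using norm_power_ineq[of "cross_op 0 0 H" "2 ^ k"]
  by (intro mult_mono) (auto simp: nat_add_distrib nat_mult_distrib)
 finally show ?thesis .
qed
have "p H <= ?r"
proof (rule ccontr)
 assume "~ p H <= ?r"
 hence less: "?r < p H" by simp
 \<comment> \<open>A ratio below 1 would beat the linear factor:
   \<open>(2 * d * n + 1) * q ^ n\<close> tends to 0, whereas the bound above keeps it at least 1
   along the powers of 2.\<close>
 define q where "q = ?r / p H"
 have pH: "0 < p H" using less by (meson le_less_trans norm_ge_zero)
 have q: "0 <= q" "q < 1" using less pH by (auto simp: q_def)
 have "(%n. (2 * real d * real n + 1) * q ^ n) ----> 0"
 proof -
  have "(%n. real n * q ^ n) ----> 0"
   using powser_times_n_limit_0[of q] q by simp
  moreover have "(%n. q ^ n) ----> 0" using q by (simp add: LIMSEQ_realpow_zero)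
  ultimately have "(%n. 2 * real d * (real n * q ^ n) + q ^ n) ----> 2 * real d * 0 + 0"
   by (intro tendsto_add tendsto_mult tendsto_const)
  thus ?thesis by (simp add: algebra_simps)
 qed
 then obtain n0 where n0: "\<forall>n\<ge>n0. norm ((2 * real d * real n + 1) * q ^ n - 0) < 1"
  using LIMSEQ_D[of _ 0 1] by fastforce
 have "n0 <= 2 ^ n0" by (rule less_imp_le) simp
 hence "norm ((2 * real d * real (2 ^ n0) + 1) * q ^ (2 ^ n0) - 0) < 1" using n0 by blast
 hence "(2 * real d * 2 ^ n0 + 1) * q ^ (2 ^ n0) < 1" by simp
 moreover have "p H ^ (2 ^ n0) <= (2 * real d * 2 ^ n0 + 1) * (q * p H) ^ (2 ^ n0)"
  using bound[of n0] pH by (simp add: q_def add.commute)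
 ultimately show False using pH
  by (simp add: power_mult_distrib mult.assoc[symmetric] mult_le_cancel_right1)
qed
moreover have "?r = (norm (cross_op 0 0 F))\<^sup>2"
 using cstar_seminorm_cross_op F by (simp add: cstar_seminorm_def H_def)
moreover have "p H = (p F)\<^sup>2" using p F by (simp add: cstar_seminorm_def H_def)
ultimately have "(p F)\<^sup>2 <= (norm (cross_op 0 0 F))\<^sup>2" by simp
thus ?thesis by (rule power2_le_imp_le) simp
qed

text \<open>The regular seminorm is one of the admissible seminorms and dominates all the others, so
  the supremum is attained there.\<close>

lemma crossed_norm_eq: "F \<in> CA ==> crossed_norm X \<theta> F = norm (cross_op i j F)"
proof -
assume F: "F \<in> CA"
let ?P = "{p. cstar_seminorm \<A> p & (\<forall>y\<in>CA. p y <= l1_norm X y)}"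
have mem: "(%F. norm (cross_op 0 0 F)) \<in> ?P"
 using cstar_seminorm_cross_op norm_cross_op_l1 by blast
have "(SUP p\<in>?P. p F) = norm (cross_op 0 0 F)"
proof (rule antisym)
 show "(SUP p\<in>?P. p F) <= norm (cross_op 0 0 F)"
  using mem by (intro cSUP_least) (auto intro: cstar_seminorm_le_regular[OF _ _ F])
 show "norm (cross_op 0 0 F) <= (SUP p\<in>?P. p F)"
 proof (rule cSUP_upper2[OF _ mem])
  show "bdd_above ((%p. p F) ` ?P)"
   by (rule bdd_aboveI[of _ "l1_norm X F"]) (use F in auto)
 qed simp
qed
thus ?thesis using norm_cross_op[OF F, of i j] by (simp add: enveloping_norm_def)
qed

end

section \<open>The crossed product as an algebra of operators\<close>

lemma class_op2_eq:
assumes "equiv C r" "a \<in> C" "b \<in> C"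
 and "!!a a' b b'. (a, a') \<in> r ==> (b, b') \<in> r ==> (f a b, f a' b') \<in> r"
shows "class_op2 r f (r `` {a}) (r `` {b}) = r `` {f a b}"
proof -
have "r `` {f a' b'} = r `` {f a b}" if "a' \<in> r `` {a}" "b' \<in> r `` {b}" for a' b'
 using that assms(4)[of a a' b b'] equiv_class_eq[OF assms(1)] by blast
moreover have "a \<in> r `` {a}" "b \<in> r `` {b}" using equiv_class_self[OF assms(1)] assms by auto
ultimately show ?thesis unfolding class_op2_def by blast
qed

lemma class_op1_eq:
assumes "equiv C r" "a \<in> C" and "!!a a'. (a, a') \<in> r ==> (f a, f a') \<in> r"
shows "class_op1 r f (r `` {a}) = r `` {f a}"
proof -
have "r `` {f a'} = r `` {f a}" if "a' \<in> r `` {a}" for a'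
 using that assms(3)[of a a'] equiv_class_eq[OF assms(1)] by blast
moreover have "a \<in> r `` {a}" using equiv_class_self[OF assms(1)] assms by auto
ultimately show ?thesis unfolding class_op1_def by blast
qed

text \<open>The defect \<open>V - V * P\<close> has \<open>star\<close> square 0, hence is 0 by the
  C*-identity.\<close>

lemma partial_isometry_support:
fixes V :: "'i bop"
assumes "star V * V = P" "V * star V = Q" "P * P = P" "star P = P"
shows "V * P = V" "Q * V = V"
proof -
have "star (V - V * P) * (V - V * P) = star V * V - star V * V * P - P * (star V * V) + P * (star V * V) * P"
 by (simp only: star_diff star_simps(7) assms(4) left_diff_distrib right_diff_distrib mult.assoc) simp
also have "... = 0" by (simp only: assms(1,3)) simp
finally have "(norm (V - V * P))\<^sup>2 = 0" by (metis norm_star_mult norm_zero)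
thus VP: "V * P = V" by simp
have "Q * V = V * (star V * V)" by (simp add: assms(2)[symmetric] mult.assoc)
thus "Q * V = V" using VP assms by simp
qed

context zero_dim_system
begin

abbreviation "\<B> \<equiv> crossed_product X \<theta>"
abbreviation "\<N> \<equiv> crossed_norm X \<theta>"
abbreviation "CB \<equiv> carrier \<B>"
abbreviation "\<P> \<equiv> projections \<B>"
abbreviation "\<S> \<equiv> cauchy_seqs \<A> \<N>"
abbreviation bmult (infixl "\<odot>" 70) where "a \<odot> b \<equiv> a \<otimes>\<^bsub>\<B>\<^esub> b"

lemma abelian_group_alg: "abelian_group \<A>"
proof (rule abelian_groupI)
fix F assume F: "F \<in> CA"
have "(%n x. - 1 * F n x) \<in> CA"
 using cscale_closed[OF F, of "- 1"] by (simp add: alg_simps)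
thus "\<exists>H\<in>CA. H \<oplus>\<^bsub>\<A>\<^esub> F = \<zero>\<^bsub>\<A>\<^esub>"
 by (intro bexI[of _ "%n x. - 1 * F n x"]) (simp_all add: alg_simps)
qed (use add_closed zero_closed in "auto simp: alg_simps fun_eq_iff")

lemma minus_alg:
assumes "F \<in> CA" "H \<in> CA"
shows "F \<ominus>\<^bsub>\<A>\<^esub> H = F \<oplus>\<^bsub>\<A>\<^esub> cscale \<A> (- 1) H"
proof -
interpret abelian_group \<A> by (rule abelian_group_alg)
have "cscale \<A> (- 1) H \<oplus>\<^bsub>\<A>\<^esub> H = \<zero>\<^bsub>\<A>\<^esub>" by (simp add: alg_simps)
hence "\<ominus>\<^bsub>\<A>\<^esub> H = cscale \<A> (- 1) H"
 by (rule minus_equality) (use assms cscale_closed in blast)+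
thus ?thesis by (simp add: a_minus_def)
qed

lemma minus_closed: "F \<in> CA ==> H \<in> CA ==> F \<ominus>\<^bsub>\<A>\<^esub> H \<in> CA"
by (simp add: minus_alg add_closed cscale_closed)

lemma cross_op_minus:
assumes "F \<in> CA" "H \<in> CA"
shows "cross_op i j (F \<ominus>\<^bsub>\<A>\<^esub> H) = cross_op i j F - cross_op i j H"
proof (rule bop_eqI)
fix x
have "cscl (- 1) y = - y" for y :: "('x idx) ell2" by (rule ell2_eqI) simp
thus "app (cross_op i j (F \<ominus>\<^bsub>\<A>\<^esub> H)) x = app (cross_op i j F - cross_op i j H) x"
 using assms by (simp add: minus_alg cross_op_add cscale_closed cross_op_cscale)
qed

lemma cauchy_seqs_iff:
"s \<in> \<S> <-> (\<forall>k. s k \<in> CA) & Cauchy (%k. cross_op i j (s k))"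
unfolding cauchy_seqs_def Cauchy_def dist_norm
by (auto simp: crossed_norm_eq[of _ i j] minus_closed cross_op_minus)

definition seq_op :: "nat => nat => (nat => int => 'x => complex) => 'x idx bop" where
"seq_op i j s = lim (%k. cross_op i j (s k))"

lemma seq_op_lim:
assumes "s \<in> \<S>"
shows "(%k. cross_op i j (s k)) ----> seq_op i j s"
using assms unfolding cauchy_seqs_iff[of _ i j] seq_op_def
by (simp add: Cauchy_convergent_iff convergent_LIMSEQ_iff)

lemma cauchy_seqs_carrier: "s \<in> \<S> ==> s k \<in> CA"
by (simp add: cauchy_seqs_def)

lemma null_rel_iff:
"(s, t) \<in> null_rel \<A> \<N> <->
  s \<in> \<S> & t \<in> \<S> & seq_op i j s = seq_op i j t"
proof -
have "(%k. \<N> (s k \<ominus>\<^bsub>\<A>\<^esub> t k)) ----> 0 <-> seq_op i j s = seq_op i j t"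
 if st: "s \<in> \<S>" "t \<in> \<S>"
proof -
 have "(%k. \<N> (s k \<ominus>\<^bsub>\<A>\<^esub> t k)) = (%k. norm (cross_op i j (s k) - cross_op i j (t k)))"
  using st by (simp add: crossed_norm_eq[of _ i j] minus_closed cross_op_minus cauchy_seqs_carrier)
 moreover have lim: "(%k. cross_op i j (s k) - cross_op i j (t k)) ----> seq_op i j s - seq_op i j t"
  by (intro tendsto_diff seq_op_lim st)
 moreover have "(%k. cross_op i j (s k) - cross_op i j (t k)) ----> 0 <->
   seq_op i j s - seq_op i j t = 0"
 proof
  assume "seq_op i j s - seq_op i j t = 0"
  thus "(%k. cross_op i j (s k) - cross_op i j (t k)) ----> 0" using lim by (simp only:)
 qed (rule LIMSEQ_unique[OF lim])
 ultimately show ?thesis by (simp add: tendsto_norm_zero_iff)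
qed
thus ?thesis by (auto simp: null_rel_def)
qed

lemma equiv_null_rel: "equiv (\<S>) (null_rel \<A> \<N>)"
by (rule equivI) (auto simp: refl_on_def sym_def trans_def null_rel_iff[of _ _ 0 0])

lemma carrier_crossed: "CB = \<S> // null_rel \<A> \<N>"
by (simp add: crossed_product_def completion_def)

abbreviation cls :: "(nat => int => 'x => complex) => 'x cel" where
"cls s \<equiv> null_rel \<A> \<N> `` {s}"

lemma crossed_cases:
assumes "a \<in> CB" obtains s where "s \<in> \<S>" "a = cls s"
using assms by (auto simp: carrier_crossed quotient_def)

lemma cls_closed: "s \<in> \<S> ==> cls s \<in> CB"
by (auto simp: carrier_crossed quotient_def)

text \<open>Extends \<open>cross_op\<close> to the completion through an arbitrary representing
  Cauchy sequence. By \<open>comp_op_inject\<close>, identities in the abstract completion can be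
  verified on operators.\<close>

definition comp_op :: "nat => nat => 'x cel => 'x idx bop" where
"comp_op i j a = seq_op i j (SOME s. s \<in> a)"

lemma comp_op_cls:
assumes "s \<in> \<S>" shows "comp_op i j (cls s) = seq_op i j s"
proof -
have "s \<in> cls s" using equiv_class_self[OF equiv_null_rel assms] .
hence "(SOME t. t \<in> cls s) \<in> cls s" by (rule someI[of "%t. t \<in> cls s"])
hence "(s, SOME t. t \<in> cls s) \<in> null_rel \<A> \<N>" by blast
hence "seq_op i j s = seq_op i j (SOME t. t \<in> cls s)" using null_rel_iff[of s _ i j] by blast
thus ?thesis unfolding comp_op_def by (rule sym)
qed

lemma comp_op_inject:
assumes "a \<in> CB" "b \<in> CB" "comp_op i j a = comp_op i j b" shows "a = b"
proof -
obtain s t where st: "s \<in> \<S>" "a = cls s" "t \<in> \<S>" "b = cls t"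
 using assms crossed_cases by metis
hence "(s, t) \<in> null_rel \<A> \<N>" using assms(3) by (simp add: null_rel_iff[of _ _ i j] comp_op_cls)
thus ?thesis using st equiv_class_eq[OF equiv_null_rel] by blast
qed

lemma seqI:
assumes "!!k. s k \<in> CA" "(%k. cross_op i j (s k)) ----> A"
shows "s \<in> \<S>" "seq_op i j s = A"
proof -
show s: "s \<in> \<S>"
 unfolding cauchy_seqs_iff[of _ i j] using assms LIMSEQ_imp_Cauchy by auto
show "seq_op i j s = A" by (rule LIMSEQ_unique[OF seq_op_lim[OF s] assms(2)])
qed

lemma seq_mult:
assumes "s \<in> \<S>" "t \<in> \<S>"
shows "(%k. s k \<cdot> t k) \<in> \<S>" (is ?A)
 "seq_op i j s * seq_op j l t = seq_op i l (%k. s k \<cdot> t k)" (is ?B)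
proof -
have *: "(%k. cross_op i l (s k \<cdot> t k)) ----> seq_op i j s * seq_op j l t"
 using tendsto_mult[OF assms[THEN seq_op_lim], of i j j l] assms by (simp add: cross_op_mult cauchy_seqs_carrier)
have c: "s k \<cdot> t k \<in> CA" for k using assms by (simp add: mult_closed cauchy_seqs_carrier)
show ?A ?B using seqI[OF c *] by auto
qed

lemma seq_add:
assumes "s \<in> \<S>" "t \<in> \<S>"
shows "(%k. s k \<oplus>\<^bsub>\<A>\<^esub> t k) \<in> \<S>" (is ?A)
 "seq_op i j (%k. s k \<oplus>\<^bsub>\<A>\<^esub> t k) = seq_op i j s + seq_op i j t" (is ?B)
proof -
have *: "(%k. cross_op i j (s k \<oplus>\<^bsub>\<A>\<^esub> t k)) ----> seq_op i j s + seq_op i j t"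
 using tendsto_add[OF assms[THEN seq_op_lim], of i j i j] assms by (simp add: cross_op_add cauchy_seqs_carrier)
have c: "s k \<oplus>\<^bsub>\<A>\<^esub> t k \<in> CA" for k using assms by (simp add: add_closed cauchy_seqs_carrier)
show ?A ?B using seqI[OF c *] by auto
qed

lemma seq_adj:
assumes "s \<in> \<S>"
shows "(%k. adj \<A> (s k)) \<in> \<S>" (is ?A) "seq_op j i (%k. adj \<A> (s k)) = star (seq_op i j s)" (is ?B)
proof -
have *: "(%k. cross_op j i (adj \<A> (s k))) ----> star (seq_op i j s)"
 using bounded_linear.tendsto[OF bounded_linear_star seq_op_lim[OF assms, of i j]] assms
 by (simp add: star_cross_op cauchy_seqs_carrier)
have c: "adj \<A> (s k) \<in> CA" for k using assms by (simp add: adj_closed cauchy_seqs_carrier)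
show ?A ?B using seqI[OF c *] by auto
qed

lemma seq_const:
assumes "F \<in> CA"
shows "(%_. F) \<in> \<S>" "seq_op i j (%_. F) = cross_op i j F"
using seqI[of "%_. F" i j "cross_op i j F"] assms by auto

lemma crossed_ops:
assumes "s \<in> \<S>" "t \<in> \<S>"
shows "cls s \<odot> cls t = cls (%k. s k \<cdot> t k)"
 "cls s \<oplus>\<^bsub>\<B>\<^esub> cls t = cls (%k. s k \<oplus>\<^bsub>\<A>\<^esub> t k)" "adj \<B> (cls s) = cls (%k. adj \<A> (s k))"
unfolding crossed_product_def completion_def monoid.simps ring.simps star_algebra.simps
by (rule class_op2_eq[OF equiv_null_rel assms] class_op1_eq[OF equiv_null_rel assms(1)];
  auto simp: null_rel_iff[of _ _ 0 0] seq_mult(1) seq_mult(2)[of _ _ 0 0 0, symmetric] seq_add seq_adj)+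

lemma crossed_zero_one: "\<zero>\<^bsub>\<B>\<^esub> = cls (%_. \<zero>\<^bsub>\<A>\<^esub>)" "\<one>\<^bsub>\<B>\<^esub> = cls (%_. \<one>\<^bsub>\<A>\<^esub>)"
by (simp_all add: crossed_product_def completion_def)

lemma crossed_closed:
assumes "a \<in> CB" "b \<in> CB"
shows "a \<odot> b \<in> CB" (is ?A) "a \<oplus>\<^bsub>\<B>\<^esub> b \<in> CB" (is ?B) "adj \<B> a \<in> CB" (is ?C)
proof -
obtain s t where st: "s \<in> \<S>" "a = cls s" "t \<in> \<S>" "b = cls t"
 using assms crossed_cases by metis
thus ?A ?B ?C
 by (simp_all add: crossed_ops cls_closed seq_mult(1) seq_add(1) seq_adj(1))
qed

lemma crossed_zero_closed: "\<zero>\<^bsub>\<B>\<^esub> \<in> CB" and crossed_one_closed: "\<one>\<^bsub>\<B>\<^esub> \<in> CB"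
by (simp_all add: crossed_zero_one cls_closed seq_const zero_closed one_closed)

lemma comp_op_simps:
assumes "a \<in> CB" "b \<in> CB"
shows "comp_op i j a * comp_op j l b = comp_op i l (a \<odot> b)" (is ?A)
 "comp_op i j (a \<oplus>\<^bsub>\<B>\<^esub> b) = comp_op i j a + comp_op i j b" (is ?B)
 "star (comp_op i j a) = comp_op j i (adj \<B> a)" (is ?C)
proof -
obtain s t where st: "s \<in> \<S>" "a = cls s" "t \<in> \<S>" "b = cls t"
 using assms crossed_cases by metis
thus ?A ?B ?C
 by (simp_all add: crossed_ops comp_op_cls seq_mult seq_add seq_adj)
qed

lemma comp_op_mult_ne:
assumes "a \<in> CB" "b \<in> CB" "j ~= j'"
shows "comp_op i j a * comp_op j' l b = 0"
proof -
obtain s t where st: "s \<in> \<S>" "a = cls s" "t \<in> \<S>" "b = cls t"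
 using assms crossed_cases by metis
have "(%k. cross_op i j (s k) * cross_op j' l (t k)) ----> seq_op i j s * seq_op j' l t"
 by (intro tendsto_mult seq_op_lim st)
hence "(%k. 0) ----> seq_op i j s * seq_op j' l t"
 using st assms(3) by (simp add: cross_op_mult cauchy_seqs_carrier)
thus ?thesis using st LIMSEQ_unique tendsto_const by (simp add: comp_op_cls) blast
qed

lemma cross_op_zero: "cross_op i j \<zero>\<^bsub>\<A>\<^esub> = 0"
by (simp add: cross_op_def alg_simps)

lemma comp_op_zero: "comp_op i j \<zero>\<^bsub>\<B>\<^esub> = 0"
by (simp add: crossed_zero_one comp_op_cls seq_const zero_closed cross_op_zero)

lemma abelian_monoid_crossed: "abelian_monoid \<B>"
by (rule abelian_monoidI; (rule comp_op_inject[of _ _ 0 0])?;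
  simp add: crossed_closed crossed_zero_closed comp_op_simps comp_op_zero add_ac)

lemma comp_op_finsum:
assumes "finite K" "!!k. k \<in> K ==> f k \<in> CB"
shows "finsum \<B> f K \<in> CB" "comp_op i j (finsum \<B> f K) = (\<Sum>k\<in>K. comp_op i j (f k))"
proof -
interpret abelian_monoid \<B> by (rule abelian_monoid_crossed)
show "finsum \<B> f K \<in> CB" using assms by auto
from assms show "comp_op i j (finsum \<B> f K) = (\<Sum>k\<in>K. comp_op i j (f k))"
proof (induction K rule: finite_induct)
 case (insert k K)
 have "finsum \<B> f K \<in> CB" using insert.prems by auto
 moreover have "f \<in> K \<rightarrow> CB" "f k \<in> CB" using insert.prems by auto
 ultimately show ?case using insert by (simp add: finsum_insert comp_op_simps)
qed (simp add: comp_op_zero)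
qed

lemma comp_op_dense:
assumes "a \<in> CB" "0 < e"
shows "\<exists>F\<in>CA. norm (comp_op i j a - cross_op i j F) < e"
proof -
obtain s where s: "s \<in> \<S>" "a = cls s" using assms crossed_cases by metis
obtain k where "norm (cross_op i j (s k) - seq_op i j s) < e"
 using LIMSEQ_D[OF seq_op_lim[OF s(1), of i j] assms(2)] by blast
thus ?thesis using s by (metis cauchy_seqs_carrier comp_op_cls norm_minus_commute)
qed

text \<open>Diagonal argument: each \<open>a k\<close> is replaced by a Laurent polynomial at
  distance less than \<open>1 / Suc k\<close>. These polynomials have the same limit and form a
  representing sequence themselves.\<close>

lemma comp_op_closed:
assumes "!!k. a k \<in> CB" "(%k. comp_op i j (a k)) ----> A"
shows "\<exists>b\<in>CB. A = comp_op i j b"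
proof -
have "\<forall>k. \<exists>F\<in>CA. norm (comp_op i j (a k) - cross_op i j F) < 1 / real (Suc k)"
 using comp_op_dense assms(1) by simp
then obtain F where F: "!!k. F k \<in> CA"
 "!!k. norm (comp_op i j (a k) - cross_op i j (F k)) < 1 / real (Suc k)" by metis
have "(%k. comp_op i j (a k) - cross_op i j (F k)) ----> 0"
 by (rule Lim_null_comparison[OF _ LIMSEQ_inverse_real_of_nat])
  (use F(2) in "auto simp: inverse_eq_divide intro!: always_eventually less_imp_le")
from tendsto_diff[OF assms(2) this] have "(%k. cross_op i j (F k)) ----> A" by simp
from seqI[OF F(1) this] show ?thesis by (metis cls_closed comp_op_cls)
qed

abbreviation "bmat n m p \<equiv> \<forall>i<n. \<forall>j<m. p i j \<in> CB"
abbreviation "mmul m p q i j \<equiv> \<Oplus>\<^bsub>\<B>\<^esub>k\<in>{..<m::nat}. p i k \<odot> q k j"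
abbreviation "mstar p i j \<equiv> adj \<B> (p j i)"

definition mat_op :: "nat => nat => (nat => nat => 'x cel) =>
 'x idx bop" where
"mat_op n m p = (\<Sum>i<n. \<Sum>j<m. comp_op i j (p i j))"

definition Mat :: "nat => nat => 'x idx bop set" where
"Mat n m = {mat_op n m p | p. bmat n m p}"

definition munit :: "nat => nat => 'x idx bop" where
"munit i j = comp_op i j \<one>\<^bsub>\<B>\<^esub>"

abbreviation "corner i j A \<equiv> munit i i * A * munit j j"

lemma crossed_one:
assumes "a \<in> CB" shows "a \<odot> \<one>\<^bsub>\<B>\<^esub> = a" "\<one>\<^bsub>\<B>\<^esub> \<odot> a = a"
proof -
obtain s where s: "s \<in> \<S>" "a = cls s" using assms crossed_cases by metis
show "a \<odot> \<one>\<^bsub>\<B>\<^esub> = a" "\<one>\<^bsub>\<B>\<^esub> \<odot> a = a"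
 using s by (simp_all add: crossed_zero_one crossed_ops seq_const one_closed alg_one cauchy_seqs_carrier)
qed

lemma munit_mult:
assumes "a \<in> CB"
shows "munit i j * comp_op k l a = (if j = k then comp_op i l a else 0)"
 "comp_op k l a * munit i j = (if l = i then comp_op k j a else 0)"
using assms by (auto simp: munit_def comp_op_simps comp_op_mult_ne crossed_one_closed crossed_one)

lemma crossed_adj_one: "adj \<B> \<one>\<^bsub>\<B>\<^esub> = \<one>\<^bsub>\<B>\<^esub>"
proof -
have "adj \<A> \<one>\<^bsub>\<A>\<^esub> = \<one>\<^bsub>\<A>\<^esub>" by (auto simp: alg_simps fun_eq_iff)
thus ?thesis
 using crossed_ops(3)[OF seq_const(1)[OF one_closed] seq_const(1)[OF one_closed]]
 by (simp only: crossed_zero_one)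
qed

lemma star_munit: "star (munit i j) = munit j i"
by (simp add: munit_def comp_op_simps[OF crossed_one_closed crossed_one_closed] crossed_adj_one)

lemma mat_op_entry:
assumes "bmat n m p"
shows "munit k i * mat_op n m p * munit j l = (if i < n & j < m then comp_op k l (p i j) else 0)"
proof -
have "munit k i * mat_op n m p * munit j l =
  (\<Sum>i'<n. \<Sum>j'<m. munit k i * comp_op i' j' (p i' j') * munit j l)"
 by (simp add: mat_op_def sum_distrib_left sum_distrib_right)
also have "... = (\<Sum>i'<n. \<Sum>j'<m. if i' = i then (if j' = j then comp_op k l (p i' j') else 0) else 0)"
 using assms by (intro sum.cong refl) (auto simp: munit_mult)
also have "... = (\<Sum>i'<n. if i' = i then (if j < m then comp_op k l (p i' j) else 0) else 0)"
 by (intro sum.cong refl) auto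
finally show ?thesis by auto
qed

lemma mat_op_eq_iff:
assumes "bmat n m p" "bmat n m q"
shows "mat_op n m p = mat_op n m q <-> (\<forall>i<n. \<forall>j<m. p i j = q i j)"
proof
assume "mat_op n m p = mat_op n m q"
hence "comp_op 0 0 (p i j) = comp_op 0 0 (q i j)" if "i < n" "j < m" for i j
 using mat_op_entry[OF assms(1), of 0 i j 0] mat_op_entry[OF assms(2), of 0 i j 0] that by simp
thus "\<forall>i<n. \<forall>j<m. p i j = q i j" using assms comp_op_inject by blast
qed (simp add: mat_op_def)

lemma mat_op_mult:
assumes "bmat n m p" "bmat m l q"
shows "mat_op n m p * mat_op m l q = mat_op n l (mmul m p q)"
proof -
have "mat_op n m p * mat_op m l q =
  (\<Sum>i<n. \<Sum>k<m. \<Sum>k'<m. \<Sum>j<l. comp_op i k (p i k) * comp_op k' j (q k' j))"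
 unfolding mat_op_def sum_distrib_right unfolding sum_distrib_left ..
also have "... = (\<Sum>i<n. \<Sum>k<m. \<Sum>k'<m. if k' = k then \<Sum>j<l. comp_op i k (p i k) * comp_op k j (q k j) else 0)"
 using assms by (intro sum.cong refl) (auto intro!: sum.neutral simp: comp_op_mult_ne)
also have "... = (\<Sum>i<n. \<Sum>k<m. \<Sum>j<l. comp_op i k (p i k) * comp_op k j (q k j))"
 by (rule sum.cong[OF refl], rule sum.cong[OF refl], simp)
also have "... = (\<Sum>i<n. \<Sum>k<m. \<Sum>j<l. comp_op i j (p i k \<odot> q k j))"
 using assms by (intro sum.cong refl) (simp add: comp_op_simps)
also have "... = (\<Sum>i<n. \<Sum>j<l. \<Sum>k<m. comp_op i j (p i k \<odot> q k j))"
 by (rule sum.cong[OF refl], rule sum.swap)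
also have "... = mat_op n l (mmul m p q)"
 unfolding mat_op_def
 by (rule sum.cong[OF refl], rule sum.cong[OF refl], rule comp_op_finsum(2)[symmetric])
  (use assms in "auto intro!: crossed_closed")
finally show ?thesis .
qed

lemma star_mat_op:
assumes "bmat n m p"
shows "star (mat_op n m p) = mat_op m n (mstar p)"
proof -
have "star (mat_op n m p) = (\<Sum>i<n. \<Sum>j<m. comp_op j i (adj \<B> (p i j)))"
 unfolding mat_op_def star_sum using assms
 by (intro sum.cong refl) (auto simp: comp_op_simps(3)[OF _ crossed_one_closed])
thus ?thesis unfolding mat_op_def by (subst sum.swap)
qed

lemma Mat_mult: "A \<in> Mat n m ==> B \<in> Mat m l ==> A * B \<in> Mat n l"
proof -
assume "A \<in> Mat n m" "B \<in> Mat m l"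
then obtain p q where pq: "bmat n m p" "A = mat_op n m p"
 "bmat m l q" "B = mat_op m l q" by (auto simp: Mat_def)
hence "A * B = mat_op n l (mmul m p q)" by (simp add: mat_op_mult)
moreover have "bmat n l (mmul m p q)"
 using pq by (intro allI impI comp_op_finsum crossed_closed) auto
ultimately show ?thesis unfolding Mat_def by blast
qed

lemma Mat_star: "A \<in> Mat n m ==> star A \<in> Mat m n"
proof -
assume "A \<in> Mat n m"
then obtain p where p: "bmat n m p" "A = mat_op n m p" by (auto simp: Mat_def)
hence "star A = mat_op m n (mstar p)" by (simp add: star_mat_op)
moreover have "bmat m n (mstar p)" using p crossed_closed(3) by blast
ultimately show ?thesis unfolding Mat_def by blast
qed

text \<open>A description by corners instead of a chosen matrix of elements. Corners depend
  continuously and linearly on the operator, which is what \<open>Mat_closed\<close> and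
  \<open>Mat_lin\<close> need.\<close>

lemma Mat_iff:
"A \<in> Mat n m <-> A = (\<Sum>i<n. \<Sum>j<m. corner i j A) &
  (\<forall>i<n. \<forall>j<m. corner i j A \<in> comp_op i j ` CB)" (is "_ = ?r")
proof
assume "A \<in> Mat n m"
then obtain p where p: "bmat n m p" "A = mat_op n m p" by (auto simp: Mat_def)
have "corner i j A = comp_op i j (p i j)" if "i < n" "j < m" for i j
 using mat_op_entry[OF p(1), of i i j j] that p(2) by simp
thus ?r
 using p by (auto simp: mat_op_def intro!: sum.cong)
next
assume *: ?r
hence "\<forall>i j. \<exists>a. i < n --> j < m --> a \<in> CB & corner i j A = comp_op i j a"
 by blast
then obtain p where p: "\<forall>i<n. \<forall>j<m. p i j \<in> CB & corner i j A = comp_op i j (p i j)"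
 by metis
have "(\<Sum>i<n. \<Sum>j<m. corner i j A) = mat_op n m p"
 unfolding mat_op_def using p by (intro sum.cong refl) auto
thus "A \<in> Mat n m" using * p unfolding Mat_def by (auto intro!: exI[of _ p])
qed

lemma comp_op_scaleR:
assumes "a \<in> CB" shows "\<exists>b\<in>CB. r *r comp_op i j a = comp_op i j b"
proof -
obtain s where s: "s \<in> \<S>" "a = cls s" using assms crossed_cases by metis
have c: "cscale \<A> (of_real r) (s k) \<in> CA" for k using s by (simp add: cscale_closed cauchy_seqs_carrier)
have "cross_op i j (cscale \<A> (of_real r) (s k)) = r *r cross_op i j (s k)" for k
 using s by (intro bop_eqI)
  (auto simp: cross_op_cscale cauchy_seqs_carrier scaleR_conv_of_real[where 'a = complex] intro!: ell2_eqI)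
hence "(%k. cross_op i j (cscale \<A> (of_real r) (s k))) ----> r *r seq_op i j s"
 using seq_op_lim[OF s(1)] by (simp add: tendsto_scaleR)
from seqI[OF c this] show ?thesis using s by (metis cls_closed comp_op_cls)
qed

lemma Mat_lin:
assumes "A \<in> Mat n m" "B \<in> Mat n m" shows "A + r *r B \<in> Mat n m"
unfolding Mat_iff
proof (intro conjI allI impI)
have "A = (\<Sum>i<n. \<Sum>j<m. corner i j A)" "B = (\<Sum>i<n. \<Sum>j<m. corner i j B)"
 using assms unfolding Mat_iff by blast+
hence "A + r *r B = (\<Sum>i<n. \<Sum>j<m. corner i j A) + r *r (\<Sum>i<n. \<Sum>j<m. corner i j B)"
 by simp
also have "... = (\<Sum>i<n. \<Sum>j<m. corner i j (A + r *r B))"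
 by (simp add: scaleR_sum_right sum.distrib algebra_simps)
finally show "A + r *r B = (\<Sum>i<n. \<Sum>j<m. corner i j (A + r *r B))" .
fix i j assume ij: "i < n" "j < m"
obtain a b where ab: "a \<in> CB" "b \<in> CB"
 "corner i j A = comp_op i j a" "corner i j B = comp_op i j b"
 using assms ij unfolding Mat_iff by blast
obtain b' where b': "b' \<in> CB" "r *r comp_op i j b = comp_op i j b'"
 using comp_op_scaleR[OF ab(2)] by blast
have "corner i j (A + r *r B) = comp_op i j (a \<oplus>\<^bsub>\<B>\<^esub> b')"
 using ab b' by (simp add: comp_op_simps algebra_simps)
thus "corner i j (A + r *r B) \<in> comp_op i j ` CB"
 using ab b' crossed_closed by blast
qed

lemma Mat_closed: "closed (Mat n m)"
proof (rule closed_sequential_limits[THEN iffD2], intro allI impI, elim conjE)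
fix x A assume x: "\<forall>k. x k \<in> Mat n m" and lim: "x ----> A"
show "A \<in> Mat n m"
 unfolding Mat_iff
proof (intro conjI allI impI)
 have "(%k. \<Sum>i<n. \<Sum>j<m. corner i j (x k)) ----> (\<Sum>i<n. \<Sum>j<m. corner i j A)"
  by (intro tendsto_intros lim)
 moreover have "(\<Sum>i<n. \<Sum>j<m. corner i j (x k)) = x k" for k
 proof -
  have "x k = (\<Sum>i<n. \<Sum>j<m. corner i j (x k))" using x unfolding Mat_iff by blast
  thus ?thesis by (rule sym)
 qed
 ultimately have "x ----> (\<Sum>i<n. \<Sum>j<m. corner i j A)" by (simp only:)
 with lim show "A = (\<Sum>i<n. \<Sum>j<m. corner i j A)" by (rule LIMSEQ_unique)
 fix i j assume ij: "i < n" "j < m"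
 have "\<forall>k. \<exists>a\<in>CB. corner i j (x k) = comp_op i j a"
  using x ij unfolding Mat_iff by blast
 then obtain a where a: "!!k. a k \<in> CB" "!!k. corner i j (x k) = comp_op i j (a k)" by metis
 have "(%k. corner i j (x k)) ----> corner i j A"
  by (intro tendsto_intros lim)
 hence "(%k. comp_op i j (a k)) ----> corner i j A" by (simp add: a(2))
 from comp_op_closed[OF a(1) this] show "corner i j A \<in> comp_op i j ` CB" by auto
qed
qed

lemma Mat_comp_op: "a \<in> CB ==> i < n ==> j < m ==> comp_op i j a \<in> Mat n m"
proof -
assume *: "a \<in> CB" "i < n" "j < m"
have ite: "comp_op i' j' (if i' = i & j' = j then a else \<zero>\<^bsub>\<B>\<^esub>) =
  (if i' = i then (if j' = j then comp_op i' j' a else 0) else 0)" for i' j'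
 by (simp add: comp_op_zero)
have "mat_op n m (%i' j'. if i' = i & j' = j then a else \<zero>\<^bsub>\<B>\<^esub>) =
  (\<Sum>i'<n. if i' = i then (\<Sum>j'<m. if j' = j then comp_op i' j' a else 0) else 0)"
 unfolding mat_op_def ite by (rule sum.cong[OF refl]) simp
also have "... = comp_op i j a" using * by simp
finally show ?thesis using * crossed_zero_closed unfolding Mat_def
 by (intro CollectI exI[of _ "%i' j'. if i' = i & j' = j then a else \<zero>\<^bsub>\<B>\<^esub>"]) auto
qed

lemma Mat_zero: "0 \<in> Mat n m"
proof -
have "mat_op n m (%_ _. \<zero>\<^bsub>\<B>\<^esub>) = 0" by (simp add: mat_op_def comp_op_zero)
thus ?thesis unfolding Mat_def using crossed_zero_closed by (intro CollectI exI[of _ "%_ _. \<zero>\<^bsub>\<B>\<^esub>"]) simp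
qed

lemma Mat_add: "A \<in> Mat n m ==> B \<in> Mat n m ==> A + B \<in> Mat n m"
using Mat_lin[of A n m B 1] by simp

lemma Mat_scaleR: "A \<in> Mat n m ==> r *r A \<in> Mat n m"
using Mat_lin[OF Mat_zero, of A n m r] by simp

lemma Mat_diff: "A \<in> Mat n m ==> B \<in> Mat n m ==> A - B \<in> Mat n m"
using Mat_lin[of A n m B "- 1"] by simp

lemma Mat_sum: "(!!k. k \<in> K ==> f k \<in> Mat n m) ==> sum f K \<in> Mat n m"
by (induction K rule: infinite_finite_induct) (auto intro: Mat_zero Mat_add)

lemma Mat_mono: "n <= n' ==> m <= m' ==> Mat n m \<subseteq> Mat n' m'"
unfolding Mat_def[of n m] mat_op_def by (auto intro!: Mat_sum Mat_comp_op)

lemma Mat_munit: "i < n ==> j < m ==> munit i j \<in> Mat n m"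
unfolding munit_def by (intro Mat_comp_op crossed_one_closed)

abbreviation proj_op :: "'x cel sq_matrix => 'x idx bop" where
"proj_op P \<equiv> mat_op (fst P) (fst P) (snd P)"

lemma projections_iff:
"P \<in> \<P> <-> (\<forall>i<fst P. \<forall>j<fst P. snd P i j \<in> CB) &
  star (proj_op P) = proj_op P & proj_op P * proj_op P = proj_op P"
proof -
obtain n p where P: "P = (n, p)" by force
show ?thesis
proof (cases "bmat n n p")
 case True
 have "bmat n n (mstar p)" using True crossed_closed(3) by blast
 hence "star (mat_op n n p) = mat_op n n p <-> (\<forall>i<n. \<forall>j<n. mstar p i j = p i j)"
  unfolding star_mat_op[OF True] by (rule mat_op_eq_iff[OF _ True])
 moreover have "mat_op n n p * mat_op n n p = mat_op n n p <->
   (\<forall>i<n. \<forall>j<n. mmul n p p i j = p i j)"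
  unfolding mat_op_mult[OF True True]
  by (rule mat_op_eq_iff[OF _ True]) (intro allI impI comp_op_finsum crossed_closed, use True in auto)
 moreover have "(n, p) \<in> \<P> <-> (bmat n n p) &
   (\<forall>i<n. \<forall>j<n. mstar p i j = p i j) &
   (\<forall>i<n. \<forall>j<n. mmul n p p i j = p i j)"
  unfolding projections_def by blast
 ultimately show ?thesis unfolding P fst_conv snd_conv by simp
next
 case False
 thus ?thesis unfolding P projections_def fst_conv snd_conv by blast
qed
qed

text \<open>Matrix positions are natural numbers, so matrices of all sizes act on one space and
  enlarging a matrix by zeros does not change its operator.\<close>

definition Mat_all :: "'x idx bop set" where "Mat_all = (\<Union>n. Mat n n)"

lemma Mat_all_I: "A \<in> Mat n m ==> A \<in> Mat_all"
unfolding Mat_all_def using Mat_mono[of n "max n m" m "max n m"] by auto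

lemma Mat_all_2:
assumes "A \<in> Mat_all" "B \<in> Mat_all" obtains n where "A \<in> Mat n n" "B \<in> Mat n n"
proof -
obtain n m where "A \<in> Mat n n" "B \<in> Mat m m" using assms by (auto simp: Mat_all_def)
hence "A \<in> Mat (max n m) (max n m)" "B \<in> Mat (max n m) (max n m)"
 using Mat_mono[of n "max n m" n "max n m"] Mat_mono[of m "max n m" m "max n m"] by auto
thus thesis by (rule that)
qed

lemma Mat_all_closed:
assumes "A \<in> Mat_all" "B \<in> Mat_all"
shows "A * B \<in> Mat_all" "A + B \<in> Mat_all" "star A \<in> Mat_all"
using Mat_all_2[OF assms] by (metis Mat_all_I Mat_mult Mat_add Mat_star)+

lemma Mat_corner:
assumes "V \<in> Mat k k" "A \<in> Mat n n" "B \<in> Mat m m" shows "A * V * B \<in> Mat n m"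
proof -
have "V \<in> Mat (max k (max n m)) (max k (max n m))" using assms Mat_mono by (meson max.cobounded1 subsetD)
moreover have "A \<in> Mat n (max k (max n m))" "B \<in> Mat (max k (max n m)) m"
 using assms Mat_mono[of n n n "max k (max n m)"] Mat_mono[of m "max k (max n m)" m m]
 by (auto simp: subset_iff le_max_iff_disj)
ultimately show ?thesis using Mat_mult by blast
qed

text \<open>The shape of \<open>V\<close> need not be prescribed: a partial isometry equals its
  compression by its initial and final projections, and this compression has the right
  shape.\<close>

lemma mvn_rel_iff:
"(P, Q) \<in> mvn_rel \<B> <-> P \<in> \<P> & Q \<in> \<P> &
  (\<exists>V\<in>Mat_all. star V * V = proj_op P & V * star V = proj_op Q)"
proof -
obtain n p where P: "P = (n, p)" by force
obtain m q where Q: "Q = (m, q)" by force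
have eq: "(\<exists>v. (bmat m n v) &
    (\<forall>i<n. \<forall>j<n. mmul m (mstar v) v i j = p i j) &
    (\<forall>i<m. \<forall>j<m. mmul n v (mstar v) i j = q i j)) <->
  (\<exists>V\<in>Mat m n. star V * V = mat_op n n p & V * star V = mat_op m m q)" (is "?l <-> ?r")
 if pq: "(n, p) \<in> \<P>" "(m, q) \<in> \<P>"
proof -
 have c: "bmat n n p" "bmat m m q"
  using pq by (auto simp: projections_def)
 have *: "star (mat_op m n v) * mat_op m n v = mat_op n n p & mat_op m n v * star (mat_op m n v) = mat_op m m q
   <-> (\<forall>i<n. \<forall>j<n. mmul m (mstar v) v i j = p i j) &
    (\<forall>i<m. \<forall>j<m. mmul n v (mstar v) i j = q i j)"
  if v: "bmat m n v" for v
 proof -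
  have v': "bmat n m (mstar v)" using v crossed_closed(3) by blast
  have 1: "bmat n n (mmul m (mstar v) v)"
   by (intro allI impI comp_op_finsum crossed_closed) (use v v' in auto)
  have 2: "bmat m m (mmul n v (mstar v))"
   by (intro allI impI comp_op_finsum crossed_closed) (use v v' in auto)
  show ?thesis
   unfolding star_mat_op[OF v] mat_op_mult[OF v' v] mat_op_mult[OF v v']
    mat_op_eq_iff[OF 1 c(1)] mat_op_eq_iff[OF 2 c(2)] ..
 qed
 show ?thesis unfolding Mat_def using * by blast
qed
have "(\<exists>V\<in>Mat m n. star V * V = mat_op n n p & V * star V = mat_op m m q) <->
  (\<exists>V\<in>Mat_all. star V * V = mat_op n n p & V * star V = mat_op m m q)" (is "?l <-> ?r")
 if pq: "(n, p) \<in> \<P>" "(m, q) \<in> \<P>"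
proof
 assume ?r
 then obtain V k where V: "V \<in> Mat k k" "star V * V = mat_op n n p" "V * star V = mat_op m m q"
  by (auto simp: Mat_all_def)
 define W where "W = mat_op m m q * V * mat_op n n p"
 have pr: "star (mat_op n n p) = mat_op n n p" "mat_op n n p * mat_op n n p = mat_op n n p"
  "star (mat_op m m q) = mat_op m m q" "mat_op m m q * mat_op m m q = mat_op m m q"
  using pq unfolding projections_iff by auto
 have "mat_op n n p \<in> Mat n n" "mat_op m m q \<in> Mat m m"
  using pq by (auto simp: projections_def Mat_def)
 hence W: "W \<in> Mat m n" unfolding W_def using V(1) Mat_corner by blast
 have "W = V" using partial_isometry_support[OF V(2,3) pr(2,1)] by (simp add: W_def)
 with W V show ?l by auto
qed (auto intro: Mat_all_I)
with eq show ?thesis by (auto simp: P Q mvn_rel_def)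
qed

lemma equiv_mvn_rel: "equiv (\<P>) (mvn_rel \<B>)"
proof (rule equivI)
show "mvn_rel \<B> \<subseteq> \<P> \<times> \<P>" by (auto simp: mvn_rel_iff)
show "refl_on (\<P>) (mvn_rel \<B>)"
proof (rule refl_onI)
 fix P assume P: "P \<in> \<P>"
 hence "proj_op P \<in> Mat_all" by (auto simp: projections_iff Mat_def intro!: Mat_all_I[of _ "fst P" "fst P"])
 with P show "(P, P) \<in> mvn_rel \<B>" unfolding mvn_rel_iff by (auto simp: projections_iff intro!: bexI[of _ "proj_op P"])
qed
show "sym (mvn_rel \<B>)"
proof (rule symI)
 fix P Q assume "(P, Q) \<in> mvn_rel \<B>"
 then obtain V where V: "P \<in> \<P>" "Q \<in> \<P>" "V \<in> Mat_all"
  "star V * V = proj_op P" "V * star V = proj_op Q" by (auto simp: mvn_rel_iff)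
 thus "(Q, P) \<in> mvn_rel \<B>" unfolding mvn_rel_iff
  using Mat_all_closed(3)[OF V(3) V(3)] by (auto intro!: bexI[of _ "star V"])
qed
show "trans (mvn_rel \<B>)"
proof (rule transI)
 fix P Q R assume "(P, Q) \<in> mvn_rel \<B>" "(Q, R) \<in> mvn_rel \<B>"
 then obtain V W where V: "P \<in> \<P>" "Q \<in> \<P>" "R \<in> \<P>"
  "V \<in> Mat_all" "star V * V = proj_op P" "V * star V = proj_op Q"
  "W \<in> Mat_all" "star W * W = proj_op Q" "W * star W = proj_op R" by (auto simp: mvn_rel_iff)
 have "star (W * V) * (W * V) = star V * (star W * W) * V" by (simp add: mult.assoc)
 also have "... = star V * V * (star V * V)" by (simp add: V(8) V(6)[symmetric] mult.assoc)
 also have "... = proj_op P" using V(1) by (simp add: V(5) projections_iff)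
 finally have 1: "star (W * V) * (W * V) = proj_op P" .
 have "(W * V) * star (W * V) = W * (V * star V) * star W" by (simp add: mult.assoc)
 also have "... = W * star W * (W * star W)" by (simp add: V(6) V(8)[symmetric] mult.assoc)
 also have "... = proj_op R" using V(3) by (simp add: V(9) projections_iff)
 finally show "(P, R) \<in> mvn_rel \<B>" unfolding mvn_rel_iff
  using 1 V Mat_all_closed(1)[OF V(7) V(4)] by (auto intro!: bexI[of _ "W * V"])
qed
qed

end

section \<open>Grothendieck groups\<close>

context
fixes M :: "'m monoid" (structure) assumes M: "comm_monoid M"
begin

lemma grothendieck_equiv: "equiv (carrier M \<times> carrier M) (grothendieck_rel M)"
proof -
interpret comm_monoid M by (rule M)
show ?thesis
proof (rule equivI)
 show "trans (grothendieck_rel M)"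
 proof (rule transI, clarify)
  fix a b c d a' b'
  assume "((a, b), (c, d)) \<in> grothendieck_rel M" "((c, d), (a', b')) \<in> grothendieck_rel M"
  then obtain e e' where *: "a \<in> carrier M" "b \<in> carrier M" "c \<in> carrier M" "d \<in> carrier M"
   "a' \<in> carrier M" "b' \<in> carrier M" "e \<in> carrier M" "e' \<in> carrier M"
   "a \<otimes> d \<otimes> e = c \<otimes> b \<otimes> e" "c \<otimes> b' \<otimes> e' = a' \<otimes> d \<otimes> e'"
   unfolding grothendieck_rel_def by blast
  have "a \<otimes> b' \<otimes> (d \<otimes> e \<otimes> e') = (a \<otimes> d \<otimes> e) \<otimes> (b' \<otimes> e')"
   using *(1-8) by (simp add: m_ac)
  also have "... = (c \<otimes> b' \<otimes> e') \<otimes> (b \<otimes> e)" unfolding *(9) using *(1-8) by (simp add: m_ac)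
  also have "... = a' \<otimes> b \<otimes> (d \<otimes> e \<otimes> e')" unfolding *(10) using *(1-8) by (simp add: m_ac)
  finally have "a \<otimes> b' \<otimes> (d \<otimes> e \<otimes> e') = a' \<otimes> b \<otimes> (d \<otimes> e \<otimes> e')" .
  moreover have "d \<otimes> e \<otimes> e' \<in> carrier M" using * by simp
  ultimately show "((a, b), (a', b')) \<in> grothendieck_rel M"
   using * unfolding grothendieck_rel_def by blast
 qed
 show "sym (grothendieck_rel M)"
 proof (rule symI, clarify)
  fix a b c d assume "((a, b), (c, d)) \<in> grothendieck_rel M"
  thus "((c, d), (a, b)) \<in> grothendieck_rel M"
   unfolding grothendieck_rel_def by (auto intro: sym)
 qed
qed (auto simp: refl_on_def grothendieck_rel_def)
qed

abbreviation (input) gclass :: "'m => 'm => ('m \<times> 'm) set" where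
"gclass a b \<equiv> grothendieck_rel M `` {(a, b)}"

lemma gclass_eqI:
assumes "a \<in> carrier M" "b \<in> carrier M" "c \<in> carrier M" "d \<in> carrier M" "e \<in> carrier M"
 "a \<otimes> d \<otimes> e = c \<otimes> b \<otimes> e"
shows "gclass a b = gclass c d"
proof -
have "((a, b), (c, d)) \<in> grothendieck_rel M" using assms unfolding grothendieck_rel_def by blast
thus ?thesis by (rule equiv_class_eq[OF grothendieck_equiv])
qed

lemma gclass_eqD:
assumes "gclass a b = gclass c d" "c \<in> carrier M" "d \<in> carrier M"
shows "\<exists>e\<in>carrier M. a \<otimes> d \<otimes> e = c \<otimes> b \<otimes> e"
proof -
have "((a, b), (c, d)) \<in> grothendieck_rel M"
 using eq_equiv_class[OF assms(1) grothendieck_equiv] assms(2,3) by blast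
thus ?thesis unfolding grothendieck_rel_def by blast
qed

lemma gclass_mult:
assumes "a \<in> carrier M" "b \<in> carrier M" "c \<in> carrier M" "d \<in> carrier M"
shows "gclass a b \<otimes>\<^bsub>grothendieck_group M\<^esub> gclass c d = gclass (a \<otimes> c) (b \<otimes> d)"
proof -
interpret comm_monoid M by (rule M)
have "class_op2 (grothendieck_rel M) (%x y. (fst x \<otimes> fst y, snd x \<otimes> snd y)) (gclass a b) (gclass c d)
 = grothendieck_rel M `` {(fst (a, b) \<otimes> fst (c, d), snd (a, b) \<otimes> snd (c, d))}"
proof (rule class_op2_eq[OF grothendieck_equiv], goal_cases)
 case (3 x x' y y')
 obtain a b a' b' c d c' d' where x: "x = (a, b)" "x' = (a', b')" "y = (c, d)" "y' = (c', d')"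
  by (metis surj_pair)
 obtain e e' where *: "a \<in> carrier M" "b \<in> carrier M" "c \<in> carrier M" "d \<in> carrier M"
   "a' \<in> carrier M" "b' \<in> carrier M" "c' \<in> carrier M" "d' \<in> carrier M" "e \<in> carrier M" "e' \<in> carrier M"
   "a \<otimes> b' \<otimes> e = a' \<otimes> b \<otimes> e" "c \<otimes> d' \<otimes> e' = c' \<otimes> d \<otimes> e'"
  using 3 unfolding x grothendieck_rel_def by blast
 have "(a \<otimes> c) \<otimes> (b' \<otimes> d') \<otimes> (e \<otimes> e') = (a \<otimes> b' \<otimes> e) \<otimes> (c \<otimes> d' \<otimes> e')"
  using *(1-10) by (simp add: m_ac)
 also have "... = (a' \<otimes> c') \<otimes> (b \<otimes> d) \<otimes> (e \<otimes> e')"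
  unfolding *(11,12) using *(1-10) by (simp add: m_ac)
 finally have "\<exists>e\<in>carrier M. (a \<otimes> c) \<otimes> (b' \<otimes> d') \<otimes> e = (a' \<otimes> c') \<otimes> (b \<otimes> d) \<otimes> e"
  using *(9,10) m_closed by blast
 thus ?case using *(1-8) unfolding x grothendieck_rel_def by simp
qed (use assms in auto)
thus ?thesis by (simp add: grothendieck_group_def)
qed

lemma grothendieck_carrier:
"x \<in> carrier (grothendieck_group M) <-> (\<exists>a\<in>carrier M. \<exists>b\<in>carrier M. x = gclass a b)"
by (auto simp: grothendieck_group_def quotient_def)

end

section \<open>Diagonal projections and their rank functions\<close>

context zero_dim_system
begin

definition loc_const :: "('x => 'c) => bool" where
"loc_const f <-> continuous_map X (discrete_topology UNIV) f"

lemma loc_const_open: "loc_const f ==> openin X {x \<in> XX. f x \<in> V}"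
and loc_const_closed: "loc_const f ==> closedin X {x \<in> XX. f x \<in> V}"
unfolding loc_const_def by (auto intro: openin_continuous_map_preimage closedin_continuous_map_preimage)

lemma loc_const_iff: "loc_const f <-> (\<forall>v. openin X {x \<in> XX. f x = v})"
proof (intro iffI allI)
show "loc_const f ==> openin X {x \<in> XX. f x = v}" for v using loc_const_open[of f "{v}"] by simp
assume "\<forall>v. openin X {x \<in> XX. f x = v}"
hence "openin X (\<Union>v\<in>V. {x \<in> XX. f x = v})" for V by blast
moreover have "(\<Union>v\<in>V. {x \<in> XX. f x = v}) = {x \<in> XX. f x \<in> V}" for V by auto
ultimately show "loc_const f" by (simp add: loc_const_def continuous_map_def)
qed

lemma loc_const_comp: "loc_const f ==> loc_const (%x. h (f x))"
unfolding loc_const_def using continuous_map_compose[of X "discrete_topology UNIV" f _ h] by (simp add: o_def)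

lemma loc_const_const [simp]: "loc_const (%_. c)" by (simp add: loc_const_def)

lemma loc_const_comp2: "loc_const f ==> loc_const h ==> loc_const (%x. F (f x) (h x))"
using loc_const_comp[of "%x. (f x, h x)" "case_prod F"]
by (simp add: loc_const_def UNIV_Times_UNIV[symmetric] prod_topology_discrete_topology continuous_map_pairedI del: UNIV_Times_UNIV)

lemma loc_const_sum:
fixes f :: "'c => 'x => 'b :: comm_monoid_add"
assumes "!!i. i \<in> I ==> loc_const (f i)" shows "loc_const (%x. \<Sum>i\<in>I. f i x)"
using assms by (induction I rule: infinite_finite_induct) (auto intro: loc_const_comp2[where F = "(+)"])

lemma loc_const_theta: "loc_const f ==> loc_const (%x. f (\<theta> n x))"
unfolding loc_const_def using continuous_map_compose[OF theta_continuous] by (fastforce simp: o_def)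

lemma loc_const_finite: "loc_const f ==> finite (f ` XX)"
using image_compactin[of X "XX"] compact unfolding loc_const_def compact_space_def
by (metis compactin_discrete_topology)

lemma loc_const_bounded:
fixes f :: "'x => nat"
assumes "loc_const f" shows "\<exists>m. \<forall>x\<in>XX. f x <= m"
using loc_const_finite[OF assms] finite_nat_set_iff_bounded_le by auto

definition clopen :: "'x set => bool" where "clopen U <-> openin X U & closedin X U"

lemma clopen_subset: "clopen U ==> U \<subseteq> XX"
by (simp add: clopen_def openin_subset)

lemma loc_const_clopen: "clopen U ==> loc_const (%x. x \<in> U)"
unfolding loc_const_iff
proof
fix v assume U: "clopen U"
hence "{x \<in> XX. (x \<in> U) = v} = (if v then U else XX - U)"
 using clopen_subset by auto
thus "openin X {x \<in> XX. (x \<in> U) = v}" using U by (auto simp: clopen_def)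
qed

text \<open>Turns every pointwise choice that persists on a neighbourhood into a locally constant
  one. Finitely many clopen pieces suffice; the set of pieces that contain a point is a locally
  constant function of the point, and so is any value chosen from this set.\<close>

lemma loc_const_selection:
assumes "!!x. x \<in> XX ==> \<exists>c W. openin X W & x \<in> W & (\<forall>y\<in>W. Q y c)"
shows "\<exists>\<sigma>. loc_const \<sigma> & (\<forall>x\<in>XX. Q x (\<sigma> x))"
proof -
have "\<forall>x\<in>XX. \<exists>c U. clopen U & x \<in> U & (\<forall>y\<in>U. Q y c)"
 using assms zero_dim unfolding clopen_def by (metis (no_types, lifting) in_mono)
then obtain c U where U: "!!x. x \<in> XX ==> clopen (U x) & x \<in> U x & (\<forall>y\<in>U x. Q y (c x))"
 by metis
have "\<exists>\<F>. finite \<F> & \<F> \<subseteq> U ` XX & XX \<subseteq> \<Union>\<F>"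
 using compact U unfolding compact_space_alt by (elim allE[of _ "U ` XX"]) (auto simp: clopen_def)
then obtain I where I: "finite I" "I \<subseteq> XX" "XX \<subseteq> \<Union>(U ` I)"
 by (metis finite_subset_image)
have "loc_const (%x. {z\<in>I. x \<in> U z})" using I(1,2)
proof (induction I rule: finite_induct)
 case (insert z J)
 have "loc_const (%x. if x \<in> U z then insert z {z\<in>J. x \<in> U z} else {z\<in>J. x \<in> U z})"
  using insert U loc_const_comp2[OF loc_const_clopen, of "U z" _ "%b S. if b then insert z S else S"] by simp
 moreover have "(if x \<in> U z then insert z {z\<in>J. x \<in> U z} else {z\<in>J. x \<in> U z}) = {y\<in>insert z J. x \<in> U y}" for x by auto
 ultimately show ?case by simp
qed simp
hence "loc_const (%x. c (SOME z. z \<in> {z\<in>I. x \<in> U z}))" by (rule loc_const_comp)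
moreover have "Q x (c (SOME z. z \<in> {z\<in>I. x \<in> U z}))" if x: "x \<in> XX" for x
proof -
 have "(SOME z. z \<in> {z\<in>I. x \<in> U z}) \<in> {z\<in>I. x \<in> U z}" by (rule someI_ex) (use I(3) x in auto)
 thus ?thesis using U I(2) by blast
qed
ultimately show ?thesis by blast
qed

lemma clopen_level: "loc_const f ==> clopen {x \<in> XX. P (f x)}"
unfolding clopen_def using loc_const_open[of f "Collect P"] loc_const_closed[of f "Collect P"] by auto

lemma cfun_loc_const:
assumes "loc_const f" "!!x. x ~: XX ==> f x = 0" shows "f \<in> cfun X"
using assms loc_const_open[OF assms(1)] by (auto simp: cfun_def continuous_map_def)

lemma cfun_indicator: "clopen U ==> (indicator U :: 'x => complex) \<in> cfun X"
proof (rule cfun_loc_const)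
assume U: "clopen U"
have "loc_const (%x. if x \<in> U then 1 else 0 :: complex)"
 by (rule loc_const_comp[OF loc_const_clopen[OF U]])
thus "loc_const (indicator U :: 'x => complex)" by (simp add: indicator_def[abs_def] of_bool_def)
show "indicator U x = 0" if "x ~: XX" for x using clopen_subset[OF U] that by (auto simp: indicator_def)
qed

definition embed0 :: "('x => complex) => int => 'x => complex" where
"embed0 f = (%n x. if n = 0 then f x else 0)"

lemma embed0_closed: "f \<in> cfun X ==> embed0 f \<in> CA"
proof -
assume f: "f \<in> cfun X"
have "fsupp (embed0 f) \<subseteq> {0}" by (auto simp: embed0_def)
hence "finite (fsupp (embed0 f))" by (rule finite_subset) simp
moreover have "embed0 f n \<in> cfun X" for n using f by (cases "n = 0") (auto simp: embed0_def)
ultimately show ?thesis by (simp add: carrier_iff)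
qed

lemma cfun_embed_eq: "cfun_embed X \<theta> f = cls (%_. embed0 f)"
by (simp add: cfun_embed_def embed0_def)

lemma cfun_embed_closed: "f \<in> cfun X ==> cfun_embed X \<theta> f \<in> CB"
by (simp add: cfun_embed_eq cls_closed seq_const embed0_closed)

lemma comp_op_embed: "f \<in> cfun X ==> comp_op i j (cfun_embed X \<theta> f) = cross_op i j (embed0 f)"
by (simp add: cfun_embed_eq comp_op_cls seq_const embed0_closed)

lemma coord_embed0:
assumes "f \<in> cfun X"
shows "coord (app (cross_op i j (embed0 f)) x) (s, k, c) =
 (if c = i then f (\<theta> (- k) s) * coord x (s, k, j) else 0)"
proof -
have "fsupp (embed0 f) \<subseteq> {0}" by (auto simp: embed0_def)
from coord_cross_op[OF embed0_closed[OF assms] _ this] show ?thesis by (simp add: embed0_def)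
qed

definition cmat :: "nat => nat => (nat => nat => 'x => complex) => bool" where
"cmat n m a <-> (\<forall>i<n. \<forall>j<m. a i j \<in> cfun X)"

definition clopens :: "nat => (nat => 'x set) => bool" where
"clopens m A <-> (\<forall>i<m. clopen (A i))"

lemma cmatI: "(!!i j. i < n ==> j < m ==> a i j \<in> cfun X) ==> cmat n m a"
and cmatD: "cmat n m a ==> i < n ==> j < m ==> a i j \<in> cfun X"
by (auto simp: cmat_def)

lemma clopensD: "clopens m A ==> i < m ==> clopen (A i)"
by (simp add: clopens_def)

text \<open>Matrices over \<open>C(X)\<close> inside the operators: they preserve every level and
  every fibre.\<close>

definition fibre :: "nat => nat => (nat => nat => 'x => complex) => 'x idx bop" where
"fibre n m a = mat_op n m (%i j. cfun_embed X \<theta> (a i j))"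

lemma fibre_eq:
assumes "cmat n m a"
shows "fibre n m a = (\<Sum>i<n. \<Sum>j<m. cross_op i j (embed0 (a i j)))"
unfolding fibre_def mat_op_def using assms by (intro sum.cong refl) (simp add: comp_op_embed cmatD)

lemma fibre_Mat:
assumes "cmat n m a" shows "fibre n m a \<in> Mat n m"
unfolding fibre_def Mat_def using assms cfun_embed_closed cmatD by blast

lemma coord_fibre:
assumes "cmat n m a"
shows "coord (app (fibre n m a) x) (s, k, c) =
 (if c < n then \<Sum>j<m. a c j (\<theta> (- k) s) * coord x (s, k, j) else 0)"
proof -
have "coord (app (fibre n m a) x) (s, k, c) =
  (\<Sum>i<n. \<Sum>j<m. if c = i then a i j (\<theta> (- k) s) * coord x (s, k, j) else 0)"
 unfolding fibre_eq[OF assms] app_sum_left coord_sum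
 using assms by (intro sum.cong refl) (simp add: coord_embed0 cmatD)
also have "... = (\<Sum>i<n. if c = i then \<Sum>j<m. a i j (\<theta> (- k) s) * coord x (s, k, j) else 0)"
 by (rule sum.cong[OF refl]) simp
finally show ?thesis by simp
qed

lemma fibre_mult:
assumes "cmat n m a" "cmat m l b"
shows "fibre n m a * fibre m l b = fibre n l (%i j x. \<Sum>k<m. a i k x * b k j x)"
proof (intro bop_eqI ell2_eqI)
fix x and q :: "'x idx"
obtain s k c where q: "q = (s, k, c)" by (cases q)
have ab: "cmat n l (%i j x. \<Sum>k<m. a i k x * b k j x)"
 by (intro cmatI cfun_sum cfun_mult) (auto intro: assms[THEN cmatD])
have "(\<Sum>j<m. a c j (\<theta> (- k) s) * (\<Sum>j'<l. b j j' (\<theta> (- k) s) * coord x (s, k, j'))) =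
  (\<Sum>j'<l. (\<Sum>j<m. a c j (\<theta> (- k) s) * b j j' (\<theta> (- k) s)) * coord x (s, k, j'))"
 unfolding sum_distrib_left sum_distrib_right by (subst sum.swap) (simp add: mult.assoc)
thus "coord (app (fibre n m a * fibre m l b) x) q =
  coord (app (fibre n l (%i j x. \<Sum>k<m. a i k x * b k j x)) x) q"
 unfolding q app_simps coord_fibre[OF assms(1)] coord_fibre[OF ab] by (simp add: coord_fibre[OF assms(2)])
qed

lemma star_fibre:
assumes "cmat n m a"
shows "star (fibre n m a) = fibre m n (%i j x. cnj (a j i x))"
proof -
have adj: "adj \<A> (embed0 f) = embed0 (%x. cnj (f x))" for f
 by (auto simp: alg_simps embed0_def fun_eq_iff)
have "star (fibre n m a) = (\<Sum>i<n. \<Sum>j<m. cross_op j i (embed0 (%x. cnj (a i j x))))"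
 unfolding fibre_eq[OF assms] star_sum
 using assms by (intro sum.cong refl) (simp add: star_cross_op embed0_closed adj cmatD)
also have "... = fibre m n (%i j x. cnj (a j i x))"
 using assms by (subst sum.swap) (rule fibre_eq[symmetric], auto intro!: cmatI cfun_cnj dest: cmatD)
finally show ?thesis .
qed

lemma fibre_cong:
assumes "!!i j x. i < n ==> j < m ==> a i j x = b i j x" shows "fibre n m a = fibre n m b"
proof -
have "a i j = b i j" if "i < n" "j < m" for i j using assms that by auto
thus ?thesis unfolding fibre_def mat_op_def by (intro sum.cong refl) auto
qed

definition diag_fun :: "(nat => 'x set) => nat => nat => 'x => complex" where
"diag_fun A i j = (if i = j then indicator (A i) else (%_. 0))"

definition diag_proj :: "nat => (nat => 'x set) => 'x cel sq_matrix" where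
"diag_proj m A = (m, %i j. cfun_embed X \<theta> (diag_fun A i j))"

lemma diag_proj_simps: "fst (diag_proj m A) = m" "mat_op m m (snd (diag_proj m A)) = fibre m m (diag_fun A)"
by (simp_all add: diag_proj_def fibre_def)

lemma diag_fun_cfun: "clopen (A i) ==> diag_fun A i j \<in> cfun X"
by (auto simp: diag_fun_def cfun_indicator)

lemma cmat_diag_fun: "clopens m A ==> cmat m m (diag_fun A)"
by (auto intro!: cmatI diag_fun_cfun dest: clopensD)

lemma coord_diag:
assumes "clopens m A"
shows "coord (app (fibre m m (diag_fun A)) x) (s, k, c) = (if c < m & \<theta> (- k) s \<in> A c then coord x (s, k, c) else 0)"
proof -
have "(\<Sum>j<m. diag_fun A c j (\<theta> (- k) s) * coord x (s, k, j)) =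
  (\<Sum>j<m. if j = c then (if \<theta> (- k) s \<in> A c then coord x (s, k, c) else 0) else 0)"
 by (intro sum.cong refl) (auto simp: diag_fun_def)
thus ?thesis by (simp add: coord_fibre[OF cmat_diag_fun[OF assms]])
qed

lemma diag_fibre_star_mult:
assumes "clopens m A"
shows "star (fibre m m (diag_fun A)) = fibre m m (diag_fun A)"
 "fibre m m (diag_fun A) * fibre m m (diag_fun A) = fibre m m (diag_fun A)"
proof -
note c = cmat_diag_fun[OF assms]
show "star (fibre m m (diag_fun A)) = fibre m m (diag_fun A)"
 unfolding star_fibre[OF c] by (rule fibre_cong) (auto simp: diag_fun_def indicator_def)
show "fibre m m (diag_fun A) * fibre m m (diag_fun A) = fibre m m (diag_fun A)"
 by (intro bop_eqI ell2_eqI) (auto simp: split_paired_all coord_diag[OF assms])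
qed

lemma diag_proj_projections:
assumes "clopens m A" shows "diag_proj m A \<in> \<P>"
unfolding projections_iff diag_proj_simps
using diag_fibre_star_mult[OF assms] assms
by (auto simp: diag_proj_simps) (auto simp: diag_proj_def intro!: cfun_embed_closed diag_fun_cfun dest: clopensD)

text \<open>The pointwise rank of a diagonal projection. With an index \<open>i\<close> in place of
  \<open>m\<close> it also numbers the sets containing \<open>x\<close> that precede the
  \<open>i\<close>-th one.\<close>

definition crank :: "nat => (nat => 'x set) => 'x => nat" where
"crank m A x = card {i. i < m & x \<in> A i}"

lemma crank_sum: "crank m A x = (\<Sum>i<m. if x \<in> A i then 1 else 0)"
proof -
have "{i. i < m & x \<in> A i} = {i\<in>{..<m}. x \<in> A i}" by auto
thus ?thesis unfolding crank_def by (simp only: card_eq_sum sum.inter_filter[OF finite_lessThan])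
qed

lemma loc_const_crank: "clopens m A ==> loc_const (crank m A)"
unfolding crank_sum[abs_def]
by (intro loc_const_sum loc_const_comp[where h = "%b. if b then 1 else 0"] loc_const_clopen) (auto dest: clopensD)

lemma mvnI:
assumes "P \<in> \<P>" "Q \<in> \<P>" "V \<in> Mat_all" "star V * V = proj_op P" "V * star V = proj_op Q"
shows "(P, Q) \<in> mvn_rel \<B>"
unfolding mvn_rel_iff using assms by blast

lemma mvn_refl_op:
assumes "P \<in> \<P>" "Q \<in> \<P>" "proj_op P = proj_op Q" shows "(P, Q) \<in> mvn_rel \<B>"
proof (rule mvnI[OF assms(1,2)])
show "proj_op P \<in> Mat_all" using assms(1) by (auto simp: projections_iff Mat_def intro!: Mat_all_I[of _ "fst P" "fst P"])
qed (use assms in "auto simp: projections_iff")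

end

lemma rank_bijection:
fixes S :: "nat set"
assumes "finite S"
shows "bij_betw (%j. card {j'\<in>S. j' < j}) S {..<card S}"
proof -
have less: "card {j'\<in>S. j' < i} < card {j'\<in>S. j' < j}" if "i \<in> S" "i < j" for i j
 by (rule psubset_card_mono) (use that assms in auto)
have inj: "inj_on (%j. card {j'\<in>S. j' < j}) S"
proof (rule inj_onI)
 fix i j assume "i \<in> S" "j \<in> S" "card {j'\<in>S. j' < i} = card {j'\<in>S. j' < j}"
 thus "i = j" using less[of i j] less[of j i] by (cases i j rule: linorder_cases) auto
qed
have sub: "(%j. card {j'\<in>S. j' < j}) ` S \<subseteq> {..<card S}"
 using assms by (auto intro!: psubset_card_mono)
show ?thesis
 by (simp add: bij_betw_def inj card_subset_eq[OF finite_lessThan sub] card_image[OF inj])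
qed

lemma rank_matching_sum:
fixes S T :: "nat set"
assumes "finite S" "finite T" "card S = card T" "j \<in> S" "T \<subseteq> {..<l}"
shows "(\<Sum>i<l. if i \<in> T & card {i'\<in>T. i' < i} = card {j'\<in>S. j' < j} then 1 else 0 :: complex) = 1"
proof -
have "card {j'\<in>S. j' < j} \<in> (%i. card {i'\<in>T. i' < i}) ` T"
 using bij_betw_apply[OF rank_bijection[OF assms(1)] assms(4)] assms(3)
  bij_betw_imp_surj_on[OF rank_bijection[OF assms(2)]] by simp
then obtain i0 where i0: "i0 \<in> T" "card {j'\<in>S. j' < j} = card {i'\<in>T. i' < i0}"
 by (rule imageE)
have u: "i = i0" if "i \<in> T" "card {i'\<in>T. i' < i} = card {j'\<in>S. j' < j}" for i
 by (rule inj_onD[OF bij_betw_imp_inj_on[OF rank_bijection[OF assms(2)]]]) (use i0 that in auto)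
have "(\<Sum>i<l. if i \<in> T & card {i'\<in>T. i' < i} = card {j'\<in>S. j' < j} then 1 else 0 :: complex) =
  (\<Sum>i<l. if i = i0 then 1 else 0)"
 by (intro sum.cong refl) (use u i0 in auto)
thus ?thesis using i0 assms(5) by auto
qed

context zero_dim_system
begin

text \<open>At each point the sets of \<open>A\<close> and of \<open>B\<close> that contain it are
  matched in increasing order. The coincidence sets are clopen, and their indicators form at every
  point a partial permutation matrix.\<close>

lemma matching_isometry:
assumes A: "clopens m A" and B: "clopens l B"
 and r: "\<forall>x\<in>XX. crank m A x = crank l B x"
 and C: "C = (%i j. {x \<in> XX. x \<in> B i & x \<in> A j & crank i B x = crank j A x})"
shows "star (fibre l m (%i j. indicator (C i j))) * fibre l m (%i j. indicator (C i j)) = fibre m m (diag_fun A)"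
 and "cmat l m (%i j. indicator (C i j))"
proof -
have cl: "clopen (C i j)" if "i < l" "j < m" for i j
proof -
 have "loc_const (%x. x \<in> B i)" "loc_const (%x. x \<in> A j)" "loc_const (crank i B)" "loc_const (crank j A)"
  using A B that by (auto intro!: loc_const_clopen loc_const_crank simp: clopens_def)
 hence "loc_const (%x. x \<in> B i & x \<in> A j & crank i B x = crank j A x)"
  by (intro loc_const_comp2[where F = "(&)"] loc_const_comp2[where F = "(=)"])
 from clopen_level[OF this, of "%b. b"] show ?thesis unfolding C .
qed
thus c: "cmat l m (%i j. indicator (C i j))" by (intro cmatI cfun_indicator)
have c': "cmat m l (%i j x. cnj (indicator (C j i) x))"
 using c by (intro cmatI cfun_cnj) (auto dest: cmatD)
show "star (fibre l m (%i j. indicator (C i j))) * fibre l m (%i j. indicator (C i j)) = fibre m m (diag_fun A)"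
 unfolding star_fibre[OF c] fibre_mult[OF c' c]
proof (rule fibre_cong)
 fix j j' x assume j: "j < m" "j' < m"
 let ?S = "{i. i < m & x \<in> A i}" and ?T = "{i. i < l & x \<in> B i}"
 have rk: "crank i A x = card {j'\<in>?S. j' < i}" if "i < m" for i
  unfolding crank_def using that by (intro arg_cong[of _ _ card]) auto
 have rk': "crank i B x = card {j'\<in>?T. j' < i}" if "i < l" for i
  unfolding crank_def using that by (intro arg_cong[of _ _ card]) auto
 show "(\<Sum>i<l. cnj (indicator (C i j) x) * indicator (C i j') x) = diag_fun A j j' x"
 proof (cases "x \<in> XX & j = j' & x \<in> A j")
  case True
  have "(\<Sum>i<l. cnj (indicator (C i j) x) * indicator (C i j') x) =
    (\<Sum>i<l. if i \<in> ?T & card {i'\<in>?T. i' < i} = card {j'\<in>?S. j' < j} then 1 else 0 :: complex)"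
   using True j by (intro sum.cong refl) (auto simp: C indicator_def rk rk')
  also have "... = 1"
   by (rule rank_matching_sum) (use True j r in "auto simp: crank_def")
  finally show ?thesis using True by (auto simp: diag_fun_def)
 next
  case False
  have "cnj (indicator (C i j) x) * indicator (C i j') x = (0 :: complex)" if i: "i < l" for i
  proof (rule ccontr)
   assume "cnj (indicator (C i j) x) * indicator (C i j') x ~= (0 :: complex)"
   hence *: "x \<in> C i j" "x \<in> C i j'" by (auto simp: indicator_def split: if_splits)
   hence "card {i\<in>?S. i < j} = card {i\<in>?S. i < j'}" "j \<in> ?S" "j' \<in> ?S"
    using j rk unfolding C by auto
   moreover have "inj_on (%j. card {i\<in>?S. i < j}) ?S"
    by (rule bij_betw_imp_inj_on[OF rank_bijection]) simp
   ultimately have "j = j'" by (simp only: inj_onD)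
   thus False using False * unfolding C by auto
  qed
  moreover have "diag_fun A j j' x = 0"
   using False clopen_subset[OF clopensD[OF A j(1)]] by (auto simp: diag_fun_def indicator_def)
  ultimately show ?thesis by (metis (no_types, lifting) lessThan_iff sum.neutral)
 qed
qed
qed

lemma diag_proj_mvn:
assumes A: "clopens m A" and B: "clopens l B"
 and r: "\<forall>x\<in>XX. crank m A x = crank l B x"
shows "(diag_proj m A, diag_proj l B) \<in> mvn_rel \<B>"
proof -
define C where "C = (%i j. {x \<in> XX. x \<in> B i & x \<in> A j & crank i B x = crank j A x})"
define D where "D = (%i j. {x \<in> XX. x \<in> A i & x \<in> B j & crank i A x = crank j B x})"
have r': "\<forall>x\<in>XX. crank l B x = crank m A x" using r by simp
have DC: "D j i = C i j" for i j by (auto simp: C_def D_def)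
note 1 = matching_isometry[OF A B r C_def]
note 2 = matching_isometry(1)[OF B A r' D_def]
let ?V = "fibre l m (%i j. indicator (C i j))"
note c = 1(2)
have "star ?V = fibre m l (%i j. indicator (D i j))"
 unfolding star_fibre[OF c] DC by (rule fibre_cong) (auto simp: indicator_def)
hence sV: "fibre m l (%i j. indicator (D i j)) = star ?V" ..
show ?thesis
proof (rule mvnI)
 show "?V \<in> Mat_all" using fibre_Mat[OF c] by (rule Mat_all_I)
 show "?V * star ?V = proj_op (diag_proj l B)" using 2 unfolding sV by (simp add: diag_proj_simps)
qed (use 1 in "simp_all add: diag_proj_simps diag_proj_projections A B")
qed

lemma clopens_theta: "clopens m A ==> clopens m (%i. {x \<in> XX. \<theta> n x \<in> A i})"
using clopen_level[OF loc_const_theta[OF loc_const_clopen], of "A _" "%b. b"] by (simp add: clopens_def)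

text \<open>The canonical unitary implements \<theta>; its \<open>n\<close>-th power, cut down by
  the sets \<open>A i\<close>, is a partial isometry between the two projections. This is why
  coboundaries die in \<open>K\<^sub>0\<close>.\<close>

lemma diag_proj_theta_mvn:
assumes A: "clopens m A"
shows "(diag_proj m (%i. {x \<in> XX. \<theta> n x \<in> A i}), diag_proj m A) \<in> mvn_rel \<B>"
proof -
define F where "F i = (%k x. if k = n then indicator (A i) x else (0 :: complex))" for i :: nat
let ?B = "%i. {x \<in> XX. \<theta> n x \<in> A i}"
have B: "clopens m ?B" by (rule clopens_theta[OF A])
have supp: "fsupp (F i) \<subseteq> {n}" for i by (auto simp: F_def)
have F: "F i \<in> CA" if "i < m" for i
proof -
 have "F i k \<in> cfun X" for k using cfun_indicator[OF clopensD[OF A that]] by (cases "k = n") (auto simp: F_def)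
 moreover have "finite (fsupp (F i))" using supp by (rule finite_subset) simp
 ultimately show ?thesis by (simp add: carrier_iff)
qed
have supp': "fsupp (adj \<A> (F i)) \<subseteq> {- n}" for i unfolding fsupp_adj using supp by auto
define V where "V = (\<Sum>i<m. cross_op i i (F i))"
have cV: "coord (app V x) (s, k, c) = (if c < m & \<theta> (- k) s \<in> A c then coord x (s, k + n, c) else 0)" for x s k c
proof -
 have "coord (app V x) (s, k, c) = (\<Sum>i<m. if i = c then F c n (\<theta> (- k) s) * coord x (s, k + n, c) else 0)"
  unfolding V_def app_sum_left coord_sum by (intro sum.cong refl) (simp add: coord_cross_op[OF F _ supp])
 thus ?thesis by (simp add: F_def)
qed
have cS: "coord (app (star V) x) (s, k, c) = (if c < m & \<theta> (n - k) s \<in> A c then coord x (s, k - n, c) else 0)" for x s k c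
proof -
 have "coord (app (star V) x) (s, k, c) = (\<Sum>i<m. if i = c then cnj (F c n (\<theta> (n - k) s)) * coord x (s, k - n, c) else 0)"
  unfolding V_def star_sum app_sum_left coord_sum
  by (intro sum.cong refl) (simp add: star_cross_op F coord_cross_op[OF adj_closed[OF F] _ supp'], simp add: alg_simps)
 thus ?thesis by (simp add: F_def)
qed
have AX: "y \<in> A i ==> i < m ==> y \<in> XX" for i y using clopen_subset[OF clopensD[OF A]] by auto
show ?thesis
proof (rule mvnI)
 have "cross_op i i (F i) \<in> Mat m m" if "i < m" for i
 proof -
  have "cross_op i i (F i) = comp_op i i (cls (%_. F i))" using F[OF that] by (simp add: comp_op_cls seq_const)
  thus ?thesis using F[OF that] that by (simp add: Mat_comp_op cls_closed seq_const)
 qed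
 thus "V \<in> Mat_all" unfolding V_def by (intro Mat_all_I[of _ m m] Mat_sum) auto
 show "star V * V = proj_op (diag_proj m ?B)" "V * star V = proj_op (diag_proj m A)"
  unfolding diag_proj_simps by (intro bop_eqI ell2_eqI; auto simp: split_paired_all cV cS coord_diag[OF A] coord_diag[OF B] dest: AX)+
qed (use A B in "auto intro!: diag_proj_projections")
qed

end

section \<open>Rank functions and the group \<open>K\<^sub>0\<close>\<close>

lemma sum_lessThan_add: "(\<Sum>i<n + m. f i) = (\<Sum>i<n. f i) + (\<Sum>i<m. f (n + i))"
for f :: "nat => 'b :: comm_monoid_add"
by (induction m) (auto simp: add_ac)

lemma mult_subst: "a * b = c ==> a * (b * x) = c * x" for a :: "'a :: semigroup_mult"
by (simp add: mult.assoc[symmetric])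

context zero_dim_system
begin

lemma Mat_all_star: "A \<in> Mat_all ==> star A \<in> Mat_all"
using Mat_all_closed(3)[of A A] .

lemma proj_op_Mat: "P \<in> \<P> ==> proj_op P \<in> Mat (fst P) (fst P)"
unfolding projections_iff Mat_def by blast

lemma mvnE:
assumes "(P, Q) \<in> mvn_rel \<B>"
obtains V where "V \<in> Mat (fst Q) (fst P)" "star V * V = proj_op P" "V * star V = proj_op Q"
 "P \<in> \<P>" "Q \<in> \<P>"
proof -
obtain V k where V: "V \<in> Mat k k" "star V * V = proj_op P" "V * star V = proj_op Q"
 and PQ: "P \<in> \<P>" "Q \<in> \<P>"
 using assms by (auto simp: mvn_rel_iff Mat_all_def)
have "V = proj_op Q * V * proj_op P"
 using partial_isometry_support[OF V(2,3)] PQ by (simp add: projections_iff)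
with PQ have "V \<in> Mat (fst Q) (fst P)" using Mat_corner[OF V(1)] proj_op_Mat by metis
with V PQ show thesis by (intro that)
qed

text \<open>An isometry that moves the first \<open>m\<close> matrix positions behind the first
  \<open>n\<close>, so that a direct sum becomes a sum of two orthogonal projections on the same
  space.\<close>

definition mshift :: "nat => nat => 'x idx bop" where
"mshift n m = (\<Sum>i<m. munit (n + i) i)"

lemma star_mshift: "star (mshift n m) = (\<Sum>i<m. munit i (n + i))"
unfolding mshift_def star_sum by (simp add: star_munit)

lemma mshift_mult:
assumes "a \<in> CB"
shows "mshift n m * comp_op i j a = (if i < m then comp_op (n + i) j a else 0)"
 "comp_op i j a * star (mshift n m) = (if j < m then comp_op i (n + j) a else 0)"
 "comp_op i j a * mshift n m = (if n <= j & j < n + m then comp_op i (j - n) a else 0)"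
proof -
have "(\<Sum>i'<m. munit (n + i') i' * comp_op i j a) = (\<Sum>i'<m. if i' = i then comp_op (n + i') j a else 0)"
 using assms by (intro sum.cong refl) (simp add: munit_mult)
thus "mshift n m * comp_op i j a = (if i < m then comp_op (n + i) j a else 0)"
 by (simp add: mshift_def sum_distrib_right)
have "(\<Sum>i'<m. comp_op i j a * munit i' (n + i')) = (\<Sum>i'<m. if i' = j then comp_op i (n + i') a else 0)"
 using assms by (intro sum.cong refl) (auto simp add: munit_mult)
thus "comp_op i j a * star (mshift n m) = (if j < m then comp_op i (n + j) a else 0)"
 by (simp add: star_mshift sum_distrib_left)
have "(\<Sum>i'<m. comp_op i j a * munit (n + i') i') =
  (\<Sum>i'<m. if i' = j - n then (if n <= j then comp_op i (j - n) a else 0) else 0)"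
 using assms by (intro sum.cong refl) (auto simp add: munit_mult)
thus "comp_op i j a * mshift n m = (if n <= j & j < n + m then comp_op i (j - n) a else 0)"
 by (auto simp: mshift_def sum_distrib_left)
qed

lemma mshift_Mat: "mshift n m \<in> Mat (n + m) m"
unfolding mshift_def by (intro Mat_sum Mat_munit) auto

lemma MatE:
assumes "A \<in> Mat n m" obtains p where "!!i j. i < n ==> j < m ==> p i j \<in> CB"
 "A = (\<Sum>i<n. \<Sum>j<m. comp_op i j (p i j))"
using assms by (auto simp: Mat_def mat_op_def)

lemma mshift_orth: "A \<in> Mat k n ==> A * mshift n m = 0"
by (elim MatE) (auto simp: sum_distrib_right mshift_mult intro!: sum.neutral)

lemma mshift_isometry: "A \<in> Mat m k ==> star (mshift n m) * (mshift n m * A) = A"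
proof (elim MatE)
fix p assume p: "!!i j. i < m ==> j < k ==> p i j \<in> CB" and A: "A = (\<Sum>i<m. \<Sum>j<k. comp_op i j (p i j))"
have c: "star (mshift n m) * comp_op (n + i) j a = (if i < m then comp_op i j a else 0)" if "a \<in> CB" for i j a
proof -
 have "(\<Sum>i'<m. munit i' (n + i') * comp_op (n + i) j a) = (\<Sum>i'<m. if i' = i then comp_op i' j a else 0)"
  using that by (intro sum.cong refl) (simp add: munit_mult)
 thus ?thesis by (simp add: star_mshift sum_distrib_right)
qed
have "star (mshift n m) * (mshift n m * A) = (\<Sum>i<m. \<Sum>j<k. star (mshift n m) * (mshift n m * comp_op i j (p i j)))"
 unfolding A by (simp add: sum_distrib_left)
also have "... = A" unfolding A using p by (intro sum.cong refl) (simp add: mshift_mult c)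
finally show "star (mshift n m) * (mshift n m * A) = A" .
qed

lemma mshift_isometry': "A \<in> Mat k m ==> A * star (mshift n m) * mshift n m = A"
using arg_cong[OF mshift_isometry[OF Mat_star, of A k m n], of star] by (simp add: mult.assoc)

lemma direct_sum_fst: "fst (direct_sum \<B> P Q) = fst P + fst Q"
by (simp add: direct_sum_def)

lemma proj_op_direct_sum:
assumes P: "P \<in> \<P>" and Q: "Q \<in> \<P>"
shows "proj_op (direct_sum \<B> P Q) = proj_op P + mshift (fst P) (fst Q) * (proj_op Q * star (mshift (fst P) (fst Q)))"
proof -
obtain n p where P': "P = (n, p)" by force
obtain m q where Q': "Q = (m, q)" by force
have c: "!!i j. i < m ==> j < m ==> q i j \<in> CB"
 using Q by (auto simp: projections_iff Q')
let ?d = "%i j. if i < n & j < n then p i j else if n <= i & n <= j then q (i - n) (j - n) else \<zero>\<^bsub>\<B>\<^esub>"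
have "mat_op (n + m) (n + m) ?d = (\<Sum>i<n. \<Sum>j<n. comp_op i j (p i j)) + (\<Sum>i<m. \<Sum>j<m. comp_op (n + i) (n + j) (q i j))"
 unfolding mat_op_def sum_lessThan_add sum.distrib[symmetric]
 by (intro arg_cong2[where f = "(+)"] sum.cong refl) (auto simp: comp_op_zero intro!: sum.cong sum.neutral)
also have "(\<Sum>i<m. \<Sum>j<m. comp_op (n + i) (n + j) (q i j)) = mshift n m * (mat_op m m q * star (mshift n m))"
 unfolding mat_op_def sum_distrib_left sum_distrib_right using c
 by (intro sum.cong refl) (simp add: mshift_mult)
finally show ?thesis unfolding direct_sum_def P' Q' fst_conv snd_conv mat_op_def[of n n] .
qed

text \<open>All cross terms contain one of the factors \<open>P * P'\<close> and
  \<open>Q * Q'\<close> once the supports of \<open>V\<close> and \<open>W\<close> are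
  inserted.\<close>

lemma orth_sum_isometry:
assumes V: "star V * V = P" "V * star V = Q" "P * P = P" "star P = P"
 and W: "star W * W = P'" "W * star W = Q'" "P' * P' = P'" "star P' = P'"
 and o: "P * P' = 0" "Q * Q' = 0"
shows "star (V + W) * (V + W) = P + P'" "(V + W) * star (V + W) = Q + Q'"
proof -
note v = partial_isometry_support[OF V] and w = partial_isometry_support[OF W]
have sQ: "star Q = Q" using V(2) by auto
have sV: "star V * Q = star V" using arg_cong[OF v(2), of star] by (simp add: sQ)
have VW: "star V * W = 0"
proof -
 have "star V * W = (star V * Q) * (Q' * W)" by (simp only: sV w(2))
 also have "... = star V * (Q * Q') * W" by (simp add: mult.assoc)
 finally show ?thesis by (simp add: o)
qed
have WV: "star W * V = 0" using arg_cong[OF VW, of star] by simp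
have sP: "star W = P' * star W" using arg_cong[OF w(1), of star] by (simp add: W(4))
have VW': "V * star W = 0"
proof -
 have "V * star W = (V * P) * (P' * star W)" by (simp only: v(1) sP[symmetric])
 also have "... = V * (P * P') * star W" by (simp add: mult.assoc)
 finally show ?thesis by (simp add: o)
qed
have WV': "W * star V = 0" using arg_cong[OF VW', of star] by simp
show "star (V + W) * (V + W) = P + P'" "(V + W) * star (V + W) = Q + Q'"
 by (simp_all add: distrib_left distrib_right VW WV VW' WV' V W)
qed

lemma proj_opD:
assumes "P \<in> \<P>"
shows "star (proj_op P) = proj_op P" "proj_op P * proj_op P = proj_op P" "proj_op P * (mshift (fst P) m * A) = 0"
using assms mult_subst[OF mshift_orth[OF proj_op_Mat[OF assms], of m]] by (auto simp: projections_iff)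

abbreviation "pshift n Q \<equiv> mshift n (fst Q) * (proj_op Q * star (mshift n (fst Q)))"

lemma pshift:
assumes "Q \<in> \<P>"
shows "star (pshift n Q) = pshift n Q" "pshift n Q * pshift n Q = pshift n Q"
by (simp_all add: mult.assoc proj_opD[OF assms] mult_subst[OF proj_opD(2)[OF assms]]
  mult_subst[OF mshift_isometry[OF proj_op_Mat[OF assms]], unfolded mult.assoc])

lemma pshift_orth:
assumes P: "P \<in> \<P>" and Q: "Q \<in> \<P>" shows "pshift (fst P) Q * proj_op P = 0"
proof -
have "star (proj_op P * pshift (fst P) Q) = star (pshift (fst P) Q) * star (proj_op P)" by simp
thus ?thesis unfolding pshift(1)[OF Q] proj_opD(1,3)[OF P] by simp
qed

lemma direct_sum_projections:
assumes P: "P \<in> \<P>" and Q: "Q \<in> \<P>"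
shows "direct_sum \<B> P Q \<in> \<P>"
proof -
have c: "\<forall>i<fst P + fst Q. \<forall>j<fst P + fst Q. snd (direct_sum \<B> P Q) i j \<in> CB"
 using P Q by (auto simp: direct_sum_def projections_iff crossed_zero_closed)
thus ?thesis
 unfolding projections_iff proj_op_direct_sum[OF P Q] unfolding direct_sum_fst
 by (simp only: distrib_left distrib_right pshift_orth[OF assms] proj_opD[OF P] pshift[OF Q] star_simps(4)) simp
qed

lemma direct_sum_mvn:
assumes "(P, P') \<in> mvn_rel \<B>" "(Q, Q') \<in> mvn_rel \<B>"
shows "(direct_sum \<B> P Q, direct_sum \<B> P' Q') \<in> mvn_rel \<B>"
proof -
obtain V where V: "V \<in> Mat (fst P') (fst P)" "star V * V = proj_op P" "V * star V = proj_op P'"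
 "P \<in> \<P>" "P' \<in> \<P>" using assms(1) by (rule mvnE)
obtain W where W: "W \<in> Mat (fst Q') (fst Q)" "star W * W = proj_op Q" "W * star W = proj_op Q'"
 "Q \<in> \<P>" "Q' \<in> \<P>" using assms(2) by (rule mvnE)
define W' where "W' = mshift (fst P') (fst Q') * W * star (mshift (fst P) (fst Q))"
have W': "star W' * W' = pshift (fst P) Q" "W' * star W' = pshift (fst P') Q'"
 using mult_subst[OF W(2)] mult_subst[OF mshift_isometry[OF W(1)], unfolded mult.assoc]
  mult_subst[OF mshift_isometry'[OF W(1)], unfolded mult.assoc] mult_subst[OF W(3)]
 by (simp_all add: W'_def mult.assoc)
note sum = orth_sum_isometry[OF V(2,3) proj_opD(2,1)[OF V(4)] W' pshift(2,1)[OF W(4)] proj_opD(3)[OF V(4)] proj_opD(3)[OF V(5)]]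
have "V + W' \<in> Mat_all" unfolding W'_def
 by (intro Mat_all_closed(1,2) Mat_all_star Mat_all_I[OF mshift_Mat] Mat_all_I[OF W(1)] Mat_all_I[OF V(1)])
show ?thesis
 by (rule mvnI[OF _ _ \<open>V + W' \<in> Mat_all\<close>]) (use V(4,5) W(4,5) sum in "simp_all add: direct_sum_projections proj_op_direct_sum del: star_simps(4)")
qed

text \<open>\<open>V\<close> moves \<open>P\<close> behind the positions of \<open>Q\<close>, while
  \<open>W\<close> moves the shifted copy of \<open>Q\<close> back to the front.\<close>

lemma direct_sum_comm:
assumes P: "P \<in> \<P>" and Q: "Q \<in> \<P>"
shows "(direct_sum \<B> P Q, direct_sum \<B> Q P) \<in> mvn_rel \<B>"
proof -
define V where "V = mshift (fst Q) (fst P) * proj_op P"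
define W where "W = proj_op Q * star (mshift (fst P) (fst Q))"
have VW: "star V * V = proj_op P" "V * star V = pshift (fst Q) P" "star W * W = pshift (fst P) Q" "W * star W = proj_op Q"
 by (simp_all only: V_def W_def star_simps mult.assoc mshift_isometry[OF proj_op_Mat[OF P]] mshift_isometry[OF proj_op_Mat[OF Q]]
   proj_opD[OF P] proj_opD[OF Q] mult_subst[OF proj_opD(2)[OF P]] mult_subst[OF proj_opD(2)[OF Q]])
note sum = orth_sum_isometry[OF VW(1,2) proj_opD(2,1)[OF P] VW(3,4) pshift(2,1)[OF Q] proj_opD(3)[OF P] pshift_orth[OF Q P]]
have "V + W \<in> Mat_all" unfolding V_def W_def
 by (intro Mat_all_closed(1,2) Mat_all_star Mat_all_I[OF mshift_Mat] Mat_all_I[OF proj_op_Mat] P Q)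
show ?thesis
 by (rule mvnI[OF _ _ \<open>V + W \<in> Mat_all\<close>]) (simp_all only: direct_sum_projections P Q proj_op_direct_sum sum add.commute[of "pshift _ _"])
qed

abbreviation "\<M> \<equiv> projection_monoid \<B>"
abbreviation mmult (infixl "\<star>" 70) where "a \<star> b \<equiv> a \<otimes>\<^bsub>\<M>\<^esub> b"
abbreviation pcls :: "'x cel sq_matrix => 'x cel sq_matrix set" where
"pcls P \<equiv> mvn_rel \<B> `` {P}"

lemma pcls_eqI: "(P, Q) \<in> mvn_rel \<B> ==> pcls P = pcls Q"
by (rule equiv_class_eq[OF equiv_mvn_rel])

lemma projection_monoid_simps:
"x \<in> carrier \<M> <-> (\<exists>P\<in>\<P>. x = pcls P)"
"\<one>\<^bsub>\<M>\<^esub> = pcls (0, %_ _. \<zero>\<^bsub>\<B>\<^esub>)"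
by (auto simp: projection_monoid_def quotient_def)

lemma projection_monoid_mult:
"P \<in> \<P> ==> Q \<in> \<P> ==> pcls P \<star> pcls Q = pcls (direct_sum \<B> P Q)"
unfolding projection_monoid_def monoid.simps
by (rule class_op2_eq[OF equiv_mvn_rel]) (auto intro: direct_sum_mvn)

lemma zero_projection: "(0, p) \<in> \<P>"
by (simp add: projections_def)

lemma comm_monoid_projections: "comm_monoid \<M>"
proof (rule comm_monoidI)
fix x y assume "x \<in> carrier \<M>" "y \<in> carrier \<M>"
then obtain P Q where *: "P \<in> \<P>" "Q \<in> \<P>" "x = pcls P" "y = pcls Q"
 unfolding projection_monoid_simps(1) by blast
thus "x \<star> y \<in> carrier \<M>"
 using direct_sum_projections unfolding projection_monoid_simps(1) by (simp add: projection_monoid_mult) blast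
show "x \<star> y = y \<star> x"
 unfolding *(3,4) projection_monoid_mult[OF *(1,2)] projection_monoid_mult[OF *(2,1)]
 by (rule pcls_eqI[OF direct_sum_comm[OF *(1,2)]])
next
fix x y z assume "x \<in> carrier \<M>" "y \<in> carrier \<M>" "z \<in> carrier \<M>"
then obtain P Q R where *: "P \<in> \<P>" "Q \<in> \<P>" "R \<in> \<P>"
 "x = pcls P" "y = pcls Q" "z = pcls R" unfolding projection_monoid_simps(1) by blast
have "direct_sum \<B> (direct_sum \<B> P Q) R = direct_sum \<B> P (direct_sum \<B> Q R)"
 by (simp add: direct_sum_def fun_eq_iff diff_diff_left add.assoc not_less[symmetric]) linarith
thus "x \<star> y \<star> z = x \<star> (y \<star> z)"
 using * by (simp add: projection_monoid_mult direct_sum_projections)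
next
fix x assume "x \<in> carrier \<M>"
then obtain P where P: "P \<in> \<P>" "x = pcls P" unfolding projection_monoid_simps(1) by blast
have "proj_op (direct_sum \<B> (0, %_ _. \<zero>\<^bsub>\<B>\<^esub>) P) = proj_op P"
 unfolding mat_op_def by (simp add: direct_sum_def)
hence "(direct_sum \<B> (0, %_ _. \<zero>\<^bsub>\<B>\<^esub>) P, P) \<in> mvn_rel \<B>"
 by (intro mvn_refl_op direct_sum_projections zero_projection P)
thus "\<one>\<^bsub>\<M>\<^esub> \<star> x = x"
 using P by (simp add: projection_monoid_simps(2) projection_monoid_mult zero_projection pcls_eqI)
qed (use zero_projection in "auto simp: projection_monoid_simps")

text \<open>The class of the staircase projection with pointwise rank \<open>r\<close>. The least
  bound merely fixes a size: by \<open>rcls_eq\<close> every clopen family with rank function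
  \<open>r\<close> gives the same class.\<close>

definition rcls :: "('x => nat) => 'x cel sq_matrix set" where
"rcls r = pcls (diag_proj (LEAST m. \<forall>x\<in>XX. r x <= m) (%i. {x \<in> XX. i < r x}))"

lemma crank_level:
assumes "x \<in> XX" "\<forall>x\<in>XX. r x <= m" shows "crank m (%i. {x \<in> XX. i < r x}) x = r x"
proof -
have "{i. i < m & x \<in> {x \<in> XX. i < r x}} = {..<r x}" using assms by (auto intro: less_le_trans)
thus ?thesis unfolding crank_def by simp
qed

lemma rcls_eq:
assumes A: "clopens m A" and r: "!!x. x \<in> XX ==> crank m A x = r x"
shows "pcls (diag_proj m A) = rcls r"
proof -
let ?M = "LEAST m. \<forall>x\<in>XX. r x <= m" and ?B = "%i. {x \<in> XX. i < r x}"
have "r x <= m" if "x \<in> XX" for x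
proof -
 have "crank m A x <= card {..<m}" unfolding crank_def by (rule card_mono) auto
 thus ?thesis using r[OF that] by simp
qed
hence M: "\<forall>x\<in>XX. r x <= ?M" by (intro LeastI[of "%m. \<forall>x\<in>XX. r x <= m" m]) auto
have lc: "loc_const (crank m A)" by (rule loc_const_crank[OF A])
have "?B i = {x \<in> XX. i < crank m A x}" for i using r by auto
hence B: "clopens ?M ?B" using clopen_level[OF lc] unfolding clopens_def by simp
show ?thesis unfolding rcls_def by (intro pcls_eqI diag_proj_mvn A B) (simp add: crank_level M r)
qed

lemma rcls_repr:
assumes "loc_const r"
shows "\<exists>m A. clopens m A & (\<forall>x\<in>XX. crank m A x = r x) & rcls r = pcls (diag_proj m A)"
proof -
obtain m where m: "\<forall>x\<in>XX. r x <= m" using loc_const_bounded[OF assms] by blast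
let ?A = "%i. {x \<in> XX. i < r x}"
have A: "clopens m ?A" using clopen_level[OF assms] unfolding clopens_def by simp
from A show ?thesis using crank_level[OF _ m] rcls_eq[OF A, of r] by (intro exI[of _ m] exI[of _ ?A]) simp
qed

lemma rcls_zero: "\<one>\<^bsub>\<M>\<^esub> = rcls (%_. 0)"
proof -
have "\<one>\<^bsub>\<M>\<^esub> = pcls (diag_proj 0 (%_. {}))" unfolding projection_monoid_simps
 by (intro pcls_eqI mvn_refl_op zero_projection diag_proj_projections)
  (auto simp: clopens_def diag_proj_simps mat_op_def fibre_def)
also have "... = rcls (%_. 0)" by (rule rcls_eq) (auto simp: clopens_def crank_def)
finally show ?thesis .
qed

lemma rcls_closed: "loc_const r ==> rcls r \<in> carrier \<M>"
using rcls_repr[of r] diag_proj_projections unfolding projection_monoid_simps(1) by blast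

lemma rcls_cong: "(!!x. x \<in> XX ==> r x = r' x) ==> rcls r = rcls r'"
proof -
assume *: "!!x. x \<in> XX ==> r x = r' x"
have "{x \<in> XX. i < r x} = {x \<in> XX. i < r' x}" for i using * by auto
moreover have "(\<forall>x\<in>XX. r x <= m) <-> (\<forall>x\<in>XX. r' x <= m)" for m using * by auto
ultimately show ?thesis unfolding rcls_def by simp
qed

lemma direct_sum_diag:
assumes "clopens m A" "clopens l B"
shows "pcls (diag_proj m A) \<star> pcls (diag_proj l B) = rcls (%x. crank m A x + crank l B x)"
proof -
let ?C = "%i. if i < m then A i else B (i - m)"
have C: "clopens (m + l) ?C" using assms unfolding clopens_def by auto
have z: "cfun_embed X \<theta> (%_. 0) = \<zero>\<^bsub>\<B>\<^esub>"
 by (simp add: cfun_embed_eq crossed_zero_one embed0_def alg_simps)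
have "snd (direct_sum \<B> (diag_proj m A) (diag_proj l B)) i j = snd (diag_proj (m + l) ?C) i j" for i j
 by (auto simp: direct_sum_def diag_proj_def diag_fun_def z)
hence "(direct_sum \<B> (diag_proj m A) (diag_proj l B), diag_proj (m + l) ?C) \<in> mvn_rel \<B>"
 by (intro mvn_refl_op direct_sum_projections diag_proj_projections assms C)
  (simp add: direct_sum_fst diag_proj_simps(1) mat_op_def)
hence "pcls (diag_proj m A) \<star> pcls (diag_proj l B) = pcls (diag_proj (m + l) ?C)"
 using assms by (simp add: projection_monoid_mult diag_proj_projections pcls_eqI)
also have "... = rcls (%x. crank m A x + crank l B x)"
 by (rule rcls_eq[OF C]) (simp add: crank_sum sum_lessThan_add)
finally show ?thesis .
qed

lemma rcls_add:
assumes "loc_const r" "loc_const r'"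
shows "rcls r \<star> rcls r' = rcls (%x. r x + r' x)"
proof -
obtain m A where A: "clopens m A" "\<forall>x\<in>XX. crank m A x = r x" "rcls r = pcls (diag_proj m A)"
 using rcls_repr[OF assms(1)] by blast
obtain l B where B: "clopens l B" "\<forall>x\<in>XX. crank l B x = r' x" "rcls r' = pcls (diag_proj l B)"
 using rcls_repr[OF assms(2)] by blast
have "rcls (%x. crank m A x + crank l B x) = rcls (%x. r x + r' x)"
 using A(2) B(2) by (intro rcls_cong) simp
thus ?thesis using direct_sum_diag[OF A(1) B(1)] A(3) B(3) by simp
qed

lemma rcls_theta:
assumes "loc_const r" shows "rcls (%x. r (\<theta> n x)) = rcls r"
proof -
obtain m A where A: "clopens m A" "\<forall>x\<in>XX. crank m A x = r x" "rcls r = pcls (diag_proj m A)"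
 using rcls_repr[OF assms] by blast
let ?B = "%i. {x \<in> XX. \<theta> n x \<in> A i}"
have mv: "(diag_proj m ?B, diag_proj m A) \<in> mvn_rel \<B>" by (rule diag_proj_theta_mvn[OF A(1)])
have B: "clopens m ?B" by (rule clopens_theta[OF A(1)])
have "pcls (diag_proj m ?B) = rcls (%x. r (\<theta> n x))"
 by (rule rcls_eq[OF B]) (use A(2) in "simp add: crank_def")
thus ?thesis using pcls_eqI[OF mv] A(3) by simp
qed

abbreviation "\<K> \<equiv> K0 \<B>"
abbreviation kmult (infixl "\<ast>" 70) where "a \<ast> b \<equiv> a \<otimes>\<^bsub>\<K>\<^esub> b"

text \<open>The natural map from the integer-valued functions, as the \<open>K\<^sub>0\<close> group
  of \<open>C(X)\<close>, to \<open>K\<^sub>0\<close> of the crossed product.\<close>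

definition kcls :: "('x => int) => ('x cel sq_matrix set \<times>
 'x cel sq_matrix set) set" where
"kcls f = grothendieck_rel \<M> `` {(rcls (%x. nat (f x)), rcls (%x. nat (- f x)))}"

lemma loc_const_nat: "loc_const f ==> loc_const (%x. nat (f x))" "loc_const f ==> loc_const (%x. nat (- f x))"
by (erule loc_const_comp)+

lemma gclass_rcls:
assumes "loc_const r" "loc_const r'" "!!x. x \<in> XX ==> f x = int (r x) - int (r' x)" "loc_const f"
shows "grothendieck_rel \<M> `` {(rcls r, rcls r')} = kcls f"
unfolding kcls_def
proof (rule gclass_eqI[OF comm_monoid_projections])
have "rcls r \<star> rcls (%x. nat (- f x)) = rcls (%x. nat (f x)) \<star> rcls r'"
 using assms by (simp add: rcls_add loc_const_nat) (rule rcls_cong, auto simp: nat_diff_distrib)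
thus "rcls r \<star> rcls (%x. nat (- f x)) \<star> rcls (%_. 0) =
 rcls (%x. nat (f x)) \<star> rcls r' \<star> rcls (%_. 0)" by simp
qed (use assms in "simp_all add: rcls_closed loc_const_nat")

lemma kcls_closed: "loc_const f ==> kcls f \<in> carrier \<K>"
unfolding kcls_def K0_def grothendieck_carrier[OF comm_monoid_projections]
by (rule bexI[OF _ rcls_closed], rule bexI[OF _ rcls_closed], rule refl) (auto intro: loc_const_nat)

lemma kcls_add:
assumes "loc_const f" "loc_const h"
shows "kcls f \<ast> kcls h = kcls (%x. f x + h x)"
proof -
have lc: "loc_const (%x. f x + h x)" using assms by (rule loc_const_comp2)
have "kcls f \<ast> kcls h = grothendieck_rel \<M> ``
  {(rcls (%x. nat (f x)) \<star> rcls (%x. nat (h x)), rcls (%x. nat (- f x)) \<star> rcls (%x. nat (- h x)))}"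
 unfolding kcls_def K0_def
 by (rule gclass_mult[OF comm_monoid_projections]) (simp_all add: rcls_closed loc_const_nat assms)
also have "... = kcls (%x. f x + h x)"
 unfolding rcls_add[OF loc_const_nat(1)[OF assms(1)] loc_const_nat(1)[OF assms(2)]]
  rcls_add[OF loc_const_nat(2)[OF assms(1)] loc_const_nat(2)[OF assms(2)]]
 by (rule gclass_rcls) (use assms lc in \<open>auto intro!: loc_const_comp2[where F = "(+)"] loc_const_nat\<close>)
finally show ?thesis .
qed

lemma kcls_one: "\<one>\<^bsub>\<K>\<^esub> = kcls (%_. 0)"
unfolding K0_def kcls_def grothendieck_group_def by (simp add: rcls_zero)

lemma kcls_theta: "loc_const f ==> kcls (%x. f (\<theta> n x)) = kcls f"
unfolding kcls_def using rcls_theta[OF loc_const_nat(1), of f n] rcls_theta[OF loc_const_nat(2), of f n] by simp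

text \<open>Links the generators used in \<open>K0_filtration\<close> to
  \<open>kcls\<close>.\<close>

lemma K0_class_indicator:
assumes "clopen U"
shows "K0_class \<B> (1, %_ _. cfun_embed X \<theta> (indicator U)) = kcls (indicator U)"
proof -
have lc: "loc_const (indicator U :: 'x => nat)" "loc_const (indicator U :: 'x => int)"
 using loc_const_comp[OF loc_const_clopen[OF assms], of of_bool] by (simp_all add: indicator_def[abs_def])
have c: "clopens 1 (%_. U)" using assms by (simp add: clopens_def)
have eq: "proj_op (1, %_ _. cfun_embed X \<theta> (indicator U)) = proj_op (diag_proj 1 (%_. U))"
 by (simp add: mat_op_def diag_proj_def diag_fun_def)
have "(1, %_ _. cfun_embed X \<theta> (indicator U)) \<in> \<P>"
 using diag_proj_projections[OF c] cfun_embed_closed[OF cfun_indicator[OF assms]]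
 unfolding projections_iff eq by auto
with eq have "pcls (1, %_ _. cfun_embed X \<theta> (indicator U)) = pcls (diag_proj 1 (%_. U))"
 by (intro pcls_eqI mvn_refl_op diag_proj_projections c)
also have "... = rcls (indicator U)"
 by (rule rcls_eq[OF c]) (auto simp: crank_def indicator_def)
finally show ?thesis unfolding K0_class_def
 by (simp add: rcls_zero gclass_rcls lc indicator_def[of U])
qed

end

section \<open>Hermitian matrices\<close>

locale hermitian_form =
fixes B :: "(nat => complex) => (nat => complex) => complex"
assumes lin: "B u (%i. a * v i + w i) = a * B u v + B u w"
 and sym: "B v u = cnj (B u v)"
begin

lemma zero_right: "B u (%i. 0) = 0"
using lin[of u 1 "%_. 0" "%_. 0"] by simp

lemma scale_right: "B u (%i. a * v i) = a * B u v"
using lin[of u a v "%_. 0"] by (simp add: zero_right)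

lemma lin_left: "B (%i. a * v i + w i) u = cnj a * B v u + B w u"
unfolding sym[of _ u] lin by simp

lemma scale_left: "B (%i. a * v i) u = cnj a * B v u"
unfolding sym[of _ u] scale_right by simp

lemma sum_right: "B u (%i. \<Sum>k\<in>K. a k * v k i) = (\<Sum>k\<in>K. a k * B u (v k))"
by (induction K rule: infinite_finite_induct) (auto simp: zero_right lin)

lemma diff_right: "B u (%i. v i - w i) = B u v - B u w"
using lin[of u "- 1" w v] by simp

lemma real_diag: "B u u = complex_of_real (Re (B u u))"
using sym[of u u] by (simp add: complex_eq_iff)

text \<open>One Gram-Schmidt step. The signs are their own inverses, so multiplication by
  \<open>\<sigma> j\<close> replaces division by the value of the form.\<close>

definition remainder :: "nat => (nat => nat => complex) => (nat => complex) => (nat => complex) => nat => complex" where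
"remainder l c \<sigma> u = (%i. u i - (\<Sum>j<l. (\<sigma> j * B (c j) u) * c j i))"

lemma B_remainder: "B v (remainder l c \<sigma> u) = B v u - (\<Sum>j<l. (\<sigma> j * B (c j) u) * B v (c j))"
unfolding remainder_def by (simp add: diff_right sum_right)

text \<open>If the form vanished on all combinations, the coefficients \<open>1, 1\<close> would
  kill the real part of \<open>B u v\<close> and \<open>1, \<i>\<close> its imaginary part.\<close>

lemma anisotropic_combination:
assumes "B u v ~= 0" shows "\<exists>a b. B (%i. a * u i + b * v i) (%i. a * u i + b * v i) ~= 0"
proof (rule ccontr)
assume "~ ?thesis"
hence z: "cnj a * (a * B u u + b * B u v) + cnj b * (a * cnj (B u v) + b * B v v) = 0" for a b
 unfolding lin lin_left scale_right scale_left sym[of v u] by (simp add: algebra_simps)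
have "B u u = 0" "B v v = 0" using z[of 1 0] z[of 0 1] by auto
thus False using z[of 1 1] z[of 1 \<i>] assms by (auto simp: complex_eq_iff)
qed

definition ofam :: "nat => (nat => nat => complex) => (nat => complex) => bool" where
"ofam l c \<sigma> <-> (\<forall>j<l. \<sigma> j = 1 | \<sigma> j = - 1) & (\<forall>i<l. \<forall>j<l. B (c i) (c j) = (if i = j then \<sigma> i else 0))"

lemma ofam_remainder: "ofam l c \<sigma> ==> j < l ==> B (c j) (remainder l c \<sigma> u) = 0"
proof -
assume *: "ofam l c \<sigma>" "j < l"
have "(\<Sum>k<l. (\<sigma> k * B (c k) u) * B (c j) (c k)) = (\<Sum>k<l. if k = j then B (c j) u else 0)"
 using * by (intro sum.cong refl) (auto simp: ofam_def)
thus ?thesis using * by (simp add: B_remainder)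
qed

lemma ofam_extend:
assumes o: "ofam l c \<sigma>" and nz: "B (remainder l c \<sigma> u) (remainder l c \<sigma> v) ~= 0"
shows "\<exists>c \<sigma>. ofam (Suc l) c \<sigma>"
proof -
obtain a b where ab: "B (%i. a * remainder l c \<sigma> u i + b * remainder l c \<sigma> v i)
  (%i. a * remainder l c \<sigma> u i + b * remainder l c \<sigma> v i) ~= 0"
 using anisotropic_combination[OF nz] by blast
define z where "z = (%i. a * remainder l c \<sigma> u i + b * remainder l c \<sigma> v i)"
define \<rho> where "\<rho> = Re (B z z)"
have Bz: "B z z = complex_of_real \<rho>" unfolding \<rho>_def by (rule real_diag)
hence \<rho>: "\<rho> ~= 0" using ab unfolding z_def[symmetric] by auto
define e where "e = (%i. complex_of_real (1 / sqrt \<bar>\<rho>\<bar>) * z i)"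
have "B e e = complex_of_real (1 / sqrt \<bar>\<rho>\<bar> * (1 / sqrt \<bar>\<rho>\<bar>) * \<rho>)"
 unfolding e_def scale_right scale_left Bz by (simp only: of_real_mult complex_cnj_complex_of_real mult.assoc)
also have "1 / sqrt \<bar>\<rho>\<bar> * (1 / sqrt \<bar>\<rho>\<bar>) * \<rho> = sgn \<rho>" using \<rho> by (simp add: sgn_if field_simps)
finally have e: "B e e = complex_of_real (sgn \<rho>)" .
have ce: "B (c j) e = 0" if "j < l" for j
 unfolding e_def scale_right z_def lin by (simp only: ofam_remainder[OF o that] mult_zero_right add_0)
hence "B e (c j) = 0" if "j < l" for j using sym[of e "c j"] that by simp
with o ce e \<rho> have "ofam (Suc l) (c(l := e)) (\<sigma>(l := complex_of_real (sgn \<rho>)))"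
 unfolding ofam_def by (auto simp: less_Suc_eq sgn_if)
thus ?thesis by blast
qed

end

definition herm :: "nat => (nat => nat => complex) => bool" where
"herm m A <-> (\<forall>i<m. \<forall>j<m. A j i = cnj (A i j))"

definition nondeg :: "nat => (nat => nat => complex) => bool" where
"nondeg m A <-> (\<forall>v. (\<forall>i<m. (\<Sum>j<m. A i j * v j) = 0) --> (\<forall>j<m. v j = 0))"

text \<open>For a maximal orthogonal family with values 1 or -1 the remainders are orthogonal to
  everything, hence 0 by nondegeneracy. The last conclusion exhibits the inverse of
  \<open>C\<close>; it serves both to invert \<open>A\<close> and to select frames later.\<close>

theorem sylvester:
assumes A: "herm m A" "nondeg m A"
obtains C \<sigma> where "!!j. j < m ==> \<sigma> j = (1 :: complex) | \<sigma> j = - 1"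
 "!!i j. i < m ==> j < m ==> (\<Sum>k<m. \<Sum>l<m. cnj (C k i) * A k l * C l j) = (if i = j then \<sigma> i else 0)"
 "!!i j. i < m ==> j < m ==> (\<Sum>k<m. \<Sum>l<m. \<sigma> k * C i k * cnj (C l k) * A l j) = (if i = j then 1 else 0)"
proof -
define B where "B u v = (\<Sum>k<m. \<Sum>l<m. cnj (u k) * A k l * v l)" for u v
interpret hermitian_form B
proof
 show "B u (%i. a * v i + w i) = a * B u v + B u w" for u a v w
  by (simp add: B_def algebra_simps sum.distrib sum_distrib_left)
 have "cnj (cnj (u k) * A k l * v l) = cnj (v l) * A l k * u k" if "k < m" "l < m" for u v :: "nat => complex" and k l
 proof -
  have "A l k = cnj (A k l)" using A(1) that unfolding herm_def by blast
  thus ?thesis by (simp add: mult_ac)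
 qed
 hence "(\<Sum>k<m. \<Sum>l<m. cnj (cnj (u k) * A k l * v l)) = (\<Sum>k<m. \<Sum>l<m. cnj (v l) * A l k * u k)" for u v :: "nat => complex"
  by (intro sum.cong refl) auto
 thus "B v u = cnj (B u v)" for u v
  unfolding B_def cnj_sum by (subst sum.swap) simp
qed
have Bcong: "B v u = B v u'" if "!!i. i < m ==> u i = u' i" for u u' v using that by (simp add: B_def)
have bound: "l <= m" if o: "ofam l c \<sigma>" for l c \<sigma>
proof -
 interpret V: vector_space "%a v i. a * v i :: complex"
  by unfold_locales (auto simp: fun_eq_iff algebra_simps)
 have fs: "sum f S i = (\<Sum>k\<in>S. f k i)" for f :: "nat => nat => complex" and S i
  by (induction S rule: infinite_finite_induct) auto
 \<comment> \<open>Vectors are functions on all natural numbers of which \<open>B\<close> sees only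
   the first \<open>m\<close> values. They are truncated before dimensions are counted.\<close>
 define c' where "c' j = (%i. if i < m then c j i else 0)" for j
 have B: "B (c i) (c' j) = (if i = j then \<sigma> i else 0)" "\<sigma> i ~= 0" if "i < l" "j < l" for i j
  using o that Bcong[of "c' j" "c j" "c i"] by (auto simp: ofam_def c'_def)
 have inj: "inj_on c' {..<l}"
  by (rule inj_onI) (metis B lessThan_iff)
 have "V.independent (c' ` {..<l})"
 proof
  assume "V.dependent (c' ` {..<l})"
  then obtain r j where r: "j < l" "r (c' j) ~= 0" "(\<Sum>v\<in>c' ` {..<l}. (%i. r v * v i)) = 0"
   by (auto simp: V.dependent_finite)
  have "(%i. \<Sum>k<l. r (c' k) * c' k i) = (%_. 0)"
   using r(3) unfolding sum.reindex[OF inj] by (simp add: fun_eq_iff fs)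
  hence "0 = (\<Sum>k<l. r (c' k) * B (c j) (c' k))" using sum_right[of "c j" "%k. r (c' k)" c' "{..<l}"] by (simp add: zero_right)
  also have "... = (\<Sum>k<l. if k = j then r (c' k) * \<sigma> j else 0)" using B r(1) by (intro sum.cong refl) auto
  finally show False using r B(2)[OF r(1) r(1)] by simp
 qed
 moreover have "c' j \<in> V.span ((%i k. if k = i then 1 else 0) ` {..<m})" for j
 proof -
  have "c' j = (\<Sum>i<m. (%k. c j i * (if k = i then 1 else 0)))"
   by (auto simp: c'_def fun_eq_iff fs if_distrib[of "(*) _"] cong: if_cong)
  also have "... \<in> V.span ((%i k. if k = i then 1 else 0) ` {..<m})"
   by (intro V.span_sum V.span_scale V.span_base) auto
  finally show ?thesis .
 qed
 ultimately have "card (c' ` {..<l}) <= card ((%i k. if k = i then 1 else 0 :: complex) ` {..<m})"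
  by (intro V.independent_span_bound[THEN conjunct2]) auto
 also have "... <= m" using card_image_le[of "{..<m}"] by simp
 finally show ?thesis by (simp add: card_image[OF inj])
qed
have "\<exists>l. (\<exists>c \<sigma>. ofam l c \<sigma>) & ~ (\<exists>c \<sigma>. ofam (Suc l) c \<sigma>)"
proof (rule ccontr)
 assume *: "~ ?thesis"
 have "\<exists>c \<sigma>. ofam l c \<sigma>" for l
 proof (induction l)
  case (Suc l) thus ?case using * by blast
 qed (simp add: ofam_def)
 thus False using bound[of "Suc m"] by fastforce
qed
then obtain l c \<sigma> where o: "ofam l c \<sigma>" and max: "~ (\<exists>c \<sigma>. ofam (Suc l) c \<sigma>)" by blast
have \<sigma>: "!!j. j < l ==> \<sigma> j = 1 | \<sigma> j = - 1" and c: "!!i j. i < l ==> j < l ==> B (c i) (c j) = (if i = j then \<sigma> i else 0)"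
 using o by (auto simp: ofam_def)
have r: "B w (remainder l c \<sigma> v) = 0" for v w
proof -
 have "B (remainder l c \<sigma> v) (c j) = 0" if "j < l" for j
  using ofam_remainder[OF o that, of v] sym[of "remainder l c \<sigma> v" "c j"] by simp
 hence "B (remainder l c \<sigma> v) w = B (remainder l c \<sigma> v) (remainder l c \<sigma> w)"
  by (simp add: B_remainder[of "remainder l c \<sigma> v"])
 also have "... = 0" using max ofam_extend[OF o] by blast
 finally show ?thesis using sym[of w] by simp
qed
define e where "e i = (%j. if j = i then 1 else 0 :: complex)" for i :: nat
have Be: "B (e i) v = (\<Sum>j<m. A i j * v j)" if "i < m" for i v
proof -
 have "B (e i) v = (\<Sum>k<m. if k = i then \<Sum>j<m. A i j * v j else 0)"
  unfolding B_def by (intro sum.cong refl) (auto simp: e_def)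
 thus ?thesis using that by simp
qed
have rem0: "remainder l c \<sigma> (e i) j = 0" if "j < m" for i j
 using A(2) r[of _ "e i"] Be that unfolding nondeg_def by metis
have expand: "(\<Sum>k<l. \<Sum>l'<m. \<sigma> k * c k i * cnj (c k l') * A l' j) = (if i = j then 1 else 0)"
 if ij: "i < m" "j < m" for i j
proof -
 have "B (c k) (e j) = (\<Sum>l'<m. cnj (c k l') * A l' j)" for k
 proof -
  have "(\<Sum>l<m. cnj (c k k') * A k' l * e j l) = (\<Sum>l<m. if l = j then cnj (c k k') * A k' j else 0)" for k'
   by (intro sum.cong refl) (auto simp: e_def)
  thus ?thesis unfolding B_def using ij by simp
 qed
 moreover have "e j i - (\<Sum>k<l. (\<sigma> k * B (c k) (e j)) * c k i) = 0"
  using rem0[OF ij(1)] unfolding remainder_def .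
 ultimately have "e j i = (\<Sum>k<l. (\<sigma> k * (\<Sum>l'<m. cnj (c k l') * A l' j)) * c k i)"
  by (simp only: right_minus_eq)
 moreover have "(\<sigma> k * (\<Sum>l'<m. cnj (c k l') * A l' j)) * c k i =
   (\<Sum>l'<m. \<sigma> k * c k i * cnj (c k l') * A l' j)" for k
  unfolding sum_distrib_left sum_distrib_right by (rule sum.cong[OF refl]) (simp only: mult_ac)
 ultimately show ?thesis by (simp add: e_def)
qed
\<comment> \<open>Taking the trace of the expansion of the identity: each member of the family
  contributes \<open>\<sigma> k * \<sigma> k = 1\<close>, so the family has exactly \<open>m\<close>
  members.\<close>
have "of_nat m = (\<Sum>i<m. \<Sum>k<l. \<Sum>l'<m. \<sigma> k * c k i * cnj (c k l') * A l' i)"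
 using expand by simp
also have "... = (\<Sum>k<l. \<sigma> k * B (c k) (c k))"
proof -
 have "(\<Sum>i<m. \<Sum>l'<m. \<sigma> k * c k i * cnj (c k l') * A l' i) = \<sigma> k * B (c k) (c k)" for k
  unfolding B_def sum_distrib_left by (subst sum.swap) (simp only: mult_ac)
 thus ?thesis by (subst sum.swap) (simp only:)
qed
also have "... = (\<Sum>k<l. 1)" using \<sigma> c by (intro sum.cong refl) force
finally have "m = l" by (metis card_lessThan of_nat_eq_iff of_nat_sum sum_constant mult_1_right sum.cong of_nat_1 of_nat_id)
show thesis
proof (rule that[of \<sigma> "%i j. c j i"])
 fix i j assume "i < m" "j < m"
 thus "(\<Sum>k<m. \<Sum>l<m. cnj (c i k) * A k l * c j l) = (if i = j then \<sigma> i else 0)"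
  "(\<Sum>k<m. \<Sum>l<m. \<sigma> k * c k i * cnj (c k l) * A l j) = (if i = j then 1 else 0)"
  using c[of i j] expand[of i j] \<open>m = l\<close> by (simp_all add: B_def)
qed (use \<sigma> \<open>m = l\<close> in auto)
qed

definition inverse_matrix :: "nat => (nat => nat => complex) => (nat => nat => complex) => bool" where
"inverse_matrix m A B <-> (\<forall>i<m. \<forall>j<m. (\<Sum>k<m. A i k * B k j) = (if i = j then 1 else 0)) &
  (\<forall>i<m. \<forall>j<m. (\<Sum>k<m. B i k * A k j) = (if i = j then 1 else 0))"

lemma herm_inverse:
assumes A: "herm m A" "nondeg m A" obtains B where "inverse_matrix m A B"
proof -
obtain C \<sigma> where \<sigma>: "!!j. j < m ==> \<sigma> j = (1 :: complex) | \<sigma> j = - 1"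
 and C: "!!i j. i < m ==> j < m ==> (\<Sum>k<m. \<Sum>l<m. \<sigma> k * C i k * cnj (C l k) * A l j) = (if i = j then 1 else 0)"
 by (rule sylvester[OF A]) blast
define B where "B i l = (\<Sum>k<m. \<sigma> k * C i k * cnj (C l k))" for i l
have BA: "(\<Sum>l<m. B i l * A l j) = (if i = j then 1 else 0)" if "i < m" "j < m" for i j
 using C[OF that] unfolding B_def sum_distrib_right by (subst sum.swap) simp
have hB: "B i l = cnj (B l i)" for i l
 unfolding B_def cnj_sum by (intro sum.cong refl) (use \<sigma> in "force simp: mult_ac")
have "(\<Sum>k<m. A i k * B k j) = (if i = j then 1 else 0)" if "i < m" "j < m" for i j
proof -
 have "(\<Sum>k<m. A i k * B k j) = cnj (\<Sum>k<m. B j k * A k i)"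
  unfolding cnj_sum
 proof (rule sum.cong[OF refl])
  fix k assume "k \<in> {..<m}"
  hence "k < m" by simp
  hence "A i k = cnj (A k i)" using A(1) that unfolding herm_def by blast
  thus "A i k * B k j = cnj (B j k * A k i)" by (simp add: hB[of k j] mult.commute)
 qed
 thus ?thesis using BA[OF that(2,1)] by auto
qed
with BA show thesis by (intro that[of B]) (auto simp: inverse_matrix_def)
qed

definition msum :: "nat => (nat => nat => complex) => real" where
"msum m A = (\<Sum>i<m. \<Sum>j<m. cmod (A i j))"

lemma msum_nonneg: "0 <= msum m A"
unfolding msum_def by (intro sum_nonneg) auto

lemma msum_entry: "i < m ==> j < m ==> cmod (A i j) <= msum m A"
unfolding msum_def sum.cartesian_product
using member_le_sum[of "(i, j)" "{..<m} \<times> {..<m}" "%(i, j). cmod (A i j)"] by force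

lemma vec_mult_le: "(\<Sum>i<m. cmod (\<Sum>j<m. A i j * v j)) <= msum m A * (\<Sum>j<m. cmod (v j))"
proof -
have "(\<Sum>i<m. cmod (\<Sum>j<m. A i j * v j)) <= (\<Sum>i<m. \<Sum>j<m. cmod (A i j) * (\<Sum>j<m. cmod (v j)))"
proof (rule sum_mono)
 fix i assume "i \<in> {..<m}"
 have "cmod (\<Sum>j<m. A i j * v j) <= (\<Sum>j<m. cmod (A i j * v j))" by (rule norm_sum)
 also have "... <= (\<Sum>j<m. cmod (A i j) * (\<Sum>j<m. cmod (v j)))"
  unfolding norm_mult by (intro sum_mono mult_left_mono member_le_sum) auto
 finally show "cmod (\<Sum>j<m. A i j * v j) <= (\<Sum>j<m. cmod (A i j) * (\<Sum>j<m. cmod (v j)))" .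
qed
thus ?thesis by (simp add: msum_def sum_distrib_right)
qed

text \<open>Write \<open>v\<close> as \<open>B (A v)\<close>; replacing \<open>A\<close> by
  \<open>A'\<close> costs at most half of the norm of \<open>v\<close>, which is absorbed on the
  left.\<close>

lemma inverse_matrix_lower_bound:
assumes B: "inverse_matrix m A B" and small: "msum m (%i j. A i j - A' i j) * msum m B <= 1 / 2"
shows "(\<Sum>i<m. cmod (v i)) <= 2 * msum m B * (\<Sum>i<m. cmod (\<Sum>j<m. A' i j * v j))"
proof -
let ?n = "%v. \<Sum>i<m. cmod (v i)" and ?m = "%A v i. \<Sum>j<m. A i j * v j :: complex" and ?D = "%i j. A i j - A' i j"
have "?m B (?m A v) i = v i" if "i < m" for i
proof -
 have "?m B (?m A v) i = (\<Sum>l<m. (\<Sum>k<m. B i k * A k l) * v l)"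
  unfolding sum_distrib_left sum_distrib_right by (subst sum.swap) (simp add: mult.assoc)
 also have "... = (\<Sum>l<m. if l = i then v l else 0)"
  using B that by (intro sum.cong refl) (auto simp: inverse_matrix_def)
 finally show ?thesis using that by simp
qed
hence "?n v = ?n (?m B (?m A v))" by (intro sum.cong refl) simp
also have "... <= msum m B * ?n (?m A v)" by (rule vec_mult_le)
also have "?n (?m A v) <= ?n (?m A' v) + ?n (?m ?D v)"
 unfolding sum.distrib[symmetric] by (intro sum_mono) (simp add: left_diff_distrib sum_subtractf norm_triangle_sub)
also have "?n (?m ?D v) <= msum m ?D * ?n v" by (rule vec_mult_le)
finally have "?n v <= msum m B * ?n (?m A' v) + msum m ?D * msum m B * ?n v"
 using mult_left_mono[OF _ msum_nonneg[of m B]] by (simp add: distrib_left mult_ac)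
also have "msum m ?D * msum m B * ?n v <= 1 / 2 * ?n v" by (intro mult_right_mono small sum_nonneg) simp
finally show ?thesis by simp
qed

context zero_dim_system
begin

lemma cfun_iff_local:
"f \<in> cfun X <-> (\<forall>x. x ~: XX --> f x = 0) &
  (\<forall>x\<in>XX. \<forall>e>0. \<exists>U. openin X U & x \<in> U & (\<forall>y\<in>U. cmod (f y - f x) < e))"
unfolding cfun_def mtopology_is_euclidean[symmetric] Met_TC.continuous_map_to_metric
by (auto simp: dist_norm norm_minus_commute)

lemma msum_near:
assumes "cmat m m A" "x \<in> XX" "0 < e"
shows "\<exists>U. openin X U & x \<in> U & (\<forall>y\<in>U. msum m (%i j. A i j y - A i j x) < e)"
proof -
have "continuous_map X euclidean (%y. A i j y - A i j x)" if "i < m" "j < m" for i j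
 using cmatD[OF assms(1) that] by (intro continuous_map_diff) (auto simp: cfun_def)
hence "continuous_map X euclideanreal (%y. msum m (%i j. A i j y - A i j x))"
 unfolding msum_def by (intro continuous_map_sum continuous_map_norm) auto
hence "openin X {y \<in> XX. msum m (%i j. A i j y - A i j x) \<in> {..<e}}"
 by (rule openin_continuous_map_preimage) simp
thus ?thesis
 using assms by (intro exI[of _ "{y \<in> XX. msum m (%i j. A i j y - A i j x) \<in> {..<e}}"]) (auto simp: msum_def)
qed

lemma cmat_lower_bound:
assumes A: "cmat m m A" and x: "x \<in> XX" and B: "inverse_matrix m (%i j. A i j x) B" and e: "0 < e"
shows "\<exists>U. openin X U & x \<in> U & (\<forall>y\<in>U. msum m (%i j. A i j x - A i j y) < e &
 (\<forall>v. (\<Sum>i<m. cmod (v i)) <= 2 * msum m B * (\<Sum>i<m. cmod (\<Sum>j<m. A i j y * v j))))"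
proof -
have d: "0 < min e (1 / (2 * (msum m B + 1)))" using e msum_nonneg[of m B] by simp
obtain U where U: "openin X U" "x \<in> U" "\<forall>y\<in>U. msum m (%i j. A i j y - A i j x) < min e (1 / (2 * (msum m B + 1)))"
 using msum_near[OF A x d] by blast
have "msum m (%i j. A i j x - A i j y) < e & msum m (%i j. A i j x - A i j y) * msum m B <= 1 / 2" if "y \<in> U" for y
proof -
 have "msum m (%i j. A i j x - A i j y) = msum m (%i j. A i j y - A i j x)" by (simp add: msum_def norm_minus_commute)
 hence s: "msum m (%i j. A i j x - A i j y) < min e (1 / (2 * (msum m B + 1)))" using U(3) that by simp
 hence "msum m (%i j. A i j x - A i j y) * msum m B <= 1 / (2 * (msum m B + 1)) * (msum m B + 1)"
  using msum_nonneg[of m B] by (intro mult_mono) auto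
 also have "... = 1 / 2" using msum_nonneg[of m B] by (simp add: field_simps)
 finally show ?thesis using s by simp
qed
hence "\<forall>y\<in>U. msum m (%i j. A i j x - A i j y) < e &
 (\<forall>v. (\<Sum>i<m. cmod (v i)) <= 2 * msum m B * (\<Sum>i<m. cmod (\<Sum>j<m. A i j y * v j)))"
 using inverse_matrix_lower_bound[OF B] by simp
with U(1,2) show ?thesis by blast
qed

lemma nondeg_near:
assumes A: "cmat m m A" and x: "x \<in> XX" and h: "herm m (%i j. A i j x)" "nondeg m (%i j. A i j x)"
shows "\<exists>U. openin X U & x \<in> U & (\<forall>y\<in>U. nondeg m (%i j. A i j y))"
proof -
obtain B where B: "inverse_matrix m (%i j. A i j x) B" using herm_inverse[OF h] by blast
obtain U where U: "openin X U" "x \<in> U"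
 "\<forall>y\<in>U. \<forall>v. (\<Sum>i<m. cmod (v i)) <= 2 * msum m B * (\<Sum>i<m. cmod (\<Sum>j<m. A i j y * v j))"
 using cmat_lower_bound[OF A x B zero_less_one] by blast
have "nondeg m (%i j. A i j y)" if "y \<in> U" for y
 unfolding nondeg_def
proof (intro allI impI)
 fix v i assume "\<forall>i<m. (\<Sum>j<m. A i j y * v j) = 0" "i < m"
 with spec[OF bspec[OF U(3) that], of v] have "(\<Sum>i<m. cmod (v i)) <= 0" by (simp cong: sum.cong_simp)
 moreover have "cmod (v i) <= (\<Sum>i<m. cmod (v i))" using \<open>i < m\<close> by (intro member_le_sum) auto
 ultimately show "v i = 0" by (metis norm_le_zero_iff order_trans)
qed
with U show ?thesis by blast
qed

text \<open>The pointwise inverses are continuous: \<open>A(y)\<close> applied to the difference of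
  inverse columns at \<open>y\<close> and \<open>x\<close> equals \<open>A(x) - A(y)\<close> applied
  to the column at \<open>x\<close>, and \<open>A(y)\<close> is bounded below uniformly near
  \<open>x\<close>.\<close>

lemma cmat_herm_inverse:
assumes A: "cmat m m A" and h: "!!x. x \<in> XX ==> herm m (%i j. A i j x) & nondeg m (%i j. A i j x)"
obtains B where "cmat m m B" "!!x. x \<in> XX ==> inverse_matrix m (%i j. A i j x) (%i j. B i j x)"
proof -
have "\<forall>x. \<exists>b. x \<in> XX --> inverse_matrix m (%i j. A i j x) b"
 using h herm_inverse by metis
then obtain b where b: "!!x. x \<in> XX ==> inverse_matrix m (%i j. A i j x) (b x)" by metis
define B where "B i j x = (if x \<in> XX then b x i j else 0)" for i j x
have inv: "inverse_matrix m (%i j. A i j x) (%i j. B i j x)" if "x \<in> XX" for x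
 using b[OF that] that by (simp add: B_def)
have "cmat m m B"
proof (intro cmatI, unfold cfun_iff_local, intro allI impI conjI ballI)
 fix i j x and e :: real assume ij: "i < m" "j < m" and x: "x \<in> XX" and e: "0 < e"
 let ?b = "msum m (%i j. B i j x)"
 have b: "0 <= ?b" by (rule msum_nonneg)
 \<comment> \<open>The estimate below loses the factor \<open>2 * ?b^2\<close>; the added 1 guards
   against division by zero.\<close>
 have d: "0 < e / (2 * (?b + 1)\<^sup>2)" using e b by simp
 obtain U where U: "openin X U" "x \<in> U" "!!y. y \<in> U ==> msum m (%i j. A i j x - A i j y) < e / (2 * (?b + 1)\<^sup>2)"
  "!!y v. y \<in> U ==> (\<Sum>i<m. cmod (v i)) <= 2 * ?b * (\<Sum>i<m. cmod (\<Sum>j<m. A i j y * v j))"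
  using cmat_lower_bound[OF A x inv[OF x] d] by blast
 have "cmod (B i j y - B i j x) < e" if y: "y \<in> U" for y
 proof -
  have "y \<in> XX" using U(1) y openin_subset by blast
  let ?\<delta> = "msum m (%i j. A i j x - A i j y)"
  have "(\<Sum>k<m. A l k y * (B k j y - B k j x)) = (\<Sum>k<m. (A l k x - A l k y) * B k j x)" if "l < m" for l
   using inv[OF x] inv[OF \<open>y \<in> XX\<close>] that ij
   by (simp add: inverse_matrix_def left_diff_distrib right_diff_distrib sum_subtractf)
  hence "(\<Sum>l<m. cmod (\<Sum>k<m. A l k y * (B k j y - B k j x))) <= ?\<delta> * (\<Sum>k<m. cmod (B k j x))"
   using vec_mult_le[of "%i j. A i j x - A i j y" "%k. B k j x" m] by simp
  also have "... <= ?\<delta> * ?b"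
   unfolding msum_def[of m "%i j. B i j x"] using ij
   by (intro mult_left_mono msum_nonneg sum_mono member_le_sum) auto
  finally have "(\<Sum>k<m. cmod (B k j y - B k j x)) <= 2 * ?b * (?\<delta> * ?b)"
   using U(4)[OF y, of "%k. B k j y - B k j x"] b by (meson mult_left_mono order_trans mult_nonneg_nonneg zero_le_numeral)
  also have "... = 2 * ?b\<^sup>2 * ?\<delta>" by (simp add: power2_eq_square)
  also have "... <= 2 * (?b + 1)\<^sup>2 * ?\<delta>" using b by (intro mult_right_mono mult_left_mono power_mono msum_nonneg) auto
  also have "... < e" using U(3)[OF y] b by (simp add: field_simps)
  finally show ?thesis
   using member_le_sum[of i "{..<m}" "%k. cmod (B k j y - B k j x)"] ij(1) by force
 qed
 thus "\<exists>U. openin X U & x \<in> U & (\<forall>y\<in>U. cmod (B i j y - B i j x) < e)"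
  using U(1,2) by blast
qed (simp add: B_def)
thus thesis using inv by (rule that)
qed

end

section \<open>Covariant operators, their coefficient functions and triangular factorization\<close>

lemma coord_app_idx:
"(!!y j d. coef A q (y, j, d) = 0 | coord x (y, j, d) = 0) ==> coord (app A x) q = 0"
by (rule coord_app_disjoint) (auto simp: split_paired_all)

lemma coord_app_fibre:
assumes "finite L" "!!y j d. y ~= x | (j, d) ~: L ==> coef A (x, p) (y, j, d) = 0 | coord \<eta> (y, j, d) = 0"
shows "coord (app A \<eta>) (x, p) = (\<Sum>l\<in>L. coef A (x, p) (x, l) * coord \<eta> (x, l))"
proof -
have "coord (app A \<eta>) (x, p) = (\<Sum>r\<in>Pair x ` L. coef A (x, p) r * coord \<eta> r)"
 using assms by (intro coord_app) (auto simp: split_paired_all)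
also have "... = (\<Sum>l\<in>L. coef A (x, p) (x, l) * coord \<eta> (x, l))"
 by (subst sum.reindex) (auto simp: inj_on_def)
finally show ?thesis .
qed

context zero_dim_system
begin

text \<open>Covariance of the regular representation: the columns at level 0 determine the whole
  matrix and are continuous in the point. The condition survives norm limits, so it holds for the
  completion and not only for Laurent polynomials.\<close>

definition structured :: "nat => nat => 'x idx bop => bool" where
"structured n m A <-> (\<forall>c d i. (%x. coef A (x, i, c) (x, 0, d)) \<in> cfun X) &
  (\<forall>x i c x' j d. coef A (x, i, c) (x', j, d) =
   (if x = x' & c < n & d < m then coef A (\<theta> (- j) x, i - j, c) (\<theta> (- j) x, 0, d) else 0))"

lemma structured_cross_op:
assumes F: "F \<in> CA" and "c < n" "d < m" shows "structured n m (cross_op c d F)"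
proof -
have "(%x. coef (cross_op c d F) (x, i, c') (x, 0, d')) \<in> cfun X" for c' d' i
 unfolding coef_cross_op[OF F]
 using cfun_theta[OF carrierD(1)[OF F], of "- i" "- i"] by (cases "c' = c & d' = d") (auto split: if_splits)
thus ?thesis using assms unfolding structured_def
 by (auto simp: coef_cross_op[OF F])
qed

lemma structured_approx:
assumes "!!e. 0 < e ==> \<exists>B. structured n m B & norm (A - B) < e"
shows "structured n m A"
proof -
have "\<exists>B. structured n m B & norm (A - B) < inverse (real (Suc k))" for k by (intro assms) simp
then obtain B where B: "!!k. structured n m (B k)" "!!k. norm (A - B k) < inverse (real (Suc k))" by metis
have d: "cmod (coef A q r - coef (B k) q r) < inverse (real (Suc k))" for k q r
 using norm_coef_le[of "A - B k" q r] B(2)[of k] by simp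
have lim: "(%k. coef (B k) q r) ----> coef A q r" for q r
proof -
 have "(%k. coef A q r - coef (B k) q r) ----> 0"
  by (rule Lim_null_comparison[OF _ LIMSEQ_inverse_real_of_nat]) (intro always_eventually allI less_imp_le d)
 from tendsto_diff[OF tendsto_const this, of "coef A q r"] show ?thesis by simp
qed
have "coef A (x, i, c) (x', j, d) =
   (if x = x' & c < n & d < m then coef A (\<theta> (- j) x, i - j, c) (\<theta> (- j) x, 0, d) else 0)" for x i c x' j d
proof (rule LIMSEQ_unique[OF lim])
 have "coef (B k) (x, i, c) (x', j, d) = (if x = x' & c < n & d < m
  then coef (B k) (\<theta> (- j) x, i - j, c) (\<theta> (- j) x, 0, d) else 0)" for k
  using B(1) unfolding structured_def by blast
 thus "(%k. coef (B k) (x, i, c) (x', j, d)) ---->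
  (if x = x' & c < n & d < m then coef A (\<theta> (- j) x, i - j, c) (\<theta> (- j) x, 0, d) else 0)"
  using lim by (simp only:) auto
qed
moreover have "(%x. coef A (x, i, c) (x, 0, d)) \<in> cfun X" (is "?f \<in> _") for c d i
 unfolding cfun_def
proof (intro CollectI conjI allI impI)
 have Bf: "(%x. coef (B k) (x, i, c) (x, 0, d)) \<in> cfun X" for k using B(1) unfolding structured_def by blast
 show "?f x = 0" if "x ~: XX" for x
  using Bf that lim[of "(x, i, c)" "(x, 0, d)"] by (simp add: cfun_def LIMSEQ_const_iff)
 show "continuous_map X euclidean ?f"
 proof (unfold mtopology_is_euclidean[symmetric], rule Met_TC.continuous_map_uniform_limit[where F = sequentially])
  show "\<forall>\<^sub>F k in sequentially. continuous_map X Met_TC.mtopology (%x. coef (B k) (x, i, c) (x, 0, d))"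
   using Bf by (simp add: cfun_def)
  fix e :: real assume "0 < e"
  hence "\<forall>\<^sub>F k in sequentially. inverse (real (Suc k)) < e" by (intro order_tendstoD(2)[OF LIMSEQ_inverse_real_of_nat])
  thus "\<forall>\<^sub>F k in sequentially. \<forall>x\<in>XX. ?f x \<in> UNIV & dist (coef (B k) (x, i, c) (x, 0, d)) (?f x) < e"
   by eventually_elim (metis UNIV_I d dist_commute dist_norm less_trans)
 qed auto
qed
ultimately show ?thesis unfolding structured_def by blast
qed

lemma structured_sum:
assumes "!!k. k \<in> K ==> structured n m (F k)" shows "structured n m (sum F K)"
proof -
have "coef (F k) (x, i, c) (x', j, d) = (if x = x' & c < n & d < m then
  coef (F k) (\<theta> (- j) x, i - j, c) (\<theta> (- j) x, 0, d) else 0)" if "k \<in> K" for k x i c x' j d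
 using assms[OF that] unfolding structured_def by blast
hence e: "(\<Sum>k\<in>K. coef (F k) (x, i, c) (x', j, d)) = (\<Sum>k\<in>K. if x = x' & c < n & d < m then
  coef (F k) (\<theta> (- j) x, i - j, c) (\<theta> (- j) x, 0, d) else 0)" for x i c x' j d
 by (intro sum.cong refl) blast
have "(%x. \<Sum>k\<in>K. coef (F k) (x, i, c) (x, 0, d)) \<in> cfun X" for i c d
 using assms unfolding structured_def by (intro cfun_sum) blast
moreover have f: "(\<Sum>k\<in>K. if b then f k else (0 :: complex)) = (if b then \<Sum>k\<in>K. f k else 0)" for b f
 by (cases b) simp_all
ultimately show ?thesis unfolding structured_def coef_sum
 by (intro conjI allI) (blast, rule trans[OF e f])
qed

lemma Mat_structured: "A \<in> Mat n m ==> structured n m A"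
proof (elim MatE)
fix p assume p: "!!i j. i < n ==> j < m ==> p i j \<in> CB"
 and A: "A = (\<Sum>i<n. \<Sum>j<m. comp_op i j (p i j))"
show "structured n m A" unfolding A
proof (intro structured_sum structured_approx)
 fix i j and e :: real assume "i \<in> {..<n}" "j \<in> {..<m}" "0 < e"
 thus "\<exists>B. structured n m B & norm (comp_op i j (p i j) - B) < e"
  using comp_op_dense[of "p i j" e i j] p structured_cross_op by (metis lessThan_iff)
qed
qed

text \<open>The coefficient functions of the formal Laurent series of an element, up to the sign and
  the translation built into the regular representation; \<open>i\<close> is the level
  difference.\<close>

definition ent :: "'x idx bop => nat => nat => int => 'x => complex" where
"ent A c d i x = coef A (x, i, c) (x, 0, d)"

lemma coef_ent:
assumes "A \<in> Mat n m"
shows "coef A (x, i, c) (x', j, d) = (if x = x' & c < n & d < m then ent A c d (i - j) (\<theta> (- j) x) else 0)"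
using Mat_structured[OF assms] unfolding structured_def ent_def by blast

lemma ent_cfun: "A \<in> Mat n m ==> ent A c d i \<in> cfun X"
using Mat_structured[of A n m] unfolding structured_def ent_def by blast

lemma ent_outside: "A \<in> Mat n m ==> x ~: XX ==> ent A c d i x = 0"
using ent_cfun[of A n m] unfolding cfun_def by blast

lemma norm_ent_le: "cmod (ent A c d i x) <= norm A"
unfolding ent_def by (rule norm_coef_le)

lemma Mat_eqI:
assumes "A \<in> Mat n m" "B \<in> Mat n m"
 and "!!c d i x. x \<in> XX ==> c < n ==> d < m ==> ent A c d i x = ent B c d i x"
shows "A = B"
proof (rule bop_idx_eqI)
fix x i c x' j d
have "ent A c d (i - j) (\<theta> (- j) x) = ent B c d (i - j) (\<theta> (- j) x)" if "c < n" "d < m"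
 using assms(3)[OF _ that] ent_outside[OF assms(1)] ent_outside[OF assms(2)]
 by (cases "\<theta> (- j) x \<in> XX") auto
thus "coef A (x, i, c) (x', j, d) = coef B (x, i, c) (x', j, d)"
 unfolding coef_ent[OF assms(1)] coef_ent[OF assms(2)] by (intro if_cong refl) blast
qed

lemma ent_fibre: "cmat n m a ==> c < n ==> d < m ==> ent (fibre n m a) c d i x = (if i = 0 then a c d x else 0)"
proof -
assume *: "cmat n m a" "c < n" "d < m"
have "(\<Sum>j<m. a c j (\<theta> (- i) x) * (if i = 0 & j = d then 1 else 0)) =
  (\<Sum>j<m. if j = d then (if i = 0 then a c j x else 0) else 0)"
 by (intro sum.cong refl) auto
with * show ?thesis by (simp add: ent_def coef_def coord_fibre coord_unit_vec)
qed

abbreviation Id :: "nat => 'x idx bop" where "Id m \<equiv> fibre m m (diag_fun (%_. XX))"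

lemma clopens_top: "clopens m (%_. XX)" by (simp add: clopens_def clopen_def)

lemma Id_Mat: "Id m \<in> Mat m m" by (intro fibre_Mat cmat_diag_fun clopens_top)

lemma star_Id [simp]: "star (Id m) = Id m" by (rule diag_fibre_star_mult[OF clopens_top])

lemma coord_Id: "coord (app (Id m) x) (s, k, c) = (if c < m & s \<in> XX then coord x (s, k, c) else 0)"
by (auto simp: coord_diag clopens_top)

lemma Id_mult: "A \<in> Mat m n ==> Id m * A = A"
proof (rule bop_idx_eqI)
fix s k c x j d assume A: "A \<in> Mat m n"
have "coef A (s, k, c) (x, j, d) = 0" if "~ (c < m & s \<in> XX)"
 using that unfolding coef_ent[OF A] using ent_outside[OF A] by auto
thus "coef (Id m * A) (s, k, c) (x, j, d) = coef A (s, k, c) (x, j, d)" by (auto simp: coef_def coord_Id)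
qed

lemma mult_Id: "A \<in> Mat n m ==> A * Id m = A"
using Id_mult[OF Mat_star, of A n m] by (metis star_Id star_simps(1,7))

end

context zero_dim_system
begin

lemma coef_star_mult:
assumes "finite S" "!!p. p ~: S ==> coef A p q = 0 | coef B p r = 0"
shows "coef (star A * B) q r = (\<Sum>p\<in>S. cnj (coef A p q) * coef B p r)"
unfolding coef_mult using assms
by (subst coord_app[of S]) (auto simp: coef_star coef_def[of B])

lemma Mat_cross_op: "F \<in> CA ==> c < n ==> d < m ==> cross_op c d F \<in> Mat n m"
using Mat_comp_op[of "cls (%_. F)" c n d m] by (simp add: comp_op_cls cls_closed seq_const)

text \<open>\<open>star M\<close> involves at level \<open>i\<close> only levels from
  \<open>i\<close> on, and its diagonal blocks are invertible. A vector with a top level is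
  therefore eliminated downwards, the levels above the current one being zero already.\<close>

lemma level_nondeg:
assumes M: "M \<in> Mat m m"
 and low: "!!x i c j d. i < j ==> coef M (x, i, c) (x, j, d) = 0"
 and nd: "!!x. x \<in> XX ==> nondeg m (%c d. cnj (ent M d c 0 x))"
 and supp: "!!y i c. coord \<eta> (y, i, c) ~= 0 ==> y = x & i <= j & c < m"
 and x: "x \<in> XX" and z: "app (star M) \<eta> = 0"
shows "\<eta> = 0"
proof -
have "coord \<eta> (x, i, c) = 0" for i c
proof (induction "nat (j - i)" arbitrary: i c rule: less_induct)
 case less
 show ?case
 proof (cases "i <= j & c < m")
  case True
  have "(\<Sum>d<m. cnj (ent M d c 0 (\<theta> (- i) x)) * coord \<eta> (x, i, d)) = 0" if "c < m" for c
  proof -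
   have "0 = coord (app (star M) \<eta>) (x, i, c)" by (simp add: z)
   also have "... = (\<Sum>l\<in>Pair i ` {..<m}. coef (star M) (x, i, c) (x, l) * coord \<eta> (x, l))"
   proof (rule coord_app_fibre)
    fix y i' d assume p: "y ~= x | (i', d) ~: Pair i ` {..<m}"
    show "coef (star M) (x, i, c) (y, i', d) = 0 | coord \<eta> (y, i', d) = 0"
    proof (rule disjCI)
     assume "coord \<eta> (y, i', d) ~= 0"
     moreover from supp[OF this] have "y = x" "i' <= j" "i' ~= i" using p by auto
     ultimately have "i' < i" using less(1)[of i' d] by force
     thus "coef (star M) (x, i, c) (y, i', d) = 0" using low by (simp add: coef_star \<open>y = x\<close>)
    qed
   qed simp
   also have "... = (\<Sum>d<m. coef (star M) (x, i, c) (x, i, d) * coord \<eta> (x, i, d))"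
    by (subst sum.reindex) (auto simp: inj_on_def)
   also have "... = (\<Sum>d<m. cnj (ent M d c 0 (\<theta> (- i) x)) * coord \<eta> (x, i, d))"
    using that by (intro sum.cong refl) (simp add: coef_star coef_ent[OF M])
   finally show ?thesis by simp
  qed
  moreover have "nondeg m (%c d. cnj (ent M d c 0 (\<theta> (- i) x)))" using nd x by simp
  ultimately show ?thesis
   using True unfolding nondeg_def by (elim allE[of _ "%d. coord \<eta> (x, i, d)"]) blast
 next
  case False
  thus ?thesis using supp by blast
 qed
qed
hence "coord \<eta> (y, i, c) = 0" for y i c using supp by blast
thus ?thesis by (intro ell2_eqI) (auto simp: split_paired_all)
qed

text \<open>The columns of \<open>M\<close> solve the equations of \<open>h\<close> on the half-lines \<open>i >= j\<close>, so \<open>star M * h * M\<close> is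
at once triangular and selfadjoint, hence block diagonal.\<close>

lemma half_line_diagonalization:
assumes h: "h \<in> Mat m m" "star h = h" and M: "M \<in> Mat m m"
 and low: "!!x i c j d. i < j ==> coef M (x, i, c) (x, j, d) = 0"
 and up: "!!x i c j d. x \<in> XX ==> j <= i ==> c < m ==> d < m ==>
  coef (h * M) (x, i, c) (x, j, d) = (if i = j & c = d then 1 else 0)"
obtains a where "cmat m m a" "!!x. x \<in> XX ==> herm m (%i j. a i j x)"
 "!!x. x \<in> XX ==> nondeg m (%i j. a i j x)" "star M * h * M = fibre m m a"
 "!!b. cmat m m b ==> fibre m m b * fibre m m a = Id m ==> fibre m m a * fibre m m b = Id m ==>
   h * M * fibre m m b * star M = Id m"
proof -
define V where "V = h * M"
define a where "a c d = ent M c d 0" for c d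
have V: "V \<in> Mat m m" using h M Mat_mult by (auto simp: V_def)
have ca: "cmat m m a" unfolding a_def by (intro cmatI ent_cfun[OF M])
have E: "star M * V \<in> Mat m m" using V M Mat_mult Mat_star by blast
have Es: "star (star M * V) = star M * V" using h by (simp add: V_def mult.assoc)
have zero: "coef M (x, i, c) (y, j, d) = 0" if "i < j | x ~= y | ~ c < m | ~ d < m" for x i c y j d
 using that low[of i j x c d] by (auto simp: coef_ent[OF M])
have vzero: "coef V (x, i, c) (y, j, d) = 0" if "j < i | x ~= y | ~ c < m | ~ d < m" for x i c y j d
proof (cases "x = y & c < m & d < m & x \<in> XX")
 case True thus ?thesis using that up[of x j i c d] by (auto simp: V_def)
next
 case False thus ?thesis using ent_outside[OF V] by (auto simp: coef_ent[OF V])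
qed
have diag: "ent (star M * V) c d i x = (if i = 0 then cnj (a d c x) else 0)"
 if x: "x \<in> XX" and cd: "c < m" "d < m" and "0 <= i" for i c d x
proof -
 have "ent (star M * V) c d i x = (\<Sum>p\<in>(if i = 0 then {(x, 0, d)} else {}). cnj (coef M p (x, i, c)) * coef V p (x, 0, d))"
  unfolding ent_def
 proof (rule coef_star_mult, unfold split_paired_all)
  fix y :: 'x and k :: int and e :: nat assume p: "(y, k, e) ~: (if i = 0 then {(x, 0, d)} else {})"
  show "coef M (y, k, e) (x, i, c) = 0 | coef V (y, k, e) (x, 0, d) = 0"
   using zero[of k i y x e c] vzero[of 0 k y x e d] up[of x 0 k e d] x cd p \<open>0 <= i\<close>
   by (cases "k < i | 0 < k | y ~= x | ~ e < m") (auto simp: V_def)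
 qed auto
 also have "... = (if i = 0 then cnj (a d c x) else 0)"
  using up[of x 0 0 d d] x cd by (auto simp: a_def ent_def V_def)
 finally show ?thesis .
qed
have star_ent: "ent (star M * V) c d i x = cnj (ent (star M * V) d c (- i) (\<theta> (- i) x))"
 if "c < m" "d < m" for c d i x
proof -
 have "ent (star M * V) c d i x = cnj (coef (star (star M * V)) (x, 0, d) (x, i, c))"
  unfolding ent_def by (simp only: coef_star complex_cnj_cnj)
 thus ?thesis unfolding Es coef_ent[OF E] using that by simp
qed
have hm: "a c d x = cnj (a d c x)" if "x \<in> XX" "c < m" "d < m" for c d x
 using star_ent[of c d 0 x] diag[of x c d 0] diag[of x d c 0] that by simp
have Ea: "star M * V = fibre m m a"
proof (rule Mat_eqI[OF E fibre_Mat[OF ca]])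
 fix c d i x assume x: "x \<in> XX" "c < m" "d < m"
 show "ent (star M * V) c d i x = ent (fibre m m a) c d i x"
 proof (cases "0 <= i")
  case True
  thus ?thesis using diag[OF x True] hm[OF x] x by (auto simp: ent_fibre[OF ca])
 next
  case False
  thus ?thesis using star_ent[of c d i x] diag[of "\<theta> (- i) x" d c "- i"] x
   by (auto simp: ent_fibre[OF ca])
 qed
qed
have nd: "nondeg m (%c d. a c d x)" if x: "x \<in> XX" for x
 unfolding nondeg_def
proof (intro allI impI)
 fix v j assume v: "\<forall>i<m. (\<Sum>j<m. a i j x * v j) = 0" and "j < m"
 \<comment> \<open>For a kernel vector \<open>v\<close> of the diagonal block, the combination
   \<eta> of level-0 columns lives on positive levels only, while \<open>h \<eta>\<close> stops at
   level 0. Then \<open>star V\<close>, triangular with unit diagonal, annihilates \<eta> on all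
   positive levels, which forces \<eta> to vanish upwards; finally level 0 of
   \<open>V \<epsilon>\<close> returns \<open>v\<close>.\<close>
 define \<epsilon> where "\<epsilon> = (\<Sum>d<m. cscl (v d) (unit_vec (x, 0 :: int, d)))"
 define \<eta> where "\<eta> = app M \<epsilon>"
 have co: "coord (app A \<epsilon>) q = (\<Sum>d<m. coef A q (x, 0, d) * v d)" for A q
  by (simp add: \<epsilon>_def app_sum coord_sum coef_def mult.commute)
 have \<eta>: "coord \<eta> (y, i, c) = 0" if "y ~= x | i <= 0 | ~ c < m" for y i c
 proof (cases "y ~= x | i < 0 | ~ c < m")
  case True
  thus ?thesis unfolding \<eta>_def co using zero by (intro sum.neutral) auto
 next
  case False
  hence "i = 0" "y = x" "c < m" using that by auto
  thus ?thesis unfolding \<eta>_def co using v by (simp add: a_def ent_def)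
 qed
 have h\<eta>: "app h \<eta> = app V \<epsilon>" by (simp add: \<eta>_def V_def)
 have h\<eta>0: "coord (app h \<eta>) (y, i, c) = 0" if "y ~= x | 0 < i" for y i c
  unfolding h\<eta> co using vzero that by (intro sum.neutral) auto
 have V\<eta>: "coord (app (star V) \<eta>) (x, i, c) = 0" if "0 < i" for i c
 proof -
  have "app (star V) \<eta> = app (star M) (app h \<eta>)" using h by (simp add: V_def)
  moreover have "coord (app (star M) (app h \<eta>)) (x, i, c) = 0"
  proof (rule coord_app_idx)
   show "coef (star M) (x, i, c) (y, k, e) = 0 | coord (app h \<eta>) (y, k, e) = 0" for y k e
    using zero[of k i y x e c] h\<eta>0[of y k e] that by (cases "k < i") (auto simp: coef_star)
  qed
  ultimately show ?thesis by simp
 qed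
 have "coord \<eta> (x, i, c) = 0" for i c
 proof (induction "nat i" arbitrary: i c rule: less_induct)
  case less
  show ?case
  proof (cases "0 < i & c < m")
   case True
   have "coord (app (star V) \<eta>) (x, i, c) = (\<Sum>l\<in>{(i, c)}. coef (star V) (x, i, c) (x, l) * coord \<eta> (x, l))"
   proof (rule coord_app_fibre)
    fix y k e assume p: "y ~= x | (k, e) ~: {(i, c)}"
    show "coef (star V) (x, i, c) (y, k, e) = 0 | coord \<eta> (y, k, e) = 0"
    proof (rule disjCI)
     assume nz: "coord \<eta> (y, k, e) ~= 0"
     hence y: "y = x" "0 < k" "e < m" using \<eta> by (metis not_le)+
     hence "~ k < i" using less(1)[of k e] nz \<open>0 < i & c < m\<close> by auto
     hence "coef V (y, k, e) (x, i, c) = 0"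
      using up[of x i k e c] x y p \<open>0 < i & c < m\<close> by (auto simp: V_def)
     thus "coef (star V) (x, i, c) (y, k, e) = 0" by (simp only: coef_star complex_cnj_zero)
    qed
   qed simp
   moreover have "coef (star V) (x, i, c) (x, i, c) = 1"
    using True up[of x i i c c] x unfolding coef_star V_def by simp
   ultimately show ?thesis using V\<eta>[of i c] True by simp
  next
   case False thus ?thesis using \<eta>[of x i c] by auto
  qed
 qed
 hence "coord \<eta> (y, i, c) = 0" for y i c using \<eta>[of y i c] by (cases "y = x") auto
 hence "\<eta> = 0" by (intro ell2_eqI) (auto simp: split_paired_all)
 hence "0 = coord (app V \<epsilon>) (x, 0, j)" using h\<eta> by simp
 also have "... = (\<Sum>d<m. if d = j then v d else 0)"
  unfolding co using up[of x 0 0 j] x \<open>j < m\<close> by (intro sum.cong refl) (auto simp: V_def)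
 finally show "v j = 0" using \<open>j < m\<close> by simp
qed
show thesis
proof (rule that[OF ca])
 show "herm m (%i j. a i j x)" if "x \<in> XX" for x using hm[OF that] unfolding herm_def by blast
 show "star M * h * M = fibre m m a" using Ea by (simp add: V_def mult.assoc)
 fix b assume b: "cmat m m b" "fibre m m b * fibre m m a = Id m" "fibre m m a * fibre m m b = Id m"
 \<comment> \<open>The columns of \<open>Q\<close> have a top level and are annihilated by
   \<open>star M\<close>, so \<open>level_nondeg\<close> applies. This upgrades the congruence to an
   explicit inverse of \<open>h\<close> on the other side.\<close>
 define Q where "Q = V * fibre m m b * star M - Id m"
 have QM: "Q \<in> Mat m m" unfolding Q_def
  by (intro Mat_diff Mat_mult[of _ m m] V fibre_Mat[OF b(1)] Mat_star[OF M] Id_Mat)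
 have "star M * V * fibre m m b * star M = star M" unfolding Ea b(3) by (rule Id_mult[OF Mat_star[OF M]])
 hence "star M * Q = 0"
  unfolding Q_def right_diff_distrib mult_Id[OF Mat_star[OF M]] by (simp add: mult.assoc)
 have "coef Q (y, i, c) (x, j, d) = 0" for y i c x j d
 proof (cases "x \<in> XX & d < m")
  case True
  let ?r = "(x, j, d)"
  define \<eta> where "\<eta> = app Q (unit_vec ?r)"
  have "\<eta> = 0"
  proof (rule level_nondeg[OF M low, where x = x and j = j])
   show "app (star M) \<eta> = 0" using \<open>star M * Q = 0\<close> app_simps(5)[of "star M" Q "unit_vec ?r"]
    by (simp add: \<eta>_def)
   show "nondeg m (%c d. cnj (ent M d c 0 y))" if "y \<in> XX" for y
   proof -
    have "cnj (a d c y) = a c d y" if "c < m" "d < m" for c d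
     using hm[OF \<open>y \<in> XX\<close> that] by simp
    hence "(\<Sum>d<m. cnj (a d c y) * v d) = (\<Sum>d<m. a c d y * v d)" if "c < m" for c v
     using that by (intro sum.cong refl) auto
    thus ?thesis using nd[OF that] unfolding nondeg_def a_def by simp
   qed
   fix y i c assume nz: "coord \<eta> (y, i, c) ~= 0"
   hence yc: "y = x & c < m" using coef_ent[OF QM, of y i c x j d] by (auto simp: \<eta>_def coef_def split: if_splits)
   have "i <= j"
   proof (rule ccontr)
    assume ij: "~ i <= j"
    define \<zeta> where "\<zeta> = app (fibre m m b) (app (star M) (unit_vec ?r))"
    have z: "coord \<zeta> (y, k, e) = 0" if "j < k" for y k e
     unfolding \<zeta>_def coord_fibre[OF b(1)] using zero that by (simp add: coef_def[symmetric] coef_star)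
    have "coord (app V \<zeta>) (x, i, c) = 0"
    proof (rule coord_app_idx)
     show "coef V (x, i, c) (y, k, e) = 0 | coord \<zeta> (y, k, e) = 0" for y k e
      using z[of k y e] vzero[of k i x y c e] ij by (cases "j < k") auto
    qed
    moreover have "coord (unit_vec ?r) (x, i, c) = 0" using ij by (simp add: coord_unit_vec)
    ultimately show False using nz yc by (simp add: \<eta>_def Q_def \<zeta>_def coord_Id split: if_splits)
   qed
   with yc show "y = x & i <= j & c < m" by simp
  qed (use True in auto)
  thus ?thesis by (simp add: coef_def \<eta>_def)
 next
  case False
  thus ?thesis using ent_outside[OF QM] by (auto simp: coef_ent[OF QM])
 qed
 hence "Q = 0" by (intro bop_idx_eqI) simp
 thus "h * M * fibre m m b * star M = Id m" by (simp add: Q_def V_def)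
qed (rule nd)
qed

text \<open>The class of coefficient families that can be summed in norm band by band; it is stable
  under all operations used to write down the half-line solution.\<close>

definition expdec :: "real => 'x lau => bool" where
"expdec r \<kappa> <-> (\<forall>i. \<kappa> i \<in> cfun X) & (\<exists>C. \<forall>i x. cmod (\<kappa> i x) <= C * r ^ nat \<bar>i\<bar>)"

text \<open>The bands of degree \<open>k\<close> and \<open>- k\<close> together form a Laurent
  polynomial of norm at most a constant times \<open>r ^ k\<close>, so the series of bands converges
  inside the closed space \<open>Mat n m\<close>.\<close>

lemma band_operator_entry:
assumes r: "0 < r" "r < 1" and \<kappa>: "expdec r \<kappa>" and cd: "c < n" "d < m"
shows "\<exists>A\<in>Mat n m. \<forall>c' d' i x. ent A c' d' i x = (if c' = c & d' = d then \<kappa> i x else 0)"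
proof -
obtain C where C: "!!i x. cmod (\<kappa> i x) <= C * r ^ nat \<bar>i\<bar>" and \<kappa>c: "!!i. \<kappa> i \<in> cfun X"
 using \<kappa> unfolding expdec_def by blast
\<comment> \<open>The signs and the translation undo those in the entry formula of
  \<open>cross_op\<close>, where degree \<open>- i\<close> at the point
  \<open>\<theta> (- i) x\<close> yields the entry of index \<open>i\<close> at
  \<open>x\<close>.\<close>
define F where "F k l = (%x. if nat \<bar>l\<bar> = k then \<kappa> (- l) (\<theta> (- l) x) else 0)" for k l
have supp: "fsupp (F k) \<subseteq> {int k, - int k}" for k by (auto simp: F_def)
have F: "F k \<in> CA" for k
proof -
 have "F k l \<in> cfun X" for l using cfun_theta[OF \<kappa>c] by (cases "nat \<bar>l\<bar> = k") (auto simp: F_def)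
 thus ?thesis unfolding carrier_iff using supp finite_subset by blast
qed
define T where "T k = cross_op c d (F k)" for k
have Tn: "norm (T k) <= 2 * C * r ^ k" for k
proof -
 have le: "cmod (F k l x) <= C * r ^ k" for l x
  using C[of "- l" "\<theta> (- l) x"] order_trans[OF norm_ge_zero C[of "int k" x]] by (auto simp: F_def)
 have "l1_norm X (F k) <= (\<Sum>l\<in>{int k, - int k}. C * r ^ k)"
  unfolding l1_norm_def
 proof (rule order_trans[OF sum_mono sum_mono2[OF _ supp]])
  show "(SUP x\<in>XX. cmod (F k l x)) <= C * r ^ k" for l using nonempty le by (intro cSUP_least) auto
 qed (use order_trans[OF norm_ge_zero le] in auto)
 also have "... <= 2 * C * r ^ k" using order_trans[OF norm_ge_zero le] by (cases "k = 0") auto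
 finally show ?thesis using norm_cross_op_l1[OF F, of c d k] by (simp add: T_def)
qed
have sT: "summable T"
 by (rule summable_norm_cancel, rule summable_comparison_test'[OF summable_mult[OF summable_geometric]])
  (use Tn r in auto)
have "suminf T \<in> Mat n m"
 by (rule closed_sequentially[OF Mat_closed _ summable_LIMSEQ[OF sT]]) (intro Mat_sum, simp add: T_def Mat_cross_op F cd)
moreover have "ent (suminf T) c' d' i x = (if c' = c & d' = d then \<kappa> i x else 0)" for c' d' i x
proof -
 have lin: "bounded_linear (%A. ent A c' d' i x)"
  unfolding ent_def coef_def
  by (rule bounded_linear_compose[OF bounded_linear_coord bounded_linear_app_left])
 have eT: "ent (T k) c' d' i x = (if k = nat \<bar>i\<bar> then if c' = c & d' = d then \<kappa> i x else 0 else 0)" for k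
  unfolding ent_def T_def coef_cross_op[OF F] by (auto simp: F_def)
 have "ent (suminf T) c' d' i x = (suminf (%k. ent (T k) c' d' i x))"
  by (rule bounded_linear.suminf[OF lin sT])
 also have "... = (\<Sum>k\<in>{nat \<bar>i\<bar>}. ent (T k) c' d' i x)" by (rule suminf_finite) (auto simp: eT)
 finally show ?thesis by (simp add: eT)
qed
ultimately show ?thesis by blast
qed

lemma band_operator:
assumes r: "0 < r" "r < 1" and \<kappa>: "!!c d. c < n ==> d < m ==> expdec r (\<kappa> c d)"
obtains A where "A \<in> Mat n m" "!!c d i x. c < n ==> d < m ==> ent A c d i x = \<kappa> c d i x"
proof -
have "\<exists>A. c < n --> d < m --> A \<in> Mat n m &
  (\<forall>c' d' i x. ent A c' d' i x = (if c' = c & d' = d then \<kappa> c d i x else 0))" for c d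
proof (cases "c < n & d < m")
 case True
 hence cd: "c < n" "d < m" by auto
 from band_operator_entry[OF r \<kappa>[OF cd] cd] show ?thesis by blast
qed blast
then obtain A where A: "!!c d. c < n ==> d < m ==> A c d \<in> Mat n m" "!!c d c' d' i x. c < n ==> d < m ==>
  ent (A c d) c' d' i x = (if c' = c & d' = d then \<kappa> c d i x else 0)" by metis
show thesis
proof (rule that)
 show "(\<Sum>c<n. \<Sum>d<m. A c d) \<in> Mat n m" by (intro Mat_sum A) auto
 fix c d i x assume cd: "c < n" "d < m"
 have "ent (\<Sum>c<n. \<Sum>d<m. A c d) c d i x = (\<Sum>c'<n. \<Sum>d'<m. ent (A c' d') c d i x)"
  by (simp add: ent_def coef_sum)
 also have "... = (\<Sum>c'<n. \<Sum>d'<m. if d' = d then if c' = c then \<kappa> c d i x else 0 else 0)"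
  using A(2) by (intro sum.cong refl) auto
 finally show "ent (\<Sum>c<n. \<Sum>d<m. A c d) c d i x = \<kappa> c d i x" using cd by simp
qed
qed

end

section \<open>The edge equations of a banded operator on a half-line\<close>

lemma orthogonal_card_le:
fixes F :: "'k => 'v :: real_inner"
assumes "finite T" "F ` I \<subseteq> span T" "!!i. i \<in> I ==> F i ~= 0"
 and o: "!!i j. i \<in> I ==> j \<in> I ==> i ~= j ==> inner (F i) (F j) = 0"
shows "card I <= card T"
proof -
have "inj_on F I" using assms(3) o by (intro inj_onI) (metis inner_eq_zero_iff)
moreover have "independent (F ` I)"
 using assms(3) o by (intro pairwise_orthogonal_independent) (auto simp: pairwise_def orthogonal_def)
ultimately show ?thesis using independent_span_bound[OF assms(1)] assms(2) by (metis card_image)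
qed

definition half :: "'x idx bop" where
"half = wop (%(y, i, c). if 0 <= i then 1 else 0) id"

lemma coord_half: "coord (app half \<eta>) (y, i, c) = (if 0 <= i then coord \<eta> (y, i, c) else 0)"
unfolding half_def by (subst wop_aux(1)[where C = 1]) (auto split: prod.splits)

lemma star_half: "star half = half"
by (rule bop_idx_eqI) (simp add: coef_star, auto simp: coef_def coord_half coord_unit_vec)

context zero_dim_system
begin

lemma coef_cfun: "A \<in> Mat n m ==> (%x. coef A (x, p) (x, q)) \<in> cfun X"
proof -
assume A: "A \<in> Mat n m"
obtain i c j d where "p = (i, c)" "q = (j, d)" by (metis prod.collapse)
thus ?thesis using cfun_theta[OF ent_cfun[OF A], of c d "i - j" "- j"]
 by (cases "c < n & d < m") (auto simp: coef_ent[OF A])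
qed

end

text \<open>\<open>h\<close> is the banded selfadjoint approximation of a symmetry; its inverse
  \<open>g\<close> is in general not banded but has exponentially decaying coefficients.\<close>

locale band_inverse = zero_dim_system X \<theta> for X :: "'x topology" and \<theta> +
fixes n D :: nat and h g :: "'x idx bop" and \<rho> :: real
assumes n: "0 < n" and D: "0 < D" and h_Mat: "h \<in> Mat n n" and star_h: "star h = h"
 and band: "int D < \<bar>i\<bar> ==> ent h c d i x = 0"
 and g_Mat: "g \<in> Mat n n" and hg: "h * g = Id n" and gh: "g * h = Id n"
 and \<rho>: "0 < \<rho>" "\<rho> < 1" and g_dec: "expdec \<rho> (ent g c d)"
begin

abbreviation "N \<equiv> D * n"

definition blk :: "int => int => (int \<times> nat) set" where "blk a b = {a..<b} \<times> {..<n}"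

text \<open>Enumerates the sites to the left of the half-line, level \<open>-1\<close> first. The
  first \<open>N\<close> of them fill the \<open>D\<close> levels that \<open>h\<close> reaches from
  the half-line, the first \<open>2 * N\<close> fill \<open>2 * D\<close> levels.\<close>

definition pos :: "nat => int \<times> nat" where "pos k = (- int (k div n) - 1, k mod n)"

lemma finite_blk [simp]: "finite (blk a b)" by (simp add: blk_def)

lemma mem_blk [simp]: "(i, c) \<in> blk a b <-> a <= i & i < b & c < n" by (auto simp: blk_def)

lemma pos_inj: "pos k = pos l ==> k = l"
proof -
assume "pos k = pos l"
hence "k div n = l div n" "k mod n = l mod n" by (auto simp: pos_def)
thus "k = l" by (metis div_mult_mod_eq)
qed

lemma pos_blk: "pos ` {..<K * n} = blk (- int K) 0"
proof (intro equalityI subsetI)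
fix p assume "p \<in> pos ` {..<K * n}"
then obtain k where k: "p = pos k" "k < K * n" by auto
hence "k div n < K" using n by (simp add: less_mult_imp_div_less)
thus "p \<in> blk (- int K) 0" using k n by (simp add: pos_def)
next
fix p assume p: "p \<in> blk (- int K) 0"
obtain i c where ic: "p = (i, c)" by (metis prod.collapse)
define k where "k = nat (- i - 1) * n + c"
have "pos k = p" using p n by (simp add: pos_def k_def ic)
moreover have "nat (- i - 1) + 1 <= K" using p unfolding ic mem_blk by arith
hence "(nat (- i - 1) + 1) * n <= K * n" by (rule mult_right_mono) simp
hence "k < K * n" using p by (simp add: k_def ic)
ultimately show "p \<in> pos ` {..<K * n}" by auto
qed

lemma coef_h_zero: "y ~= x | int D < \<bar>i - j\<bar> | ~ c < n | ~ d < n ==> coef h (x, i, c) (y, j, d) = 0"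
by (auto simp: coef_ent[OF h_Mat] band)

lemma coef_g_zero: "y ~= x | ~ c < n | ~ d < n ==> coef g (x, i, c) (y, j, d) = 0"
by (auto simp: coef_ent[OF g_Mat])

lemma star_g: "star g = g"
proof -
have "star g * h = Id n" using arg_cong[OF hg, of star] by (simp add: star_h)
hence "star g * (h * g) = Id n * g" by (metis mult.assoc)
thus ?thesis by (simp add: hg mult_Id[OF Mat_star[OF g_Mat]] Id_mult[OF g_Mat])
qed

lemma coef_h_cnj: "cnj (coef h q r) = coef h r q" and coef_g_cnj: "cnj (coef g q r) = coef g r q"
using coef_star[of h r q] coef_star[of g r q] by (simp_all add: star_h star_g)

lemma hg_sum:
assumes "x \<in> XX" "c < n"
shows "(\<Sum>l\<in>blk (i - int D) (i + int D + 1). coef h (x, i, c) (x, l) * coef g (x, l) (x, q)) =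
 (if q = (i, c) then 1 else 0)"
proof -
have "coord (app h (app g (unit_vec (x, q)))) (x, i, c) =
  (\<Sum>l\<in>blk (i - int D) (i + int D + 1). coef h (x, i, c) (x, l) * coord (app g (unit_vec (x, q))) (x, l))"
proof (rule coord_app_fibre)
 fix y j d assume "y ~= x | (j, d) ~: blk (i - int D) (i + int D + 1)"
 thus "coef h (x, i, c) (y, j, d) = 0 | coord (app g (unit_vec (x, q))) (y, j, d) = 0"
  using coef_h_zero[of y x i j c d] by auto
qed simp
moreover have "coord (app h (app g (unit_vec (x, q)))) (x, i, c) = coord (app (Id n) (unit_vec (x, q))) (x, i, c)"
 using hg by (metis app_simps(5))
ultimately show ?thesis using assms by (auto simp: coef_def coord_Id coord_unit_vec)
qed

text \<open>An obstruction to solving the edge equations with parameter \<open>t\<close>. The image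
  under \<open>g\<close> has to vanish on \<open>2 * D\<close> levels because then cutting it off at
  level 0 does not affect \<open>h\<close> on the levels from \<open>- D\<close> on.\<close>

definition edge :: "'x => real => ('x idx) ell2 => bool" where
"edge x t v <-> (\<forall>y i c. coord v (y, i, c) ~= 0 --> y = x & - int D <= i & i < 0 & c < n) &
  (\<forall>i c. - (2 * int D) <= i --> i < 0 --> coord (app g (t *r v + app half (app h v))) (x, i, c) = 0)"

lemma edge_solution:
assumes x: "x \<in> XX" and v: "edge x t v" and i: "- int D <= i"
shows "coord (app h (app half (app g (t *r v + app half (app h v))))) (y, i, c) =
 coord (t *r v + app half (app h v)) (y, i, c)"
proof -
define u where "u = t *r v + app half (app h v)"
define w where "w = app g u"
have v0: "coord v (y, i, c) = 0" if "y ~= x | ~ c < n" for y i c using v that unfolding edge_def by blast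
have hv0: "coord (app h v) (y, i, c) = 0" if "y ~= x | ~ c < n" for y i c
proof (rule coord_app_idx)
 fix y' j d
 show "coef h (y, i, c) (y', j, d) = 0 | coord v (y', j, d) = 0"
  using that v0[of y' d j] coef_h_zero[of y' y i j c d] by auto
qed
have u0: "coord u (y, i, c) = 0" if "y ~= x | ~ c < n" for y i c
 using v0[OF that] hv0[OF that] by (simp add: u_def coord_half)
have w0: "coord w (y, i, c) = 0" if "y ~= x" for y i c unfolding w_def
proof (rule coord_app_idx)
 fix y' j d
 show "coef g (y, i, c) (y', j, d) = 0 | coord u (y', j, d) = 0"
  using that u0[of y' d j] coef_g_zero[of y' y c d i j] by auto
qed
have "coord (app h (w - app half w)) (y, i, c) = 0"
proof (rule coord_app_idx)
 fix y' j d
 show "coef h (y, i, c) (y', j, d) = 0 | coord (w - app half w) (y', j, d) = 0"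
 proof (cases "int D < \<bar>i - j\<bar>")
  case True thus ?thesis using coef_h_zero[of y' y i j c d] by simp
 next
  case False
  hence "- (2 * int D) <= j" using i by simp
  hence "j < 0 ==> coord w (x, j, d) = 0"
   using v unfolding edge_def w_def u_def by blast
  thus ?thesis using w0[of y' j d] by (cases "y' = x") (auto simp: coord_half)
 qed
qed
hence "coord (app h (app half w)) (y, i, c) = coord (app (h * g) u) (y, i, c)" by (simp add: w_def)
also have "... = coord u (y, i, c)" using u0[of y c i] x by (auto simp: hg coord_Id)
finally show ?thesis by (simp add: w_def u_def)
qed

text \<open>Obstructions behave like eigenvectors of a symmetric problem with eigenvalue
  \<open>t\<close>. With \<open>w\<close> the cut-off image under \<open>g\<close>, the symmetric
  form \<open>inner w (h w')\<close> equals \<open>t * inner v v'\<close> and, read the other way,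
  \<open>t' * inner v v'\<close>.\<close>

lemma edge_orthogonal:
assumes x: "x \<in> XX" and v: "edge x t v" and v': "edge x t' v'" and "t ~= t'"
shows "inner v v' = 0"
proof -
define w where "w = (%t v. app half (app g (t *r v + app half (app h v))))"
have key: "inner (w t v) (app h (w t' v')) = t * inner v v'" if v: "edge x t v" and v': "edge x t' v'" for t t' v v'
proof -
 have hh: "app half (w t v) = w t v" for t v
  by (rule ell2_eqI) (auto simp: w_def coord_half split_paired_all)
 have "app half (app h (w t' v')) = app half (app h v')"
 proof (rule ell2_eqI, clarify)
  fix y i c
  have "coord v' (y, i, c) = 0" if "0 <= i" using v' that unfolding edge_def by (meson not_le)
  thus "coord (app half (app h (w t' v'))) (y, i, c) = coord (app half (app h v')) (y, i, c)"
   using edge_solution[OF x v', of i y c] by (auto simp: w_def coord_half)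
 qed
 hence "inner (w t v) (app h (w t' v')) = inner (w t v) (app h v')"
  using star_inner[of half "w t v"] star_half hh by metis
 also have "... = inner (app h (w t v)) v'" by (metis star_inner star_h)
 also have "inner (app h (w t v) - t *r v) v' = 0"
 proof (rule inner_eq_0_disjoint, clarify)
  fix y i c assume "coord v' (y, i, c) ~= 0"
  hence "- int D <= i" "i < 0" using v' unfolding edge_def by blast+
  thus "coord (app h (w t v) - t *r v) (y, i, c) = 0"
   using edge_solution[OF x v, of i y c] by (simp add: w_def coord_half)
 qed
 hence "inner (app h (w t v)) v' = t * inner v v'" by (simp add: inner_diff_left)
 finally show ?thesis .
qed
have "t * inner v v' = inner (app h (w t v)) (w t' v')" using key[OF v v'] by (metis star_inner star_h)
also have "... = t' * inner v' v" using key[OF v' v] by (simp add: inner_commute)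
finally show ?thesis using \<open>t ~= t'\<close> by (simp add: inner_commute)
qed

text \<open>The coefficient matrix of the edge equations: row \<open>p\<close> is the equation at
  the site \<open>pos p\<close>, and column \<open>q\<close> is the contribution of the column of
  \<open>g\<close> at \<open>pos q\<close>. With \<open>p < N\<close> and \<open>q < 2 * N\<close>
  the system is underdetermined.\<close>

definition Xi :: "complex => 'x => nat => nat => complex" where
"Xi t x p q = t * coef g (x, pos p) (x, pos q) +
  (\<Sum>l\<in>blk 0 (int D). coef h (x, pos p) (x, l) * coef g (x, l) (x, pos q))"

text \<open>\<open>Xi\<close> times its adjoint. When it is invertible, the adjoint of
  \<open>Xi\<close> times its inverse is a right inverse of \<open>Xi\<close> that depends
  continuously on the point.\<close>

definition gram :: "complex => 'x => nat => nat => complex" where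
"gram t x p p' = (\<Sum>q<2 * N. Xi t x p q * cnj (Xi t x p' q))"

text \<open>A kernel vector of a Gram matrix is annihilated by the adjoint of \<open>Xi\<close>. In
  coordinates, using that \<open>h\<close> and \<open>g\<close> are selfadjoint, this is the
  vanishing condition in \<open>edge\<close>.\<close>

lemma edge_from_kernel:
assumes x: "x \<in> XX" and deg: "~ nondeg N (gram (of_real t) x)"
obtains v where "edge x t v" "v ~= 0"
proof -
let ?X = "Xi (of_real t) x"
obtain a j where a: "!!p. p < N ==> (\<Sum>p'<N. gram (of_real t) x p p' * a p') = 0" "j < N" "a j ~= 0"
 using deg unfolding nondeg_def by blast
define s where "s q = (\<Sum>p<N. cnj (?X p q) * a p)" for q
have "(\<Sum>q<2 * N. cnj (s q) * s q) = (\<Sum>q<2 * N. \<Sum>p<N. \<Sum>p'<N. cnj (a p) * (?X p q * cnj (?X p' q) * a p'))"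
proof (rule sum.cong[OF refl])
 fix q
 have c: "cnj (s q) = (\<Sum>p<N. ?X p q * cnj (a p))" by (simp add: s_def)
 show "cnj (s q) * s q = (\<Sum>p<N. \<Sum>p'<N. cnj (a p) * (?X p q * cnj (?X p' q) * a p'))"
  unfolding c unfolding s_def sum_product by (simp only: mult_ac)
qed
also have "... = (\<Sum>p<N. cnj (a p) * (\<Sum>p'<N. gram (of_real t) x p p' * a p'))"
proof -
 have "(\<Sum>q<2 * N. \<Sum>p'<N. cnj (a p) * (?X p q * cnj (?X p' q) * a p')) =
   cnj (a p) * (\<Sum>p'<N. gram (of_real t) x p p' * a p')" for p
  unfolding gram_def sum_distrib_left sum_distrib_right by (rule sum.swap)
 thus ?thesis by (subst sum.swap) (simp only:)
qed
also have "... = 0" using a(1) by simp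
finally have "complex_of_real (\<Sum>q<2 * N. (cmod (s q))\<^sup>2) = 0"
 unfolding of_real_sum complex_norm_square by (simp only: mult.commute)
hence "(\<Sum>q<2 * N. (cmod (s q))\<^sup>2) = 0" by (simp only: of_real_eq_0_iff)
hence s0: "s q = 0" if "q < 2 * N" for q using that by (subst (asm) sum_nonneg_eq_0_iff) auto
define v where "v = (\<Sum>p<N. cscl (a p) (unit_vec (x, pos p)))"
have Av: "coord (app A v) q = (\<Sum>p<N. coef A q (x, pos p) * a p)" for A q
 by (simp add: v_def app_sum coord_sum coef_def mult.commute)
have v: "coord v (y, l) = (\<Sum>p<N. if y = x & l = pos p then a p else 0)" for y l
 unfolding v_def coord_sum coord_cscl coord_unit_vec by (intro sum.cong) auto
have vs: "y = x & l \<in> blk (- int D) 0" if "coord v (y, l) ~= 0" for y l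
proof -
 have "~ (\<forall>p\<in>{..<N}. (if y = x & l = pos p then a p else 0) = 0)"
  using that unfolding v by (rule contrapos_nn) (rule sum.neutral)
 then obtain p where "p < N" "y = x" "l = pos p" by (auto split: if_splits)
 thus ?thesis using pos_blk[of D] by blast
qed
have hv: "coord (app half (app h v)) (y, l) = 0" if "y ~= x | l ~: blk 0 (int D)" for y l
proof -
 obtain i c where l: "l = (i, c)" by (metis prod.collapse)
 have "coord (app h v) (y, i, c) = 0" if "0 <= i"
 proof (rule coord_app_idx)
  fix y' j d show "coef h (y, i, c) (y', j, d) = 0 | coord v (y', j, d) = 0"
   using vs[of y' "(j, d)"] coef_h_zero[of y' y i j c d] \<open>y ~= x | l ~: blk 0 (int D)\<close> that by (auto simp: l)
 qed
 thus ?thesis by (auto simp: l coord_half)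
qed
have "edge x t v" unfolding edge_def
proof (intro conjI allI impI)
 fix y i c assume "coord v (y, i, c) ~= 0"
 from vs[OF this] show "y = x" "- int D <= i" "i < 0" "c < n" by auto
next
 fix i c assume i: "- (2 * int D) <= i" "i < 0"
 show "coord (app g (t *r v + app half (app h v))) (x, i, c) = 0"
 proof (cases "c < n")
  case False
  thus ?thesis using coef_g_zero by (intro coord_app_idx) auto
 next
  case True
  hence "(i, c) \<in> pos ` {..<(2 * D) * n}" using i by (simp add: pos_blk)
  then obtain q where q: "q < 2 * N" "(i, c) = pos q" by (auto simp: mult.assoc)
  have "coord (app g (app half (app h v))) (x, pos q) =
    (\<Sum>l\<in>blk 0 (int D). coef g (x, pos q) (x, l) * (\<Sum>p<N. coef h (x, l) (x, pos p) * a p))"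
  proof (subst coord_app_fibre)
   show "coef g (x, pos q) (y, j, d) = 0 | coord (app half (app h v)) (y, j, d) = 0"
    if "y ~= x | (j, d) ~: blk 0 (int D)" for y j d using hv[OF that] by simp
   show "(\<Sum>l\<in>blk 0 (int D). coef g (x, pos q) (x, l) * coord (app half (app h v)) (x, l)) =
    (\<Sum>l\<in>blk 0 (int D). coef g (x, pos q) (x, l) * (\<Sum>p<N. coef h (x, l) (x, pos p) * a p))"
    by (rule sum.cong) (auto simp: coord_half Av)
  qed simp
  also have "... = (\<Sum>p<N. (\<Sum>l\<in>blk 0 (int D). coef h (x, l) (x, pos p) * coef g (x, pos q) (x, l)) * a p)"
   unfolding sum_distrib_left sum_distrib_right by (subst sum.swap) (simp only: mult_ac)
  finally have "coord (app g (t *r v + app half (app h v))) (x, pos q) = s q"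
   unfolding s_def Xi_def
   by (simp add: Av scaleR_conv_of_real coef_h_cnj coef_g_cnj sum_distrib_left sum.distrib algebra_simps)
  thus ?thesis using s0[OF q(1)] q(2) by simp
 qed
qed
moreover have "coord v (x, pos j) = a j"
proof -
 have "coord v (x, pos j) = (\<Sum>p<N. if p = j then a p else 0)"
  unfolding v using pos_inj by (intro sum.cong) auto
 thus ?thesis using a(2) by simp
qed
ultimately show thesis using a(3) by (intro that[of v]) auto
qed

text \<open>Otherwise the \<open>2 * N + 1\<close> parameters \<open>0, ..., 2 * N\<close> would
  yield as many nonzero orthogonal vectors in a real space spanned by \<open>2 * N\<close>
  vectors.\<close>

lemma edge_nondeg:
assumes x: "x \<in> XX"
obtains t where "nondeg N (gram (of_nat t) x)"
proof (rule ccontr)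
assume "~ thesis"
hence "\<exists>v. edge x (real t) v & v ~= 0" for t
 using edge_from_kernel[OF x, of "real t"] \<open>!!t. nondeg N (gram (of_nat t) x) ==> thesis\<close> by (metis of_real_of_nat_eq)
then obtain v where v: "!!t. edge x (real t) (v t)" "!!t. v t ~= 0" by metis
define T where "T = (%p. unit_vec (x, pos p)) ` {..<N} \<union> (%p. cscl \<i> (unit_vec (x, pos p))) ` {..<N}"
have sp: "u \<in> span T" if "edge x t u" for t u
proof -
 have "u = (\<Sum>p<N. Re (coord u (x, pos p)) *r unit_vec (x, pos p) + Im (coord u (x, pos p)) *r cscl \<i> (unit_vec (x, pos p)))"
  (is "_ = ?s")
 proof (rule ell2_eqI)
  fix q :: "'x idx" obtain y l where q: "q = (y, l)" by (metis prod.collapse)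
  have "coord ?s q = (\<Sum>p<N. if y = x & l = pos p then coord u (x, pos p) else 0)"
   unfolding coord_sum by (intro sum.cong) (auto simp: q coord_unit_vec complex_eq_iff)
  also have "... = coord u q"
  proof (cases "y = x & l \<in> pos ` {..<N}")
   case True
   then obtain k where k: "k < N" "l = pos k" "y = x" by auto
   have "(\<Sum>p<N. if y = x & l = pos p then coord u (x, pos p) else 0) = (\<Sum>p<N. if p = k then coord u (x, pos p) else 0)"
    using k pos_inj by (intro sum.cong) auto
   thus ?thesis using k by (simp add: q)
  next
   case False
   obtain i c where "l = (i, c)" by (metis prod.collapse)
   with False have "coord u q = 0" using that unfolding edge_def pos_blk q by (metis mem_blk)
   thus ?thesis using False by (intro trans[OF sum.neutral]) auto
  qed
  finally show "coord u q = coord ?s q" by simp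
 qed
 moreover have "?s \<in> span T"
  by (intro span_sum span_add span_scale span_base) (auto simp: T_def)
 ultimately show ?thesis by simp
qed
have "card {..2 * N} <= card T"
proof (rule orthogonal_card_le)
 show "v ` {..2 * N} \<subseteq> span T" using sp v(1) by blast
 show "inner (v i) (v j) = 0" if "i ~= j" for i j using edge_orthogonal[OF x v(1) v(1)] that by simp
qed (use v(2) in "auto simp: T_def")
moreover have "card T <= N + N"
 unfolding T_def by (intro order_trans[OF card_Un_le] add_mono order_trans[OF card_image_le]) auto
ultimately show False by simp
qed

text \<open>A parameter that is good at a point stays good nearby, so it can be selected locally
  constantly; \<open>t\<close> is then a real continuous function and the Gram matrices have a
  continuous inverse.\<close>

lemma edge_solvable:
obtains t R where "t \<in> cfun X" "!!x. cnj (t x) = t x" "!!q p. q < 2 * N ==> p < N ==> R q p \<in> cfun X"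
 "!!x p p'. x \<in> XX ==> p < N ==> p' < N ==>
   (\<Sum>q<2 * N. Xi (t x) x p q * R q p' x) = (if p = p' then 1 else 0)"
proof -
have Xi_cfun: "(%x. Xi (t x) x p q) \<in> cfun X" if "t \<in> cfun X" for t p q
 unfolding Xi_def by (intro cfun_add cfun_mult cfun_sum that coef_cfun[OF g_Mat] coef_cfun[OF h_Mat])
have gram_cfun: "cmat N N (%p p' x. gram (t x) x p p')" if "t \<in> cfun X" for t
 unfolding gram_def by (intro cmatI cfun_sum cfun_mult cfun_cnj Xi_cfun that)
have gram_herm: "herm N (gram t x)" for t x
 unfolding herm_def gram_def by (simp add: mult.commute)
have const: "(%x. if x \<in> XX then of_nat (\<sigma> x) else 0) \<in> cfun X" if "loc_const \<sigma>" for \<sigma> :: "'x => nat"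
proof (rule cfun_loc_const)
 show "loc_const (%x. if x \<in> XX then of_nat (\<sigma> x) else (0 :: complex))"
  using that unfolding loc_const_iff
 proof (intro allI)
  fix v :: complex assume a: "\<forall>v. openin X {x \<in> XX. \<sigma> x = v}"
  have "{x \<in> XX. (if x \<in> XX then of_nat (\<sigma> x) else 0) = v} = {x \<in> XX. \<sigma> x \<in> {k. of_nat k = v}}" by auto
  thus "openin X {x \<in> XX. (if x \<in> XX then of_nat (\<sigma> x) else 0) = v}"
   using loc_const_open[OF that, of "{k. of_nat k = v}"] by (simp only: mem_Collect_eq)
 qed
qed simp
have "\<exists>c W. openin X W & x \<in> W & (\<forall>y\<in>W. nondeg N (gram (of_nat c) y))" if x: "x \<in> XX" for x
proof -
 obtain t where "nondeg N (gram (of_nat t) x)" using edge_nondeg[OF x] by blast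
 moreover have "(%x. if x \<in> XX then of_nat t else 0) \<in> cfun X" using const[of "%_. t"] by simp
 ultimately obtain U where "openin X U" "x \<in> U" "\<forall>y\<in>U. nondeg N (gram (if y \<in> XX then of_nat t else 0) y)"
  using nondeg_near[OF gram_cfun x, of "%y. if y \<in> XX then of_nat t else 0"] gram_herm x by auto
 moreover have "nondeg N (gram (of_nat t) y)" if "y \<in> U" for y
 proof -
  have "y \<in> XX" using calculation(1) that openin_subset by blast
  thus ?thesis using calculation(3) that by auto
 qed
 ultimately show ?thesis by blast
qed
from loc_const_selection[OF this] obtain \<sigma> where \<sigma>: "loc_const \<sigma>"
 "!!x. x \<in> XX ==> nondeg N (gram (of_nat (\<sigma> x)) x)" by blast
define t where "t x = (if x \<in> XX then of_nat (\<sigma> x) else (0 :: complex))" for x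
have t: "t \<in> cfun X" unfolding t_def by (rule const[OF \<sigma>(1)])
have "herm N (%p p'. gram (t x) x p p') & nondeg N (%p p'. gram (t x) x p p')" if "x \<in> XX" for x
 using gram_herm \<sigma>(2)[OF that] that by (simp add: t_def)
from cmat_herm_inverse[OF gram_cfun[OF t] this] obtain B where B: "cmat N N B"
 "!!x. x \<in> XX ==> inverse_matrix N (%p p'. gram (t x) x p p') (%p p'. B p p' x)" by blast
show thesis
proof (rule that[OF t])
 show "cnj (t x) = t x" for x by (simp add: t_def)
 show "(%x. \<Sum>p'<N. cnj (Xi (t x) x p' q) * B p' p x) \<in> cfun X" if "p < N" for q p
  using that by (intro cfun_sum cfun_mult cfun_cnj Xi_cfun t cmatD[OF B(1)]) auto
 fix x p p' assume "x \<in> XX" "p < N" "p' < N"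
 hence "(\<Sum>p''<N. gram (t x) x p p'' * B p'' p' x) = (if p = p' then 1 else 0)"
  using B(2) unfolding inverse_matrix_def by blast
 moreover have "(\<Sum>q<2 * N. Xi (t x) x p q * (\<Sum>p''<N. cnj (Xi (t x) x p'' q) * B p'' p' x)) =
   (\<Sum>p''<N. gram (t x) x p p'' * B p'' p' x)"
  unfolding gram_def sum_distrib_left sum_distrib_right by (subst sum.swap) (simp only: mult.assoc)
 ultimately show "(\<Sum>q<2 * N. Xi (t x) x p q * (\<Sum>p''<N. cnj (Xi (t x) x p'' q) * B p'' p' x)) = (if p = p' then 1 else 0)"
  by simp
qed
qed

end

section \<open>Closure properties of exponentially decaying families\<close>

context zero_dim_system
begin

lemma expdecI:
"(!!i. \<kappa> i \<in> cfun X) ==> (!!i x. cmod (\<kappa> i x) <= C * r ^ nat \<bar>i\<bar>) ==> expdec r \<kappa>"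
unfolding expdec_def by blast

lemma expdec_bound:
assumes "expdec r \<kappa>" "0 < r"
obtains C where "0 <= C" "!!i x. cmod (\<kappa> i x) <= C * r ^ nat \<bar>i\<bar>"
proof -
obtain C where C: "!!i x. cmod (\<kappa> i x) <= C * r ^ nat \<bar>i\<bar>" using assms unfolding expdec_def by blast
have "0 <= cmod (\<kappa> 0 undefined)" by simp
also have "... <= C" using C[of 0 undefined] by simp
finally show thesis using C that by blast
qed

lemma expdec_add:
assumes "expdec r \<kappa>" "expdec r \<kappa>'" shows "expdec r (%i x. \<kappa> i x + \<kappa>' i x)"
proof -
obtain C C' where "!!i x. cmod (\<kappa> i x) <= C * r ^ nat \<bar>i\<bar>" "!!i x. cmod (\<kappa>' i x) <= C' * r ^ nat \<bar>i\<bar>"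
 using assms unfolding expdec_def by blast
hence "cmod (\<kappa> i x + \<kappa>' i x) <= (C + C') * r ^ nat \<bar>i\<bar>" for i x
 unfolding distrib_right by (rule norm_triangle_mono)
thus ?thesis using assms by (intro expdecI cfun_add) (auto simp: expdec_def)
qed

lemma expdec_zero: "expdec r (%i x. 0)"
by (rule expdecI[where C = 0]) auto

lemma expdec_sum: "finite K ==> (!!k. k \<in> K ==> expdec r (\<kappa> k)) ==> expdec r (%i x. \<Sum>k\<in>K. \<kappa> k i x)"
by (induction K rule: finite_induct) (auto intro: expdec_add expdec_zero)

lemma expdec_mult:
assumes "expdec r \<kappa>" "0 < r" and a: "!!i. a i \<in> cfun X" "!!i x. cmod (a i x) <= B"
shows "expdec r (%i x. a i x * \<kappa> i x)"
proof -
obtain C where C: "0 <= C" "!!i x. cmod (\<kappa> i x) <= C * r ^ nat \<bar>i\<bar>"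
 using expdec_bound[OF assms(1,2)] by blast
have "0 <= B" using a(2)[of undefined undefined] norm_ge_zero order_trans by blast
hence "cmod (a i x * \<kappa> i x) <= (B * C) * r ^ nat \<bar>i\<bar>" for i x
 unfolding norm_mult mult.assoc using a(2) C by (intro mult_mono) auto
thus ?thesis using assms by (intro expdecI cfun_mult) (auto simp: expdec_def)
qed

lemma expdec_mult_cfun:
assumes "expdec r \<kappa>" "0 < r" "f \<in> cfun X" shows "expdec r (%i x. \<kappa> i x * f x)"
proof -
have "expdec r (%i x. f x * \<kappa> i x)"
 by (rule expdec_mult[OF assms(1,2)]) (rule assms(3), rule cfun_bound(2)[OF assms(3)])
thus ?thesis by (simp only: mult.commute)
qed

lemma expdec_if: "expdec r \<kappa> ==> 0 < r ==> expdec r (%i x. if P i then \<kappa> i x else 0)"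
proof -
assume \<kappa>: "expdec r \<kappa>" "0 < r"
then obtain C where C: "0 <= C" "!!i x. cmod (\<kappa> i x) <= C * r ^ nat \<bar>i\<bar>"
 using expdec_bound by blast
have "(%x. if P i then \<kappa> i x else 0) \<in> cfun X" for i using \<kappa>(1) by (cases "P i") (auto simp: expdec_def)
thus ?thesis using C \<kappa>(2) by (intro expdecI[of _ C]) auto
qed

lemma expdec_shift:
assumes "expdec r \<kappa>" "0 < r" "r < 1" shows "expdec r (%i. \<kappa> (i + s))"
proof -
obtain C where C: "0 <= C" "!!i x. cmod (\<kappa> i x) <= C * r ^ nat \<bar>i\<bar>"
 using expdec_bound[OF assms(1,2)] by blast
have "cmod (\<kappa> (i + s) x) <= (C / r ^ nat \<bar>s\<bar>) * r ^ nat \<bar>i\<bar>" for i x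
proof -
 have "nat \<bar>i\<bar> <= nat \<bar>i + s\<bar> + nat \<bar>s\<bar>" by linarith
 hence "r ^ (nat \<bar>i + s\<bar> + nat \<bar>s\<bar>) <= r ^ nat \<bar>i\<bar>" using assms by (intro power_decreasing) auto
 hence "r ^ nat \<bar>i + s\<bar> <= r ^ nat \<bar>i\<bar> / r ^ nat \<bar>s\<bar>" using assms by (simp add: power_add field_simps)
 hence "C * r ^ nat \<bar>i + s\<bar> <= C * (r ^ nat \<bar>i\<bar> / r ^ nat \<bar>s\<bar>)" using C(1) by (rule mult_left_mono)
 thus ?thesis using C(2)[of "i + s" x] by simp
qed
thus ?thesis using assms(1) unfolding expdec_def by blast
qed

lemma expdec_theta: "expdec r \<kappa> ==> expdec r (%i x. \<kappa> i (\<theta> k x))"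
unfolding expdec_def using cfun_theta by blast

lemma expdec_finite:
assumes "!!i. \<kappa> i \<in> cfun X" "0 < r" "!!i x. B < \<bar>i\<bar> ==> \<kappa> i x = 0"
shows "expdec r \<kappa>"
proof -
define M where "M i = (SUP x\<in>XX. cmod (\<kappa> i x))" for i
have M: "cmod (\<kappa> i x) <= M i" for i x unfolding M_def by (rule cfun_bound(2)[OF assms(1)])
define C where "C = (\<Sum>i\<in>{- B..B}. M i / r ^ nat \<bar>i\<bar>)"
have M0: "0 <= M i" for i using M[of i undefined] norm_ge_zero order_trans by blast
have "cmod (\<kappa> i x) <= C * r ^ nat \<bar>i\<bar>" for i x
proof (cases "B < \<bar>i\<bar>")
 case True
 have "0 <= C" unfolding C_def using M0 assms(2) by (intro sum_nonneg) auto
 thus ?thesis using True assms by simp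
next
 case False
 have "M i / r ^ nat \<bar>i\<bar> <= C" unfolding C_def using False M0 assms(2) by (intro member_le_sum) auto
 hence "M i <= C * r ^ nat \<bar>i\<bar>" using assms(2) by (simp add: field_simps)
 thus ?thesis using M[of i x] by linarith
qed
thus ?thesis by (intro expdecI assms(1))
qed

end

section \<open>Dilation by hyperbolic summands and its half-line solution\<close>

definition sh :: "int => int \<times> nat => int \<times> nat" where "sh s p = (fst p + s, snd p)"

locale half_line = band_inverse X \<theta> n D h g \<rho>
for X :: "'x topology" and \<theta> and n D :: nat and h g :: "'x idx bop" and \<rho> :: real +
fixes t :: "'x => complex" and R :: "nat => nat => 'x => complex"
assumes t_cfun: "t \<in> cfun X" and t_real: "cnj (t x) = t x"
 and R_cfun: "q < 2 * N ==> p < N ==> R q p \<in> cfun X"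
 and R_solves: "x \<in> XX ==> p < N ==> p' < N ==>
   (\<Sum>q<2 * N. Xi (t x) x p q * R q p' x) = (if p = p' then 1 else 0)"
begin

abbreviation "m \<equiv> n + 2 * N"

text \<open>The right-hand side on the first \<open>n\<close> components for column
  \<open>d\<close>. For the last block of columns it cancels what \<open>Kop\<close> feeds in from
  the unit that the second block carries at level 1.\<close>

definition source :: "nat => 'x => int \<times> nat => complex" where
"source d x l = (if d < n then (if l = (0, d) & x \<in> XX then 1 else 0)
  else if n + N <= d & 1 <= fst l then - coef h (x, l) (x, sh 1 (pos (d - n - N))) else 0)"

definition gsource :: "nat => 'x => int \<times> nat => complex" where
"gsource d x p = (\<Sum>l\<in>blk 0 (int D + 1). coef g (x, p) (x, l) * source d x l)"

definition one_at :: "bool => 'x => complex" where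
"one_at b x = (if b & x \<in> XX then 1 else 0)"

text \<open>Coefficients of the columns of \<open>g\<close> at \<open>2 * N\<close> sites outside
  the half-line, found by \<open>R\<close> from the defects of the edge equations. Adding such
  columns leaves the equations at levels from 0 on untouched, because \<open>h * g\<close> is the
  identity.\<close>

definition corr :: "nat => 'x => nat => complex" where
"corr d x q = (\<Sum>k<N. R q k x * (one_at (d = n + k) x - t x * gsource d x (pos k) -
  (\<Sum>l\<in>blk 0 (int D). coef h (x, pos k) (x, l) * gsource d x l)))"

definition sol :: "nat => 'x => int \<times> nat => complex" where
"sol d x p = gsource d x p + (\<Sum>q<2 * N. coef g (x, p) (x, pos q) * corr d x q)"

text \<open>The level-0 columns of the triangular solution for the dilated operator. The first block
  is \<open>sol\<close> on the half-line, the second stores at level 0 the values of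
  \<open>sol\<close> at the \<open>N\<close> sites outside, and the third is what the rows of the
  second block force.\<close>

definition column :: "nat => nat => int => 'x => complex" where
"column c d i x =
  (if c < n then (if 0 <= i then sol d x (i, c) else 0)
  else if c < n + N then
   (if i = 0 then sol d x (pos (c - n)) else 0) + (if i = 1 then one_at (d = c + N) x else 0)
  else (if 0 <= i then (\<Sum>l\<in>blk 0 (int D).
    (- coef h (x, sh (i + 1) (pos (c - n - N))) (x, sh (i + 1) l)) * sol d x (sh (i + 1) l)) else 0) +
   (if i = 0 then - (t (\<theta> (- 1) x) * one_at (d = c) x) else 0))"

lemma one_at_cfun: "one_at b \<in> cfun X"
using cfun_one unfolding one_at_def by (cases b) auto

lemma source_cfun: "(%x. source d x l) \<in> cfun X"
proof -
have "(%x. if l = (0, d) & x \<in> XX then 1 else 0) \<in> cfun X"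
 using one_at_cfun[of "l = (0, d)"] unfolding one_at_def by simp
thus ?thesis
 unfolding source_def using cfun_minus[OF coef_cfun[OF h_Mat]] by (cases "d < n"; cases "n + N <= d & 1 <= fst l") auto
qed

lemma gsource_cfun: "(%x. gsource d x p) \<in> cfun X"
unfolding gsource_def by (intro cfun_sum cfun_mult coef_cfun[OF g_Mat] source_cfun)

lemma corr_cfun: "q < 2 * N ==> (%x. corr d x q) \<in> cfun X"
unfolding corr_def
by (intro cfun_sum cfun_mult cfun_diff coef_cfun[OF h_Mat] gsource_cfun t_cfun R_cfun) (auto simp: one_at_cfun)

lemma sol_cfun: "(%x. sol d x p) \<in> cfun X"
unfolding sol_def
by (intro cfun_add cfun_sum cfun_mult coef_cfun[OF g_Mat] gsource_cfun corr_cfun) auto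

lemma expdec_g: "expdec \<rho> (%i x. coef g (x, i + s, c) (x, p))"
proof -
obtain j d where p: "p = (j, d)" by (metis prod.collapse)
show ?thesis
proof (cases "c < n & d < n")
 case True
 thus ?thesis
  using expdec_shift[OF expdec_theta[OF g_dec[of c d], of "- j"] \<rho>, of "s - j"]
  by (simp add: coef_ent[OF g_Mat] p algebra_simps)
next
 case False
 thus ?thesis using expdec_zero by (simp add: coef_g_zero p)
qed
qed

lemma expdec_sol: "expdec \<rho> (%i x. sol d x (i + s, c))"
unfolding sol_def gsource_def
by (intro expdec_add expdec_sum expdec_mult_cfun[OF expdec_g] \<rho> source_cfun corr_cfun) auto

lemma expdec_point: "f \<in> cfun X ==> expdec \<rho> (%i x. if i = k then f x else 0)"
proof (rule expdec_finite[where B = "\<bar>k\<bar>"])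
assume "f \<in> cfun X"
thus "(%x. if i = k then f x else 0) \<in> cfun X" for i by (cases "i = k") auto
qed (use \<rho> in auto)

lemma expdec_column: "expdec \<rho> (column c d)"
proof -
have 1: "expdec \<rho> (%i x. if 0 <= i then sol d x (i, c) else 0)"
 using expdec_sol[of d 0 c] by (intro expdec_if \<rho>) simp
have 2: "expdec \<rho> (%i x. (if i = 0 then sol d x (pos (c - n)) else 0) + (if i = 1 then one_at (d = c + N) x else 0))"
 by (intro expdec_add expdec_point one_at_cfun sol_cfun)
have 3: "expdec \<rho> (%i x. (if 0 <= i then (\<Sum>l\<in>blk 0 (int D).
    (- coef h (x, sh (i + 1) (pos (c - n - N))) (x, sh (i + 1) l)) * sol d x (sh (i + 1) l)) else 0) +
   (if i = 0 then - (t (\<theta> (- 1) x) * one_at (d = c) x) else 0))"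
proof (rule expdec_add[OF expdec_if[OF expdec_sum] expdec_point])
 show "(%x. - (t (\<theta> (- 1) x) * one_at (d = c) x)) \<in> cfun X"
  by (intro cfun_minus cfun_mult one_at_cfun cfun_theta[OF t_cfun])
 fix l
 have "expdec \<rho> (%i x. sol d x (sh (i + 1) l))"
  using expdec_sol[of d "1 + fst l" "snd l"] by (simp add: sh_def algebra_simps)
 thus "expdec \<rho> (%i x. (- coef h (x, sh (i + 1) (pos (c - n - N))) (x, sh (i + 1) l)) * sol d x (sh (i + 1) l))"
  by (rule expdec_mult[where B = "norm h"]) (use \<rho> cfun_minus[OF coef_cfun[OF h_Mat]] norm_coef_le[of h] in auto)
qed (use \<rho> in auto)
show ?thesis
proof (cases "c < n")
 case True thus ?thesis using 1 unfolding column_def by simp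
next
 case False
 thus ?thesis using 2 3 unfolding column_def by (cases "c < n + N") auto
qed
qed

lemma source_zero: "int D < i ==> source d x (i, c) = 0"
proof -
assume "int D < i"
moreover have "fst (sh 1 (pos k)) <= 0" for k by (simp add: sh_def pos_def)
ultimately have "coef h (x, i, c) (x, sh 1 (pos k)) = 0" for k
 using coef_h_zero[of x x i "fst (sh 1 (pos k))" c "snd (sh 1 (pos k))"]
 by (smt (verit) prod.collapse)
thus ?thesis using \<open>int D < i\<close> D by (simp add: source_def)
qed

text \<open>\<open>h * g\<close> is the identity, so the source is reproduced, while the correction
  columns produce values only at negative levels.\<close>

lemma h_sol:
assumes x: "x \<in> XX" and "c < n" "0 <= i"
shows "(\<Sum>l\<in>blk (i - int D) (i + int D + 1). coef h (x, i, c) (x, l) * sol d x l) = source d x (i, c)"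
proof -
let ?S = "%q. \<Sum>l\<in>blk (i - int D) (i + int D + 1). coef h (x, i, c) (x, l) * coef g (x, l) (x, q)"
have S: "?S q = (if q = (i, c) then 1 else 0)" for q by (rule hg_sum[OF x \<open>c < n\<close>])
have "(\<Sum>l\<in>blk (i - int D) (i + int D + 1). coef h (x, i, c) (x, l) * sol d x l) =
  (\<Sum>q\<in>blk 0 (int D + 1). ?S q * source d x q) + (\<Sum>q<2 * N. ?S (pos q) * corr d x q)"
 unfolding sol_def gsource_def distrib_left sum.distrib sum_distrib_left sum_distrib_right
 by (intro arg_cong2[where f = "(+)"]; subst sum.swap) (simp_all only: mult.assoc)
also have "(\<Sum>q<2 * N. ?S (pos q) * corr d x q) = 0"
 unfolding S using \<open>0 <= i\<close> by (intro sum.neutral) (auto simp: pos_def)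
also have "(\<Sum>q\<in>blk 0 (int D + 1). ?S q * source d x q) = (\<Sum>q\<in>blk 0 (int D + 1). if q = (i, c) then source d x q else 0)"
 unfolding S by (intro sum.cong) auto
finally show ?thesis using assms source_zero[of i d x c] by auto
qed

lemma edge_sol:
assumes x: "x \<in> XX" and k: "k < N"
shows "(\<Sum>l\<in>blk 0 (int D). coef h (x, pos k) (x, l) * sol d x l) + t x * sol d x (pos k) = one_at (d = n + k) x"
proof -
define b where "b k = one_at (d = n + k) x - t x * gsource d x (pos k) -
  (\<Sum>l\<in>blk 0 (int D). coef h (x, pos k) (x, l) * gsource d x l)" for k
have c: "corr d x q = (\<Sum>k<N. R q k x * b k)" for q by (simp add: corr_def b_def)
have "(\<Sum>q<2 * N. Xi (t x) x k q * corr d x q) = (\<Sum>k'<N. (\<Sum>q<2 * N. Xi (t x) x k q * R q k' x) * b k')"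
 unfolding c sum_distrib_left sum_distrib_right by (subst sum.swap) (simp only: mult.assoc)
also have "... = (\<Sum>k'<N. if k' = k then b k' else 0)"
 using R_solves[OF x k] by (intro sum.cong) auto
finally have bk: "(\<Sum>q<2 * N. Xi (t x) x k q * corr d x q) = b k" using k by simp
have "(\<Sum>q<2 * N. Xi (t x) x k q * corr d x q) =
  t x * (\<Sum>q<2 * N. coef g (x, pos k) (x, pos q) * corr d x q) +
  (\<Sum>l\<in>blk 0 (int D). coef h (x, pos k) (x, l) * (\<Sum>q<2 * N. coef g (x, l) (x, pos q) * corr d x q))"
 unfolding Xi_def distrib_right sum.distrib sum_distrib_left sum_distrib_right
 by (intro arg_cong2[where f = "(+)"]) (simp only: mult.assoc, subst sum.swap, simp only: mult.assoc)
thus ?thesis using bk unfolding b_def sol_def distrib_left sum.distrib by (simp add: algebra_simps)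
qed

text \<open>One half of the hyperbolic form pairing the second with the third block. The shift by
  one level matters: on the half-line the rows of the third block prescribe the second block only
  from level 1 on, leaving its level 0 free for the outside values of the solution.\<close>

definition Z :: "'x idx bop" where
"Z = (\<Sum>k<N. cross_op (n + N + k) (n + k) (%l x. one_at (l = 1) x))"

lemma gen_carrier: "(%l x. one_at (l = s) x) \<in> CA"
proof -
have "fsupp (%l x. one_at (l = s) x) \<subseteq> {s}" by (auto simp: one_at_def)
thus ?thesis unfolding carrier_iff using one_at_cfun finite_subset by blast
qed

lemma adj_gen: "adj \<A> (%l x. one_at (l = 1) x) = (%l x. one_at (l = - 1) x)"
by (intro ext) (auto simp: alg_simps one_at_def)

lemma coord_gen:
"coord (app (cross_op i j (%l x. one_at (l = s) x)) \<eta>) (x, k, c) =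
 (if c = i & x \<in> XX then coord \<eta> (x, k + s, j) else 0)"
by (subst coord_cross_op[OF gen_carrier, of "{s}"]) (auto simp: one_at_def)

lemma coord_Z: "coord (app Z \<eta>) (x, i, c) =
 (if n + N <= c & c < m & x \<in> XX then coord \<eta> (x, i + 1, c - N) else 0)"
and coord_star_Z: "coord (app (star Z) \<eta>) (x, i, c) =
 (if n <= c & c < n + N & x \<in> XX then coord \<eta> (x, i - 1, c + N) else 0)"
proof -
have "coord (app Z \<eta>) (x, i, c) =
  (\<Sum>k<N. if k = c - (n + N) then (if n + N <= c & x \<in> XX then coord \<eta> (x, i + 1, c - N) else 0) else 0)"
 unfolding Z_def app_sum_left coord_sum coord_gen by (intro sum.cong) auto
thus "coord (app Z \<eta>) (x, i, c) =
 (if n + N <= c & c < m & x \<in> XX then coord \<eta> (x, i + 1, c - N) else 0)" by auto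
have "star Z = (\<Sum>k<N. cross_op (n + k) (n + N + k) (%l x. one_at (l = - 1) x))"
 unfolding Z_def star_sum using star_cross_op[OF gen_carrier] adj_gen by simp
hence "coord (app (star Z) \<eta>) (x, i, c) =
  (\<Sum>k<N. if k = c - n then (if n <= c & x \<in> XX then coord \<eta> (x, i - 1, c + N) else 0) else 0)"
 by (simp only: app_sum_left coord_sum coord_gen) (intro sum.cong, auto simp: add_ac)
thus "coord (app (star Z) \<eta>) (x, i, c) =
 (if n <= c & c < n + N & x \<in> XX then coord \<eta> (x, i - 1, c + N) else 0)" by auto
qed

lemma Z_Mat: "Z \<in> Mat m m"
unfolding Z_def by (intro Mat_sum Mat_cross_op gen_carrier) auto

definition Tfun :: "nat => nat => 'x => complex" where
"Tfun c d x = (if c = d & n <= c & c < n + N then t x else 0)"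

definition Top :: "'x idx bop" where "Top = fibre m m Tfun"

lemma cmat_Tfun: "cmat m m Tfun"
proof (rule cmatI)
fix c d show "Tfun c d \<in> cfun X"
proof (cases "c = d & n <= c & c < n + N")
 case True
 hence "Tfun c d = t" by (auto simp: Tfun_def fun_eq_iff)
 thus ?thesis using t_cfun by simp
next
 case False
 hence "Tfun c d = (%_. 0)" unfolding Tfun_def by (intro ext if_not_P)
 thus ?thesis by simp
qed
qed

lemma Top_Mat: "Top \<in> Mat m m" unfolding Top_def by (rule fibre_Mat[OF cmat_Tfun])

lemma coord_Top: "coord (app Top \<eta>) (x, i, c) =
 (if n <= c & c < n + N then t (\<theta> (- i) x) * coord \<eta> (x, i, c) else 0)"
proof -
have "(\<Sum>d<m. Tfun c d (\<theta> (- i) x) * coord \<eta> (x, i, d)) =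
  (\<Sum>d<m. if d = c then (if n <= c & c < n + N then t (\<theta> (- i) x) * coord \<eta> (x, i, c) else 0) else 0)"
 by (intro sum.cong) (auto simp: Tfun_def)
thus ?thesis unfolding Top_def coord_fibre[OF cmat_Tfun] by auto
qed

lemma star_Top: "star Top = Top"
unfolding Top_def star_fibre[OF cmat_Tfun] by (rule fibre_cong) (auto simp: Tfun_def t_real)

text \<open>The entries of \<open>h\<close> leading from the \<open>N\<close> sites outside the
  half-line into it. Through them the second block plays the role of these sites.\<close>

definition Kfun :: "nat => nat => int => 'x => complex" where
"Kfun c d i x = (if n <= d & d < n + N & 0 <= i then coef h (x, i, c) (x, pos (d - n)) else 0)"

lemma coef_h_high: "int D <= i ==> coef h (x, i + j, c) (x, sh j (pos k)) = 0"
unfolding sh_def pos_def by (rule coef_h_zero) auto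

lemma expdec_Kfun: "expdec \<rho> (Kfun c d)"
proof (rule expdec_finite[where B = "int D"])
show "Kfun c d i \<in> cfun X" for i
 unfolding Kfun_def using coef_cfun[OF h_Mat] by (cases "n <= d & d < n + N & 0 <= i") auto
show "Kfun c d i x = 0" if "int D < \<bar>i\<bar>" for i x
 using that coef_h_high[of i x 0 c "d - n"] by (auto simp: Kfun_def sh_def)
qed (rule \<rho>)

definition Kop :: "'x idx bop" where
"Kop = (SOME A. A \<in> Mat n m & (\<forall>c<n. \<forall>d<m. \<forall>i x. ent A c d i x = Kfun c d i x))"

lemma Kop: "Kop \<in> Mat n m" "c < n ==> d < m ==> ent Kop c d i x = Kfun c d i x"
proof -
have "\<exists>A. A \<in> Mat n m & (\<forall>c<n. \<forall>d<m. \<forall>i x. ent A c d i x = Kfun c d i x)"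
 using band_operator[OF \<rho>, of n m Kfun] expdec_Kfun by metis
from someI_ex[OF this] show "Kop \<in> Mat n m" "c < n ==> d < m ==> ent Kop c d i x = Kfun c d i x"
 unfolding Kop_def by blast+
qed

lemma coef_h_theta: "coef h (\<theta> (- j) x, i - j, c) (\<theta> (- j) x, p) = coef h (x, i, c) (x, sh j p)"
proof -
obtain k d where "p = (k, d)" by (metis prod.collapse)
thus ?thesis by (simp add: coef_ent[OF h_Mat] sh_def algebra_simps)
qed

lemma coef_Kop: "coef Kop (x, i, c) (y, j, d) = (if x = y & c < n & n <= d & d < n + N & j <= i
 then coef h (x, i, c) (x, sh j (pos (d - n))) else 0)"
proof -
have "ent Kop c d (i - j) (\<theta> (- j) x) =
  (if n <= d & d < n + N & j <= i then coef h (x, i, c) (x, sh j (pos (d - n))) else 0)" if "c < n" "d < m"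
 unfolding Kop(2)[OF that] Kfun_def coef_h_theta by simp
thus ?thesis unfolding coef_ent[OF Kop(1)] by (cases "x = y & c < n & d < m") auto
qed

text \<open>The coupling by \<open>Kop\<close> and \<open>Top\<close> makes the half-line equations
  solvable and does not change the congruence class, see \<open>dil_congruence\<close>.\<close>

definition dil :: "'x idx bop" where
"dil = h + Z + star Z + (Kop + star Kop + Top)"

lemma big_Mat: "h \<in> Mat m m" "Kop \<in> Mat m m" "star Kop \<in> Mat m m" "star Z \<in> Mat m m" "dil \<in> Mat m m"
proof -
show *: "h \<in> Mat m m" "Kop \<in> Mat m m"
 using h_Mat Kop(1) Mat_mono[of n m n m] Mat_mono[of n m m m] by auto
show **: "star Kop \<in> Mat m m" "star Z \<in> Mat m m" using *(2) Z_Mat Mat_star by auto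
show "dil \<in> Mat m m" unfolding dil_def by (intro Mat_add * ** Z_Mat Top_Mat)
qed

lemma star_dil: "star dil = dil"
by (simp add: dil_def star_h star_Top add_ac)

end

context half_line
begin

definition Mop :: "'x idx bop" where
"Mop = (SOME A. A \<in> Mat m m & (\<forall>c<m. \<forall>d<m. \<forall>i x. ent A c d i x = column c d i x))"

lemma Mop: "Mop \<in> Mat m m" "c < m ==> d < m ==> ent Mop c d i x = column c d i x"
proof -
have "\<exists>A. A \<in> Mat m m & (\<forall>c<m. \<forall>d<m. \<forall>i x. ent A c d i x = column c d i x)"
 using band_operator[OF \<rho>, of m m column] expdec_column by metis
from someI_ex[OF this] show "Mop \<in> Mat m m" "c < m ==> d < m ==> ent Mop c d i x = column c d i x"
 unfolding Mop_def by blast+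
qed

lemma column_low: "i < 0 ==> column c d i x = 0"
by (simp add: column_def)

lemma Mop_low: "i < j ==> coef Mop (x, i, c) (x, j, d) = 0"
by (simp add: coef_ent[OF Mop(1)] Mop(2) column_low)

context
fixes x :: 'x and d :: nat and \<eta>
assumes x: "x \<in> XX" and d: "d < m" and \<eta>: "\<eta> = app Mop (unit_vec (x, 0, d))"
begin

lemma coord_col: "coord \<eta> (y, i, c) = (if y = x & c < m then column c d i x else 0)"
using d coef_ent[OF Mop(1), of y i c x 0 d] Mop(2)[OF _ d] by (auto simp: \<eta> coef_def)

lemma sum_pos: "(\<Sum>k<N. F (pos k)) = (\<Sum>l\<in>blk (- int D) 0. F l)" for F :: "_ => complex"
unfolding pos_blk[symmetric] by (subst sum.reindex) (auto simp: inj_on_def pos_inj)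

lemma dil_row_x:
assumes c: "c < n" and i: "0 <= i"
shows "coord (app h \<eta>) (x, i, c) + coord (app Kop \<eta>) (x, i, c) = (if i = 0 & c = d then 1 else 0)"
proof -
have 1: "coord (app h \<eta>) (x, i, c) = (\<Sum>l\<in>blk 0 (i + int D + 1). coef h (x, i, c) (x, l) * sol d x l)"
proof (rule trans[OF coord_app_fibre])
 fix y j e assume "y ~= x | (j, e) ~: blk 0 (i + int D + 1)"
 thus "coef h (x, i, c) (y, j, e) = 0 | coord \<eta> (y, j, e) = 0"
  using coef_h_zero[of y x i j c e] by (auto simp: coord_col column_low)
next
 show "(\<Sum>l\<in>blk 0 (i + int D + 1). coef h (x, i, c) (x, l) * coord \<eta> (x, l)) =
  (\<Sum>l\<in>blk 0 (i + int D + 1). coef h (x, i, c) (x, l) * sol d x l)"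
  by (intro sum.cong refl) (auto simp: coord_col column_def)
qed simp
\<comment> \<open>In the second block the column lives on levels 0 and 1 only.\<close>
let ?L = "(%k. (0 :: int, n + k)) ` {..<N} \<union> (%k. (1, n + k)) ` {..<N}"
have "coord (app Kop \<eta>) (x, i, c) = (\<Sum>l\<in>?L. coef Kop (x, i, c) (x, l) * coord \<eta> (x, l))"
proof (rule coord_app_fibre)
 fix y j e assume a: "y ~= x | (j, e) ~: ?L"
 show "coef Kop (x, i, c) (y, j, e) = 0 | coord \<eta> (y, j, e) = 0"
 proof (cases "y = x & n <= e & e < n + N")
  case True
  hence e: "e = n + (e - n)" "e - n < N" by auto
  hence "j ~= 0 & j ~= 1" using a True by (metis UnI1 UnI2 imageI lessThan_iff)
  thus ?thesis using True by (auto simp: coord_col column_def)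
 next
  case False thus ?thesis by (auto simp: coef_Kop)
 qed
qed simp
also have "... = (\<Sum>k<N. coef Kop (x, i, c) (x, 0, n + k) * coord \<eta> (x, 0, n + k)) +
  (\<Sum>k<N. coef Kop (x, i, c) (x, 1, n + k) * coord \<eta> (x, 1, n + k))"
 by (subst sum.union_disjoint, simp, simp, force, subst (1 2) sum.reindex) (auto simp: inj_on_def)
also have "(\<Sum>k<N. coef Kop (x, i, c) (x, 0, n + k) * coord \<eta> (x, 0, n + k)) =
  (\<Sum>k<N. coef h (x, i, c) (x, pos k) * sol d x (pos k))"
 using c i by (intro sum.cong) (auto simp: coef_Kop coord_col column_def sh_def)
also have "(\<Sum>k<N. coef Kop (x, i, c) (x, 1, n + k) * coord \<eta> (x, 1, n + k)) =
  (\<Sum>k<N. if k = d - (n + N) then (if n + N <= d & 1 <= i then coef h (x, i, c) (x, sh 1 (pos (d - n - N))) else 0) else 0)"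
 using c x by (intro sum.cong) (auto simp: coef_Kop coord_col column_def one_at_def)
also have "... = (if n + N <= d & 1 <= i then coef h (x, i, c) (x, sh 1 (pos (d - n - N))) else 0)"
 using d by auto
finally have 2: "coord (app Kop \<eta>) (x, i, c) = (\<Sum>k<N. coef h (x, i, c) (x, pos k) * sol d x (pos k)) +
  (if n + N <= d & 1 <= i then coef h (x, i, c) (x, sh 1 (pos (d - n - N))) else 0)" .
have "(\<Sum>l\<in>blk (i - int D) (i + int D + 1). coef h (x, i, c) (x, l) * sol d x l) =
  (\<Sum>l\<in>blk (- int D) 0 \<union> blk 0 (i + int D + 1). coef h (x, i, c) (x, l) * sol d x l)"
proof (rule sum.mono_neutral_left)
 show "\<forall>l\<in>blk (- int D) 0 \<union> blk 0 (i + int D + 1) - blk (i - int D) (i + int D + 1). coef h (x, i, c) (x, l) * sol d x l = 0"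
 proof (clarify)
  fix j e assume "(j, e) \<in> blk (- int D) 0 \<union> blk 0 (i + int D + 1)" "(j, e) ~: blk (i - int D) (i + int D + 1)"
  hence "int D < \<bar>i - j\<bar>" using i by auto
  thus "coef h (x, i, c) (x, j, e) * sol d x (j, e) = 0" by (simp add: coef_h_zero)
 qed
qed (use i in "auto simp: blk_def")
also have "... = (\<Sum>k<N. coef h (x, i, c) (x, pos k) * sol d x (pos k)) +
  (\<Sum>l\<in>blk 0 (i + int D + 1). coef h (x, i, c) (x, l) * sol d x l)"
 unfolding sum_pos[of "%l. coef h (x, i, c) (x, l) * sol d x l"] by (rule sum.union_disjoint) (auto simp: blk_def)
finally have "coord (app h \<eta>) (x, i, c) + coord (app Kop \<eta>) (x, i, c) = source d x (i, c) +
  (if n + N <= d & 1 <= i then coef h (x, i, c) (x, sh 1 (pos (d - n - N))) else 0)"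
 using h_sol[OF x c i, of d] unfolding 1 2 by simp
thus ?thesis using x c by (auto simp: source_def)
qed

lemma star_Kop_col:
assumes c: "n <= c" "c < n + N" and i: "0 <= i"
shows "coord (app (star Kop) \<eta>) (x, i, c) =
 (\<Sum>l\<in>blk 0 (int D). coef h (x, sh i (pos (c - n))) (x, sh i l) * sol d x (sh i l))"
proof -
have k: "coef (star Kop) (x, i, c) (y, j, e) = (if y = x & e < n & i <= j then coef h (x, sh i (pos (c - n))) (x, j, e) else 0)" for y j e
 using c by (auto simp: coef_star coef_Kop coef_h_cnj)
have "coord (app (star Kop) \<eta>) (x, i, c) = (\<Sum>l\<in>sh i ` blk 0 (int D). coef (star Kop) (x, i, c) (x, l) * coord \<eta> (x, l))"
proof (rule coord_app_fibre)
 fix y j e assume a: "y ~= x | (j, e) ~: sh i ` blk 0 (int D)"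
 have "coef h (x, sh i (pos (c - n))) (x, j, e) = 0" if "i <= j" "e < n" "y = x"
 proof -
  have "~ (j - i < int D)"
  proof
   assume "j - i < int D"
   hence "(j - i, e) \<in> blk 0 (int D)" using that by simp
   hence "sh i (j - i, e) \<in> sh i ` blk 0 (int D)" by (rule imageI)
   thus False using a that by (simp add: sh_def)
  qed
  hence "coef h (x, j, e) (x, sh i (pos (c - n))) = 0" using coef_h_high[of "j - i" x i e] by simp
  thus ?thesis using coef_h_cnj[of "(x, j, e)" "(x, sh i (pos (c - n)))"] by simp
 qed
 thus "coef (star Kop) (x, i, c) (y, j, e) = 0 | coord \<eta> (y, j, e) = 0" by (auto simp: k)
qed simp
also have "... = (\<Sum>l\<in>blk 0 (int D). coef (star Kop) (x, i, c) (x, sh i l) * coord \<eta> (x, sh i l))"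
 by (subst sum.reindex) (auto simp: inj_on_def sh_def)
also have "... = (\<Sum>l\<in>blk 0 (int D). coef h (x, sh i (pos (c - n))) (x, sh i l) * sol d x (sh i l))"
 using i by (intro sum.cong refl) (auto simp: k sh_def coord_col column_def)
finally show ?thesis .
qed

text \<open>At level 0 this is an edge equation, since the third block has nothing at level
  \<open>-1\<close>; at each higher level it is the definition of the third block one level
  below.\<close>

lemma dil_row_y:
assumes c: "n <= c" "c < n + N" and i: "0 <= i"
shows "coord (app (star Kop) \<eta>) (x, i, c) + t (\<theta> (- i) x) * column c d i x + column (c + N) d (i - 1) x =
 (if i = 0 & c = d then 1 else 0)"
proof (cases "i = 0")
case True
have "coord (app (star Kop) \<eta>) (x, i, c) + t x * sol d x (pos (c - n)) = one_at (d = n + (c - n)) x"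
 using star_Kop_col[OF c, of 0] edge_sol[OF x, of "c - n" d] c True by (simp add: sh_def)
thus ?thesis using True x c by (auto simp: column_def one_at_def)
next
case False
have "column (c + N) d (i - 1) x = - coord (app (star Kop) \<eta>) (x, i, c) -
  (if i = 1 then t (\<theta> (- 1) x) * one_at (d = c + N) x else 0)"
 unfolding star_Kop_col[OF assms] using False i c by (simp add: column_def sum_negf)
thus ?thesis using False c by (simp add: column_def)
qed

lemma dil_col:
assumes c: "c < m" and i: "0 <= i"
shows "coord (app dil \<eta>) (x, i, c) = (if i = 0 & c = d then 1 else 0)"
proof -
have h0: "coord (app h \<eta>) (x, i, c) = 0" "coord (app Kop \<eta>) (x, i, c) = 0" if "~ c < n"
 using that by (auto intro!: coord_app_idx simp: coef_h_zero coef_Kop)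
have k0: "coord (app (star Kop) \<eta>) (x, i, c) = 0" if "~ (n <= c & c < n + N)"
 using that by (auto intro!: coord_app_idx simp: coef_star coef_Kop)
consider "c < n" | "n <= c" "c < n + N" | "n + N <= c" by linarith
thus ?thesis
proof cases
 case 1
 thus ?thesis using dil_row_x[OF 1 i] k0
  by (simp add: dil_def coord_Z coord_star_Z coord_Top)
next
 case 2
 thus ?thesis using dil_row_y[OF 2 i] h0 x
  by (simp add: dil_def coord_Z coord_star_Z coord_Top coord_col algebra_simps)
next
 case 3
 thus ?thesis using h0 k0 x c i
  by (auto simp: dil_def coord_Z coord_star_Z coord_Top coord_col column_def one_at_def)
qed
qed

end

text \<open>By covariance the triangular conditions only have to be checked for columns at level 0,
  which is \<open>dil_col\<close>.\<close>

lemma dil_diagonalization: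
obtains a where "cmat m m a" "!!x. x \<in> XX ==> herm m (%i j. a i j x)"
 "!!x. x \<in> XX ==> nondeg m (%i j. a i j x)" "star Mop * dil * Mop = fibre m m a"
 "!!b. cmat m m b ==> fibre m m b * fibre m m a = Id m ==> fibre m m a * fibre m m b = Id m ==>
   dil * Mop * fibre m m b * star Mop = Id m"
proof (rule half_line_diagonalization[OF big_Mat(5) star_dil Mop(1) Mop_low, of thesis])
fix x :: 'x and i j :: int and c d :: nat assume a: "x \<in> XX" "j <= i" "c < m" "d < m"
have "coef (dil * Mop) (x, i, c) (x, j, d) = ent (dil * Mop) c d (i - j) (\<theta> (- j) x)"
 using a by (simp add: coef_ent[OF Mat_mult[OF big_Mat(5) Mop(1)]])
also have "... = (if i = j & c = d then 1 else 0)"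
 using dil_col[OF _ a(4) refl a(3), of "\<theta> (- j) x" "i - j"] a by (simp add: ent_def coef_def)
finally show "coef (dil * Mop) (x, i, c) (x, j, d) = (if i = j & c = d then 1 else 0)" .
qed (use that in blast)+

definition Py :: "'x idx bop" where
"Py = fibre m m (diag_fun (%c. if n <= c & c < n + N then XX else {}))"

text \<open>\<open>Top\<close> is selfadjoint and is split evenly, so that
  \<open>Lop + star Lop\<close> is the whole coupling.\<close>

definition Lop :: "'x idx bop" where "Lop = star Kop + (1 / 2) *r Top"

definition Sop :: "'x idx bop" where "Sop = Id m + Z * Lop"

definition Sinv :: "'x idx bop" where "Sinv = Id m - Z * Lop"

lemma clopens_Py: "clopens m (%c. if n <= c & c < n + N then XX else {})"
by (auto simp: clopens_def clopen_def)

lemma coord_Py: "coord (app Py \<eta>) (x, i, c) = (if n <= c & c < n + N & x \<in> XX then coord \<eta> (x, i, c) else 0)"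
proof -
let ?A = "%c. if n <= c & c < n + N then XX else {}"
have "(\<Sum>d<m. diag_fun ?A c d (\<theta> (- i) x) * coord \<eta> (x, i, d)) =
  (\<Sum>d<m. if d = c then (if n <= c & c < n + N & x \<in> XX then coord \<eta> (x, i, c) else 0) else 0)"
 by (intro sum.cong refl) (auto simp: diag_fun_def)
thus ?thesis unfolding Py_def coord_fibre[OF cmat_diag_fun[OF clopens_Py]] by auto
qed

lemma block_rels:
"h * Z = 0" "Z * h = 0" "Z * Z = 0" "star Z * Z = Py" "star Z * Py = 0" "Py * star Kop = star Kop"
"Py * Top = Top" "star Kop * Z = 0" "Top * Z = 0"
proof -
have idZ: "Id n * Z = 0" "Z * Id n = 0"
 by (intro bop_eqI ell2_eqI; clarsimp simp: coord_Z coord_Id; linarith)+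
show "h * Z = 0" using mult_Id[OF h_Mat] idZ by (metis mult.assoc mult_zero_right)
show "Z * h = 0" using Id_mult[OF h_Mat] idZ by (metis mult.assoc mult_zero_left)
show "Z * Z = 0" "star Z * Z = Py" "star Z * Py = 0" "Top * Z = 0"
 by (intro bop_eqI ell2_eqI; clarsimp simp: coord_Z coord_star_Z coord_Py coord_Top; linarith?)+
show "Py * Top = Top"
proof (intro bop_eqI ell2_eqI, clarify)
 fix \<eta> x i c
 have "t (\<theta> (- i) x) = 0" if "x ~: XX" using t_cfun that unfolding cfun_def by simp
 thus "coord (app (Py * Top) \<eta>) (x, i, c) = coord (app Top \<eta>) (x, i, c)"
  by (auto simp: coord_Py coord_Top)
qed
have "star Kop * Id n = star Kop" by (rule mult_Id[OF Mat_star[OF Kop(1)]])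
thus "star Kop * Z = 0" using idZ by (metis mult.assoc mult_zero_right)
show "Py * star Kop = star Kop"
proof (rule bop_coef_eqI, clarify)
 fix x y :: 'x and i j :: int and c d :: nat
 have "coef (star Kop) (x, i, c) (y, j, d) = 0" if "x ~: XX"
  using that ent_outside[OF Mat_star[OF Kop(1)], of "\<theta> (- j) x"]
  unfolding coef_ent[OF Mat_star[OF Kop(1)]] by (simp only: theta_topspace if_cancel not_False_eq_True)
 moreover have "coef (star Kop) (x, i, c) (y, j, d) = 0" if "~ (n <= c & c < n + N)"
  using that by (auto simp: coef_star coef_Kop)
 ultimately show "coef (Py * star Kop) (x, i, c) (y, j, d) = coef (star Kop) (x, i, c) (y, j, d)"
  by (auto simp: coef_def coord_Py)
qed
qed

lemma Lop_rels: "Py * Lop = Lop" "Lop * Z = 0" "Lop + star Lop = Kop + star Kop + Top"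
proof -
show "Py * Lop = Lop" "Lop * Z = 0" by (simp_all add: Lop_def distrib_left distrib_right block_rels)
have "(1 / 2) *r Top + (1 / 2) *r Top = Top" by (simp flip: scaleR_left_distrib)
thus "Lop + star Lop = Kop + star Kop + Top" by (simp add: Lop_def star_Top algebra_simps)
qed

lemma Lop_Mat: "Lop \<in> Mat m m" "Z * Lop \<in> Mat m m" "Sop \<in> Mat m m" "Sinv \<in> Mat m m"
proof -
show *: "Lop \<in> Mat m m" unfolding Lop_def by (intro Mat_add Mat_scaleR Top_Mat big_Mat)
thus **: "Z * Lop \<in> Mat m m" using Z_Mat Mat_mult by blast
show "Sop \<in> Mat m m" "Sinv \<in> Mat m m" unfolding Sop_def Sinv_def by (intro Mat_add Mat_diff Id_Mat **)+
qed

lemma Sop_inverse: "Sop * Sinv = Id m" "Sinv * Sop = Id m"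
proof -
have "Z * Lop * (Z * Lop) = 0" using Lop_rels(2) by (simp add: mult.assoc mult_subst)
thus "Sop * Sinv = Id m" "Sinv * Sop = Id m"
 unfolding Sop_def Sinv_def
 by (simp_all only: distrib_left distrib_right left_diff_distrib right_diff_distrib
   Id_mult[OF Lop_Mat(2)] mult_Id[OF Lop_Mat(2)] Id_mult[OF Id_Mat]) simp_all
qed

text \<open>Completing the square: \<open>h + Z + star Z\<close> maps \<open>Z * Lop\<close> to
  \<open>Lop\<close>, so the substitution \<open>Id m + Z * Lop\<close> produces the coupling
  \<open>Lop + star Lop\<close>. The quadratic term vanishes because the third block is isotropic
  for the hyperbolic form.\<close>

lemma dil_congruence: "star Sop * (h + Z + star Z) * Sop = dil"
proof -
define A where "A = h + Z + star Z"
have A: "A \<in> Mat m m" unfolding A_def by (intro Mat_add big_Mat Z_Mat)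
have sA: "star A = A" by (simp add: A_def star_h add_ac)
have 1: "A * (Z * Lop) = Lop"
 by (simp add: A_def distrib_right mult_subst[OF block_rels(1)] mult_subst[OF block_rels(3)]
   mult_subst[OF block_rels(4)] Lop_rels)
have 2: "star (Z * Lop) * A = star Lop" using arg_cong[OF 1, of star] sA by simp
have "star Lop * star Z * Lop = star Lop * (star Z * Py) * Lop"
 by (simp add: mult.assoc Lop_rels(1))
hence 3: "star (Z * Lop) * Lop = 0" by (simp add: block_rels(5))
have "A * Sop = A + Lop" by (simp only: Sop_def distrib_left mult_Id[OF A] 1)
hence "star Sop * A * Sop = star Sop * (A + Lop)" by (simp only: mult.assoc)
also have "... = A + Lop + star Lop"
 by (simp only: Sop_def star_simps(4) star_Id distrib_left distrib_right 2 3 Id_mult[OF A] Id_mult[OF Lop_Mat(1)] add_0_left add_0_right add_ac)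
finally show ?thesis using Lop_rels(3) by (simp only: A_def dil_def add.assoc)
qed

lemma congruent_to_fibre:
obtains W a where "W \<in> Mat m m" "cmat m m a" "!!x. x \<in> XX ==> herm m (%i j. a i j x)"
 "!!x. x \<in> XX ==> nondeg m (%i j. a i j x)" "star W * (h + Z + star Z) * W = fibre m m a"
 "!!b. cmat m m b ==> fibre m m b * fibre m m a = Id m ==> fibre m m a * fibre m m b = Id m ==>
   (h + Z + star Z) * W * fibre m m b * star W = Id m"
proof -
obtain a where a: "cmat m m a" "!!x. x \<in> XX ==> herm m (%i j. a i j x)"
 "!!x. x \<in> XX ==> nondeg m (%i j. a i j x)" "star Mop * dil * Mop = fibre m m a"
 and inv: "!!b. cmat m m b ==> fibre m m b * fibre m m a = Id m ==> fibre m m a * fibre m m b = Id m ==>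
   dil * Mop * fibre m m b * star Mop = Id m" using dil_diagonalization by blast
define A where "A = h + Z + star Z"
have A: "A \<in> Mat m m" unfolding A_def by (intro Mat_add big_Mat Z_Mat)
have dil: "dil = star Sop * A * Sop" by (simp add: dil_congruence A_def)
have SS: "star Sinv * star Sop = Id m" using arg_cong[OF Sop_inverse(1), of star] by simp
have SS': "star Sop * star Sinv = Id m" using arg_cong[OF Sop_inverse(2), of star] by simp
show thesis
proof (rule that[OF Mat_mult[OF Lop_Mat(3) Mop(1)] a(1-3)], unfold A_def[symmetric])
 show "star (Sop * Mop) * A * (Sop * Mop) = fibre m m a"
  using a(4) unfolding dil by (simp add: mult.assoc)
 fix b assume b: "cmat m m b" "fibre m m b * fibre m m a = Id m" "fibre m m a * fibre m m b = Id m"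
 let ?Y = "Sop * Mop * fibre m m b * star Mop"
 have Y: "?Y \<in> Mat m m" by (intro Mat_mult[of _ m m] Lop_Mat Mop(1) Mat_star fibre_Mat b(1))
 have "star Sop * (A * ?Y) = Id m" using inv[OF b] unfolding dil by (simp add: mult.assoc)
 hence "star Sinv * (star Sop * (A * ?Y)) = star Sinv"
  using mult_Id[OF Mat_star[OF Lop_Mat(4)]] by simp
 hence "A * ?Y = star Sinv"
  unfolding mult.assoc[symmetric] SS using Id_mult[OF A] by (simp add: mult.assoc)
 hence "A * ?Y * star Sop = Id m" by (simp add: SS)
 thus "A * (Sop * Mop) * fibre m m b * star (Sop * Mop) = Id m" by (simp add: mult.assoc)
qed
qed

end

section \<open>Congruent forms and equivalence of spectral projections\<close>

lemma inner_star_mult: "inner (app (star W * A * W) x) y = inner (app A (app W x)) (app W y)"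
by (simp add: star_inner')

text \<open>Two forms that are close to symmetries and congruent to each other have equivalent
positive spectral projections: the compression of the congruence is bounded below both ways.\<close>

lemma congruence_bounded_below:
fixes P Q I A F W Y :: "'i bop"
assumes I: "star I = I" "I * I = I"
 and P: "star P = P" "P * P = P" "P * I = P" "I * P = P"
 and Q: "star Q = Q" "Q * Q = Q" "Q * I = Q" "I * Q = Q"
 and W: "I * W = W" "W * I = W" and A: "norm (A - (2 *r P - I)) <= 1 / 8" and F: "norm (F - (2 *r Q - I)) <= 1 / 8"
 and WAW: "star W * A * W = F" and Y: "F * Y = I" "I * Y = Y" "A * W * Y * star W = I"
shows "3 / 7 * (norm (app Q x))\<^sup>2 <= (norm (app (P * W * Q) x))\<^sup>2"
 and "3 / 7 * (norm (app P x))\<^sup>2 <= (norm (app (star (P * W * Q)) x))\<^sup>2"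
proof -
have close: "norm (app B y - (2 *r app R y - app I y)) <= 1 / 8 * norm y"
 if "norm (B - (2 *r R - I)) <= 1 / 8" for B R y
 using order_trans[OF norm_app_le mult_right_mono[OF that norm_ge_zero], of y] by simp
have sym: "norm (2 *r app R y - y) = norm y" "inner (2 *r app R y - y) z = inner y (2 *r app R z - z)"
 "inner (2 *r app R y - y) y = 2 * (norm (app R y))\<^sup>2 - (norm y)\<^sup>2"
 if "star R = R" "R * R = R" for R and y z :: "'i ell2"
proof -
 have "inner (app R y) z = inner y (app R z)" for y z by (metis star_inner that(1))
 moreover have "app R (app R y) = app R y" for y by (metis app_simps(5) that(2))
 ultimately have *: "app R (app R y) = app R y" "inner (app R y) z = inner y (app R z)" for y z by metis+
 show "inner (2 *r app R y - y) z = inner y (2 *r app R z - z)"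
  by (simp add: inner_diff_left inner_diff_right *)
 show "inner (2 *r app R y - y) y = 2 * (norm (app R y))\<^sup>2 - (norm y)\<^sup>2"
  unfolding power2_norm_eq_inner by (simp add: inner_diff_left *)
 have "inner (2 *r app R y - y) (2 *r app R y - y) = inner y y"
  by (simp add: inner_diff_left inner_diff_right * inner_commute)
 thus "norm (2 *r app R y - y) = norm y" by (simp add: norm_eq_sqrt_inner)
qed
have ids: "app I (app I y) = app I y" "app I (app P y) = app P y" "app I (app Q y) = app Q y" "app I (app W y) = app W y"
 "app P (app P y) = app P y" "app Q (app Q y) = app Q y" "app I (app Y y) = app Y y" "app F (app Y y) = app I y" for y
 by (metis app_simps(5) I P Q W Y)+
have WI: "app I (app (star W) y) = app (star W) y" for y
 by (metis W(2) I(1) app_simps(5) star_simps(7))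
{
 define \<eta> w where "\<eta> = app Q x" and "w = app W \<eta>"
 have w: "app I w = w" "app I \<eta> = \<eta>" "app Q \<eta> = \<eta>" by (simp_all add: w_def \<eta>_def ids)
 have "inner (app A w) w = inner (app F \<eta>) \<eta>" unfolding WAW[symmetric] inner_star_mult w_def ..
 moreover have "(norm \<eta>)\<^sup>2 - 1 / 8 * (norm \<eta>)\<^sup>2 <= inner (app F \<eta>) \<eta>"
 proof -
  have "2 *r \<eta> - \<eta> = \<eta>" by (simp add: scaleR_2)
  hence "norm (app F \<eta> - \<eta>) <= 1 / 8 * norm \<eta>" using close[OF F, of \<eta>] by (simp add: w)
  hence "norm (app F \<eta> - \<eta>) * norm \<eta> <= 1 / 8 * (norm \<eta>)\<^sup>2"
   using mult_right_mono[of _ _ "norm \<eta>"] by (force simp: power2_eq_square)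
  hence "- (1 / 8 * (norm \<eta>)\<^sup>2) <= inner (app F \<eta> - \<eta>) \<eta>"
   using Cauchy_Schwarz_ineq2[of "app F \<eta> - \<eta>" \<eta>] by linarith
  thus ?thesis by (simp add: inner_diff_left power2_norm_eq_inner)
 qed
 moreover have "inner (app A w) w <= 2 * (norm (app P w))\<^sup>2 - (norm w)\<^sup>2 + 1 / 8 * (norm w)\<^sup>2"
 proof -
  have "norm (app A w - (2 *r app P w - w)) * norm w <= 1 / 8 * (norm w)\<^sup>2"
   using mult_right_mono[OF close[OF A, of w], of "norm w"] by (simp add: w power2_eq_square)
  hence "inner (app A w - (2 *r app P w - w)) w <= 1 / 8 * (norm w)\<^sup>2"
   using Cauchy_Schwarz_ineq2[of "app A w - (2 *r app P w - w)" w] by linarith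
  thus ?thesis using sym(3)[OF P(1,2), of w] by (simp add: inner_diff_left)
 qed
 \<comment> \<open>From \<open>7/8 * (norm \<eta>)^2 \<le> 2 * (norm (P w))^2 - 7/8 * (norm
   w)^2\<close>; afterwards 7/16 is weakened to 3/7 to share one constant with the dual
   estimate.\<close>
 ultimately have "7 / 16 * (norm \<eta>)\<^sup>2 <= (norm (app P w))\<^sup>2" using zero_le_power2[of "norm w"] by linarith
 thus "3 / 7 * (norm (app Q x))\<^sup>2 <= (norm (app (P * W * Q) x))\<^sup>2"
 proof -
  have "3 / 7 * (norm \<eta>)\<^sup>2 <= 7 / 16 * (norm \<eta>)\<^sup>2" by (intro mult_right_mono) auto
  with \<open>7 / 16 * (norm \<eta>)\<^sup>2 <= (norm (app P w))\<^sup>2\<close> have "3 / 7 * (norm \<eta>)\<^sup>2 <= (norm (app P w))\<^sup>2" by linarith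
  thus ?thesis by (simp only: \<eta>_def w_def app_simps)
 qed
}
{
 define \<xi> \<zeta> where "\<xi> = app P x" and "\<zeta> = app (star W) \<xi>"
 \<comment> \<open>The preimages of \<zeta> under \<open>F\<close> and of \<xi> under
   \<open>A\<close>. With them the argument is repeated for the inverse forms, which are congruent
   through \<open>star W\<close>.\<close>
 define \<zeta>0 \<tau> where "\<zeta>0 = app Y \<zeta>" and "\<tau> = app W \<zeta>0"
 have i: "app I \<xi> = \<xi>" "app P \<xi> = \<xi>" "app I \<zeta> = \<zeta>" "app I \<zeta>0 = \<zeta>0" "app I \<tau> = \<tau>"
  by (simp_all add: \<xi>_def \<zeta>_def \<zeta>0_def \<tau>_def ids WI)
 have "app A \<tau> = \<xi>" using i(1) Y(3) by (metis \<tau>_def \<zeta>0_def \<zeta>_def app_simps(5))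
 have "app F \<zeta>0 = \<zeta>" by (simp add: \<zeta>0_def ids i)
 \<comment> \<open>Passing to the inverse of a form at distance 1/8 from a symmetry multiplies the
   error by at most 8/7, hence 1/7.\<close>
 have small: "norm z0 <= 8 / 7 * norm z" "norm (z - (2 *r app R z0 - z0)) <= 1 / 7 * norm z"
  if "norm (B - (2 *r R - I)) <= 1 / 8" "app B z0 = z" "app I z0 = z0" "star R = R" "R * R = R" for B R z z0
 proof -
  have d: "norm (z - (2 *r app R z0 - z0)) <= 1 / 8 * norm z0" using close[OF that(1), of z0] that by simp
  thus "norm z0 <= 8 / 7 * norm z"
   using sym(1)[OF that(4,5), of z0] norm_triangle_ineq2[of "2 *r app R z0 - z0" z]
   by (simp add: norm_minus_commute)
  with d show "norm (z - (2 *r app R z0 - z0)) <= 1 / 7 * norm z" by linarith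
 qed
 have "inner \<xi> \<tau> = inner \<zeta> \<zeta>0" by (simp add: \<tau>_def \<zeta>_def star_inner')
 moreover have "(norm \<xi>)\<^sup>2 - 1 / 7 * (norm \<xi>)\<^sup>2 <= inner \<xi> \<tau>"
 proof -
  let ?d = "\<xi> - (2 *r app P \<tau> - \<tau>)"
  have "norm \<xi> * norm ?d <= norm \<xi> * (1 / 7 * norm \<xi>)"
   using small(2)[OF A \<open>app A \<tau> = \<xi>\<close> i(5) P(1,2)] by (rule mult_left_mono) simp
  hence "inner \<xi> ?d <= 1 / 7 * (norm \<xi>)\<^sup>2"
   using Cauchy_Schwarz_ineq2[of \<xi> ?d] by (simp add: power2_eq_square)
  moreover have "2 *r \<xi> - \<xi> = \<xi>" by (simp add: scaleR_2)
  hence "inner \<xi> (2 *r app P \<tau> - \<tau>) = inner \<xi> \<tau>" using sym(2)[OF P(1,2), of \<xi> \<tau>] i by simp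
  ultimately show ?thesis by (simp add: inner_diff_right power2_norm_eq_inner)
 qed
 moreover have "inner \<zeta> \<zeta>0 <= 2 * (norm (app Q \<zeta>))\<^sup>2 - (norm \<zeta>)\<^sup>2 + 1 / 7 * (norm \<zeta>)\<^sup>2"
 proof -
  let ?f = "%y. 2 *r app Q y - y"
  have ff: "?f (?f y) = y" if "app I y = y" for y
   by (simp add: ids scaleR_2)
  have "inner \<zeta> \<zeta>0 = inner (?f \<zeta>) (?f \<zeta>0)" using sym(2)[OF Q(1,2), of \<zeta> "?f \<zeta>0"] ff[OF i(4)] by simp
  also have "... = inner (?f \<zeta>) \<zeta> - inner (?f \<zeta>) (\<zeta> - ?f \<zeta>0)" by (simp add: inner_diff_right)
  finally have e: "inner \<zeta> \<zeta>0 = inner (?f \<zeta>) \<zeta> - inner (?f \<zeta>) (\<zeta> - ?f \<zeta>0)" .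
  have "- inner (?f \<zeta>) (\<zeta> - ?f \<zeta>0) <= norm \<zeta> * (1 / 7 * norm \<zeta>)"
   using Cauchy_Schwarz_ineq2[of "?f \<zeta>" "\<zeta> - ?f \<zeta>0"] sym(1)[OF Q(1,2), of \<zeta>]
    mult_left_mono[OF small(2)[OF F \<open>app F \<zeta>0 = \<zeta>\<close> i(4) Q(1,2)], of "norm \<zeta>"] by simp
  thus ?thesis using sym(3)[OF Q(1,2), of \<zeta>] e by (simp add: power2_eq_square)
 qed
 \<comment> \<open>From \<open>6/7 * (norm \<xi>)^2 \<le> 2 * (norm (Q \<zeta>))^2 - 6/7 * (norm
   \<zeta>)^2\<close>.\<close>
 ultimately have "3 / 7 * (norm \<xi>)\<^sup>2 <= (norm (app Q \<zeta>))\<^sup>2" using zero_le_power2[of "norm \<zeta>"] by linarith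
 thus "3 / 7 * (norm (app P x))\<^sup>2 <= (norm (app (star (P * W * Q)) x))\<^sup>2"
  by (simp add: P Q \<xi>_def \<zeta>_def)
}
qed

section \<open>Banded approximations and their inverses\<close>

context zero_dim_system
begin

definition banded :: "int => 'x idx bop => bool" where
"banded D A <-> (\<forall>x i c y j d. D < \<bar>i - j\<bar> --> coef A (x, i, c) (y, j, d) = 0)"

lemma bandedD: "banded D A ==> D < \<bar>i - j\<bar> ==> coef A (x, i, c) (y, j, d) = 0"
by (simp add: banded_def)

lemma banded_ent: "banded D A ==> D < \<bar>i\<bar> ==> ent A c d i x = 0"
unfolding ent_def by (rule bandedD) simp_all

lemma banded_mono: "banded D A ==> D <= D' ==> banded D' A"
by (auto simp: banded_def)

lemma banded_mult: "banded D A ==> banded D' B ==> banded (D + D') (A * B)"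
unfolding banded_def[of "D + D'"]
proof (intro allI impI)
fix x y :: 'x and i j c d assume a: "banded D A" "banded D' B" "D + D' < \<bar>i - j\<bar>"
show "coef (A * B) (x, i, c) (y, j, d) = 0"
 unfolding coef_mult
proof (rule coord_app_idx)
 fix z k e show "coef A (x, i, c) (z, k, e) = 0 | coord (app B (unit_vec (y, j, d))) (z, k, e) = 0"
  using bandedD[OF a(1), of i k] bandedD[OF a(2), of k j] a(3)
  by (cases "D < \<bar>i - k\<bar>") (auto simp: coef_def)
qed
qed

lemma banded_sum: "(!!k. k \<in> K ==> banded D (F k)) ==> banded D (sum F K)"
by (auto simp: banded_def coef_sum)

lemma banded_diff: "banded D A ==> banded D B ==> banded D (A - B)"
by (auto simp: banded_def)

lemma banded_add: "banded D A ==> banded D B ==> banded D (A + B)"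
by (auto simp: banded_def)

lemma banded_scaleR: "banded D A ==> banded D (r *r A)"
by (auto simp: banded_def coef_def)

lemma banded_star: "banded D A ==> banded D (star A)"
by (auto simp: banded_def coef_star abs_minus_commute)

lemma banded_Id: "0 <= D ==> banded D (Id n)"
by (auto simp: banded_def coef_def coord_Id coord_unit_vec)

lemma banded_cross_op: "F \<in> CA ==> \<exists>D. banded D (cross_op c d F)"
proof -
assume F: "F \<in> CA"
define B where "B = Max (abs ` fsupp F)"
have B: "\<bar>i\<bar> <= B" if "i \<in> fsupp F" for i
 unfolding B_def using carrierD(2)[OF F] that by (intro Max_ge) auto
have "F (l - k) = (%_. 0)" if "B < \<bar>k - l\<bar>" for k l using B[of "l - k"] that by force
hence "banded B (cross_op c d F)" by (auto simp: banded_def coef_cross_op[OF F])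
thus ?thesis ..
qed

lemma laurent_approx:
assumes s: "s \<in> Mat n n" "star s = s" and e: "0 < e"
obtains h D where "h \<in> Mat n n" "star h = h" "banded D h" "norm (h - s) <= e"
proof -
obtain a where a: "!!i j. i < n ==> j < n ==> a i j \<in> CB" and sa: "s = (\<Sum>i<n. \<Sum>j<n. comp_op i j (a i j))"
 using MatE[OF s(1)] by blast
define e' where "e' = e / (real n * real n + 1)"
have e': "0 < e'" using e by (simp add: e'_def add_nonneg_pos)
have "\<exists>F. F \<in> CA & norm (comp_op i j (a i j) - cross_op i j F) < e'" if "i < n" "j < n" for i j
 using comp_op_dense[OF a[OF that] e', of i j] by blast
hence "\<exists>F. \<forall>i j. i < n & j < n --> F i j \<in> CA & norm (comp_op i j (a i j) - cross_op i j (F i j)) < e'"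
 by metis
then obtain F where F: "!!i j. i < n ==> j < n ==> F i j \<in> CA"
 and Fe: "!!i j. i < n ==> j < n ==> norm (comp_op i j (a i j) - cross_op i j (F i j)) < e'" by blast
define h0 where "h0 = (\<Sum>i<n. \<Sum>j<n. cross_op i j (F i j))"
define h where "h = (1 / 2) *r (h0 + star h0)"
have h0: "h0 \<in> Mat n n" unfolding h0_def using F by (intro Mat_sum Mat_cross_op) auto
have "norm (h0 - s) <= (\<Sum>i<n. \<Sum>j<n. e')"
 unfolding sa h0_def sum_subtractf[symmetric]
 by (intro order_trans[OF norm_sum sum_mono]) (use Fe in "simp add: norm_minus_commute less_imp_le")
also have "... = (real n * real n / (real n * real n + 1)) * e" by (simp add: e'_def)
also have "... <= 1 * e" using e by (intro mult_right_mono) (auto simp: divide_le_eq_1 add_nonneg_pos)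
finally have n0: "norm (h0 - s) <= e" by simp
have "norm (star h0 - s) <= e" using n0 norm_star[of "h0 - s"] s(2) by simp
with n0 have "norm ((h0 - s) + (star h0 - s)) <= e + e" by (rule norm_triangle_mono)
moreover have "h - s = (1 / 2) *r ((h0 - s) + (star h0 - s))"
 by (simp add: h_def algebra_simps flip: scaleR_left_distrib)
ultimately have hs: "norm (h - s) <= e" by simp
have "\<exists>D. \<forall>i j. i < n & j < n --> banded (D i j) (cross_op i j (F i j))"
proof -
 have "\<exists>D. banded D (cross_op i j (F i j))" if "i < n" "j < n" for i j using banded_cross_op[OF F[OF that]] .
 thus ?thesis by metis
qed
then obtain D where D: "!!i j. i < n ==> j < n ==> banded (D i j) (cross_op i j (F i j))" by blast
define B where "B = Max ((%(i, j). D i j) ` ({..<n} \<times> {..<n}))"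
have "D i j <= B" if "i < n" "j < n" for i j unfolding B_def using that by (intro Max_ge) auto
hence "banded B h0" unfolding h0_def using D banded_mono by (intro banded_sum) (metis lessThan_iff)
hence "banded B h" unfolding h_def by (intro banded_scaleR banded_add banded_star)
moreover have "h \<in> Mat n n" unfolding h_def by (intro Mat_scaleR Mat_add h0 Mat_star)
ultimately show thesis using hs by (intro that[of h B]) (simp_all add: h_def add.commute)
qed

lemma norm_Id_le: "norm (Id n) <= 1"
proof -
have "norm (Id n) = (norm (Id n))\<^sup>2"
 using norm_star_mult[of "Id n"] Id_mult[OF Id_Mat] by simp
thus ?thesis by (cases "norm (Id n) = 0") (auto simp: power2_eq_square)
qed

text \<open>The inverse of \<open>h\<close> is \<open>h\<close> times the Neumann series of \<open>y = Id n - h * h\<close>, whose partial sums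
are banded.\<close>

lemma laurent_inverse:
assumes h: "h \<in> Mat n n" "star h = h" "banded (int D) h" and y: "norm (Id n - h * h) <= 1 / 2"
obtains g \<rho> where "g \<in> Mat n n" "h * g = Id n" "g * h = Id n" "0 < \<rho>" "\<rho> < 1" "!!c d. expdec \<rho> (ent g c d)"
proof -
define y where "y = Id n - h * h"
have yn: "norm y <= 1 / 2" using y by (simp add: y_def)
have hh: "h * h \<in> Mat n n" using h(1) Mat_mult by blast
have term_bound: "norm (h * y ^ k) <= norm h * (1 / 2) ^ k" for k
 by (rule order_trans[OF norm_mult_ineq mult_left_mono[OF order_trans[OF norm_power_ineq power_mono[OF yn]]]]) simp_all
have geo: "summable (%k. norm h * (1 / 2 :: real) ^ k)" by (intro summable_mult summable_geometric) simp
have sm: "summable (%k. h * y ^ k)"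
 by (rule summable_norm_cancel, rule summable_comparison_test'[OF geo]) (use term_bound in auto)
let ?S = "suminf (%k. y ^ k)"
have S: "summable (%k. y ^ k)" "?S = 1 + y * ?S" "?S = 1 + ?S * y" using neumann[of y] yn by simp_all
define g where "g = suminf (%k. h * y ^ k)"
have MB: "h * y ^ k \<in> Mat n n & banded (int D + 2 * int D * int k) (h * y ^ k)" for k
proof (induction k)
 case (Suc k)
 have "y \<in> Mat n n" unfolding y_def by (intro Mat_diff Id_Mat hh)
 moreover have "banded (int D + int D) y"
  unfolding y_def by (intro banded_diff banded_Id banded_mult h(3)) simp
 ultimately have "h * y ^ k * y \<in> Mat n n" "banded (int D + 2 * int D * int k + (int D + int D)) (h * y ^ k * y)"
  using Suc Mat_mult banded_mult by blast+
 thus ?case by (simp add: power_Suc2 mult.assoc algebra_simps del: power_Suc)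
qed (use h in simp)
have gM: "g \<in> Mat n n"
 using summable_LIMSEQ[OF sm] unfolding g_def
 by (rule closed_sequentially[OF Mat_closed, rotated]) (use MB in "auto intro: Mat_sum")
have hy: "h * y = y * h" unfolding y_def
 using Id_mult[OF h(1)] mult_Id[OF h(1)] by (simp add: left_diff_distrib right_diff_distrib mult.assoc)
have hyk: "h * y ^ k = y ^ k * h" for k
 by (induction k) (simp_all add: mult.assoc[symmetric] hy power_commutes, metis hy mult.assoc)
have gh: "g = h * ?S" unfolding g_def by (rule suminf_mult[OF S(1)])
have gh': "g = ?S * h" unfolding g_def hyk by (rule suminf_mult2[OF S(1), symmetric])
have hh': "h * h = Id n - y" by (simp add: y_def)
have Iy: "Id n * y = y" "y * Id n = y" unfolding y_def
 by (simp_all add: left_diff_distrib right_diff_distrib Id_mult[OF Id_Mat] Id_mult[OF hh] mult_Id[OF hh])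
have hgI: "h * g = Id n"
proof -
 have "h * g = Id n * ?S - y * ?S" unfolding gh mult.assoc[symmetric] hh' left_diff_distrib ..
 also have "Id n * ?S = Id n + y * ?S"
  by (subst S(2)) (simp only: distrib_left mult_1_right mult.assoc[symmetric] Iy)
 finally show ?thesis by simp
qed
have ghI: "g * h = Id n"
proof -
 have "g * h = ?S * Id n - ?S * y" unfolding gh' mult.assoc hh' right_diff_distrib ..
 also have "?S * Id n = Id n + ?S * y"
  by (subst S(3)) (simp only: distrib_right mult_1_left mult.assoc Iy)
 finally show ?thesis by simp
qed
\<comment> \<open>Each factor \<open>y\<close> widens the band by at most \<open>2 * D\<close>, so a
  coefficient at distance at least \<open>k * L\<close> with \<open>k > 0\<close> receives nothing
  from the first \<open>k\<close> terms. The tail beyond them has size about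
  \<open>(1 / 2) ^ k\<close>, which makes the \<open>L\<close>-th root of 1/2 the decay
  rate.\<close>
define L where "L = 2 * D + 1"
define \<rho> where "\<rho> = root L (1 / 2)"
have \<rho>: "0 < \<rho>" "\<rho> < 1" "\<rho> ^ L = 1 / 2"
 using real_root_lt_1_iff[of L "1 / 2"] by (auto simp: \<rho>_def L_def simp del: power_Suc)
have "expdec \<rho> (ent g c d)" for c d
\<comment> \<open>One factor 2 is the sum of the geometric tail, the other pays for the remainder in
  the division by \<open>L\<close>.\<close>
proof (rule expdecI[where C = "4 * norm h"])
 fix i x
 define k where "k = nat \<bar>i\<bar> div L"
 have "norm (g - (\<Sum>j<k. h * y ^ j)) <= 2 * norm h * (1 / 2) ^ k"
 proof -
  have "g - (\<Sum>j<k. h * y ^ j) = suminf (%j. h * y ^ (j + k))"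
   unfolding g_def using suminf_minus_initial_segment[OF sm, of k] by simp
  also have "norm ... <= suminf (%j. norm h * (1 / 2) ^ (j + k))"
  proof (rule norm_suminf_le)
   show "norm (h * y ^ (j + k)) <= norm h * (1 / 2) ^ (j + k)" for j by (rule term_bound)
   show "summable (%j. norm h * (1 / 2 :: real) ^ (j + k))" using geo by (rule summable_ignore_initial_segment)
  qed
  also have "... = suminf (%j. (norm h * (1 / 2) ^ k) * (1 / 2) ^ j)" by (simp add: power_add mult_ac)
  also have "... = (norm h * (1 / 2) ^ k) * 2"
   using suminf_mult[OF summable_geometric[of "1 / 2 :: real"]] suminf_geometric[of "1 / 2 :: real"] by simp
  finally show ?thesis by simp
 qed
 moreover have "ent (\<Sum>j<k. h * y ^ j) c d i x = 0"
 proof (cases "k = 0")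
  case False
  have "k * L <= nat \<bar>i\<bar>" by (simp add: k_def)
  hence "int k * (2 * int D + 1) <= \<bar>i\<bar>" unfolding L_def by (simp add: le_nat_iff algebra_simps)
  hence "int k * (2 * int D) < \<bar>i\<bar>" using False by (simp add: algebra_simps)
  moreover have "banded (int k * (2 * int D)) (\<Sum>j<k. h * y ^ j)"
  proof (rule banded_sum)
   fix j assume "j \<in> {..<k}"
   hence "(int j + 1) * (2 * int D) <= int k * (2 * int D)" by (intro mult_right_mono) auto
   hence "int D + 2 * int D * int j <= int k * (2 * int D)" by (simp add: algebra_simps)
   thus "banded (int k * (2 * int D)) (h * y ^ j)" using MB[of j] banded_mono by blast
  qed
  ultimately show ?thesis by (simp add: banded_ent)
 qed (simp add: ent_def)
 hence "cmod (ent g c d i x) <= norm (g - (\<Sum>j<k. h * y ^ j))"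
  using norm_ent_le[of "g - (\<Sum>j<k. h * y ^ j)" c d i x] by (simp add: ent_def)
 moreover have "(1 / 2) ^ k <= 2 * \<rho> ^ nat \<bar>i\<bar>"
 proof -
  have "nat \<bar>i\<bar> = L * k + nat \<bar>i\<bar> mod L" by (simp add: k_def)
  hence "\<rho> ^ nat \<bar>i\<bar> = (1 / 2) ^ k * \<rho> ^ (nat \<bar>i\<bar> mod L)" by (metis \<rho>(3) power_add power_mult)
  moreover have "\<rho> ^ L <= \<rho> ^ (nat \<bar>i\<bar> mod L)" using \<rho> by (intro power_decreasing) (auto simp: L_def less_imp_le)
  ultimately show ?thesis using \<rho>(3) by (simp add: mult_left_mono)
 qed
 hence "2 * norm h * (1 / 2) ^ k <= 4 * norm h * \<rho> ^ nat \<bar>i\<bar>"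
  using mult_left_mono[of _ _ "2 * norm h"] by force
 ultimately show "cmod (ent g c d i x) <= 4 * norm h * \<rho> ^ nat \<bar>i\<bar>" by linarith
qed (rule ent_cfun[OF gM])
with gM hgI ghI \<rho> show thesis by (intro that)
qed

end

section \<open>Diagonalization by locally constant frames and signs\<close>

context zero_dim_system
begin

lemma loc_const_cfun: "loc_const f ==> (%x. if x \<in> XX then f x else 0) \<in> cfun X"
proof (rule cfun_loc_const)
assume "loc_const f"
moreover have "{x \<in> XX. (if x \<in> XX then f x else 0) = v} = {x \<in> XX. f x = v}" for v by auto
ultimately show "loc_const (%x. if x \<in> XX then f x else 0)" unfolding loc_const_iff by simp
qed simp

lemma norm_fibre_le:
assumes "cmat m m e" "!!i j x. i < m ==> j < m ==> x \<in> XX ==> cmod (e i j x) <= \<delta>" "0 <= \<delta>"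
shows "norm (fibre m m e) <= real m * real m * \<delta>"
proof -
have "norm (cross_op i j (embed0 (e i j))) <= \<delta>" if "i < m" "j < m" for i j
proof -
 have f: "embed0 (e i j) \<in> CA" using cmatD[OF assms(1) that] by (rule embed0_closed)
 have s: "(SUP x\<in>XX. cmod (embed0 (e i j) k x)) <= \<delta>" for k
  using nonempty assms(2)[OF that] assms(3) by (intro cSUP_least) (auto simp: embed0_def)
 have "l1_norm X (embed0 (e i j)) <= (\<Sum>k\<in>fsupp (embed0 (e i j)). \<delta>)" unfolding l1_norm_def by (intro sum_mono s)
 also have "... <= (\<Sum>k\<in>{0 :: int}. \<delta>)" by (rule sum_mono2) (use assms(3) in "auto simp: embed0_def")
 finally show ?thesis using norm_cross_op_l1[OF f, of i j] by simp
qed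
hence "norm (fibre m m e) <= (\<Sum>i<m. \<Sum>j<m. \<delta>)"
 unfolding fibre_eq[OF assms(1)] by (intro order_trans[OF norm_sum sum_mono]) auto
thus ?thesis by simp
qed

lemma fibre_inverse:
assumes "cmat m m a" "cmat m m b"
 and "!!x. x \<in> XX ==> inverse_matrix m (%i j. a i j x) (%i j. b i j x)"
shows "fibre m m a * fibre m m b = Id m" "fibre m m b * fibre m m a = Id m"
proof -
have "(\<Sum>k<m. a i k x * b k j x) = diag_fun (%_. XX) i j x &
 (\<Sum>k<m. b i k x * a k j x) = diag_fun (%_. XX) i j x" if ij: "i < m" "j < m" for i j x
proof (cases "x \<in> XX")
 case True
 thus ?thesis using assms(3)[OF True] ij by (auto simp: inverse_matrix_def diag_fun_def)
next
 case False
 hence "a i k x = 0" "b i k x = 0" if "k < m" for k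
  using cmatD[OF assms(1) ij(1) that] cmatD[OF assms(2) ij(1) that] unfolding cfun_def by blast+
 thus ?thesis using False by (auto simp: diag_fun_def)
qed
thus "fibre m m a * fibre m m b = Id m" "fibre m m b * fibre m m a = Id m"
 unfolding fibre_mult[OF assms(1,2)] fibre_mult[OF assms(2,1)] by (auto intro!: fibre_cong)
qed

text \<open>The frame and signs that diagonalize the form at one point do so approximately on a
  neighbourhood when kept constant there, so both can be selected locally constantly. The entrywise
  error \<epsilon> is small enough for the crude bound \<open>m * m * \<epsilon>\<close> on the
  operator norm.\<close>

lemma locally_constant_diagonalization:
assumes a: "cmat m m a" and hn: "!!x. x \<in> XX ==> herm m (%i j. a i j x) & nondeg m (%i j. a i j x)" and "0 < \<delta>"
obtains C C' A where "cmat m m C" "cmat m m C'" "clopens m A"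
 "fibre m m C * fibre m m C' = Id m" "fibre m m C' * fibre m m C = Id m"
 "norm (star (fibre m m C) * fibre m m a * fibre m m C - (2 *r fibre m m (diag_fun A) - Id m)) <= \<delta>"
proof -
define \<epsilon> where "\<epsilon> = \<delta> / (real m * real m + 1)"
have \<epsilon>: "0 < \<epsilon>" using \<open>0 < \<delta>\<close> by (simp add: \<epsilon>_def add_nonneg_pos)
define val where "val C x i j = (\<Sum>k<m. \<Sum>l<m. cnj (C k i) * a k l x * C l j)" for C :: "nat => nat => complex" and x i j
define Q where "Q y c = (case c of (C, C', \<tau>) => inverse_matrix m C C' & (\<forall>j<m. \<tau> j = (1 :: complex) | \<tau> j = - 1) &
 msum m (%i j. val C y i j - (if i = j then \<tau> i else 0)) < \<epsilon>)" for y c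
have val_cmat: "cmat m m (%i j x. val C x i j)" for C
proof -
 have "(%x. cnj (C k i) * a k l x * C l j) \<in> cfun X" if "k < m" "l < m" for k l i j
  using cfun_scale[OF cmatD[OF a that], of "cnj (C k i) * C l j"] by (simp add: mult_ac)
 thus ?thesis unfolding val_def by (intro cmatI cfun_sum) auto
qed
have "\<exists>c W. openin X W & x \<in> W & (\<forall>y\<in>W. Q y c)" if x: "x \<in> XX" for x
proof -
 obtain C \<tau> where \<tau>: "!!j. j < m ==> \<tau> j = (1 :: complex) | \<tau> j = - 1"
  and d: "!!i j. i < m ==> j < m ==> val C x i j = (if i = j then \<tau> i else 0)"
  and inv: "!!i j. i < m ==> j < m ==> (\<Sum>k<m. \<Sum>l<m. \<tau> k * C i k * cnj (C l k) * a l j x) = (if i = j then 1 else 0)"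
  unfolding val_def by (rule sylvester[OF conjunct1[OF hn[OF x]] conjunct2[OF hn[OF x]]]) blast
 define C' where "C' i j = (\<Sum>l<m. \<tau> i * cnj (C l i) * a l j x)" for i j
 have "(\<Sum>k<m. C i k * C' k j) = (if i = j then 1 else 0)" if "i < m" "j < m" for i j
  unfolding inv[OF that, symmetric] C'_def sum_distrib_left by (simp only: mult_ac)
 moreover have "(\<Sum>k<m. C' i k * C k j) = (if i = j then 1 else 0)" if "i < m" "j < m" for i j
 proof -
  have "(\<Sum>k<m. C' i k * C k j) = \<tau> i * val C x i j"
   unfolding C'_def val_def sum_distrib_left sum_distrib_right by (subst sum.swap) (simp only: mult_ac)
  thus ?thesis using d[OF that] \<tau>[OF that(1)] by auto
 qed
 ultimately have I: "inverse_matrix m C C'" unfolding inverse_matrix_def by blast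
 obtain U where U: "openin X U" "x \<in> U" "\<forall>y\<in>U. msum m (%i j. val C y i j - val C x i j) < \<epsilon>"
  using msum_near[OF val_cmat x \<epsilon>] by blast
 have "msum m (%i j. val C y i j - val C x i j) = msum m (%i j. val C y i j - (if i = j then \<tau> i else 0))" for y
  unfolding msum_def using d by (intro sum.cong) auto
 hence "\<forall>y\<in>U. Q y (C, C', \<tau>)" using U(3) I \<tau> by (auto simp: Q_def)
 with U show ?thesis by blast
qed
from loc_const_selection[OF this] obtain \<sigma> where \<sigma>: "loc_const \<sigma>" "!!x. x \<in> XX ==> Q x (\<sigma> x)" by blast
define C where "C i j x = (if x \<in> XX then fst (\<sigma> x) i j else 0)" for i j x
define C' where "C' i j x = (if x \<in> XX then fst (snd (\<sigma> x)) i j else 0)" for i j x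
define A where "A j = {x \<in> XX. snd (snd (\<sigma> x)) j = 1}" for j
have cC: "cmat m m C" "cmat m m C'"
 unfolding C_def C'_def by (intro cmatI loc_const_cfun loc_const_comp[OF \<sigma>(1)])+
have cA: "clopens m A" unfolding clopens_def A_def using clopen_level[OF \<sigma>(1), of "%c. snd (snd c) j = 1" for j] by blast
have inv: "inverse_matrix m (%i j. C i j x) (%i j. C' i j x)" if "x \<in> XX" for x
 using \<sigma>(2)[OF that] that by (auto simp: Q_def C_def C'_def split: prod.splits)
define F where "F = (%i j x. \<Sum>k<m. (\<Sum>l<m. cnj (C l i x) * a l k x) * C k j x)"
have cS: "cmat m m (%i j x. cnj (C j i x))" using cmatD[OF cC(1)] by (intro cmatI cfun_cnj) auto
have cSa: "cmat m m (%i k x. \<Sum>l<m. cnj (C l i x) * a l k x)"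
 using cmatD[OF cS] cmatD[OF a] by (intro cmatI cfun_sum cfun_mult) auto
have F: "star (fibre m m C) * fibre m m a * fibre m m C = fibre m m F"
 unfolding star_fibre[OF cC(1)] fibre_mult[OF cS a] fibre_mult[OF cSa cC(1)] F_def ..
have cF: "cmat m m F" unfolding F_def by (intro cmatI cfun_sum cfun_mult[OF cmatD[OF cSa] cmatD[OF cC(1)]]) auto
define e where "e i j x = F i j x - (2 * diag_fun A i j x - diag_fun (%_. XX) i j x)" for i j x
have ce: "cmat m m e" unfolding e_def
 using cmatD[OF cF] cmatD[OF cmat_diag_fun[OF cA]] cmatD[OF cmat_diag_fun[OF clopens_top]]
 by (intro cmatI cfun_diff cfun_scale) auto
have "fibre m m F - (2 *r fibre m m (diag_fun A) - Id m) = fibre m m e"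
proof (rule Mat_eqI)
 show "fibre m m F - (2 *r fibre m m (diag_fun A) - Id m) \<in> Mat m m"
  by (intro Mat_diff Mat_scaleR fibre_Mat cF cmat_diag_fun cA clopens_top)
 show "ent (fibre m m F - (2 *r fibre m m (diag_fun A) - Id m)) c d i x = ent (fibre m m e) c d i x"
  if "c < m" "d < m" for c d i x
 proof -
  have "ent (B - (2 *r B' - B'')) c d i x = ent B c d i x - (2 * ent B' c d i x - ent B'' c d i x)" for B B' B''
   by (simp add: ent_def coef_def) (simp add: scaleR_conv_of_real)
  thus ?thesis using that
   by (simp add: ent_fibre cF ce cmat_diag_fun cA clopens_top e_def)
 qed
qed (rule fibre_Mat[OF ce])
moreover have "norm (fibre m m e) <= real m * real m * \<epsilon>"
proof (rule norm_fibre_le[OF ce])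
 fix i j x assume ij: "i < m" "j < m" and x: "x \<in> XX"
 obtain C0 C0' \<tau> where s: "\<sigma> x = (C0, C0', \<tau>)" by (metis prod.collapse)
 have Qx: "\<forall>j<m. \<tau> j = 1 | \<tau> j = - 1" "msum m (%i j. val C0 x i j - (if i = j then \<tau> i else 0)) < \<epsilon>"
  using \<sigma>(2)[OF x] by (simp_all add: Q_def s)
 have "F i j x = val C0 x i j"
  unfolding F_def val_def C_def sum_distrib_right using x by (subst sum.swap) (simp add: s)
 moreover have "2 * diag_fun A i j x - diag_fun (%_. XX) i j x = (if i = j then \<tau> i else 0)"
  using Qx(1) ij x by (auto simp: diag_fun_def A_def s indicator_def)
 ultimately have "cmod (e i j x) <= msum m (%i j. val C0 x i j - (if i = j then \<tau> i else 0))"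
  unfolding e_def by (simp only:) (rule msum_entry[OF ij])
 thus "cmod (e i j x) <= \<epsilon>" using Qx(2) by linarith
qed (use \<epsilon> in simp)
moreover have "real m * real m * \<epsilon> <= \<delta>"
proof -
 have "real m * real m / (real m * real m + 1) * \<delta> <= 1 * \<delta>"
  using \<open>0 < \<delta>\<close> by (intro mult_right_mono) (auto simp: divide_le_eq_1 add_nonneg_pos)
 thus ?thesis by (simp add: \<epsilon>_def)
qed
ultimately show thesis
 using that[OF cC cA fibre_inverse[OF cC inv]] unfolding F by simp
qed

lemma coord_munit: "coord (app (munit i j) \<eta>) (x, k, c) = (if c = i & x \<in> XX then coord \<eta> (x, k, j) else 0)"
proof -
have "munit i j = cross_op i j \<one>\<^bsub>\<A>\<^esub>"
 unfolding munit_def crossed_zero_one using comp_op_cls seq_const one_closed by metis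
thus ?thesis
 by (simp add: coord_cross_op[OF one_closed, of "{0}"] fsupp_one) (simp add: alg_simps)
qed

end

section \<open>Stable classes of projections\<close>

context half_line
begin

text \<open>\<open>h + Z + star Z\<close> is close to the symmetry of \<open>R\<close>, the sum of
  \<open>p\<close> and the positive half of the hyperbolic form, and is congruent to a form close to
  the symmetry of a clopen diagonal projection \<open>Q\<close>. Hence \<open>R\<close> and
  \<open>Q\<close> are equivalent. Since each hyperbolic plane has one positive direction,
  \<open>R\<close> is also equivalent to \<open>p\<close> plus \<open>N\<close> copies of the
  unit.\<close>

lemma stable_diagonalization:
assumes P: "P \<in> \<P>" "fst P = n" and close: "norm (h - (2 *r proj_op P - Id n)) <= 1 / 8"
shows "\<exists>r. loc_const r & pcls P \<star> rcls (%_. N) = rcls r"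
proof -
define p where "p = mat_op n n (snd P)"
have p: "p \<in> Mat n n" "star p = p" "p * p = p"
 using P proj_op_Mat[OF P(1)] unfolding projections_iff p_def by auto
have pm: "p \<in> Mat m m" using p(1) Mat_mono[of n m n m] by auto
obtain W a where W: "W \<in> Mat m m" and a: "cmat m m a" "!!x. x \<in> XX ==> herm m (%i j. a i j x)"
 "!!x. x \<in> XX ==> nondeg m (%i j. a i j x)" and WAW: "star W * (h + Z + star Z) * W = fibre m m a"
 and inv: "!!b. cmat m m b ==> fibre m m b * fibre m m a = Id m ==> fibre m m a * fibre m m b = Id m ==>
   (h + Z + star Z) * W * fibre m m b * star W = Id m" using congruent_to_fibre by blast
define A where "A = h + Z + star Z"
have A: "A \<in> Mat m m" unfolding A_def by (intro Mat_add big_Mat Z_Mat)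
obtain b where b: "cmat m m b" "!!x. x \<in> XX ==> inverse_matrix m (%i j. a i j x) (%i j. b i j x)"
 using cmat_herm_inverse[OF a(1)] a(2,3) by blast
have ab: "fibre m m a * fibre m m b = Id m" "fibre m m b * fibre m m a = Id m"
 by (rule fibre_inverse(1)[OF a(1) b], assumption) (rule fibre_inverse(2)[OF a(1) b], assumption)
obtain C C' B where C: "cmat m m C" "cmat m m C'" and B: "clopens m B"
 and CC: "fibre m m C * fibre m m C' = Id m" "fibre m m C' * fibre m m C = Id m"
 and F: "norm (star (fibre m m C) * fibre m m a * fibre m m C - (2 *r fibre m m (diag_fun B) - Id m)) <= 1 / 8"
 using locally_constant_diagonalization[OF a(1), of "1 / 8"] a(2,3) by auto
define c c' Q where "c = fibre m m C" and "c' = fibre m m C'" and "Q = fibre m m (diag_fun B)"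
define fa fb where "fa = fibre m m a" and "fb = fibre m m b"
have cM: "c \<in> Mat m m" "c' \<in> Mat m m" "fa \<in> Mat m m" "fb \<in> Mat m m" "Q \<in> Mat m m"
 unfolding c_def c'_def fa_def fb_def Q_def by (intro fibre_Mat C a b cmat_diag_fun B)+
have Q: "star Q = Q" "Q * Q = Q" unfolding Q_def by (rule diag_fibre_star_mult[OF B])+
\<comment> \<open>Isometry from the second block onto the eigenspace of \<open>Z + star Z\<close>
  for the eigenvalue 1: a vector plus its partner in the third block, normalized.\<close>
define V where "V = (1 / sqrt 2) *r (Py + Z)"
have sPy: "star Py = Py" "Py * Py = Py" unfolding Py_def by (rule diag_fibre_star_mult[OF clopens_Py])+
have PyM: "Py \<in> Mat m m" unfolding Py_def by (intro fibre_Mat cmat_diag_fun clopens_Py)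
have rels: "Py * Z = 0" "Z * Py = Z" "Py * star Z = star Z" "p * Py = 0" "p * Z = 0" "star Z * Z = Py"
 "Id m = Id n + Py + Z * star Z"
proof -
 have "Id n * Py = 0" "Id n * Z = 0"
  by (intro bop_eqI ell2_eqI; clarsimp simp: coord_Z coord_Id coord_Py; linarith?)+
 thus "p * Py = 0" "p * Z = 0" using mult_Id[OF p(1)] by (metis mult.assoc mult_zero_right)+
 show "Id m = Id n + Py + Z * star Z"
  by (intro bop_eqI ell2_eqI) (auto simp: coord_Z coord_star_Z coord_Id coord_Py)
 show "Z * Py = Z" "Py * star Z = star Z"
  by (intro bop_eqI ell2_eqI; auto simp: coord_Z coord_star_Z coord_Py)+
 show "Py * Z = 0"
  by (intro bop_eqI ell2_eqI; clarsimp simp: coord_Z coord_Py; linarith?)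
qed (rule block_rels)
have s2: "(1 / sqrt 2) *r (1 / sqrt 2) *r K = (1 / 2 :: real) *r K" for K :: "'x idx bop" by simp
have VV: "star V * V = Py" "V * star V = (1 / 2) *r (Py + Z + star Z + Z * star Z)"
proof -
 have "(Py + star Z) * (Py + Z) = 2 *r Py"
  by (simp add: distrib_left distrib_right sPy rels block_rels scaleR_2)
 thus "star V * V = Py" by (simp add: V_def sPy)
 have "(Py + Z) * (Py + star Z) = Py + Z + star Z + Z * star Z"
  by (simp add: distrib_left distrib_right sPy rels add_ac)
 thus "V * star V = (1 / 2) *r (Py + Z + star Z + Z * star Z)" by (simp add: V_def sPy)
qed
have "p * star Z = 0"
proof -
 have "Id n * star Z = 0"
  by (intro bop_eqI ell2_eqI; clarsimp simp: coord_star_Z coord_Id; linarith?)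
 thus ?thesis using mult_Id[OF p(1)] by (metis mult.assoc mult_zero_right)
qed
hence pV: "p * (V * star V) = 0"
 unfolding VV by (simp add: distrib_left rels mult.assoc[symmetric])
define U where "U = p + V"
have U: "star U * U = p + Py" "U * star U = p + V * star V"
 using orth_sum_isometry[of p p p V Py "V * star V"] p VV(1) sPy rels(4) pV by (simp_all add: U_def)
define R where "R = p + V * star V"
have VM: "V \<in> Mat m m" unfolding V_def by (intro Mat_scaleR Mat_add PyM Z_Mat)
have RM: "R \<in> Mat m m" unfolding R_def by (intro Mat_add pm Mat_mult[OF VM] Mat_star VM)
have UM: "U \<in> Mat m m" unfolding U_def by (intro Mat_add pm VM)
have "(p + Py) * (p + Py) = p + Py"
proof -
 have "Py * p = 0" using arg_cong[OF rels(4), of star] by (simp add: p sPy)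
 thus ?thesis by (simp add: distrib_left distrib_right p sPy rels)
qed
hence sup: "U * (p + Py) = U" "R * U = U"
 using partial_isometry_support[OF U] by (simp_all add: p sPy R_def)
have R: "star R = R" "R * R = R"
proof -
 show "star R = R" by (simp add: R_def p)
 have "R * R = R * U * star U" using U(2) by (simp add: R_def mult.assoc)
 thus "R * R = R" unfolding sup(2) using U(2) by (simp only: R_def)
qed
have "2 *r R - Id m = (2 *r p - Id n) + Z + star Z"
 unfolding R_def VV rels(7) by (simp add: scaleR_add_right algebra_simps scaleR_2)
hence Aclose: "norm (A - (2 *r R - Id m)) <= 1 / 8"
 using close unfolding A_def by (simp add: P p_def)
define W' where "W' = W * c"
define Y where "Y = c' * fb * star c'"
have W'M: "W' \<in> Mat m m" unfolding W'_def by (rule Mat_mult[OF W cM(1)])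
have YM: "Y \<in> Mat m m" unfolding Y_def by (intro Mat_mult[of _ m m] Mat_star cM)
note IM = Id_mult[of _ m m] mult_Id[of _ m m]
have cc: "c * c' = Id m" "c' * c = Id m" "star c * star c' = Id m" "star c' * star c = Id m"
proof -
 show *: "c * c' = Id m" "c' * c = Id m" using CC by (simp_all add: c_def c'_def)
 show "star c * star c' = Id m" "star c' * star c = Id m"
  unfolding star_simps(7)[symmetric] * by (rule star_Id)+
qed
have FY: "star c * fa * c * Y = Id m"
proof -
 have "star c * fa * c * Y = star c * (fa * ((c * c') * fb) * star c')" by (simp add: Y_def mult.assoc)
 also have "... = star c * (Id m * star c')" by (simp add: cc IM cM fa_def[symmetric] fb_def[symmetric] ab[folded fa_def fb_def])
 finally show ?thesis by (simp add: IM Mat_star cM cc)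
qed
have AWY: "A * W' * Y * star W' = Id m"
proof -
 have "A * W' * Y * star W' = A * (W * ((c * c') * (fb * ((star c' * star c) * star W))))"
  by (simp add: W'_def Y_def mult.assoc)
 also have "... = A * W * fb * star W" by (simp add: cc IM cM Mat_mult[of _ m m] Mat_star W mult.assoc)
 finally show ?thesis using inv[OF b(1) ab(2,1)] by (simp add: A_def fb_def)
qed
have WAW': "star W' * A * W' = star c * fa * c"
proof -
 have "star W' * A * W' = star c * (star W * A * W) * c" by (simp add: W'_def mult.assoc)
 thus ?thesis using WAW by (simp only: A_def fa_def)
qed
note bounds = congruence_bounded_below[OF star_Id Id_mult[OF Id_Mat] R mult_Id[OF RM] Id_mult[OF RM]
  Q mult_Id[OF cM(5)] Id_mult[OF cM(5)] Id_mult[OF W'M] mult_Id[OF W'M] Aclose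
  F[folded c_def fa_def Q_def] WAW' FY Id_mult[OF YM] AWY]
obtain w where w: "star w * w = Q" "w * star w = R"
 and wM: "!!M. closed M ==> R * W' * Q \<in> M ==> (!!x y r. x \<in> M ==> y \<in> M ==> x + r *r y \<in> M) ==>
   (!!x. x \<in> M ==> x * (star (R * W' * Q) * (R * W' * Q)) \<in> M) ==> w \<in> M"
proof -
 have "R * (R * W' * Q) = R * W' * Q" "R * W' * Q * Q = R * W' * Q"
  using R(2) Q(2) by (metis mult.assoc)+
 moreover have "(0 :: real) < 3 / 7" by simp
 ultimately show thesis using polar_decomposition[OF R Q _ _ _ bounds] that by blast
qed
have RWQ: "R * W' * Q \<in> Mat m m" by (intro Mat_mult[of _ m m] RM W'M cM)
have "w \<in> Mat m m"
 by (rule wM[OF Mat_closed RWQ]) (auto intro!: Mat_lin Mat_mult[of _ m m] RWQ Mat_star RM W'M cM simp del: star_simps)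
hence wU: "star w * U \<in> Mat m m" using UM Mat_mult Mat_star by blast
have 1: "star (star w * U) * (star w * U) = p + Py"
proof -
 have "star (star w * U) * (star w * U) = star U * ((w * star w) * U)" by (simp add: mult.assoc)
 thus ?thesis by (simp add: w sup U)
qed
have 2: "(star w * U) * star (star w * U) = Q"
proof -
 have "(star w * U) * star (star w * U) = star w * (U * star U) * w" by (simp add: mult.assoc)
 also have "... = star w * (w * star w) * w" by (simp add: U w R_def)
 also have "... = Q" using w(1) Q(2) by (metis mult.assoc)
 finally show ?thesis .
qed
define D1 where "D1 = diag_proj N (%_. XX)"
have D1: "D1 \<in> \<P>" unfolding D1_def by (rule diag_proj_projections[OF clopens_top])
have "Py = mshift n N * Id N * star (mshift n N)"
proof -
 have "coord (app (star (mshift n N)) \<eta>) (x, i, c) = (if c < N & x \<in> XX then coord \<eta> (x, i, n + c) else 0)" for \<eta> x i c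
 proof -
  have "coord (app (star (mshift n N)) \<eta>) (x, i, c) = (\<Sum>k<N. if k = c then (if x \<in> XX then coord \<eta> (x, i, n + c) else 0) else 0)"
   unfolding star_mshift app_sum_left coord_sum coord_munit by (intro sum.cong) auto
  thus ?thesis by simp
 qed
 moreover have "coord (app (mshift n N) \<eta>) (x, i, c) = (if n <= c & c < n + N & x \<in> XX then coord \<eta> (x, i, c - n) else 0)" for \<eta> x i c
 proof -
  have "coord (app (mshift n N) \<eta>) (x, i, c) = (\<Sum>k<N. if k = c - n then (if n <= c & x \<in> XX then coord \<eta> (x, i, c - n) else 0) else 0)"
   unfolding mshift_def app_sum_left coord_sum coord_munit by (intro sum.cong) auto
  thus ?thesis by auto
 qed
 ultimately show ?thesis by (intro bop_eqI ell2_eqI) (auto simp: coord_Py coord_Id)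
qed
hence "proj_op (direct_sum \<B> P D1) = p + Py"
 using proj_op_direct_sum[OF P(1) D1] by (simp add: P p_def D1_def diag_proj_simps mult.assoc)
moreover have "proj_op (diag_proj m B) = Q" by (simp add: diag_proj_simps Q_def)
ultimately have "(direct_sum \<B> P D1, diag_proj m B) \<in> mvn_rel \<B>"
 using 1 2 wU by (intro mvnI[of _ _ "star w * U"] direct_sum_projections P(1) D1 diag_proj_projections B)
  (auto intro: Mat_all_I)
hence "pcls P \<star> pcls D1 = pcls (diag_proj m B)"
 using projection_monoid_mult[OF P(1) D1] pcls_eqI by simp
moreover have "pcls D1 = rcls (%_. N)" unfolding D1_def by (rule rcls_eq[OF clopens_top]) (simp add: crank_def)
moreover have "pcls (diag_proj m B) = rcls (crank m B)" by (rule rcls_eq[OF B]) simp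
ultimately show ?thesis using loc_const_crank[OF B] by (intro exI[of _ "crank m B"]) simp
qed

end

context zero_dim_system
begin

lemma stable_rank_class:
assumes P: "P \<in> \<P>"
shows "\<exists>N r. loc_const r & pcls P \<star> rcls (%_. N :: nat) = rcls r"
proof (cases "fst P = 0")
case True
hence "pcls P = \<one>\<^bsub>\<M>\<^esub>" unfolding projection_monoid_simps
 by (intro pcls_eqI mvn_refl_op[OF P zero_projection]) (simp add: mat_op_def)
hence "pcls P = rcls (%_. 0)" by (simp only: rcls_zero)
thus ?thesis using rcls_add[of "%_. 0" "%_. 0"] by (intro exI[of _ 0] exI[of _ "%_. 0"]) simp
next
case False
define n where "n = fst P"
define p where "p = proj_op P"
have p: "p \<in> Mat n n" "star p = p" "p * p = p"
 using P proj_op_Mat[OF P] unfolding projections_iff p_def n_def by auto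
define s where "s = 2 *r p - Id n"
have s: "s \<in> Mat n n" "star s = s" unfolding s_def by (auto intro!: Mat_diff Mat_scaleR p Id_Mat simp: p)
have ss: "s * s = Id n"
 unfolding s_def by (simp add: algebra_simps p Id_mult[OF p(1)] mult_Id[OF p(1)] Id_mult[OF Id_Mat] scaleR_2)
\<comment> \<open>The distance 1/8 is used twice: \<open>1/64 + 1/8 + 1/8\<close> is below the 1/2
  needed for the Neumann series, and 1/8 is the tolerance in the comparison of spectral
  projections.\<close>
obtain h B where h: "h \<in> Mat n n" "star h = h" "banded B h" "norm (h - s) <= 1 / 8"
 using laurent_approx[OF s, of "1 / 8"] by auto
define D where "D = nat (max B 1)"
have hB: "banded (int D) h" by (rule banded_mono[OF h(3)]) (auto simp: D_def max_def)
have "norm s <= 1"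
proof -
 have "(norm s)\<^sup>2 <= 1" using norm_star_mult[of s] ss s(2) norm_Id_le[of n] by simp
 thus ?thesis by (rule power2_le_imp_le[of _ 1, simplified]) 
qed
have y: "norm (Id n - h * h) <= 1 / 2"
proof -
 have "Id n - h * h = - ((h - s) * (h - s)) - (h - s) * s - s * (h - s)"
  unfolding ss[symmetric] by (simp add: left_diff_distrib right_diff_distrib)
 also have "norm ... <= norm (h - s) * norm (h - s) + norm (h - s) * norm s + norm s * norm (h - s)"
  by (intro order_trans[OF norm_triangle_ineq4] add_mono norm_mult_ineq) (simp add: norm_mult_ineq)
 also have "... <= 1 / 8 * (1 / 8) + 1 / 8 * 1 + 1 * (1 / 8)"
  using h(4) \<open>norm s <= 1\<close> by (intro add_mono mult_mono) auto
 finally show ?thesis by simp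
qed
obtain g \<rho> where g: "g \<in> Mat n n" "h * g = Id n" "g * h = Id n" "0 < \<rho>" "\<rho> < 1" "!!c d. expdec \<rho> (ent g c d)"
 using laurent_inverse[OF h(1,2) hB y] by blast
have bi: "band_inverse X \<theta> n D h g \<rho>"
 using False h(1,2) banded_ent[OF hB] g
 by unfold_locales (simp_all add: n_def D_def)
interpret band_inverse X \<theta> n D h g \<rho> by (rule bi)
obtain t R where "t \<in> cfun X" "!!x. cnj (t x) = t x" "!!q p. q < 2 * (D * n) ==> p < D * n ==> R q p \<in> cfun X"
 "!!x p p'. x \<in> XX ==> p < D * n ==> p' < D * n ==>
   (\<Sum>q<2 * (D * n). Xi (t x) x p q * R q p' x) = (if p = p' then 1 else 0)"
 using edge_solvable by blast
then interpret half_line X \<theta> n D h g \<rho> t R by unfold_locales auto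
show ?thesis using stable_diagonalization[OF P n_def[symmetric]] h(4) by (auto simp: s_def p_def)
qed

lemma kcls_surj:
assumes "k \<in> carrier \<K>" obtains f where "loc_const f" "k = kcls f"
proof -
have cm: "comm_monoid \<M>" by (rule comm_monoid_projections)
obtain a a' where a: "a \<in> carrier \<M>" "a' \<in> carrier \<M>" "k = grothendieck_rel \<M> `` {(a, a')}"
 using assms unfolding K0_def grothendieck_carrier[OF cm] by blast
obtain N r where r: "loc_const r" "a \<star> rcls (%_. N) = rcls r"
 using a(1) stable_rank_class unfolding projection_monoid_simps by blast
obtain N' r' where r': "loc_const r'" "a' \<star> rcls (%_. N') = rcls r'"
 using a(2) stable_rank_class unfolding projection_monoid_simps by blast
interpret M: comm_monoid \<M> by (rule cm)
have c: "rcls (%_. k) \<in> carrier \<M>" for k by (simp add: rcls_closed)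
\<comment> \<open>The two stabilizations are added crosswise, so the formal difference is unchanged
  while both members become rank classes.\<close>
define u u' where "u = rcls (%x. r x + N')" and "u' = rcls (%x. r' x + N)"
have u: "u = a \<star> rcls (%_. N) \<star> rcls (%_. N')" "u' = a' \<star> rcls (%_. N') \<star> rcls (%_. N)"
 using r r' rcls_add[OF r(1), of "%_. N'"] rcls_add[OF r'(1), of "%_. N"] by (simp_all add: u_def u'_def)
have "a \<star> u' = u \<star> a'"
 unfolding u using a c by (simp add: M.m_assoc M.m_comm M.m_lcomm)
hence "k = grothendieck_rel \<M> `` {(u, u')}"
 unfolding a(3) using a u c M.m_closed by (intro gclass_eqI[OF cm, of _ _ _ _ "\<one>\<^bsub>\<M>\<^esub>"]) auto
moreover have l: "loc_const (%x. r x + N')" "loc_const (%x. r' x + N)"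
 using loc_const_comp[OF r(1), of "%k. k + N'"] loc_const_comp[OF r'(1), of "%k. k + N"] by simp_all
moreover have l': "loc_const (%x. int (r x + N') - int (r' x + N))"
 using loc_const_comp2[OF l, of "%a b. int a - int b"] .
ultimately show thesis
 using gclass_rcls[OF l refl l'] by (intro that[OF l']) (simp add: u_def u'_def)
qed

end

section \<open>Traces of periodic orbits\<close>

context zero_dim_system
begin

lemma orbit_sum_shift:
assumes "\<theta> (int p) x = x"
shows "(\<Sum>i<p. \<phi> (\<theta> k (\<theta> (int i) x))) = (\<Sum>i<p. (\<phi> (\<theta> (int i) x) :: 'b :: ab_group_add))"
proof -
have step: "(\<Sum>i<p. \<phi> (\<theta> 1 (\<theta> (int i) x))) = (\<Sum>i<p. \<phi> (\<theta> (int i) x))" for \<phi> :: "_ => 'b"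
 using sum.lessThan_Suc_shift[of "%i. \<phi> (\<theta> (int i) x)" p] assms by (simp add: add.commute)
show ?thesis
proof (induction k arbitrary: \<phi> rule: int_induct[where k = 0])
 case (step1 i)
 thus ?case using step1(2)[of "%y. \<phi> (\<theta> 1 y)"] step[of \<phi>] by (simp add: algebra_simps)
next
 case (step2 i)
 thus ?case using step2(2)[of "%y. \<phi> (\<theta> (- 1) y)"] step[of "%y. \<phi> (\<theta> (- 1) y)"] by (simp add: algebra_simps)
qed simp
qed

text \<open>The trace attached to the invariant counting measure on a periodic orbit: only diagonal
  entries of degree 0 contribute.\<close>

definition trace :: "'x => nat => nat => 'x idx bop => complex" where
"trace x p m A = (\<Sum>c<m. \<Sum>i<p. ent A c c 0 (\<theta> (int i) x))"

lemma infsum_sum: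
fixes f :: "'k => 'q => real"
shows "finite K ==> (!!k. k \<in> K ==> f k summable_on A) ==> infsum (%q. \<Sum>k\<in>K. f k q) A = (\<Sum>k\<in>K. infsum (f k) A)"
proof -
assume *: "finite K" "!!k. k \<in> K ==> f k summable_on A"
hence "((%q. \<Sum>k\<in>K. f k q) has_sum (\<Sum>k\<in>K. infsum (f k) A)) A"
 by (induction K rule: finite_induct) (auto intro!: has_sum_add simp: has_sum_infsum)
thus ?thesis by (rule infsumI)
qed

text \<open>A diagonal entry of \<open>star A * A\<close> is the squared length of a column of
  \<open>A\<close>, regrouped here by matrix position so that levels can be reindexed
  separately.\<close>

lemma ent_star_mult_norm:
assumes A: "A \<in> Mat m m"
shows "(%k. (cmod (ent A d c k y))\<^sup>2) summable_on UNIV"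
 and "ent (star A * A) c c 0 y = of_real (\<Sum>d<m. \<Sum>\<^sub>\<infinity>k. (cmod (ent A d c k y))\<^sup>2)"
proof -
define v where "v = app A (unit_vec (y, 0, c))"
define S where "S d = range (%k :: int. (y, k, d))" for d :: nat
have v: "coord v (y, k, d) = ent A d c k y" for k d by (simp add: v_def ent_def coef_def)
have inj: "inj_on (%k :: int. (y, k, d)) UNIV" for d :: nat by (auto simp: inj_on_def)
have sub: "(%q. (cmod (coord v q))\<^sup>2) summable_on S d" for d
 by (rule summable_on_subset_banach[OF coord_summable]) simp
thus "(%k. (cmod (ent A d c k y))\<^sup>2) summable_on UNIV"
 unfolding S_def summable_on_reindex[OF inj] o_def v .
define G where "G d q = (if q \<in> S d then (cmod (coord v q))\<^sup>2 else 0)" for d q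
have G: "G d summable_on UNIV" "infsum (G d) UNIV = (\<Sum>\<^sub>\<infinity>k. (cmod (ent A d c k y))\<^sup>2)" for d
proof -
 show "G d summable_on UNIV"
  using sub[of d] by (rule summable_on_cong_neutral[THEN iffD1, rotated -1]) (auto simp: G_def)
 have "infsum (G d) UNIV = infsum (%q. (cmod (coord v q))\<^sup>2) (S d)"
  by (rule infsum_cong_neutral) (auto simp: G_def)
 thus "infsum (G d) UNIV = (\<Sum>\<^sub>\<infinity>k. (cmod (ent A d c k y))\<^sup>2)"
  unfolding S_def infsum_reindex[OF inj] o_def v .
qed
have z: "(cmod (coord v q))\<^sup>2 = (\<Sum>d<m. G d q)" for q
proof -
 obtain z k e where q: "q = (z, k, e)" by (metis prod.collapse)
 have "coord v q = 0" if "z ~= y | ~ e < m"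
  using that by (auto simp: v_def q coef_def[symmetric] coef_ent[OF A])
 moreover have "(\<Sum>d<m. G d q) = (\<Sum>d<m. if d = e then (if z = y then (cmod (coord v q))\<^sup>2 else 0) else 0)"
  by (intro sum.cong) (auto simp: G_def S_def q)
 ultimately show ?thesis by auto
qed
have "(norm v)\<^sup>2 = (\<Sum>d<m. infsum (G d) UNIV)"
 unfolding norm_ell2_sq z by (rule infsum_sum) (simp, rule G)
moreover have "ent (star A * A) c c 0 y = of_real ((norm v)\<^sup>2)"
proof -
 have "Re (ent (star A * A) c c 0 y) = (norm v)\<^sup>2"
  unfolding ent_def coef_mult inner_unit_vec[symmetric] power2_norm_eq_inner v_def by (metis star_inner)
 moreover have "Im (ent (star A * A) c c 0 y) = 0"
 proof -
  have "star (star A * A) = star A * A" by simp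
  hence "cnj (ent (star A * A) c c 0 y) = ent (star A * A) c c 0 y"
   unfolding ent_def coef_star[symmetric] by (simp only:)
  from arg_cong[OF this, of Im] show ?thesis by (simp del: star_simps)
 qed
 ultimately show ?thesis by (simp add: complex_eq_iff)
qed
ultimately show "ent (star A * A) c c 0 y = of_real (\<Sum>d<m. \<Sum>\<^sub>\<infinity>k. (cmod (ent A d c k y))\<^sup>2)"
 by (simp only: G(2))
qed

text \<open>Both sides are sums of the same squared moduli. Passing to \<open>star A\<close>
  transposes the position, reverses the degree \<open>k\<close> and moves the point by
  \<open>k\<close> steps along the orbit, which the orbit sum does not notice.\<close>

lemma trace_star_mult:
assumes A: "A \<in> Mat m m" and x: "\<theta> (int p) x = x"
shows "trace x p m (star A * A) = trace x p m (A * star A)"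
proof -
define E where "E c d k y = (cmod (ent A c d k y))\<^sup>2" for c d k y
have sA: "star A \<in> Mat m m" using A by (rule Mat_star)
have es: "(cmod (ent (star A) c d k y))\<^sup>2 = E d c (- k) (\<theta> (- k) y)" if "c < m" "d < m" for c d k y
 unfolding E_def ent_def[of "star A"] coef_star using that by (simp add: coef_ent[OF A])
have sm: "(%k. E c d k y) summable_on UNIV" for c d y
 unfolding E_def by (rule ent_star_mult_norm(1)[OF A])
have sm': "(%k. E d c (- k) (\<theta> (- k) y)) summable_on UNIV" if "c < m" "d < m" for c d y
 using ent_star_mult_norm(1)[OF sA, of c d y] es[OF that] by simp
have key: "(\<Sum>i<p. \<Sum>\<^sub>\<infinity>k. E d c k (\<theta> (int i) x)) = (\<Sum>i<p. \<Sum>\<^sub>\<infinity>k. E d c (- k) (\<theta> (- k) (\<theta> (int i) x)))"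
 if "c < m" "d < m" for c d
proof -
 have "(\<Sum>i<p. \<Sum>\<^sub>\<infinity>k. E d c (- k) (\<theta> (- k) (\<theta> (int i) x))) = (\<Sum>\<^sub>\<infinity>k. \<Sum>i<p. E d c (- k) (\<theta> (- k) (\<theta> (int i) x)))"
  by (rule infsum_sum[symmetric]) (simp, rule sm'[OF that])
 also have "... = (\<Sum>\<^sub>\<infinity>k. \<Sum>i<p. E d c (- k) (\<theta> (int i) x))" by (simp only: orbit_sum_shift[OF x])
 also have "... = (\<Sum>\<^sub>\<infinity>k. \<Sum>i<p. E d c k (\<theta> (int i) x))"
  by (rule infsum_reindex_bij_witness[of _ uminus uminus]) auto
 also have "... = (\<Sum>i<p. \<Sum>\<^sub>\<infinity>k. E d c k (\<theta> (int i) x))" by (rule infsum_sum) (simp, rule sm)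
 finally show ?thesis by simp
qed
have "trace x p m (star A * A) = of_real (\<Sum>c<m. \<Sum>d<m. \<Sum>i<p. \<Sum>\<^sub>\<infinity>k. E d c k (\<theta> (int i) x))"
 unfolding trace_def ent_star_mult_norm(2)[OF A] of_real_sum[symmetric] E_def by (subst sum.swap) (rule refl)
also have "... = of_real (\<Sum>c<m. \<Sum>d<m. \<Sum>i<p. \<Sum>\<^sub>\<infinity>k. (cmod (ent (star A) c d k (\<theta> (int i) x)))\<^sup>2)"
 using key es by simp
also have "... = trace x p m (star (star A) * star A)"
 unfolding trace_def ent_star_mult_norm(2)[OF sA] of_real_sum[symmetric]
 by (subst sum.swap, intro arg_cong[where f = of_real] sum.cong refl sum.swap)
finally show ?thesis by simp
qed

definition ptrace :: "'x => nat => 'x cel sq_matrix => complex" where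
"ptrace x p P = trace x p (fst P) (proj_op P)"

lemma ptrace_eq: "P \<in> \<P> ==> fst P <= m ==> ptrace x p P = trace x p m (proj_op P)"
unfolding ptrace_def trace_def
by (rule sum.mono_neutral_left)
 (auto simp: ent_def coef_ent[OF proj_op_Mat] intro!: sum.neutral)

lemma ptrace_mvn:
assumes "(P, Q) \<in> mvn_rel \<B>" "\<theta> (int p) x = x"
shows "ptrace x p P = ptrace x p Q"
proof -
obtain V where V: "V \<in> Mat (fst Q) (fst P)" "star V * V = proj_op P" "V * star V = proj_op Q"
 and PQ: "P \<in> \<P>" "Q \<in> \<P>" using mvnE[OF assms(1)] by blast
define m where "m = max (fst P) (fst Q)"
have "V \<in> Mat m m" using V(1) Mat_mono[of "fst Q" m "fst P" m] by (auto simp: m_def)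
from trace_star_mult[OF this assms(2)] show ?thesis
 using ptrace_eq[OF PQ(1), of m] ptrace_eq[OF PQ(2), of m] V by (simp add: m_def)
qed

lemma ptrace_direct_sum:
assumes P: "P \<in> \<P>" and Q: "Q \<in> \<P>" and x: "\<theta> (int p) x = x"
shows "ptrace x p (direct_sum \<B> P Q) = ptrace x p P + ptrace x p Q"
proof -
define m where "m = fst P + fst Q"
define S where "S = mshift (fst P) (fst Q)"
define W where "W = S * proj_op Q"
note q = proj_op_Mat[OF Q]
have "S \<in> Mat m (fst Q)" unfolding S_def m_def by (rule mshift_Mat)
hence W: "W \<in> Mat m m" unfolding W_def using Mat_mult[OF _ q] Mat_mono[of m m "fst Q" m] by (auto simp: m_def)
have "star W * W = proj_op Q"
 using mshift_isometry[OF q] proj_opD[OF Q] by (simp add: W_def S_def mult.assoc)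
moreover have "W * star W = S * (proj_op Q * star S)"
 by (simp add: W_def proj_opD[OF Q] mult.assoc mult_subst[OF proj_opD(2)[OF Q]])
ultimately have "trace x p m (S * (proj_op Q * star S)) = ptrace x p Q"
 using trace_star_mult[OF W x] ptrace_eq[OF Q, of m] by (simp add: m_def)
moreover have "trace x p m (proj_op P) = ptrace x p P" using ptrace_eq[OF P, of m] by (simp add: m_def)
ultimately show ?thesis
 unfolding ptrace_def[of x p "direct_sum \<B> P Q"] proj_op_direct_sum[OF P Q] unfolding direct_sum_fst
 by (simp add: trace_def ent_def sum.distrib S_def m_def)
qed

lemma ptrace_diag:
assumes "clopens m A" "x \<in> XX"
shows "ptrace x p (diag_proj m A) = of_nat (\<Sum>i<p. crank m A (\<theta> (int i) x))"
proof -
have "ptrace x p (diag_proj m A) = (\<Sum>i<p. \<Sum>c<m. indicator (A c) (\<theta> (int i) x))"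
 unfolding ptrace_def trace_def diag_proj_simps
 by (subst sum.swap) (simp add: ent_fibre[OF cmat_diag_fun[OF assms(1)]] diag_fun_def)
thus ?thesis by (simp only: crank_sum of_nat_sum indicator_def of_bool_def) (simp only: if_distrib[of of_nat] of_nat_1 of_nat_0)
qed

text \<open>Triviality in a Grothendieck group means equality after adding some projection
  \<open>E\<close>. The trace is additive and invariant under equivalence, so the contribution of
  \<open>E\<close> cancels.\<close>

lemma kcls_eq_periodic:
assumes f: "loc_const f" and one: "kcls f = \<one>\<^bsub>\<K>\<^esub>" and x: "x \<in> XX" "\<theta> (int p) x = x"
shows "(\<Sum>i<p. f (\<theta> (int i) x)) = 0"
proof -
interpret M: comm_monoid \<M> by (rule comm_monoid_projections)
define r r' where "r = (%x. nat (f x))" and "r' = (%x. nat (- f x))"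
note l = loc_const_nat[OF f, folded r_def r'_def]
have "grothendieck_rel \<M> `` {(rcls r, rcls r')} = grothendieck_rel \<M> `` {(rcls (%_. 0), rcls (%_. 0))}"
 using one unfolding kcls_one by (simp add: kcls_def r_def r'_def)
from gclass_eqD[OF comm_monoid_projections this rcls_closed rcls_closed] obtain e where
 e: "e \<in> carrier \<M>" "rcls r \<star> rcls (%_. 0) \<star> e = rcls (%_. 0) \<star> rcls r' \<star> e" by auto
obtain E where E: "E \<in> \<P>" "e = pcls E" using e(1) unfolding projection_monoid_simps by blast
obtain m A where A: "clopens m A" "!!x. x \<in> XX ==> crank m A x = r x" "rcls r = pcls (diag_proj m A)"
 using rcls_repr[OF l(1)] by blast
obtain n B where B: "clopens n B" "!!x. x \<in> XX ==> crank n B x = r' x" "rcls r' = pcls (diag_proj n B)"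
 using rcls_repr[OF l(2)] by blast
note pr = diag_proj_projections[OF A(1)] diag_proj_projections[OF B(1)]
have "pcls (direct_sum \<B> (diag_proj m A) E) = pcls (direct_sum \<B> (diag_proj n B) E)"
 using e(2) rcls_add[OF l(1), of "%_. 0"] rcls_add[OF _ l(2), of "%_. 0"] E A(3) B(3)
  projection_monoid_mult[OF pr(1) E(1)] projection_monoid_mult[OF pr(2) E(1)] by simp
hence "(direct_sum \<B> (diag_proj m A) E, direct_sum \<B> (diag_proj n B) E) \<in> mvn_rel \<B>"
 by (rule eq_equiv_class[OF _ equiv_mvn_rel]) (rule direct_sum_projections[OF pr(2) E(1)])
from ptrace_mvn[OF this x(2)] have "(\<Sum>i<p. r (\<theta> (int i) x)) = (\<Sum>i<p. r' (\<theta> (int i) x))"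
 unfolding ptrace_direct_sum[OF pr(1) E(1) x(2)] ptrace_direct_sum[OF pr(2) E(1) x(2)]
  ptrace_diag[OF A(1) x(1)] ptrace_diag[OF B(1) x(1)] using x A(2) B(2) by (simp flip: of_nat_sum)
hence "(\<Sum>i<p. int (r (\<theta> (int i) x))) = (\<Sum>i<p. int (r' (\<theta> (int i) x)))" by (simp flip: of_nat_sum)
hence "(\<Sum>i<p. int (r (\<theta> (int i) x)) - int (r' (\<theta> (int i) x))) = 0" by (simp add: sum_subtractf)
moreover have "int (r y) - int (r' y) = f y" for y by (simp add: r_def r'_def)
ultimately show ?thesis by (simp only:)
qed

end

section \<open>The shift on reduced sequences\<close>

lemma (in zero_dim_system) kcls_cong: "(!!x. x \<in> XX ==> f x = f' x) ==> kcls f = kcls f'"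
unfolding kcls_def by (intro arg_cong2[where f = "%a b. grothendieck_rel \<M> `` {(a, b)}"] rcls_cong) simp_all

definition win :: "nat => (int => 'a) => int => 'a list" where
"win n x i = map (%k. x (i + int k)) [0..<n]"

definition periodic :: "'a list => int => 'a" where
"periodic w k = w ! nat (k mod int (length w))"

lemma win_simps [simp]: "length (win n x i) = n" "k < n ==> win n x i ! k = x (i + int k)"
by (simp_all add: win_def)

lemma win_shift: "win n (shift_pow j x) i = win n x (i + j)"
by (simp add: win_def shift_pow_def algebra_simps)

lemma win_Suc: "tl (win (Suc n) x i) = win n x (i + 1)" "butlast (win (Suc n) x i) = win n x i"
by (auto intro!: nth_equalityI simp: nth_tl nth_butlast algebra_simps)

lemma win_eqI: "(!!k. k < n ==> x (i + int k) = y (j + int k)) ==> win n x i = win n y j"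
by (intro nth_equalityI) auto

lemma win_periodic:
assumes "j < length w" "n <= length w"
shows "win n (periodic w) (int j) = take n (drop j (w @ w))"
proof (intro nth_equalityI)
fix k assume "k < length (win n (periodic w) (int j))"
hence k: "k < n" by simp
have "nat ((int j + int k) mod int (length w)) = (j + k) mod length w" by (metis nat_int of_nat_add of_nat_mod)
also have "... = (if j + k < length w then j + k else j + k - length w)" using assms k by (auto simp: mod_if)
finally show "win n (periodic w) (int j) ! k = take n (drop j (w @ w)) ! k"
 using k assms by (auto simp: periodic_def nth_append add.commute)
qed (use assms in simp)

text \<open>The group enters only through a fixed-point-free involution of a finite alphabet. With
  at least four letters, two prescribed ones can always be avoided, which is what closes words to
  reduced loops.\<close>

locale letter_shift =
fixes G :: "('a, 'b) monoid_scheme" and L :: "'a set"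
assumes finite_L: "finite L" and card_L: "4 <= card L"
 and inv_L: "a \<in> L ==> inv\<^bsub>G\<^esub> a \<in> L" "a \<in> L ==> inv\<^bsub>G\<^esub> (inv\<^bsub>G\<^esub> a) = a" "a \<in> L ==> inv\<^bsub>G\<^esub> a ~= a"
begin

abbreviation "\<iota> a \<equiv> inv\<^bsub>G\<^esub> a"
abbreviation "X \<equiv> reduced_space G L"
abbreviation "XS \<equiv> reduced_sequences G L"

lemma X_topspace: "topspace X = XS"
by (auto simp: reduced_space_def reduced_sequences_def)

lemma letter_ex: "\<exists>a. a \<in> L"
using card_L by (cases "L = {}") auto

lemma letter_avoiding:
assumes "a \<in> L" "b \<in> L" obtains c where "c \<in> L" "c ~= a" "c ~= b"
proof -
have "card {a, b} <= 2" by (simp add: card_insert_if)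
hence "L - {a, b} ~= {}" using card_L card_mono[of "{a, b}" L] by (metis Diff_eq_empty_iff finite.emptyI finite_insert le_trans not_numeral_le_zero numeral_le_iff semiring_norm(69,71))
thus thesis using that by blast
qed

lemma coordinate_continuous: "continuous_map X (discrete_topology L) (%x. x k)"
unfolding reduced_space_def by (intro continuous_map_from_subtopology continuous_map_product_projection) simp

lemma openin_coordinate: "openin X {x \<in> XS. x k = b}"
proof (cases "b \<in> L")
case True
thus ?thesis
 using openin_continuous_map_preimage[OF coordinate_continuous, of "{b}" k] by (simp add: X_topspace)
next
case False
hence "{x \<in> XS. x k = b} = {}" by (auto simp: reduced_sequences_def)
thus ?thesis by (simp only: openin_empty)
qed

definition cyl :: "int => (int => 'a) => (int => 'a) set" where
"cyl r x = {y \<in> XS. \<forall>i\<in>{- r..r}. y i = x i}"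

lemma openin_cyl: "openin X (cyl r x)"
proof -
have "cyl r x = XS \<inter> (\<Inter>i\<in>{- r..r}. {y \<in> XS. y i = x i})" by (auto simp: cyl_def)
thus ?thesis using openin_coordinate openin_topspace[of X]
 by (cases "{- r..r} = {}") (auto simp: X_topspace intro!: openin_Int openin_Inter)
qed

lemma closedin_cyl: "closedin X (cyl r x)"
proof -
have "XS - cyl r x = (\<Union>y\<in>XS - cyl r x. cyl r y)" by (auto simp: cyl_def)
hence "openin X (XS - cyl r x)" using openin_cyl by (metis (no_types, lifting) openin_Union imageE)
thus ?thesis by (simp add: closedin_def X_topspace) (auto simp: cyl_def)
qed

lemma cyl_base:
assumes "openin X W" "x \<in> W" obtains r where "cyl r x \<subseteq> W"
proof -
obtain V where V: "openin (product_topology (%_. discrete_topology L) UNIV) V" "W = V \<inter> XS"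
 using assms(1) unfolding reduced_space_def openin_subtopology by blast
obtain U where U: "finite {i. U i ~= L}" "x \<in> Pi\<^sub>E UNIV U" "Pi\<^sub>E UNIV U \<subseteq> V"
 using V assms(2) unfolding openin_product_topology_alt by (auto simp: Ball_def)
define r where "r = Max (insert 0 (abs ` {i. U i ~= L}))"
have "y i \<in> U i" if "y \<in> cyl r x" for y i
proof (cases "U i = L")
 case False
 hence "\<bar>i\<bar> <= r" unfolding r_def using U(1) by (intro Max_ge) auto
 hence "i \<in> {- r..r}" by auto
 hence "y i = x i" using that unfolding cyl_def by blast
 thus ?thesis using U(2) by (auto simp: PiE_def)
qed (use that in "auto simp: cyl_def reduced_sequences_def")
hence "cyl r x \<subseteq> V" using U(3) by (auto simp: PiE_def Pi_def)
thus thesis using V(2) that[of r] by (auto simp: cyl_def)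
qed

lemma X_compact: "compact_space X"
proof -
let ?P = "product_topology (%_ :: int. discrete_topology L) UNIV"
have "compact_space ?P" by (simp add: compact_space_product_topology compact_space_discrete_topology finite_L)
moreover have "closedin ?P XS"
proof -
 have "openin ?P {x \<in> topspace ?P. x k \<in> {b}}" if "b \<in> L" for k b
  using that by (intro openin_continuous_map_preimage[OF continuous_map_product_projection]) auto
 hence "openin ?P ({x \<in> topspace ?P. x k \<in> {b}} \<inter> {x \<in> topspace ?P. x (k + 1) \<in> {\<iota> b}})" if "b \<in> L" for k b
  using that inv_L(1) by blast
 hence "openin ?P (\<Union>k. \<Union>b\<in>L. {x \<in> topspace ?P. x k \<in> {b}} \<inter> {x \<in> topspace ?P. x (k + 1) \<in> {\<iota> b}})"
  by blast
 moreover have "(\<Union>k. \<Union>b\<in>L. {x \<in> topspace ?P. x k \<in> {b}} \<inter> {x \<in> topspace ?P. x (k + 1) \<in> {\<iota> b}}) = topspace ?P - XS" (is "?U = _")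
 proof (intro equalityI subsetI)
  fix x assume "x \<in> topspace ?P - XS"
  then obtain k where "x \<in> topspace ?P" "x (k + 1) = \<iota> (x k)" by (auto simp: reduced_sequences_def)
  thus "x \<in> ?U" by auto
 qed (auto simp: reduced_sequences_def)
 ultimately have "openin ?P (topspace ?P - XS)" by (simp only:)
 moreover have "XS \<subseteq> topspace ?P" by (auto simp: reduced_sequences_def)
 ultimately show ?thesis by (simp only: closedin_def)
qed
ultimately show ?thesis
 unfolding reduced_space_def by (intro compact_space_subtopology closedin_compact_space)
qed

lemma constant_sequence: "a \<in> L ==> (%_. a) \<in> XS"
using inv_L(3)[of a] by (auto simp: reduced_sequences_def)

sublocale zero_dim_system X shift_pow
proof
show "shift_pow 0 x = x" for x :: "int => 'a" by (simp add: shift_pow_def)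
show "shift_pow (m + n) x = shift_pow m (shift_pow n x)" for m n and x :: "int => 'a"
 by (simp add: shift_pow_def algebra_simps)
show "continuous_map X X (shift_pow n)" for n
proof -
 have "continuous_map X (product_topology (%_. discrete_topology L) UNIV) (shift_pow n)"
  unfolding continuous_map_componentwise_UNIV shift_pow_def using coordinate_continuous by blast
 moreover have "shift_pow n ` XS \<subseteq> XS"
  by (auto simp: shift_pow_def reduced_sequences_def) (metis add.assoc add.commute)
 ultimately show ?thesis
  unfolding reduced_space_def[of G L] continuous_map_in_subtopology
  by (auto simp: X_topspace reduced_space_def[symmetric] image_subset_iff)
qed
obtain a where "a \<in> L" using letter_ex ..
thus "topspace X ~= {}" using constant_sequence X_topspace by blast
show "\<exists>U. openin X U & closedin X U & x \<in> U & U \<subseteq> W" if "openin X W" "x \<in> W" for W x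
proof -
 obtain r where "cyl r x \<subseteq> W" using cyl_base \<open>openin X W\<close> \<open>x \<in> W\<close> .
 moreover have "x \<in> cyl r x" using that openin_subset X_topspace by (fastforce simp: cyl_def)
 ultimately show ?thesis by (intro exI[of _ "cyl r x"] conjI openin_cyl closedin_cyl)
qed
qed (rule X_compact)

text \<open>The radius of a cylinder on which \<open>f\<close> does not vary can itself be selected
  as a locally constant function, and such a function is bounded.\<close>

lemma loc_const_finite_memory:
assumes "loc_const f"
obtains r :: nat where "!!x y. x \<in> XS ==> y \<in> XS ==> (!!i. \<bar>i\<bar> <= int r ==> x i = y i) ==> f x = f y"
proof -
have "\<exists>r W. openin X W & x \<in> W & (\<forall>y\<in>W. \<forall>z\<in>cyl (int r) y. f z = f y)" if x: "x \<in> XX" for x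
proof -
 have "openin X {y \<in> XX. f y = f x}" using assms unfolding loc_const_iff by blast
 then obtain r where r: "cyl r x \<subseteq> {y \<in> XX. f y = f x}" by (rule cyl_base) (use x in auto)
 have "\<forall>y\<in>cyl r x. \<forall>z\<in>cyl (int (nat r)) y. f z = f y"
 proof (intro ballI)
  fix y z assume "y \<in> cyl r x" "z \<in> cyl (int (nat r)) y"
  hence "y \<in> cyl r x" "z \<in> cyl r x" by (auto simp: cyl_def)
  thus "f z = f y" using r by (simp add: subset_iff)
 qed
 moreover have "x \<in> cyl r x" using x X_topspace by (auto simp: cyl_def)
 ultimately show ?thesis by (intro exI[of _ "nat r"] exI[of _ "cyl r x"] conjI openin_cyl)
qed
from loc_const_selection[where Q = "%x r. \<forall>z\<in>cyl (int r) x. f z = f x", OF this]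
obtain \<sigma> where \<sigma>: "loc_const \<sigma>" "!!x z. x \<in> XX ==> z \<in> cyl (int (\<sigma> x)) x ==> f z = f x" by blast
obtain m where "!!x. x \<in> XX ==> \<sigma> x <= m" using loc_const_bounded[OF \<sigma>(1)] by blast
show thesis
proof (rule that[of m])
 fix x y assume x: "x \<in> XS" "y \<in> XS" and e: "!!i. \<bar>i\<bar> <= int m ==> x i = y i"
 have "\<sigma> x <= m" using \<open>!!x. x \<in> XX ==> \<sigma> x <= m\<close> x X_topspace by blast
 hence "y \<in> cyl (int (\<sigma> x)) x" using x e by (auto simp: cyl_def)
 thus "f x = f y" using \<sigma>(2)[of x y] x X_topspace by simp
qed
qed

definition wfun :: "nat => ('a list => 'c) => (int => 'a) => 'c" where "wfun n \<phi> x = \<phi> (win n x 0)"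

lemma loc_const_wfun: "loc_const (wfun n \<phi>)"
unfolding loc_const_iff
proof
fix v
have "{x \<in> XX. wfun n \<phi> x = v} = (\<Union>x\<in>{x \<in> XX. wfun n \<phi> x = v}. cyl (int n) x)"
proof -
 have "win n y 0 = win n x 0" if "y \<in> cyl (int n) x" for x y
  using that by (intro win_eqI) (auto simp: cyl_def)
 hence "wfun n \<phi> y = wfun n \<phi> x" if "y \<in> cyl (int n) x" for x y using that unfolding wfun_def by metis
 thus ?thesis by (fastforce simp: X_topspace cyl_def)
qed
thus "openin X {x \<in> XX. wfun n \<phi> x = v}" using openin_cyl
 by (metis (no_types, lifting) openin_Union imageE)
qed

text \<open>A symmetric window is shifted so that it starts at coordinate 0; composition with a
  power of the shift does not change the class in \<open>K\<^sub>0\<close>.\<close>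

lemma loc_const_wfun_ex:
assumes "loc_const f"
obtains n r \<phi> where "!!x. x \<in> XS ==> f (shift_pow r x) = wfun (Suc n) \<phi> x"
proof -
obtain r :: nat where r: "!!x y. x \<in> XS ==> y \<in> XS ==> (!!i. \<bar>i\<bar> <= int r ==> x i = y i) ==> f x = f y"
 using loc_const_finite_memory[OF assms] by blast
define \<phi> where "\<phi> w = f (shift_pow (int r) (SOME y. y \<in> XS & win (Suc (2 * r)) y 0 = w))" for w
have "f (shift_pow (int r) x) = wfun (Suc (2 * r)) \<phi> x" if x: "x \<in> XS" for x
proof -
 define y where "y = (SOME y. y \<in> XS & win (Suc (2 * r)) y 0 = win (Suc (2 * r)) x 0)"
 have y: "y \<in> XS" "win (Suc (2 * r)) y 0 = win (Suc (2 * r)) x 0"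
  using someI[of "%y. y \<in> XS & win (Suc (2 * r)) y 0 = win (Suc (2 * r)) x 0" x] x unfolding y_def by auto
 have "f (shift_pow (int r) x) = f (shift_pow (int r) y)"
 proof (rule r)
  show "shift_pow (int r) x \<in> XS" "shift_pow (int r) y \<in> XS" using x y(1) X_topspace theta_topspace by auto
  fix i assume "\<bar>i\<bar> <= int r"
  hence "win (Suc (2 * r)) y 0 ! nat (i + int r) = y (i + int r)"
   "win (Suc (2 * r)) x 0 ! nat (i + int r) = x (i + int r)" by (subst win_simps; auto)+
  thus "shift_pow (int r) x i = shift_pow (int r) y i" by (simp add: shift_pow_def y(2))
 qed
 thus ?thesis by (simp add: wfun_def \<phi>_def y_def)
qed
thus thesis by (rule that)
qed

definition words :: "nat => 'a list set" where
"words n = {w. length w = n & set w \<subseteq> L & successively (%a b. b ~= \<iota> a) w}"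

lemma win_words: "x \<in> XS ==> win n x i \<in> words n"
proof -
assume x: "x \<in> XS"
hence "x (i + int k + 1) ~= \<iota> (x (i + int k))" for k by (auto simp: reduced_sequences_def)
thus ?thesis
 using x by (auto simp: words_def successively_conv_nth reduced_sequences_def win_def add_ac)
qed

lemma periodic_XS:
assumes "w \<in> words p" "w ~= []" "hd w ~= \<iota> (last w)"
shows "periodic w \<in> XS" "shift_pow (int p) (periodic w) = periodic w"
proof -
have p: "length w = p" "0 < p" and l: "set w \<subseteq> L" and s: "!!k. Suc k < p ==> w ! Suc k ~= \<iota> (w ! k)"
 using assms(1,2) by (auto simp: words_def successively_conv_nth)
have "periodic w (k + 1) ~= \<iota> (periodic w k)" for k
proof -
 define j where "j = nat (k mod int p)"
 have j: "j < p" "k mod int p = int j" using p by (auto simp: j_def nat_less_iff)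
 moreover have "(k + 1) mod int p = (int j + 1) mod int p" by (metis j(2) mod_add_left_eq)
 moreover have "... = (if Suc j < p then int (Suc j) else 0)" using j(1) by (cases "Suc j = p") (auto simp: add.commute)
 ultimately have k1: "(k + 1) mod int p = (if Suc j < p then int (Suc j) else 0)" by simp
 thus ?thesis
 proof (cases "Suc j < p")
  case True
  thus ?thesis using s[of j] j(2) p k1 by (simp add: periodic_def del: of_nat_Suc)
 next
  case False
  hence "j = p - 1" using j(1) by simp
  hence "w ! j = last w" using p assms(2) by (simp add: last_conv_nth)
  thus ?thesis using False j(2) p assms(2,3) k1 by (simp add: periodic_def hd_conv_nth)
 qed
qed
moreover have "periodic w k \<in> L" for k
 unfolding periodic_def using l p by (intro subsetD[OF l] nth_mem) (simp add: nat_less_iff)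
ultimately show "periodic w \<in> XS" by (simp add: reduced_sequences_def)
show "shift_pow (int p) (periodic w) = periodic w" by (simp add: shift_pow_def periodic_def p fun_eq_iff)
qed

lemma words_append: "w @ [b] \<in> words (Suc n) <-> w \<in> words n & b \<in> L & (w ~= [] --> b ~= \<iota> (last w))"
by (auto simp: words_def successively_append_iff)

lemma words_Cons: "b # w \<in> words (Suc n) <-> w \<in> words n & b \<in> L & (w ~= [] --> hd w ~= \<iota> b)"
by (cases w) (auto simp: words_def)

lemma word_realized:
assumes "w \<in> words n" obtains x where "x \<in> XS" "win n x 0 = w"
proof (cases "w = []")
case True
obtain a where "a \<in> L" using letter_ex ..
thus thesis using that[of "%_. a"] constant_sequence assms True by (auto simp: words_def win_def)
next
case False
hence "hd w \<in> L" "last w \<in> L" using assms by (auto simp: words_def)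
\<comment> \<open>One additional letter closes the word to a reduced loop, whose periodic repetition
  contains it.\<close>
then obtain c where c: "c \<in> L" "c ~= \<iota> (last w)" "c ~= \<iota> (hd w)" using letter_avoiding inv_L(1) by metis
have "w @ [c] \<in> words (Suc n)" using assms c by (simp add: words_append)
moreover have "hd (w @ [c]) ~= \<iota> (last (w @ [c]))" using False c \<open>hd w \<in> L\<close> inv_L(2) by auto
ultimately have "periodic (w @ [c]) \<in> XS" by (intro periodic_XS) auto
moreover have "win n (periodic (w @ [c])) 0 = w"
 using win_periodic[of 0 "w @ [c]" n] assms by (auto simp: words_def)
ultimately show thesis by (rule that)
qed

lemma card_words: "card (words 0) = 1" "card (words (Suc n)) = card L * (card L - 1) ^ n" "finite (words k)"
proof -
show fin: "finite (words k)" for k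
 unfolding words_def by (rule finite_subset[OF _ finite_lists_length_eq[OF finite_L, of k]]) auto
have w0: "words 0 = {[]}" by (auto simp: words_def)
thus "card (words 0) = 1" by simp
have eq: "words (Suc n) = (%(w, b). w @ [b]) ` (SIGMA w:words n. {b \<in> L. w ~= [] --> b ~= \<iota> (last w)})" for n
proof (intro equalityI subsetI)
 fix u assume u: "u \<in> words (Suc n)"
 hence "u ~= []" by (auto simp: words_def)
 hence "u = butlast u @ [last u]" by simp
 thus "u \<in> (%(w, b). w @ [b]) ` (SIGMA w:words n. {b \<in> L. w ~= [] --> b ~= \<iota> (last w)})"
  using u words_append[of "butlast u" "last u" n] by (intro image_eqI[of _ _ "(butlast u, last u)"]) auto
next
 fix u assume "u \<in> (%(w, b). w @ [b]) ` (SIGMA w:words n. {b \<in> L. w ~= [] --> b ~= \<iota> (last w)})"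
 then obtain w b where "u = w @ [b]" "w \<in> words n" "b \<in> L" "w ~= [] --> b ~= \<iota> (last w)" by auto
 thus "u \<in> words (Suc n)" by (simp only: words_append)
qed
have c: "card (words (Suc n)) = (\<Sum>w\<in>words n. card {b \<in> L. w ~= [] --> b ~= \<iota> (last w)})" for n
 unfolding eq by (subst card_image) (auto simp: inj_on_def fin finite_L)
show "card (words (Suc n)) = card L * (card L - 1) ^ n"
proof (induction n)
 case 0 show ?case by (simp add: c w0)
next
 case (Suc n)
 have "card {b \<in> L. w ~= [] --> b ~= \<iota> (last w)} = card L - 1" if "w \<in> words (Suc n)" for w
 proof -
  have "w ~= []" "set w \<subseteq> L" using that by (auto simp: words_def)
  hence "w ~= []" "last w \<in> L" by auto
  hence "{b \<in> L. w ~= [] --> b ~= \<iota> (last w)} = L - {\<iota> (last w)}" by auto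
  thus ?thesis using inv_L(1) \<open>last w \<in> L\<close> by simp
 qed
 thus ?case unfolding c[of "Suc n"] using Suc by simp
qed
qed

definition la :: 'a where "la = (SOME a. a \<in> L)"
definition lb :: 'a where "lb = (SOME b. b \<in> L & b ~= la & b ~= \<iota> la)"

lemma la: "la \<in> L" and lb: "lb \<in> L" "lb ~= la" "lb ~= \<iota> la"
proof -
have "\<exists>a. a \<in> L" by (rule letter_ex)
thus a: "la \<in> L" unfolding la_def by (rule someI_ex)
have "\<exists>b. b \<in> L & b ~= la & b ~= \<iota> la" using letter_avoiding[OF a inv_L(1)[OF a]] by metis
from someI_ex[OF this] show "lb \<in> L" "lb ~= la" "lb ~= \<iota> la" unfolding lb_def by auto
qed

text \<open>The letter that leads from a vertex \<open>v\<close> to its predecessor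
  \<open>butlast (cc v # v)\<close> in the spanning tree. It is \<open>la\<close> whenever that
  keeps the word reduced, so iterated predecessors end at the word
  \<open>la, la, ...\<close>.\<close>

definition cc :: "'a list => 'a" where "cc v = (if v ~= [] & hd v = \<iota> la then lb else la)"

lemma cc_Cons: "v \<in> words n ==> cc v # v \<in> words (Suc n)"
using la lb inv_L by (auto simp: words_Cons cc_def) metis

lemma cc_la: "v ~= [] ==> hd v ~= \<iota> la ==> cc v = la"
by (simp add: cc_def)

lemma cc_ne: "cc v ~= \<iota> la"
using lb inv_L(3)[OF la] by (auto simp: cc_def)

lemma replicate_words: "v \<in> words n ==> v = [] | hd v ~= \<iota> la ==> replicate k la @ v \<in> words (k + n)"
proof (induction k)
case (Suc k)
hence "replicate k la @ v \<in> words (k + n)" by simp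
thus ?case using la inv_L(3)[OF la] Suc.prems by (cases k) (auto simp: words_Cons)
qed simp

text \<open>The edges \<open>cc v # v\<close>, without the loop at \<open>la, la, ...\<close>, form a spanning tree of the graph
whose edges are the words of length \<open>n + 1\<close>.\<close>

definition normal :: "nat => ('a list => int) => bool" where
"normal n \<phi> <-> (\<forall>v\<in>words n. \<phi> (cc v # v) = \<phi> (replicate (Suc n) la))"

text \<open>\<open>H v\<close> adds \<phi> along the tree walk to \<open>v\<close>, extended by
  turns in the loop at \<open>la\<close> so that it has exactly \<open>n + 1\<close> edges. One tree
  step then changes \<open>H\<close> by the value of its edge minus that of the loop, which is why
  \<phi> is normalized on the tree to the value at the loop and not to 0.\<close>

lemma normal_form:
obtains H \<phi>' where "normal n \<phi>'"
 "!!x. wfun (Suc n) \<phi> x = wfun (Suc n) \<phi>' x + (wfun n H (shift_pow 1 x) - wfun n H x)"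
proof -
define u where "u v = replicate n la @ cc v # v" for v
define H where "H v = (\<Sum>j\<le>n. \<phi> (take (Suc n) (drop j (u v))))" for v
define \<phi>' where "\<phi>' w = \<phi> w - (H (tl w) - H (butlast w))" for w
have key: "H v - H (butlast (cc v # v)) = \<phi> (cc v # v) - \<phi> (replicate (Suc n) la)" if v: "v \<in> words n" for v
proof (cases n)
 case 0
 thus ?thesis using v by (simp add: words_def cc_def)
next
 case (Suc k)
 hence ne: "v ~= []" "length v = n" using v by (auto simp: words_def)
 have "cc (butlast (cc v # v)) = la" using ne cc_ne[of v] by (simp add: cc_la)
 hence u': "u (butlast (cc v # v)) = la # butlast (u v)"
  using ne by (simp add: u_def butlast_append replicate_app_Cons_same)
 have "take (Suc n) (drop (Suc j) (u (butlast (cc v # v)))) = take (Suc n) (drop j (u v))" if "j < n" for j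
  unfolding u' using that ne by (simp add: butlast_conv_take u_def drop_take min_def del: take_Suc_Cons)
 moreover have "take (Suc n) (drop 0 (u (butlast (cc v # v)))) = replicate (Suc n) la"
  unfolding u' using ne by (simp add: butlast_conv_take u_def min_def)
 ultimately have "H (butlast (cc v # v)) = \<phi> (replicate (Suc n) la) + (\<Sum>j<n. \<phi> (take (Suc n) (drop j (u v))))"
  unfolding H_def lessThan_Suc_atMost[symmetric] sum.lessThan_Suc_shift by simp
 moreover have "H v = (\<Sum>j<n. \<phi> (take (Suc n) (drop j (u v)))) + \<phi> (cc v # v)"
  unfolding H_def lessThan_Suc_atMost[symmetric] using ne by (simp add: u_def)
 ultimately show ?thesis by simp
qed
have "normal n \<phi>'"
 unfolding normal_def
proof
 fix v assume v: "v \<in> words n"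
 have "butlast (replicate (Suc n) la) = replicate n la" "tl (replicate (Suc n) la) = replicate n la"
  by (simp_all add: butlast_conv_take min_def del: replicate_Suc)
 thus "\<phi>' (cc v # v) = \<phi>' (replicate (Suc n) la)" using key[OF v] by (simp add: \<phi>'_def)
qed
moreover have "wfun (Suc n) \<phi> x = wfun (Suc n) \<phi>' x + (wfun n H (shift_pow 1 x) - wfun n H x)" for x
 by (simp add: wfun_def \<phi>'_def win_Suc win_shift)
ultimately show thesis by (rule that)
qed

definition periodic_zero :: "((int => 'a) => int) => bool" where
"periodic_zero f <-> (\<forall>x\<in>XS. \<forall>p. shift_pow (int p) x = x --> (\<Sum>i<p. f (shift_pow (int i) x)) = 0)"

text \<open>An edge \<open>b # v\<close> lies on a closed walk that reaches it through tree edges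
  and returns by a route depending only on \<open>v\<close>. Tree edges have value 0 because the
  loop is a fixed point, so \<phi> at \<open>b # v\<close> is the negative of \<open>rest\<close>;
  the choice of the tree edge \<open>cc v # v\<close> shows that \<open>rest\<close> is 0.\<close>

lemma normal_zero:
assumes N: "normal n \<phi>" and z: "periodic_zero (wfun (Suc n) \<phi>)" and x: "x \<in> XS"
shows "wfun (Suc n) \<phi> x = 0"
proof -
have sum0: "(\<Sum>j<p. \<phi> (take (Suc n) (drop j (w @ w)))) = 0"
 if w: "w \<in> words p" "w ~= []" "hd w ~= \<iota> (last w)" "Suc n <= p" for w p
proof -
 have l: "length w = p" using w(1) by (simp add: words_def)
 have "(\<Sum>j<p. wfun (Suc n) \<phi> (shift_pow (int j) (periodic w))) = 0"
  using z periodic_XS[OF w(1-3)] unfolding periodic_zero_def by blast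
 also have "(\<Sum>j<p. wfun (Suc n) \<phi> (shift_pow (int j) (periodic w))) = (\<Sum>j<p. \<phi> (take (Suc n) (drop j (w @ w))))"
  using w(4) l by (intro sum.cong refl) (simp add: wfun_def win_shift win_periodic)
 finally show ?thesis .
qed
have const0: "\<phi> (replicate (Suc n) a) = 0" if "a \<in> L" for a
proof -
 have "shift_pow (int 1) (%_. a) = (%_. a)" by (simp add: shift_pow_def)
 hence "(\<Sum>i<1. wfun (Suc n) \<phi> (shift_pow (int i) (%_. a))) = 0"
  using z constant_sequence[OF that] unfolding periodic_zero_def by blast
 moreover have "win (Suc n) (%_. a) 0 = replicate (Suc n) a" by (rule nth_equalityI) (simp_all del: replicate_Suc)
 ultimately show ?thesis by (simp add: wfun_def)
qed
have tree: "\<phi> (cc v # v) = 0" if "v \<in> words n" for v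
 using N that const0[OF la] by (simp add: normal_def)
have "\<phi> e = 0" if e: "e \<in> words (Suc n)" for e
proof (cases n)
 case 0
 then obtain a where "e = [a]" "a \<in> L" using e by (auto simp: words_def length_Suc_conv)
 thus ?thesis using const0 0 by force
next
 case (Suc k)
 have le: "length e = Suc n" "e ~= []" "set e \<subseteq> L" using e by (auto simp: words_def)
 hence "last e \<in> L" by auto
 define v where "v = tl e"
 have v: "v \<in> words n" "length v = n" "v ~= []" "last v = last e"
  using e le Suc by (cases e; auto simp: v_def words_Cons)+
 \<comment> \<open>The letter that closes the walk: it may follow the last letter of
   \<open>v\<close> and may precede \<open>la\<close>.\<close>
 obtain r where r: "r \<in> L" "r ~= \<iota> (last e)" "r ~= \<iota> la" using letter_avoiding inv_L(1) la \<open>last e \<in> L\<close> by metis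
 define rest where "rest = (\<Sum>j<Suc n. \<phi> (take (Suc n) (drop j (v @ r # replicate n la))))"
 have loop: "\<phi> (b # v) + rest = 0" if b: "b # v \<in> words (Suc n)" for b
 proof -
  define U where "U = replicate n la @ cc (b # v) # b # v"
  define w where "w = U @ [r]"
  have cb: "cc (b # v) # b # v \<in> words (Suc (Suc n))" by (rule cc_Cons[OF b])
  have U: "U \<in> words (n + Suc (Suc n))" unfolding U_def
   by (rule replicate_words[OF cb]) (use cc_ne in simp)
  hence "w \<in> words (Suc (n + Suc (Suc n)))"
   unfolding w_def words_append using r v by (simp add: U_def)
  moreover have "hd w = la" using Suc by (simp add: w_def U_def)
  ultimately have S: "(\<Sum>j<Suc (n + Suc (Suc n)). \<phi> (take (Suc n) (drop j (w @ w)))) = 0"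
   using r(3) inv_L(2)[OF r(1)] by (intro sum0) (auto simp: w_def)
  have lU: "length U = n + Suc (Suc n)" using v by (simp add: U_def)
  \<comment> \<open>These windows start in the initial run of \<open>la\<close> or at the letter
    after it. Their first letter is the one that \<open>cc\<close> prescribes for their rest, so
    they are tree edges.\<close>
  have 1: "\<phi> (take (Suc n) (drop j (w @ w))) = 0" if "j < Suc n" for j
  proof -
   have e: "take (Suc n) (drop j (w @ w)) = take (Suc n) (drop j U)"
    using that lU by (simp add: w_def)
   define y where "y = take n (drop (Suc j) U)"
   have "drop j U = U ! j # drop (Suc j) U" using that lU by (simp add: Cons_nth_drop_Suc)
   hence t: "take (Suc n) (drop j U) = U ! j # y" by (simp add: y_def)
   have "take (Suc n) (drop j U) \<in> words (Suc n)"
   proof -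
    obtain z where "z \<in> XS" "win (n + Suc (Suc n)) z 0 = U" using word_realized[OF U] .
    hence "take (Suc n) (drop j U) = win (Suc n) z (int j)"
     using that by (intro nth_equalityI) auto
    thus ?thesis using win_words \<open>z \<in> XS\<close> by metis
   qed
   hence y: "y \<in> words n" "y ~= []" unfolding t words_Cons using Suc by (auto simp: words_def)
   have hy: "hd y = U ! Suc j" using y(2) by (simp add: y_def hd_conv_nth)
   have "U ! j = cc y"
   proof (cases "j < n")
    case True
    hence "U ! j = la" by (simp add: U_def nth_append)
    moreover have "hd y ~= \<iota> la" unfolding hy using True cc_ne inv_L(3)[OF la]
     by (cases "Suc j < n") (auto simp: U_def nth_append less_Suc_eq)
    ultimately show ?thesis using y(2) by (simp add: cc_la)
   next
    case False
    hence "j = n" using that by simp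
    thus ?thesis using y(2) hy by (simp add: U_def nth_append cc_def)
   qed
   thus ?thesis using tree[OF y(1)] by (simp only: e t)
  qed
  have 2: "take (Suc n) (drop (Suc n) (w @ w)) = b # v" using v by (simp add: w_def U_def)
  have 3: "take (Suc n) (drop (j + Suc (Suc n)) (w @ w)) = take (Suc n) (drop j (v @ r # replicate n la))" if "j < Suc n" for j
  proof -
   have "drop (j + Suc (Suc n)) (w @ w) = drop j (drop (Suc (Suc n)) (w @ w))" by (simp only: drop_drop)
   also have "drop (Suc (Suc n)) (w @ w) = (v @ r # replicate n la) @ (cc (b # v) # b # v @ [r])"
    using v by (simp add: w_def U_def)
   finally show ?thesis using that v by (simp add: min_def)
  qed
  define t where "t j = \<phi> (take (Suc n) (drop j (w @ w)))" for j
  have "(\<Sum>j<Suc (Suc n) + Suc n. t j) = (\<Sum>j<Suc (Suc n). t j) + (\<Sum>j<Suc n. t (Suc (Suc n) + j))"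
   by (rule sum_lessThan_add)
  also have "(\<Sum>j<Suc (Suc n). t j) = \<phi> (b # v)"
   unfolding sum.lessThan_Suc[of _ "Suc n"] using 1 2 by (simp add: t_def del: sum.lessThan_Suc)
  also have "(\<Sum>j<Suc n. t (Suc (Suc n) + j)) = rest"
   unfolding rest_def t_def using 3 by (intro sum.cong refl) (simp add: add.commute)
  also have "(\<Sum>j<Suc (Suc n) + Suc n. t j) = 0" using S by (simp only: t_def add_Suc add_Suc_right)
  finally show ?thesis by simp
 qed
 have "e = hd e # v" using le by (simp add: v_def)
 thus ?thesis using loop[of "hd e"] loop[OF cc_Cons[OF v(1)]] tree[OF v(1)] e by simp
qed
thus ?thesis unfolding wfun_def using win_words[OF x] by blast
qed

lemma periodic_zero_coboundary:
"periodic_zero (%x. wfun n H (shift_pow 1 x) - wfun n H x)"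
unfolding periodic_zero_def
proof (intro ballI allI impI)
fix x p assume "x \<in> XS" "shift_pow (int p) x = x"
thus "(\<Sum>i<p. wfun n H (shift_pow 1 (shift_pow (int i) x)) - wfun n H (shift_pow (int i) x)) = (0 :: int)"
 unfolding sum_subtractf using orbit_sum_shift[of p x "wfun n H" 1] by simp
qed

text \<open>An integral form of the Livsic theorem. Triviality makes all periodic sums vanish; the
  normal form of the function has the same periodic sums and is therefore 0, so only a coboundary
  remains.\<close>

lemma kcls_eq_one_iff:
assumes f: "loc_const f"
shows "kcls f = \<one>\<^bsub>\<K>\<^esub> <-> (\<exists>h. loc_const h & (\<forall>x\<in>XS. f x = h (shift_pow 1 x) - h x))"
proof
assume "\<exists>h. loc_const h & (\<forall>x\<in>XS. f x = h (shift_pow 1 x) - h x)"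
then obtain h where h: "loc_const h" "!!x. x \<in> XS ==> h (shift_pow 1 x) = f x + h x" by force
have "kcls f \<otimes>\<^bsub>\<K>\<^esub> kcls h = kcls (%x. h (shift_pow 1 x))"
 unfolding kcls_add[OF f h(1)] by (rule kcls_cong) (simp add: h(2) X_topspace)
hence "kcls f \<otimes>\<^bsub>\<K>\<^esub> kcls h = kcls h" using kcls_theta[OF h(1), of 1] by simp
hence e: "kcls (%x. f x + h x) = kcls h" unfolding kcls_add[OF f h(1)] .
have m: "loc_const (%x. - h x)" by (rule loc_const_comp[OF h(1)])
have "kcls (%x. f x + h x) \<otimes>\<^bsub>\<K>\<^esub> kcls (%x. - h x) = kcls h \<otimes>\<^bsub>\<K>\<^esub> kcls (%x. - h x)" unfolding e ..
hence "kcls (%x. f x + h x + - h x) = kcls (%x. h x + - h x)"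
 unfolding kcls_add[OF loc_const_comp2[OF f h(1)] m] kcls_add[OF h(1) m] .
thus "kcls f = \<one>\<^bsub>\<K>\<^esub>" by (simp add: kcls_one)
next
assume one: "kcls f = \<one>\<^bsub>\<K>\<^esub>"
obtain n r \<phi> where \<phi>: "!!x. x \<in> XS ==> f (shift_pow r x) = wfun (Suc n) \<phi> x" by (rule loc_const_wfun_ex[OF f], rule that)
obtain H \<phi>' where H: "normal n \<phi>'"
 "!!x. wfun (Suc n) \<phi> x = wfun (Suc n) \<phi>' x + (wfun n H (shift_pow 1 x) - wfun n H x)"
 by (rule normal_form[of n \<phi>], rule that)
have "periodic_zero (wfun (Suc n) \<phi>')"
 unfolding periodic_zero_def
proof (intro ballI allI impI)
 fix x p assume x: "x \<in> XS" "shift_pow (int p) x = x"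
 have xs: "shift_pow k x \<in> XS" for k using x(1) theta_topspace X_topspace by simp
 have "(\<Sum>i<p. f (shift_pow r (shift_pow (int i) x))) = 0"
  unfolding orbit_sum_shift[OF x(2)] using kcls_eq_periodic[OF f one _ x(2)] x(1) X_topspace by simp
 hence "(\<Sum>i<p. wfun (Suc n) \<phi> (shift_pow (int i) x)) = 0" using \<phi>[OF xs] by simp
 thus "(\<Sum>i<p. wfun (Suc n) \<phi>' (shift_pow (int i) x)) = 0"
  using periodic_zero_coboundary[of n H] x unfolding H(2) sum.distrib periodic_zero_def by simp
qed
from normal_zero[OF H(1) this] have "f (shift_pow r x) = wfun n H (shift_pow 1 x) - wfun n H x" if "x \<in> XS" for x
 using that \<phi> H(2) by simp
note eq = this
have "f x = wfun n H (shift_pow (- r) (shift_pow 1 x)) - wfun n H (shift_pow (- r) x)" if "x \<in> XS" for x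
 using eq[of "shift_pow (- r) x"] that theta_topspace[of "- r" x] X_topspace by simp
moreover have "loc_const (%x. wfun n H (shift_pow (- r) x))" by (rule loc_const_theta[OF loc_const_wfun])
ultimately show "\<exists>h. loc_const h & (\<forall>x\<in>XS. f x = h (shift_pow 1 x) - h x)" by blast
qed

end

section \<open>The first cohomology of the mapping torus\<close>

lemma continuous_map_complex_mult:
fixes f h :: "'a => complex"
shows "continuous_map Z euclidean f ==> continuous_map Z euclidean h ==> continuous_map Z euclidean (%z. f z * h z)"
by (auto simp: continuous_map_atin intro: tendsto_mult)

text \<open>Two unit numbers at distance less than 1 have a quotient with positive real part, away
  from the cut of \<open>Arg\<close>.\<close>

lemma continuous_map_Arg_quotient:
assumes a: "continuous_map Z euclidean a" and b: "continuous_map Z euclidean b"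
 and n: "!!z. z \<in> topspace Z ==> cmod (a z) = 1 & cmod (b z) = 1 & cmod (a z - b z) < 1"
shows "continuous_map Z euclideanreal (%z. Arg (a z / b z))"
 and "z \<in> topspace Z ==> a z = b z * cis (Arg (a z / b z))"
proof -
have q: "a z / b z \<in> - \<real>\<^sub>\<le>\<^sub>0" if "z \<in> topspace Z" for z
proof -
 have b0: "b z ~= 0" using n[OF that] by auto
 have "cmod (a z / b z - 1) = cmod (a z - b z) / cmod (b z)"
  using b0 by (simp add: diff_divide_distrib flip: norm_divide)
 hence "\<bar>Re (a z / b z - 1)\<bar> < 1" using n[OF that] abs_Re_le_cmod[of "a z / b z - 1"] by simp
 thus ?thesis by (auto simp: complex_nonpos_Reals_iff)
qed
have "continuous_map Z euclidean (%z. a z / b z)"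
 using a b n by (force simp: continuous_map_atin intro!: tendsto_divide)
hence "continuous_map Z (top_of_set (- \<real>\<^sub>\<le>\<^sub>0)) (%z. a z / b z)"
 using q by (auto simp: continuous_map_in_subtopology image_subset_iff)
moreover have "continuous_map (top_of_set (- \<real>\<^sub>\<le>\<^sub>0)) euclideanreal Arg"
 unfolding continuous_map_iff_continuous by (intro continuous_at_imp_continuous_on ballI continuous_at_Arg) simp
ultimately show "continuous_map Z euclideanreal (%z. Arg (a z / b z))"
 using continuous_map_compose unfolding o_def by blast
assume z: "z \<in> topspace Z"
have "b z ~= 0" "a z / b z ~= 0" "cmod (a z / b z) = 1" using n[OF z] by (auto simp: norm_divide)
thus "a z = b z * cis (Arg (a z / b z))" by (simp add: cis_Arg sgn_div_norm sgn_eq)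
qed

lemma circle_map_iff:
"continuous_map Z circle f <-> continuous_map Z euclidean f & (\<forall>z\<in>topspace Z. cmod (f z) = 1)"
by (auto simp: continuous_map_in_subtopology image_subset_iff)

text \<open>Induction along the interval. By compactness and the tube lemma there is a neighbourhood
  of each time within which all points of \<open>Y\<close> move by less than 1, so
  \<open>Arg\<close> supplies the increment of the logarithm.\<close>

lemma homotopy_log:
fixes K :: "real \<times> 'a => complex"
assumes Y: "compact_space Y" and K: "continuous_map (prod_topology (top_of_set {0..1}) Y) circle K"
shows "\<exists>\<Psi>. continuous_map Y euclideanreal \<Psi> & (\<forall>y\<in>topspace Y. K (1, y) = K (0, y) * cis (\<Psi> y))"
proof (rule connected_induction_simple[where S = "{0..1}" and a = 0 and b = 1])
let ?P = "prod_topology (top_of_set {0..1 :: real}) Y"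
fix a :: real assume a: "a \<in> {0..1}"
have c: "continuous_map ?P circle (%p. K (a, snd p))" "t \<in> {0..1} ==> continuous_map Y circle (%y. K (t, y))" for t
 using a by (auto intro!: continuous_map_compose[OF _ K, unfolded o_def] continuous_map_pairedI continuous_map_snd)
hence "continuous_map ?P euclidean (%p. K p - K (a, snd p))"
 using K by (intro continuous_map_diff) (auto simp: circle_map_iff)
hence W: "openin ?P {p \<in> topspace ?P. K p - K (a, snd p) \<in> ball 0 (1 / 2)}" (is "openin ?P ?W")
 by (rule openin_continuous_map_preimage) simp
have "{a} \<times> topspace Y \<subseteq> ?W" using a by auto
from tube_lemma_right[OF W _ _ this] Y a obtain U V where U: "openin (top_of_set {0..1}) U" "a \<in> U" "topspace Y \<subseteq> V"
 "U \<times> V \<subseteq> ?W" by (auto simp only: compact_space_def topspace_euclidean_subtopology)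
have near: "cmod (K (t', y) - K (t, y)) < 1" if "t \<in> U" "t' \<in> U" "y \<in> topspace Y" for t t' y
proof -
 have "cmod (K (t', y) - K (a, y)) < 1 / 2" "cmod (K (t, y) - K (a, y)) < 1 / 2" using U(3,4) that by force+
 thus ?thesis using norm_triangle_ineq4[of "K (t', y) - K (a, y)" "K (t, y) - K (a, y)"] by simp
qed
have "\<exists>\<Psi>. continuous_map Y euclideanreal \<Psi> & (\<forall>y\<in>topspace Y. K (t', y) = K (0, y) * cis (\<Psi> y))"
 if t: "t \<in> U" "t' \<in> U" and \<Psi>: "continuous_map Y euclideanreal \<Psi>" "\<forall>y\<in>topspace Y. K (t, y) = K (0, y) * cis (\<Psi> y)"
 for t t' \<Psi>
proof -
 have "t \<in> {0..1}" "t' \<in> {0..1}" using openin_imp_subset[OF U(1)] t by auto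
 note ct = c(2)[OF this(1), unfolded circle_map_iff] c(2)[OF this(2), unfolded circle_map_iff]
 note q = continuous_map_Arg_quotient[OF conjunct1[OF ct(2)] conjunct1[OF ct(1)]]
 show ?thesis using \<Psi> ct near[OF t] q
  by (intro exI[of _ "%y. \<Psi> y + Arg (K (t', y) / K (t, y))"] conjI continuous_map_add ballI)
   (auto simp: cis_mult[symmetric] mult.assoc[symmetric])
qed
thus "\<exists>T. openin (top_of_set {0..1}) T & a \<in> T & (\<forall>t\<in>T. \<forall>t'\<in>T.
  (\<exists>\<Psi>. continuous_map Y euclideanreal \<Psi> & (\<forall>y\<in>topspace Y. K (t, y) = K (0, y) * cis (\<Psi> y))) -->
  (\<exists>\<Psi>. continuous_map Y euclideanreal \<Psi> & (\<forall>y\<in>topspace Y. K (t', y) = K (0, y) * cis (\<Psi> y))))"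
 using U(1,2) by (intro exI[of _ U]) blast
qed (auto intro: exI[of _ "%_. 0"])

lemma continuous_map_cis: "continuous_map Z euclideanreal \<Psi> ==> continuous_map Z euclidean (%z. cis (\<Psi> z))"
using continuous_map_compose[of Z euclideanreal \<Psi> euclidean cis] by (simp add: o_def continuous_on_cis)

text \<open>Homotopy classes of circle-valued maps are such maps modulo exponentials of real
  functions; all later comparisons in the cohomology group are made in this form.\<close>

lemma homotopic_circle_iff:
fixes Y :: "'a topology"
assumes Y: "compact_space Y" and u: "continuous_map Y circle u" and v: "continuous_map Y circle v"
shows "homotopic_with (%_. True) Y circle u v <->
 (\<exists>\<Psi>. continuous_map Y euclideanreal \<Psi> & (\<forall>y\<in>topspace Y. v y = u y * cis (\<Psi> y)))"
proof
assume "homotopic_with (%_. True) Y circle u v"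
then obtain K :: "real \<times> 'a => complex" where K: "continuous_map (prod_topology (top_of_set {0..1}) Y) circle K"
 "\<forall>y. K (0, y) = u y" "\<forall>y. K (1, y) = v y" unfolding homotopic_with_def by (elim exE conjE) (rule that)
thus "\<exists>\<Psi>. continuous_map Y euclideanreal \<Psi> & (\<forall>y\<in>topspace Y. v y = u y * cis (\<Psi> y))"
 using homotopy_log[OF Y K(1)] by simp
next
assume "\<exists>\<Psi>. continuous_map Y euclideanreal \<Psi> & (\<forall>y\<in>topspace Y. v y = u y * cis (\<Psi> y))"
then obtain \<Psi> where \<Psi>: "continuous_map Y euclideanreal \<Psi>" "!!y. y \<in> topspace Y ==> v y = u y * cis (\<Psi> y)" by blast
let ?P = "prod_topology (top_of_set {0..1 :: real}) Y"
have s: "continuous_map ?P Y snd" by (rule continuous_map_snd)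
have "continuous_map ?P euclideanreal (%p. fst p * \<Psi> (snd p))"
 using continuous_map_into_fulltopology[OF continuous_map_fst[of "top_of_set {0..1 :: real}" Y]] continuous_map_compose[OF s \<Psi>(1)]
 by (intro continuous_map_real_mult) (auto simp: o_def)
from continuous_map_cis[OF this] have "continuous_map ?P euclidean (%p. u (snd p) * cis (fst p * \<Psi> (snd p)))"
 using u continuous_map_compose[OF s, of euclidean u] by (intro continuous_map_complex_mult) (auto simp: o_def circle_map_iff)
hence "continuous_map ?P circle (%p. u (snd p) * cis (fst p * \<Psi> (snd p)))"
 using u by (auto simp: circle_map_iff norm_mult)
thus "homotopic_with (%_. True) Y circle u v"
 by (subst homotopic_with) (auto intro!: exI[of _ "%p. u (snd p) * cis (fst p * \<Psi> (snd p))"] simp: \<Psi>(2))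
qed

context zero_dim_system
begin

abbreviation "\<T> \<equiv> mapping_torus X (\<theta> 1)"
abbreviation "\<C> \<equiv> cylinder X"

definition tcl :: "'x \<times> real => ('x \<times> real) set" where "tcl p = mapping_torus_rel X (\<theta> 1) `` {p}"

lemma tcl_quotient: "quotient_map \<C> \<T> tcl"
unfolding mapping_torus_def tcl_def[abs_def] by (rule quotient_map_quotient_topology)

lemma tcl_glue: "x \<in> XX ==> tcl (x, 0) = tcl (\<theta> 1 x, 1)"
proof -
assume x: "x \<in> XX"
let ?g = "mapping_torus_gluing X (\<theta> 1)"
have "((x, 0), (\<theta> 1 x, 1)) \<in> ?g" using x by (auto simp: mapping_torus_gluing_def)
hence "((x, 0), (\<theta> 1 x, 1)) \<in> (?g \<union> ?g\<inverse>)\<^sup>*" "((\<theta> 1 x, 1), (x, 0)) \<in> (?g \<union> ?g\<inverse>)\<^sup>*" by blast+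
thus ?thesis using x unfolding tcl_def mapping_torus_rel_def by (auto intro: rtrancl_trans)
qed

lemma torus_map:
assumes F: "continuous_map \<C> Z F" and g: "!!x. x \<in> XX ==> F (x, 0) = F (\<theta> 1 x, 1)"
obtains F' where "continuous_map \<T> Z F'" "!!p. p \<in> topspace \<C> ==> F' (tcl p) = F p"
proof -
have "F p = F p'" if "(p, p') \<in> (mapping_torus_gluing X (\<theta> 1) \<union> (mapping_torus_gluing X (\<theta> 1))\<inverse>)\<^sup>*" for p p'
 using that by (induction rule: rtrancl_induct) (auto simp: mapping_torus_gluing_def g)
hence c: "F p' = F p" if "p' \<in> tcl p" for p p' using that unfolding tcl_def mapping_torus_rel_def by fastforce
define F' where "F' k = F (SOME p. p \<in> k)" for k
have "F' (tcl p) = F p" if "p \<in> topspace \<C>" for p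
proof -
 have "p \<in> tcl p" using that by (auto simp: tcl_def mapping_torus_rel_def)
 thus ?thesis unfolding F'_def by (intro c someI)
qed
moreover from this have "continuous_map \<C> Z (F' \<circ> tcl)" by (intro continuous_map_eq[OF F]) simp
hence "continuous_map \<T> Z F'" using continuous_compose_quotient_map_eq[OF tcl_quotient] by blast
ultimately show thesis by (intro that)
qed

lemma torus_compact: "compact_space \<T>"
proof -
have "compact_space \<C>" using compact by (simp add: compact_space_prod_topology compact_space_subtopology)
thus ?thesis
 using image_compactin[OF _ quotient_imp_continuous_map[OF tcl_quotient], of "topspace \<C>"]
  quotient_imp_surjective_map[OF tcl_quotient] by (simp add: compact_space_def)
qed

lemma torus_points: "y \<in> topspace \<T> <-> (\<exists>x\<in>XX. \<exists>t\<in>{0..1}. y = tcl (x, t))"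
using quotient_imp_surjective_map[OF tcl_quotient] by (force simp: image_iff set_eq_iff)

abbreviation "\<H> \<equiv> cohomology1 \<T>"

definition hcl :: "(('x \<times> real) set => complex) => (('x \<times> real) set => complex) set" where
"hcl u = homotopy_rel \<T> `` {u}"

lemma homotopy_equiv: "equiv {f. continuous_map \<T> circle f} (homotopy_rel \<T>)"
proof (rule equivI)
show "homotopy_rel \<T> \<subseteq> {f. continuous_map \<T> circle f} \<times> {f. continuous_map \<T> circle f}"
 using homotopic_with_imp_continuous_maps[of "%_. True" \<T> circle] by (auto simp: homotopy_rel_def)
show "refl_on {f. continuous_map \<T> circle f} (homotopy_rel \<T>)"
 by (auto simp: refl_on_def homotopy_rel_def homotopic_with_refl dest: homotopic_with_imp_continuous_maps)
show "sym (homotopy_rel \<T>)" "trans (homotopy_rel \<T>)"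
 by (auto simp: sym_def trans_def homotopy_rel_def homotopic_with_sym intro: homotopic_with_trans)
qed

lemma hcl_eq_iff:
assumes "continuous_map \<T> circle u" "continuous_map \<T> circle v"
shows "hcl u = hcl v <-> (\<exists>\<Psi>. continuous_map \<T> euclideanreal \<Psi> & (\<forall>y\<in>topspace \<T>. v y = u y * cis (\<Psi> y)))"
unfolding hcl_def homotopic_circle_iff[OF torus_compact assms, symmetric]
using eq_equiv_class_iff[OF homotopy_equiv, of u v] assms by (simp add: homotopy_rel_def)

lemma circle_map_mult: "continuous_map Z circle u ==> continuous_map Z circle v ==> continuous_map Z circle (%z. u z * v z)"
by (auto simp: circle_map_iff norm_mult intro: continuous_map_complex_mult)

lemma hcl_mult:
assumes "continuous_map \<T> circle u" "continuous_map \<T> circle v"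
shows "hcl u \<otimes>\<^bsub>\<H>\<^esub> hcl v = hcl (%y. u y * v y)"
proof -
have "class_op2 (homotopy_rel \<T>) (%f h x. f x * h x) (homotopy_rel \<T> `` {u}) (homotopy_rel \<T> `` {v}) =
  homotopy_rel \<T> `` {%y. u y * v y}"
proof (rule class_op2_eq[OF homotopy_equiv])
 fix a a' b b' assume ab: "(a, a') \<in> homotopy_rel \<T>" "(b, b') \<in> homotopy_rel \<T>"
 hence c: "continuous_map \<T> circle a" "continuous_map \<T> circle a'" "continuous_map \<T> circle b" "continuous_map \<T> circle b'"
  using homotopic_with_imp_continuous_maps[of "%_. True" \<T> circle] by (auto simp: homotopy_rel_def)
 obtain \<Psi> \<Psi>' where "continuous_map \<T> euclideanreal \<Psi>" "\<forall>y\<in>topspace \<T>. a' y = a y * cis (\<Psi> y)"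
  "continuous_map \<T> euclideanreal \<Psi>'" "\<forall>y\<in>topspace \<T>. b' y = b y * cis (\<Psi>' y)"
  using ab unfolding homotopy_rel_def mem_Collect_eq case_prod_conv homotopic_circle_iff[OF torus_compact c(1,2)]
   homotopic_circle_iff[OF torus_compact c(3,4)] by blast
 thus "((%x. a x * b x), (%x. a' x * b' x)) \<in> homotopy_rel \<T>"
  unfolding homotopy_rel_def mem_Collect_eq case_prod_conv
   homotopic_circle_iff[OF torus_compact circle_map_mult[OF c(1,3)] circle_map_mult[OF c(2,4)]]
  by (intro exI[of _ "%y. \<Psi> y + \<Psi>' y"] conjI continuous_map_add) (auto simp: cis_mult[symmetric])
qed (use assms in auto)
thus ?thesis by (simp add: hcl_def cohomology1_def)
qed

lemma loc_const_continuous: "loc_const f ==> continuous_map X euclidean (%x. h (f x))"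
using loc_const_open[of "%x. h (f x)"] loc_const_comp[of f h] by (auto simp: continuous_map_def)

lemma integer_loc_const:
assumes d: "continuous_map X euclideanreal d" and z: "!!x. x \<in> XX ==> d x \<in> \<int>"
shows "loc_const (%x. \<lfloor>d x\<rfloor>)" "x \<in> XX ==> real_of_int \<lfloor>d x\<rfloor> = d x"
proof -
show e: "real_of_int \<lfloor>d x\<rfloor> = d x" if "x \<in> XX" for x using z[OF that] by (auto elim: Ints_cases)
have "{x \<in> XX. \<lfloor>d x\<rfloor> = v} = {x \<in> XX. d x \<in> ball (of_int v) 1}" for v
proof (intro Collect_cong conj_cong refl)
 fix x assume "x \<in> XX"
 have "\<lfloor>d x\<rfloor> = v <-> \<bar>real_of_int v - real_of_int \<lfloor>d x\<rfloor>\<bar> < 1" by linarith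
 thus "\<lfloor>d x\<rfloor> = v <-> d x \<in> ball (of_int v) 1" unfolding e[OF \<open>x \<in> XX\<close>] by (simp add: dist_real_def)
qed
thus "loc_const (%x. \<lfloor>d x\<rfloor>)"
 unfolding loc_const_iff by (simp only:) (intro allI openin_continuous_map_preimage[OF d], simp)
qed

text \<open>Winds \<open>f x\<close> times around the circle along the segment over
  \<open>x\<close>; both ends go to 1 by integrality, so the map respects the gluing.\<close>

definition tor :: "('x => int) => ('x \<times> real) set => complex" where
"tor f = (SOME u. continuous_map \<T> circle u &
  (\<forall>x\<in>XX. \<forall>t\<in>{0..1}. u (tcl (x, t)) = cis (2 * pi * (t * of_int (f x)))))"

lemma cyl_snd: "continuous_map \<C> euclideanreal snd"
using continuous_map_into_fulltopology[OF continuous_map_snd[of X "top_of_set {0..1 :: real}"]] by simp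

lemma cyl_fst: "continuous_map X Z f ==> continuous_map \<C> Z (%p. f (fst p))"
using continuous_map_compose[OF continuous_map_fst[of X "top_of_set {0..1 :: real}"]] by (auto simp: o_def)

lemma tor:
assumes f: "loc_const f"
shows "continuous_map \<T> circle (tor f)"
 and "x \<in> XX ==> t \<in> {0..1} ==> tor f (tcl (x, t)) = cis (2 * pi * (t * of_int (f x)))"
proof -
let ?F = "%p. cis (2 * pi * (snd p * of_int (f (fst p))))"
have "continuous_map \<C> euclideanreal (%p. 2 * pi * (snd p * of_int (f (fst p))))"
 by (intro continuous_map_real_mult cyl_snd cyl_fst[OF loc_const_continuous[OF f]]; simp?)
from continuous_map_cis[OF this] have F: "continuous_map \<C> circle ?F" by (simp add: circle_map_iff)
have g: "?F (x, 0) = ?F (\<theta> 1 x, 1)" for x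
 using cis_multiple_2pi[of "real_of_int (f (\<theta> 1 x))"] by simp
obtain u where "continuous_map \<T> circle u" "!!p. p \<in> topspace \<C> ==> u (tcl p) = ?F p" by (rule torus_map[OF F], rule g, (assumption | rule that)+)
hence "\<exists>u. continuous_map \<T> circle u &
  (\<forall>x\<in>XX. \<forall>t\<in>{0..1}. u (tcl (x, t)) = cis (2 * pi * (t * of_int (f x))))" by (intro exI[of _ u]) auto
from someI_ex[OF this] show "continuous_map \<T> circle (tor f)"
 "x \<in> XX ==> t \<in> {0..1} ==> tor f (tcl (x, t)) = cis (2 * pi * (t * of_int (f x)))"
 unfolding tor_def by blast+
qed

lemma cis_eq_1: "cis a = 1 <-> a / (2 * pi) \<in> \<int>"
proof
assume "cis a = 1"
hence "cos a = 1" by (simp add: complex_eq_iff)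
then obtain k :: int where "a = of_int k * 2 * pi" using cos_one_2pi_int by blast
thus "a / (2 * pi) \<in> \<int>" by simp
next
assume "a / (2 * pi) \<in> \<int>"
thus "cis a = 1" using cis_multiple_2pi[of "a / (2 * pi)"] by simp
qed

text \<open>A real logarithm of the quotient grows by \<open>2 * pi * (f' x - f x)\<close> along the
  segment over \<open>x\<close> and is a multiple of \<open>2 * pi\<close> at its ends. The gluing
  identifies ends of different segments, so the difference of the end values becomes a
  coboundary.\<close>

lemma tor_cong_iff:
assumes f: "loc_const f" "loc_const f'"
shows "hcl (tor f) = hcl (tor f') <-> (\<exists>h. loc_const h & (\<forall>x\<in>XX. f' x - f x = h (\<theta> 1 x) - h x))"
 (is "?L <-> ?R")
proof
assume ?L
then obtain \<Psi> where \<Psi>: "continuous_map \<T> euclideanreal \<Psi>" "!!y. y \<in> topspace \<T> ==> tor f' y = tor f y * cis (\<Psi> y)"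
 unfolding hcl_eq_iff[OF tor(1)[OF f(1)] tor(1)[OF f(2)]] by blast
define P where "P p = \<Psi> (tcl p)" for p
have P: "continuous_map \<C> euclideanreal P"
 using continuous_map_compose[OF quotient_imp_continuous_map[OF tcl_quotient] \<Psi>(1)] by (simp add: P_def[abs_def] o_def)
define k where "k x = real_of_int (f' x - f x)" for x
have val: "(P (x, t) - 2 * pi * (t * k x)) / (2 * pi) \<in> \<int>" if x: "x \<in> XX" "t \<in> {0..1}" for x t
proof -
 have "tcl (x, t) \<in> topspace \<T>" unfolding torus_points using x by blast
 from \<Psi>(2)[OF this] have "cis (2 * pi * (t * of_int (f' x))) = cis (2 * pi * (t * of_int (f x)) + P (x, t))"
  using tor(2)[OF f(1) x] tor(2)[OF f(2) x] by (simp add: P_def cis_mult)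
 hence "cis (2 * pi * (t * of_int (f x)) + P (x, t) - 2 * pi * (t * of_int (f' x))) = 1"
  by (simp flip: cis_divide)
 thus ?thesis unfolding cis_eq_1 by (simp add: k_def algebra_simps)
qed
have const: "P (x, 1) = P (x, 0) + 2 * pi * k x" if x: "x \<in> XX" for x
proof -
 \<comment> \<open>Continuous with integer values on an interval, hence constant.\<close>
 let ?g = "%t. (P (x, t) - 2 * pi * (t * k x)) / (2 * pi)"
 have "continuous_map (top_of_set {0..1}) \<C> (%t. (x, t))" using x by (intro continuous_map_pairedI) auto
 from continuous_map_compose[OF this P] have "continuous_on {0..1} ?g"
  by (auto simp: o_def intro!: continuous_intros)
 hence "?g constant_on {0..1}"
 proof (rule continuous_discrete_range_constant[rotated])
  fix t :: real assume t: "t \<in> {0..1}"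
  have *: "1 <= norm (?g s - ?g t)" if s: "s \<in> {0..1}" "?g s ~= ?g t" for s
   using Ints_nonzero_abs_ge1[of "?g s - ?g t"] val[OF x s(1)] val[OF x t] s(2) by simp
  show "\<exists>e>0. \<forall>y. y \<in> {0..1} & ?g y ~= ?g t --> e <= norm (?g y - ?g t)"
   by (rule exI[of _ 1], intro conjI allI impI, simp, elim conjE, rule *)
 qed simp
 then obtain y where y: "!!t. t \<in> {0..1} ==> ?g t = y" unfolding constant_on_def by blast
 have "?g 1 = y" "?g 0 = y" by (rule y, simp)+
 hence "?g 1 = ?g 0" by (simp only:)
 thus ?thesis by (simp add: field_simps)
qed
define d where "d x = P (x, 0) / (2 * pi)" for x
have "continuous_map X \<C> (%x. (x, 0))" by (intro continuous_map_pairedI) auto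
from continuous_map_compose[OF this P] have dc: "continuous_map X euclideanreal d"
 unfolding d_def by (intro continuous_map_real_divide) (auto simp: o_def)
have dz: "d x \<in> \<int>" if "x \<in> XX" for x using val[OF that, of 0] by (simp add: d_def)
note D = integer_loc_const[OF dc dz]
have dd: "d x = d (\<theta> 1 x) + k (\<theta> 1 x)" if x: "x \<in> XX" for x
proof -
 have "P (x, 0) = P (\<theta> 1 x, 1)" using tcl_glue[OF x] by (simp add: P_def)
 also have "... = P (\<theta> 1 x, 0) + 2 * pi * k (\<theta> 1 x)" using x by (intro const) simp
 finally show ?thesis by (simp add: d_def field_simps)
qed
\<comment> \<open>The end 0 over a point is glued to the end 1 over its shift. So the transfer
  function is the negative of \<open>d\<close> at the preceding point.\<close>
have "f' x - f x = - \<lfloor>d (\<theta> (- 1) (\<theta> 1 x))\<rfloor> - - \<lfloor>d (\<theta> (- 1) x)\<rfloor>" if x: "x \<in> XX" for x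
proof -
 have "real_of_int (f' x - f x) = real_of_int (- \<lfloor>d x\<rfloor> + \<lfloor>d (\<theta> (- 1) x)\<rfloor>)"
  using dd[of "\<theta> (- 1) x"] D(2)[of x] D(2)[of "\<theta> (- 1) x"] x by (simp add: k_def)
 thus ?thesis unfolding of_int_eq_iff by simp
qed
moreover have "loc_const (%x. - \<lfloor>d (\<theta> (- 1) x)\<rfloor>)"
 using loc_const_comp[OF loc_const_theta[OF D(1)], of uminus "- 1"] dz by simp
ultimately show ?R by (intro exI[of _ "%x. - \<lfloor>d (\<theta> (- 1) x)\<rfloor>"]) blast
next
assume ?R
then obtain h where h: "loc_const h" "!!x. x \<in> XX ==> f' x = f x + h (\<theta> 1 x) - h x" by force
let ?F = "%p. 2 * pi * (snd p * of_int (f' (fst p) - f (fst p)) - of_int (h (\<theta> 1 (fst p))))"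
have F: "continuous_map \<C> euclideanreal ?F"
 by (intro continuous_map_real_mult continuous_map_diff cyl_snd
   cyl_fst[OF loc_const_continuous[OF loc_const_comp2[OF f(2,1)], of real_of_int]]
   cyl_fst[OF loc_const_continuous[OF loc_const_theta[OF h(1)], of real_of_int]]) auto
have g: "?F (x, 0) = ?F (\<theta> 1 x, 1)" if "x \<in> XX" for x using that h(2)[of "\<theta> 1 x"] by simp
obtain \<Psi> where \<Psi>: "continuous_map \<T> euclideanreal \<Psi>" "!!p. p \<in> topspace \<C> ==> \<Psi> (tcl p) = ?F p" by (rule torus_map[OF F], rule g, (assumption | rule that)+)
have "tor f' y = tor f y * cis (\<Psi> y)" if y: "y \<in> topspace \<T>" for y
proof -
 obtain x t where x: "x \<in> XX" "t \<in> {0..1}" "y = tcl (x, t)" using y unfolding torus_points by blast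
 have "2 * pi * (t * of_int (f x)) + \<Psi> y = 2 * pi * (t * of_int (f' x)) + 2 * pi * of_int (- h (\<theta> 1 x))"
  using x \<Psi>(2)[of "(x, t)"] by (simp add: algebra_simps)
 hence "tor f y * cis (\<Psi> y) = cis (2 * pi * (t * of_int (f' x))) * cis (2 * pi * of_int (- h (\<theta> 1 x)))"
  using tor(2)[OF f(1) x(1,2)] x(3) by (simp only: cis_mult)
 also have "cis (2 * pi * of_int (- h (\<theta> 1 x))) = 1" by (rule cis_multiple_2pi) simp
 finally show ?thesis using tor(2)[OF f(2) x(1,2)] x(3) by simp
qed
thus ?L unfolding hcl_eq_iff[OF tor(1)[OF f(1)] tor(1)[OF f(2)]] using \<Psi>(1) by blast
qed

lemma tor_add:
assumes "loc_const f" "loc_const f'"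
shows "hcl (tor f) \<otimes>\<^bsub>\<H>\<^esub> hcl (tor f') = hcl (tor (%x. f x + f' x))"
unfolding hcl_mult[OF tor(1)[OF assms(1)] tor(1)[OF assms(2)]]
 hcl_eq_iff[OF circle_map_mult[OF tor(1)[OF assms(1)] tor(1)[OF assms(2)]] tor(1)[OF loc_const_comp2[OF assms]]]
using tor(2)[OF assms(1)] tor(2)[OF assms(2)] tor(2)[OF loc_const_comp2[OF assms, of "(+)"]]
by (intro exI[of _ "%_. 0"]) (auto simp: torus_points cis_mult algebra_simps)

lemma tor_closed: "loc_const f ==> hcl (tor f) \<in> carrier \<H>"
using tor(1)[of f] by (auto simp: cohomology1_def hcl_def intro: quotientI)

text \<open>In dimension zero a circle-valued map stays close to a locally constant one, whose
  logarithm can be chosen value by value.\<close>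

lemma circle_log:
assumes "continuous_map X circle V"
obtains \<alpha> where "continuous_map X euclideanreal \<alpha>" "!!x. x \<in> XX ==> V x = cis (\<alpha> x)"
proof -
have V: "continuous_map X euclidean V" "!!x. x \<in> XX ==> cmod (V x) = 1" using assms by (auto simp: circle_map_iff)
have "\<exists>c W. openin X W & x \<in> W & (\<forall>y\<in>W. cmod c = 1 & cmod (V y - c) < 1)" if x: "x \<in> XX" for x
 using openin_continuous_map_preimage[OF V(1), of "ball (V x) 1"] V(2)[OF x] x
 by (intro exI[of _ "V x"] exI[of _ "{y \<in> XX. V y \<in> ball (V x) 1}"]) (auto simp: dist_norm norm_minus_commute)
from loc_const_selection[where Q = "%x c. cmod c = 1 & cmod (V x - c) < 1", OF this]
obtain \<sigma> where \<sigma>: "loc_const \<sigma>" "!!x. x \<in> XX ==> cmod (\<sigma> x) = 1 & cmod (V x - \<sigma> x) < 1" by blast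
have "continuous_map X euclidean \<sigma>" using loc_const_continuous[OF \<sigma>(1), of "%c. c"] by simp
note A = continuous_map_Arg_quotient[OF V(1) this, simplified V(2) \<sigma>(2) simp_thms, OF TrueI]
have "continuous_map X euclideanreal (%x. Arg (\<sigma> x) + Arg (V x / \<sigma> x))"
 using V(2) \<sigma>(2) loc_const_continuous[OF \<sigma>(1), of Arg]
 by (intro continuous_map_add continuous_map_Arg_quotient[OF V(1) \<open>continuous_map X euclidean \<sigma>\<close>]) auto
moreover have "V x = cis (Arg (\<sigma> x) + Arg (V x / \<sigma> x))" if x: "x \<in> XX" for x
proof -
 have "\<sigma> x ~= 0" using \<sigma>(2)[OF x] by auto
 hence "cis (Arg (\<sigma> x)) = \<sigma> x" using \<sigma>(2)[OF x] by (simp add: cis_Arg sgn_eq)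
 moreover have "V x = \<sigma> x * cis (Arg (V x / \<sigma> x))"
  using V(2) \<sigma>(2) x by (intro continuous_map_Arg_quotient(2)[OF V(1) \<open>continuous_map X euclidean \<sigma>\<close>]) auto
 ultimately show ?thesis by (simp add: cis_mult[symmetric])
qed
ultimately show thesis by (rule that)
qed

text \<open>On the ends at \<open>t = 0\<close> a logarithm exists by dimension zero. Contracting
  the cylinder to these ends extends it to all segments; only its jump across the gluing is
  left.\<close>

lemma tor_surj:
assumes "k \<in> carrier \<H>" obtains f where "loc_const f" "k = hcl (tor f)"
proof -
obtain u where u: "continuous_map \<T> circle u" "k = hcl u"
 using assms by (auto simp: cohomology1_def hcl_def elim!: quotientE)
let ?K = "%p. u (tcl (fst (snd p), fst p * snd (snd p)))" and ?Q = "prod_topology (top_of_set {0..1 :: real}) \<C>"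
have U: "continuous_map \<C> circle (%p. u (tcl p))"
 using continuous_map_compose[OF quotient_imp_continuous_map[OF tcl_quotient] u(1)] by (simp add: o_def)
have "continuous_map X \<C> (%x. (x, 0))" by (intro continuous_map_pairedI) auto
from continuous_map_compose[OF this U] have "continuous_map X circle (%x. u (tcl (x, 0)))" by (simp add: o_def)
from circle_log[OF this] obtain \<alpha> where
 \<alpha>: "continuous_map X euclideanreal \<alpha>" "!!x. x \<in> XX ==> u (tcl (x, 0)) = cis (\<alpha> x)" by blast
have "continuous_map ?Q euclideanreal (%p. fst p * snd (snd p))"
 using continuous_map_compose[OF continuous_map_snd[of "top_of_set {0..1 :: real}" \<C>] cyl_snd]
  continuous_map_into_fulltopology[OF continuous_map_fst[of "top_of_set {0..1 :: real}" \<C>]]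
 by (intro continuous_map_real_mult) (auto simp: o_def)
hence "continuous_map ?Q \<C> (%p. (fst (snd p), fst p * snd (snd p)))"
 using continuous_map_compose[OF continuous_map_snd[of "top_of_set {0..1 :: real}" \<C>] continuous_map_fst]
 by (intro continuous_map_pairedI) (auto simp: o_def continuous_map_in_subtopology mult_le_one)
from continuous_map_compose[OF this U] have "continuous_map ?Q circle ?K" by (simp add: o_def)
moreover have "compact_space \<C>" using compact by (simp add: compact_space_prod_topology compact_space_subtopology)
ultimately obtain \<Psi> where \<Psi>: "continuous_map \<C> euclideanreal \<Psi>" "\<forall>p\<in>topspace \<C>. ?K (1, p) = ?K (0, p) * cis (\<Psi> p)"
 using homotopy_log by blast
have \<Psi>': "u (tcl (x, t)) = u (tcl (x, 0)) * cis (\<Psi> (x, t))" if "x \<in> XX" "t \<in> {0..1}" for x t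
 using bspec[OF \<Psi>(2), of "(x, t)"] that by simp
define \<Theta> where "\<Theta> p = \<alpha> (fst p) + \<Psi> p" for p
have \<Theta>: "continuous_map \<C> euclideanreal \<Theta>"
 unfolding \<Theta>_def by (intro continuous_map_add cyl_fst[OF \<alpha>(1)] \<Psi>(1))
have val: "u (tcl (x, t)) = cis (\<Theta> (x, t))" if "x \<in> XX" "t \<in> {0..1}" for x t
 using \<Psi>'[OF that] \<alpha>(2)[OF that(1)] by (simp add: \<Theta>_def cis_mult)
have ends: "continuous_map X euclideanreal (%x. \<Theta> (\<theta> j x, t))" if "t \<in> {0..1}" for j t
proof -
 have "continuous_map X \<C> (%x. (\<theta> j x, t))" using that theta_continuous by (intro continuous_map_pairedI) auto
 from continuous_map_compose[OF this \<Theta>] show ?thesis by (simp add: o_def)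
qed
\<comment> \<open>The jump across the gluing in units of \<open>2 * pi\<close>. It is integer-valued
  and becomes the winding function \<open>f\<close>; \<open>\<theta> 0\<close> only gives both terms
  the form required by \<open>ends\<close>.\<close>
define d where "d x = (\<Theta> (\<theta> 0 x, 1) - \<Theta> (\<theta> (- 1) x, 0)) / (2 * pi)" for x
have dc: "continuous_map X euclideanreal d"
 unfolding d_def by (intro continuous_map_real_divide continuous_map_diff ends) auto
have dz: "d x \<in> \<int>" if x: "x \<in> XX" for x
proof -
 have "tcl (\<theta> (- 1) x, 0) = tcl (x, 1)" using tcl_glue[of "\<theta> (- 1) x"] x by simp
 hence "cis (\<Theta> (x, 1) - \<Theta> (\<theta> (- 1) x, 0)) = 1"
  using val[of "\<theta> (- 1) x" 0] val[of x 1] x by (simp flip: cis_divide)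
 thus ?thesis unfolding cis_eq_1 d_def by simp
qed
define f where "f x = \<lfloor>d x\<rfloor>" for x
have f: "loc_const f" "!!x. x \<in> XX ==> real_of_int (f x) = d x"
 unfolding f_def using integer_loc_const[OF dc dz] by auto
let ?F = "%p. 2 * pi * (snd p * of_int (f (fst p))) - \<Theta> p"
have F: "continuous_map \<C> euclideanreal ?F"
 by (intro continuous_map_real_mult continuous_map_diff cyl_snd \<Theta> cyl_fst[OF loc_const_continuous[OF f(1)]]; simp?)
have g: "?F (x, 0) = ?F (\<theta> 1 x, 1)" if "x \<in> XX" for x
 using that f(2)[of "\<theta> 1 x"] by (simp add: d_def field_simps)
obtain \<Phi> where \<Phi>: "continuous_map \<T> euclideanreal \<Phi>" "!!p. p \<in> topspace \<C> ==> \<Phi> (tcl p) = ?F p" by (rule torus_map[OF F], rule g, (assumption | rule that)+)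
have "tor f y = u y * cis (\<Phi> y)" if y: "y \<in> topspace \<T>" for y
proof -
 obtain x t where x: "x \<in> XX" "t \<in> {0..1}" "y = tcl (x, t)" using y unfolding torus_points by blast
 show ?thesis using x tor(2)[OF f(1) x(1,2)] val[OF x(1,2)] \<Phi>(2)[of "(x, t)"] by (simp add: cis_mult)
qed
hence "hcl u = hcl (tor f)" unfolding hcl_eq_iff[OF u(1) tor(1)[OF f(1)]] using \<Phi>(1) by blast
thus thesis using that[OF f(1)] u(2) by simp
qed

lemma hcl_one: "\<one>\<^bsub>\<H>\<^esub> = hcl (tor (%_. 0))"
proof -
have one: "continuous_map \<T> circle (%_. 1)" by (simp add: circle_map_iff)
have l: "loc_const (%_. 0 :: int)" by simp
have "hcl (%_. 1) = hcl (tor (%_. 0))"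
 unfolding hcl_eq_iff[OF one tor(1)[OF l]] using tor(2)[OF l] by (intro exI[of _ "%_. 0"]) (auto simp: torus_points)
thus ?thesis by (simp add: cohomology1_def hcl_def)
qed

end

section \<open>Filtrations and ranks\<close>

text \<open>A common frame for both groups: each is an image of the locally constant integer
  functions under an additive map, from which it inherits the group laws.\<close>

locale additive_surjection =
fixes M :: "'m monoid" and P :: "('x => int) => bool" and q :: "('x => int) => 'm"
assumes P: "P (%_. 0)" "P f ==> P f' ==> P (%x. f x + f' x)" "P f ==> P (%x. - f x)"
 and q: "P f ==> q f \<in> carrier M" "m \<in> carrier M ==> \<exists>f. P f & m = q f"
 and mult: "P f ==> P f' ==> q f \<otimes>\<^bsub>M\<^esub> q f' = q (%x. f x + f' x)" and one: "\<one>\<^bsub>M\<^esub> = q (%_. 0)"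
begin

lemma is_group: "group M"
proof (rule groupI)
fix x y z assume "x \<in> carrier M" "y \<in> carrier M" "z \<in> carrier M"
thus "x \<otimes>\<^bsub>M\<^esub> y \<otimes>\<^bsub>M\<^esub> z = x \<otimes>\<^bsub>M\<^esub> (y \<otimes>\<^bsub>M\<^esub> z)"
 using q(2)[of x] q(2)[of y] q(2)[of z] by (auto simp: mult P add.assoc)
next
fix x assume "x \<in> carrier M"
then obtain f where "P f" "x = q f" using q(2) by blast
thus "\<one>\<^bsub>M\<^esub> \<otimes>\<^bsub>M\<^esub> x = x" "\<exists>y\<in>carrier M. y \<otimes>\<^bsub>M\<^esub> x = \<one>\<^bsub>M\<^esub>"
 by (simp_all add: mult P one) (rule bexI[of _ "q (%x. - f x)"], simp_all add: mult P q)
next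
fix x y assume "x \<in> carrier M" "y \<in> carrier M"
thus "x \<otimes>\<^bsub>M\<^esub> y \<in> carrier M" using q(2)[of x] q(2)[of y] by (auto simp: mult P q(1))
qed (simp add: one P q)

lemma inv_q: "P f ==> inv\<^bsub>M\<^esub> (q f) = q (%x. - f x)"
by (rule group.inv_equality[OF is_group]) (simp_all add: mult P q one)

lemma is_subgroup:
assumes "!!f. P' f ==> P f" "P' (%_. 0)" "!!f f'. P' f ==> P' f' ==> P' (%x. f x + f' x)" "!!f. P' f ==> P' (%x. - f x)"
shows "subgroup (q ` Collect P') M"
using assms by (intro group.subgroupI[OF is_group]) (auto simp: q(1) inv_q mult intro: exI[of P'])

end

text \<open>The structure maps are inclusions, so a class of the direct limit is determined by its
  underlying element, whatever index it carries.\<close>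

lemma exhaustive_filtrationI:
assumes H: "group H" and sub: "!!n. subgroup (F n) H" and inc: "!!n. F n \<subseteq> F (Suc n)" and all: "carrier H = (\<Union>n. F n)"
shows "exhaustive_filtration H F"
proof -
define D where "D = direct_limit (%n. H\<lparr>carrier := F n\<rparr>) (%_ x. x)"
define R where "R = direct_limit_rel (%n. H\<lparr>carrier := F n\<rparr>) (%_ x. x)"
have t: "transition (%_ x. x) m d x = x" for m d and x :: 'a by (induction d) auto
have mono: "m <= n ==> F m \<subseteq> F n" for m n by (rule lift_Suc_mono_le[of F, OF inc])
have R: "((m, x), (n, y)) \<in> R <-> x \<in> F m & y \<in> F n & x = y" for m n x y
 by (auto simp: R_def direct_limit_rel_def t intro: exI[of _ "max m n"])
have eqv: "equiv (SIGMA n:UNIV. F n) R"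
 by (rule equivI) (auto simp: refl_on_def sym_def trans_def R split_paired_all)
define \<psi> where "\<psi> c = snd (SOME p. p \<in> c)" for c :: "(nat \<times> 'a) set"
have \<psi>: "\<psi> (R `` {(n, x)}) = x" if "x \<in> F n" for n x
proof -
 have "(n, x) \<in> R `` {(n, x)}" using that by (simp add: R)
 hence "(SOME p. p \<in> R `` {(n, x)}) \<in> R `` {(n, x)}" by (rule someI)
 thus ?thesis unfolding \<psi>_def by (metis Image_singleton_iff R prod.collapse)
qed
have car: "carrier D = (SIGMA n:UNIV. F n) // R" by (simp add: D_def direct_limit_def R_def)
have cases: "\<exists>n x. x \<in> F n & c = R `` {(n, x)}" if "c \<in> carrier D" for c
 using that unfolding car by (auto elim!: quotientE)
have inj: "R `` {(n, x)} = R `` {(m, x)}" if "x \<in> F n" "x \<in> F m" for n m x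
 using that by (intro equiv_class_eq[OF eqv]) (simp add: R)
have mult: "R `` {(m, x)} \<otimes>\<^bsub>D\<^esub> R `` {(n, y)} = R `` {(max m n, x \<otimes>\<^bsub>H\<^esub> y)}" if "x \<in> F m" "y \<in> F n" for m n x y
proof -
 have "class_op2 R (%(m, x) (n, y). (max m n, x \<otimes>\<^bsub>H\<^esub> y)) (R `` {(m, x)}) (R `` {(n, y)}) =
   R `` {(%(m, x) (n, y). (max m n, x \<otimes>\<^bsub>H\<^esub> y)) (m, x) (n, y)}"
 proof (rule class_op2_eq[OF eqv], goal_cases)
  case (3 a a' b b')
  obtain k u k' l v l' where "a = (k, u)" "a' = (k', u)" "b = (l, v)" "b' = (l', v)"
   "u \<in> F k" "u \<in> F k'" "v \<in> F l" "v \<in> F l'"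
   using 3 by (metis R prod.collapse)
  thus ?case using mono[of k "max k l"] mono[of l "max k l"] mono[of k' "max k' l'"] mono[of l' "max k' l'"]
   by (auto simp: R intro!: subgroup.m_closed[OF sub])
 qed (use that in auto)
 thus ?thesis by (simp add: D_def direct_limit_def R_def[symmetric] t Let_def)
qed
have "\<psi> \<in> iso D H"
proof (rule isoI)
 show "\<psi> \<in> hom D H"
 proof (rule homI)
  fix c c' assume "c \<in> carrier D" "c' \<in> carrier D"
  then obtain m x n y where c: "x \<in> F m" "c = R `` {(m, x)}" "y \<in> F n" "c' = R `` {(n, y)}" using cases by metis
  thus "\<psi> c \<in> carrier H" using \<psi> all by auto
  have "x \<otimes>\<^bsub>H\<^esub> y \<in> F (max m n)"
   using c mono[of m "max m n"] mono[of n "max m n"] by (intro subgroup.m_closed[OF sub]) auto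
  thus "\<psi> (c \<otimes>\<^bsub>D\<^esub> c') = \<psi> c \<otimes>\<^bsub>H\<^esub> \<psi> c'" using c \<psi> mult by simp
 qed
 show "bij_betw \<psi> (carrier D) (carrier H)"
 proof (rule bij_betw_imageI)
  show "inj_on \<psi> (carrier D)" using cases \<psi> inj by (intro inj_onI) metis
  have "R `` {(n, x)} \<in> carrier D" if "x \<in> F n" for n x unfolding car using that by (auto intro: quotientI)
  thus "\<psi> ` carrier D = carrier H" using cases \<psi> all by (auto simp: image_iff) metis+
 qed
qed
thus ?thesis unfolding exhaustive_filtration_def D_def direct_limit_inj_def R_def[symmetric]
 using sub inc \<psi> by blast
qed

context letter_shift
begin

definition wfn :: "nat => ((int => 'a) => int) => bool" where "wfn n f <-> (\<exists>\<phi>. f = wfun (Suc n) \<phi>)"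

lemma wfn_loc_const: "wfn n f ==> loc_const f" by (auto simp: wfn_def loc_const_wfun)

lemma wfn_simps: "wfn n (%_. 0)" "wfn n f ==> wfn n f' ==> wfn n (%x. f x + f' x)" "wfn n f ==> wfn n (%x. - f x)"
proof -
show "wfn n (%_. 0)" unfolding wfn_def by (rule exI[of _ "%_. 0"]) (auto simp: wfun_def)
assume "wfn n f"
then obtain \<phi> where f: "f = wfun (Suc n) \<phi>" unfolding wfn_def by blast
thus "wfn n (%x. - f x)" unfolding wfn_def by (intro exI[of _ "%w. - \<phi> w"]) (auto simp: wfun_def)
assume "wfn n f'"
then obtain \<phi>' where "f' = wfun (Suc n) \<phi>'" unfolding wfn_def by blast
thus "wfn n (%x. f x + f' x)" using f unfolding wfn_def by (intro exI[of _ "%w. \<phi> w + \<phi>' w"]) (auto simp: wfun_def)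
qed

abbreviation "hc f \<equiv> hcl (tor f)"

sublocale K: additive_surjection \<K> loc_const kcls
by unfold_locales
 (auto simp: kcls_closed kcls_add kcls_one loc_const_comp2 loc_const_comp[of _ uminus] elim: kcls_surj)

sublocale H: additive_surjection \<H> loc_const hc
by unfold_locales
 (auto simp: tor_closed tor_add hcl_one loc_const_comp2 loc_const_comp[of _ uminus] elim: tor_surj)

lemma kcls_eq_iff:
assumes "loc_const f" "loc_const f'"
shows "kcls f = kcls f' <-> (\<exists>h. loc_const h & (\<forall>x\<in>XS. f' x - f x = h (shift_pow 1 x) - h x))"
proof -
interpret group \<K> by (rule K.is_group)
have "kcls (%x. f' x - f x) = kcls f' \<otimes>\<^bsub>\<K>\<^esub> inv\<^bsub>\<K>\<^esub> (kcls f)"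
 using K.mult[OF assms(2) K.P(3)[OF assms(1)]] assms by (simp add: K.inv_q)
hence "kcls f = kcls f' <-> kcls (%x. f' x - f x) = \<one>\<^bsub>\<K>\<^esub>"
 using inv_solve_right'[of "\<one>\<^bsub>\<K>\<^esub>" "kcls f'" "kcls f"] kcls_closed[OF assms(1)] kcls_closed[OF assms(2)] by auto
thus ?thesis using kcls_eq_one_iff[OF loc_const_comp2[OF assms(2,1), of "(-)"]] by simp
qed

lemma hc_eq_iff: "loc_const f ==> loc_const f' ==> hc f = hc f' <-> kcls f = kcls f'"
by (simp add: tor_cong_iff kcls_eq_iff X_topspace)

text \<open>Independent of the chosen function because both groups have the same relations, see
  \<open>hc_eq_iff\<close>.\<close>

definition Phi :: "((((int => 'a) \<times> real) set) => complex) set => _" where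
"Phi k = kcls (SOME f. loc_const f & k = hc f)"

lemma Phi: "loc_const f ==> Phi (hc f) = kcls f"
proof -
assume f: "loc_const f"
hence "loc_const (SOME f'. loc_const f' & hc f = hc f') & hc f = hc (SOME f'. loc_const f' & hc f = hc f')"
 by (intro someI_ex[of "%f'. loc_const f' & hc f = hc f'"]) auto
hence "kcls f = kcls (SOME f'. loc_const f' & hc f = hc f')" using hc_eq_iff[OF f] by blast
thus ?thesis unfolding Phi_def by simp
qed

lemma Phi_iso: "Phi \<in> iso \<H> \<K>"
proof (rule isoI)
show "Phi \<in> hom \<H> \<K>"
 by (rule homI; (drule H.q(2))+; auto simp: Phi H.mult K.mult H.P K.q(1))
show "bij_betw Phi (carrier \<H>) (carrier \<K>)"
proof (rule bij_betw_imageI)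
 show "inj_on Phi (carrier \<H>)" by (rule inj_onI; (drule H.q(2))+; elim exE conjE; simp add: Phi hc_eq_iff)
 show "Phi ` carrier \<H> = carrier \<K>"
 proof (intro equalityI subsetI)
  fix k assume "k \<in> carrier \<K>"
  then obtain f where "loc_const f" "k = kcls f" using K.q(2) by blast
  thus "k \<in> Phi ` carrier \<H>" by (intro image_eqI[of _ _ "hc f"]) (simp_all add: Phi H.q(1))
 qed (auto dest!: H.q(2) simp: Phi K.q(1))
qed
qed

text \<open>A function of a window is an integer combination of indicators of words, and only the
  finitely many reduced words matter, all of which occur in sequences.\<close>

lemma kcls_wf_filtration: "K0_filtration X n = kcls ` Collect (wfn n)"
proof -
define ind where "ind w = wfun (Suc n) (%u. if u = w then 1 else 0 :: int)" for w
define A where "A = {K0_class \<B> (1, %_ _. cfun_embed X shift_pow (indicator (word_cylinder (XX) n a))) | a. a \<in> XX}"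
have A: "K0_class \<B> (1, %_ _. cfun_embed X shift_pow (indicator (word_cylinder (XX) n a))) = kcls (ind (win (Suc n) a 0))"
 if a: "a \<in> XS" for a
proof -
 have e: "x \<in> word_cylinder (XX) n a <-> x \<in> XX & win (Suc n) x 0 = win (Suc n) a 0" for x
 proof -
  have "win (Suc n) x 0 = win (Suc n) a 0 <-> (\<forall>k\<in>{0..int n}. x k = a k)"
  proof
   assume eq: "win (Suc n) x 0 = win (Suc n) a 0"
   show "\<forall>k\<in>{0..int n}. x k = a k"
   proof
    fix k assume "k \<in> {0..int n}"
    thus "x k = a k" using arg_cong[OF eq, of "%w. w ! nat k"] win_simps(2)[of "nat k" "Suc n"] by auto
   qed
  qed (auto intro!: win_eqI)
  thus ?thesis by (auto simp: word_cylinder_def)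
 qed
 hence "word_cylinder (XX) n a = {x \<in> XX. wfun (Suc n) (%u. u = win (Suc n) a 0) x}"
  by (auto simp: wfun_def)
 hence "clopen (word_cylinder (XX) n a)" using clopen_level[OF loc_const_wfun, of "%b. b"] by simp
 from K0_class_indicator[OF this] show ?thesis
  by (simp add: ind_def) (rule kcls_cong, auto simp: e wfun_def indicator_def)
qed
interpret group \<K> by (rule K.is_group)
have ind: "loc_const (ind w)" "wfn n (ind w)" for w by (auto simp: ind_def loc_const_wfun wfn_def)
have sub: "subgroup (kcls ` Collect (wfn n)) \<K>" by (rule K.is_subgroup) (auto simp: wfn_loc_const wfn_simps)
have AK: "A \<subseteq> kcls ` Collect (wfn n)" using A ind(2) unfolding A_def X_topspace by auto
have gsub: "subgroup (generate \<K> A) \<K>"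
 using AK subgroup.subset[OF sub] by (intro generate_is_subgroup) blast
have gen: "kcls (wfun (Suc n) (%u. if u = w then k else 0)) \<in> generate \<K> A" if w: "w \<in> words (Suc n)" for w k
proof -
 obtain a where "a \<in> XS" "win (Suc n) a 0 = w" using word_realized[OF w] by blast
 hence i: "kcls (ind w) \<in> generate \<K> A" using A[of a] by (intro generate.incl) (auto simp: A_def X_topspace)
 have step: "(%x. wfun (Suc n) (%u. if u = w then k else 0) x + ind w x) = wfun (Suc n) (%u. if u = w then k + 1 else 0)"
  "(%x. wfun (Suc n) (%u. if u = w then k else 0) x - ind w x) = wfun (Suc n) (%u. if u = w then k - 1 else 0)" for k
  by (auto simp: ind_def wfun_def)
 show ?thesis
 proof (induction k rule: int_induct[where k = 0])
  case base
  have "wfun (Suc n) (%u. if u = w then 0 else 0) = (%_. 0 :: int)" by (auto simp: wfun_def)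
  thus ?case using generate.one[of \<K> A] by (simp add: K.one)
 next
  case (step1 k)
  thus ?case
   using generate.eng[OF step1(2) i] K.mult[OF loc_const_wfun ind(1)[of w]] by (simp add: step)
 next
  case (step2 k)
  have ni: "kcls (%x. - ind w x) \<in> generate \<K> A"
   using subgroup.m_inv_closed[OF gsub i] ind(1) by (simp add: K.inv_q)
  thus ?case
   using generate.eng[OF step2(2) ni] K.mult[OF loc_const_wfun K.P(3)[OF ind(1)[of w]]] by (simp add: step)
 qed
qed
have "kcls f \<in> generate \<K> A" if wfn: "wfn n f" for f
proof -
 obtain \<phi> where f: "f = wfun (Suc n) \<phi>" using wfn unfolding wfn_def by blast
 have "kcls (wfun (Suc n) (%u. if u \<in> W then \<phi> u else 0)) \<in> generate \<K> A" if "finite W" "W \<subseteq> words (Suc n)" for W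
  using that
 proof (induction W rule: finite_induct)
  case empty
  have "wfun (Suc n) (%u. if u \<in> {} then \<phi> u else 0) = (%_. 0 :: int)" by (auto simp: wfun_def)
  thus ?case using generate.one[of \<K> A] by (simp add: K.one)
 next
  case (insert w W)
  have i: "kcls (wfun (Suc n) (%u. if u \<in> W then \<phi> u else 0)) \<in> generate \<K> A" "w \<in> words (Suc n)"
   using insert by auto
  have "(%x. wfun (Suc n) (%u. if u \<in> W then \<phi> u else 0) x + wfun (Suc n) (%u. if u = w then \<phi> w else 0) x) =
    wfun (Suc n) (%u. if u \<in> insert w W then \<phi> u else 0)" using insert by (auto simp: wfun_def)
  thus ?case
   using generate.eng[OF i(1) gen[OF i(2), of "\<phi> w"]] unfolding K.mult[OF loc_const_wfun loc_const_wfun] by simp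
 qed
 from this[OF card_words(3) subset_refl] show ?thesis
  by (rule back_subst[where P = "%k. k \<in> generate \<K> A"])
   (rule kcls_cong, simp add: f wfun_def win_words X_topspace)
qed
thus ?thesis unfolding K0_filtration_def A_def[symmetric]
 using generate_subgroup_incl[OF AK sub] by blast
qed

definition Fil :: "nat => _" where "Fil n = {k \<in> carrier \<H>. Phi k \<in> K0_filtration X n}"

lemma Fil: "Fil n = hc ` Collect (wfn n)"
proof (intro equalityI subsetI)
fix k assume "k \<in> Fil n"
hence k: "k \<in> carrier \<H>" "Phi k \<in> kcls ` Collect (wfn n)" by (simp_all add: Fil_def kcls_wf_filtration)
obtain f where f: "loc_const f" "k = hc f" using H.q(2)[OF k(1)] by blast
then obtain f' where "wfn n f'" "kcls f = kcls f'" using k(2) by (auto simp: Phi)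
thus "k \<in> hc ` Collect (wfn n)" using hc_eq_iff[OF f(1) wfn_loc_const] f(2) by blast
qed (auto simp: Fil_def kcls_wf_filtration Phi wfn_loc_const H.q(1))

lemma Fil_exhaustive: "exhaustive_filtration \<H> Fil"
proof (rule exhaustive_filtrationI[OF H.is_group])
show "subgroup (Fil n) \<H>" for n unfolding Fil by (rule H.is_subgroup) (auto simp: wfn_loc_const wfn_simps)
have "wfun (Suc n) \<phi> = wfun (Suc (Suc n)) (%w. \<phi> (butlast w))" for n and \<phi> :: "'a list => int"
 by (auto simp: wfun_def win_Suc)
thus "Fil n \<subseteq> Fil (Suc n)" for n unfolding Fil wfn_def by blast
show "carrier \<H> = (\<Union>n. Fil n)"
proof (intro equalityI subsetI)
 fix k assume "k \<in> carrier \<H>"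
 then obtain f where f: "loc_const f" "k = hc f" using H.q(2) by blast
 obtain n r \<phi> where \<phi>: "!!x. x \<in> XS ==> f (shift_pow r x) = wfun (Suc n) \<phi> x" by (rule loc_const_wfun_ex[OF f(1)], rule that)
 have "kcls f = kcls (wfun (Suc n) \<phi>)"
  using kcls_theta[OF f(1), of r] kcls_cong[of "%x. f (shift_pow r x)" "wfun (Suc n) \<phi>"] \<phi> X_topspace by simp
 hence "k = hc (wfun (Suc n) \<phi>)" using hc_eq_iff[OF f(1) loc_const_wfun] f(2) by simp
 hence "k \<in> Fil n" unfolding Fil wfn_def by blast
 thus "k \<in> (\<Union>n. Fil n)" by blast
qed (auto simp: Fil_def)
qed

text \<open>The edges outside the spanning tree; the loop at \<open>la\<close> is added to represent
  the common value of a normal function on all edges \<open>cc v # v\<close>.\<close>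

definition basis :: "nat => 'a list set" where
"basis n = insert (replicate (Suc n) la) (words (Suc n) - (%v. cc v # v) ` words n)"

lemma replicate_tree: "replicate (Suc n) la \<in> (%v. cc v # v) ` words n" "replicate (Suc n) la \<in> words (Suc n)"
proof -
have w: "replicate k la \<in> words k" for k using replicate_words[of "[]" 0 k] by (simp add: words_def)
thus "replicate (Suc n) la \<in> words (Suc n)" by blast
have "cc (replicate n la) = la" using inv_L(3)[OF la] by (cases n) (auto simp: cc_def)
thus "replicate (Suc n) la \<in> (%v. cc v # v) ` words n" using w[of n] by (intro image_eqI[of _ _ "replicate n la"]) auto
qed

lemma card_basis: "card (basis n) = card (words (Suc n)) - card (words n) + 1"
proof -
have "card (words (Suc n) - (%v. cc v # v) ` words n) = card (words (Suc n)) - card (words n)"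
 using cc_Cons card_words(3) by (subst card_Diff_subset) (auto simp: card_image inj_on_def)
thus ?thesis unfolding basis_def using replicate_tree(1) card_words(3) by (subst card_insert_disjoint) auto
qed

text \<open>Normal functions are freely parametrized by their values on \<open>basis n\<close>.
  Every class has a normal representative by \<open>normal_form\<close>, and it is unique by
  \<open>normal_zero\<close> applied to differences, whose periodic sums vanish.\<close>

lemma Fil_free: "free_abelian_of_rank (\<H>\<lparr>carrier := Fil n\<rparr>) (card (basis n))"
proof -
define r where "r = card (basis n)"
have fin: "finite (basis n)" unfolding basis_def using card_words(3) by simp
then obtain e where e: "bij_betw e {..<r} (basis n)" unfolding r_def using ex_bij_betw_nat_finite lessThan_atLeast0 by metis
\<comment> \<open>Words outside the basis are sent to the index of the loop, which makes every
  \<phi> built from \<open>ix\<close> normal.\<close>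
define ix where "ix w = the_inv_into {..<r} e (if w \<in> basis n then w else replicate (Suc n) la)" for w
have ix: "ix w < r" "w \<in> basis n ==> e (ix w) = w" "w ~: basis n ==> ix w = ix (replicate (Suc n) la)" for w
 using e the_inv_into_into[of e "{..<r}"] f_the_inv_into_f_bij_betw[OF e]
 unfolding ix_def bij_betw_def by (auto simp: basis_def)
have ix_e: "ix (e i) = i" if "i < r" for i
 using that e ix(1)[of "e i"] ix(2)[of "e i"] unfolding bij_betw_def inj_on_def by blast
define \<phi> where "\<phi> c w = poly_mapping.lookup c (ix w)" for c :: "nat \<Rightarrow>\<^sub>0 int" and w
define \<xi> where "\<xi> c = hc (wfun (Suc n) (\<phi> c))" for c
let ?Fr = "free_Abelian_group {..<r}"
have normal: "normal n (\<phi> c)" for c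
 unfolding normal_def
proof
 fix v assume "v \<in> words n"
 hence "cc v # v = replicate (Suc n) la | ix (cc v # v) = ix (replicate (Suc n) la)"
  using ix(3)[of "cc v # v"] unfolding basis_def by blast
 thus "\<phi> c (cc v # v) = \<phi> c (replicate (Suc n) la)" unfolding \<phi>_def by metis
qed
have add: "\<xi> c \<otimes>\<^bsub>\<H>\<^esub> \<xi> c' = \<xi> (c + c')" for c c'
proof -
 have "(%x. wfun (Suc n) (\<phi> c) x + wfun (Suc n) (\<phi> c') x) = wfun (Suc n) (\<phi> (c + c'))"
  by (auto simp: wfun_def \<phi>_def lookup_add)
 thus ?thesis unfolding \<xi>_def using H.mult[OF loc_const_wfun loc_const_wfun] by metis
qed
have "\<xi> \<in> iso ?Fr (\<H>\<lparr>carrier := Fil n\<rparr>)"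
proof (rule isoI)
 show "\<xi> \<in> hom ?Fr (\<H>\<lparr>carrier := Fil n\<rparr>)"
  by (rule homI) (simp_all add: add, auto simp: \<xi>_def Fil wfn_def intro!: imageI)
 show "bij_betw \<xi> (carrier ?Fr) (carrier (\<H>\<lparr>carrier := Fil n\<rparr>))"
 proof (rule bij_betw_imageI)
  show "inj_on \<xi> (carrier ?Fr)"
  proof (rule inj_onI)
   fix c c' assume c: "c \<in> carrier ?Fr" "c' \<in> carrier ?Fr" and eq: "\<xi> c = \<xi> c'"
   have d: "(%x. wfun (Suc n) (\<phi> c') x + - wfun (Suc n) (\<phi> c) x) = wfun (Suc n) (\<phi> (c' - c))"
    by (auto simp: wfun_def \<phi>_def lookup_minus)
   have "kcls (wfun (Suc n) (\<phi> c)) = kcls (wfun (Suc n) (\<phi> c'))" using eq hc_eq_iff[OF loc_const_wfun loc_const_wfun] by (simp add: \<xi>_def)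
   hence one: "kcls (wfun (Suc n) (\<phi> (c' - c))) = \<one>\<^bsub>\<K>\<^esub>"
    using K.mult[OF loc_const_wfun K.P(3)[OF loc_const_wfun], of "Suc n" "\<phi> c'" "Suc n" "\<phi> c"] K.inv_q[OF loc_const_wfun, of "Suc n" "\<phi> c"]
     group.r_inv[OF K.is_group K.q(1)[OF loc_const_wfun], of "Suc n" "\<phi> c"] d by simp
   have "periodic_zero (wfun (Suc n) (\<phi> (c' - c)))"
    unfolding periodic_zero_def using kcls_eq_periodic[OF loc_const_wfun one] X_topspace by blast
   from normal_zero[OF normal this] have z: "wfun (Suc n) (\<phi> (c' - c)) x = 0" if "x \<in> XS" for x using that .
   show "c = c'"
   proof (rule poly_mapping_eqI)
    fix i
    show "poly_mapping.lookup c i = poly_mapping.lookup c' i"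
    proof (cases "i < r")
     case True
     hence "e i \<in> basis n" using e unfolding bij_betw_def by blast
     hence "e i \<in> words (Suc n)" using replicate_tree(2)[of n] by (auto simp: basis_def)
     then obtain x where "x \<in> XS" "win (Suc n) x 0 = e i" by (rule word_realized)
     thus ?thesis using z[of x] ix_e[OF True] by (simp add: wfun_def \<phi>_def lookup_minus)
    next
     case False
     hence "i ~: Poly_Mapping.keys c" "i ~: Poly_Mapping.keys c'" using c by (auto simp: carrier_free_Abelian_group_iff)
     thus ?thesis by (simp add: in_keys_iff)
    qed
   qed
  qed
  show "\<xi> ` carrier ?Fr = carrier (\<H>\<lparr>carrier := Fil n\<rparr>)"
  proof (intro equalityI subsetI)
   fix k assume "k \<in> carrier (\<H>\<lparr>carrier := Fil n\<rparr>)"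
   then obtain \<phi>0 where k: "k = hc (wfun (Suc n) \<phi>0)" by (auto simp: Fil wfn_def)
   obtain H \<phi>' where H: "normal n \<phi>'"
    "!!x. wfun (Suc n) \<phi>0 x = wfun (Suc n) \<phi>' x + (wfun n H (shift_pow 1 x) - wfun n H x)"
    by (rule normal_form[of n \<phi>0], rule that)
   define c where "c = Abs_poly_mapping (%i. if i < r then \<phi>' (e i) else 0)"
   have "finite {i. (if i < r then \<phi>' (e i) else 0) ~= 0}" by (rule finite_subset[of _ "{..<r}"]) auto
   hence c: "poly_mapping.lookup c i = (if i < r then \<phi>' (e i) else 0)" for i
    unfolding c_def by (simp add: lookup_Abs_poly_mapping)
   have cw: "\<phi> c w = \<phi>' w" if w: "w \<in> words (Suc n)" for w
   proof (cases "w \<in> basis n")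
    case True
    thus ?thesis by (simp add: \<phi>_def c ix)
   next
    case False
    then obtain v where "v \<in> words n" "w = cc v # v" using w unfolding basis_def by blast
    thus ?thesis using False H(1) ix(2)[of "replicate (Suc n) la"] ix(3)[OF False] ix(1)
     unfolding normal_def by (simp add: \<phi>_def c basis_def)
   qed
   have "wfun (Suc n) \<phi>0 x - wfun (Suc n) (\<phi> c) x = wfun n H (shift_pow 1 x) - wfun n H x" if "x \<in> XS" for x
    using H(2)[of x] cw[OF win_words[OF that]] by (simp add: wfun_def)
   hence "kcls (wfun (Suc n) (\<phi> c)) = kcls (wfun (Suc n) \<phi>0)"
    unfolding kcls_eq_iff[OF loc_const_wfun loc_const_wfun] using loc_const_wfun by blast
   hence "k = \<xi> c" unfolding k \<xi>_def using hc_eq_iff[OF loc_const_wfun loc_const_wfun] by blast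
   moreover have "c \<in> carrier ?Fr" by (auto simp: carrier_free_Abelian_group_iff in_keys_iff c split: if_splits)
   ultimately show "k \<in> \<xi> ` carrier ?Fr" by blast
  qed (auto simp: \<xi>_def Fil wfn_def intro!: imageI)
 qed
qed
hence "?Fr \<cong> \<H>\<lparr>carrier := Fil n\<rparr>" unfolding is_iso_def by blast
thus ?thesis
 unfolding free_abelian_of_rank_def r_def[symmetric] using group.iso_sym[OF group_free_Abelian_group] by blast
qed

lemma rank_basis: "card (basis 0) = card L" "1 <= n ==> card (basis n) = card L * (card L - 1) ^ (n - 1) * (card L - 2) + 1"
proof -
show "card (basis 0) = card L" using card_L by (simp add: card_basis card_words)
assume "1 <= n"
then obtain k where n: "n = Suc k" by (cases n) auto
obtain l where l: "card L = l + 2" using card_L by (intro that[of "card L - 2"]) simp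
show "card (basis n) = card L * (card L - 1) ^ (n - 1) * (card L - 2) + 1"
 unfolding card_basis n card_words l by (simp add: algebra_simps)
qed

end

lemma letter_shift_generators:
fixes G :: "('a, 'b) monoid_scheme"
assumes G: "group G" and "2 <= g" and free: "free_generators G g \<gamma>"
shows "letter_shift G (\<gamma> ` {1..2 * g})" "card (\<gamma> ` {1..2 * g}) = 2 * g"
proof -
interpret group G by (rule G)
define op where "op = opposite_index g"
have op: "op i \<in> {1..2 * g}" "op (op i) = i" "op i ~= i" if "i \<in> {1..2 * g}" for i
 using that assms(2) by (auto simp: op_def opposite_index_def)
have gen: "\<gamma> i \<in> carrier G" "\<gamma> (i + g) = inv\<^bsub>G\<^esub> \<gamma> i" if "i \<in> {1..g}" for i
 using free that unfolding free_generators_def by auto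
have car: "\<gamma> i \<in> carrier G & \<gamma> (op i) = inv\<^bsub>G\<^esub> \<gamma> i" if "i \<in> {1..2 * g}" for i
proof (cases "i <= g")
 case True thus ?thesis using gen[of i] that by (simp add: op_def opposite_index_def)
next
 case False
 hence "i - g \<in> {1..g}" "i = (i - g) + g" using that by auto
 thus ?thesis using gen[of "i - g"] False by (auto simp: op_def opposite_index_def)
qed
have inj: "inj_on \<gamma> {1..2 * g}"
proof (rule inj_onI, rule ccontr)
 fix i j assume i: "i \<in> {1..2 * g}" and j: "j \<in> {1..2 * g}" and eq: "\<gamma> i = \<gamma> j" and "i ~= j"
 hence "op j ~= op i" using op(2) by metis
 \<comment> \<open>If two letters coincided, the reduced word formed by \<open>i\<close> and the
   opposite of \<open>j\<close> would evaluate to the identity, against freeness.\<close>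
 hence "foldr (%i y. \<gamma> i \<otimes>\<^bsub>G\<^esub> y) [i, op j] \<one>\<^bsub>G\<^esub> ~= \<one>\<^bsub>G\<^esub>"
  using free i op(1)[OF j] unfolding free_generators_def op_def by (elim conjE allE[of _ "[i, opposite_index g j]"]) simp
 thus False using car[OF i] car[OF j] eq by simp
qed
show card: "card (\<gamma> ` {1..2 * g}) = 2 * g" using card_image[OF inj] by simp
show "letter_shift G (\<gamma> ` {1..2 * g})"
proof
 show "4 <= card (\<gamma> ` {1..2 * g})" using card assms(2) by simp
 fix a assume "a \<in> \<gamma> ` {1..2 * g}"
 then obtain i where i: "i \<in> {1..2 * g}" "a = \<gamma> i" by blast
 have e: "inv\<^bsub>G\<^esub> a = \<gamma> (op i)" using car[OF i(1)] i(2) by simp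
 thus "inv\<^bsub>G\<^esub> a \<in> \<gamma> ` {1..2 * g}" using op(1)[OF i(1)] by blast
 show "inv\<^bsub>G\<^esub> (inv\<^bsub>G\<^esub> a) = a" using car[OF i(1)] i(2) by simp
 have "\<gamma> (op i) ~= \<gamma> i" using inj_on_eq_iff[OF inj op(1)[OF i(1)] i(1)] op(3)[OF i(1)] by simp
 thus "inv\<^bsub>G\<^esub> a ~= a" unfolding e using i(2) by simp
qed simp
qed

theorem theorem4p12:
  fixes G :: "('a, 'b) monoid_scheme" and \<gamma> :: "nat \<Rightarrow> 'a" and g :: nat
  assumes "group G" and "g \<ge> 2" and "free_generators G g \<gamma>"
  shows "let S = reduced_space G (\<gamma> ` {1..2 * g});
             H = cohomology1 (mapping_torus S shift);
             K = K0 (crossed_product S shift_pow)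
         in \<exists>\<Phi>\<in>iso H K. \<exists>F.
              (\<forall>n. F n = {h \<in> carrier H. \<Phi> h \<in> K0_filtration S n}) \<and>
              exhaustive_filtration H F \<and>
              free_abelian_of_rank (H\<lparr>carrier := F 0\<rparr>) (2 * g) \<and>
              (\<forall>n\<ge>1. free_abelian_of_rank (H\<lparr>carrier := F n\<rparr>)
                 (2 * g * (2 * g - 1) ^ (n - 1) * (2 * g - 2) + 1))"
proof -
  interpret letter_shift G "\<gamma> ` {1..2 * g}" by (rule letter_shift_generators(1)[OF assms])
  note c = letter_shift_generators(2)[OF assms]
  show ?thesis unfolding Let_def
  proof (rule bexI[OF _ Phi_iso], rule exI[of _ Fil], intro conjI allI impI)
    show "Fil n = {h \<in> carrier \<H>. Phi h \<in> K0_filtration X n}" for n by (rule Fil_def)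
    show "exhaustive_filtration \<H> Fil" by (rule Fil_exhaustive)
    show "free_abelian_of_rank (\<H>\<lparr>carrier := Fil 0\<rparr>) (2 * g)" using Fil_free[of 0] unfolding rank_basis c .
    show "free_abelian_of_rank (\<H>\<lparr>carrier := Fil n\<rparr>) (2 * g * (2 * g - 1) ^ (n - 1) * (2 * g - 2) + 1)" if "1 \<le> n" for n
      using Fil_free[of n] unfolding rank_basis(2)[OF that] c .
  qed
qed

end
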